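(* Let $(\mathcal{N}, \mathcal{I}, \partial\mathcal{I}, \mathcal{I}^\circ)$ be the data for an iterated gluing diagram with induced iterated gluing category $\mathcal{I}_\infty$. Let $\mathcal{W} \subseteq \mathcal{I}_\infty$ be a wide subcategory of weak equivalences satisfying the 2-of-3 property, put $\mathrm{Ho}\,\mathcal{I}_\infty := \mathcal{W}^{-1}\mathcal{I}_\infty$ and let $\gamma : \mathcal{I}_\infty \to \mathrm{Ho}\,\mathcal{I}_\infty$ be the localisation. Let $\mathcal{E}$ be a category. Assume: - all limits indexed by each $\oint_{j \in \mathcal{I}_{<n}} \mathcal{I}_n^\circ(i,j)$ and each $([i]_n/\mathrm{Ho}\,\mathcal{I}_\infty)^\circ$, for $n \in \mathcal{N}$ and $i \in \partial\mathcal{I}_n$, exist in $\mathcal{E}$; - all maps in $\mathrm{Ho}\,\mathcal{I}_\infty$ are epis; - for each $n \in \mathcal{N}$ and $i \in \partial\mathcal{I}_n$, $\gamma$ restricts to a functor $\gamma|_i : i/\mathcal{I}_{<n} \to ([i]_n/\mathrm{Ho}\,\mathcal{I}_\infty)^\circ$ that is initial (i.e. for each object $f : [i]_n \to j$ of $([i]_n/\mathrm{Ho}\,\mathcal{I}_\infty)^\circ$, the comma category $\gamma|_i \downarrow f$ is non-empty and connected). Let $f : B \to A$ be a map in $\mathcal{E}^{\mathrm{Ho}\,\mathcal{I}_\infty}$ such that for each $n \in \mathcal{N}$ and $i \in \partial\mathcal{I}_n$, the following maps are powerful: - the restriction $f|_{=n} : B|_{=n} \to A|_{=n}$ in $\mathcal{E}^{\partial\mathcal{I}_n}$;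 - $M_n(\gamma^*f) : M_n(\gamma^*B) \to M_n(\gamma^*A)$ in $\mathcal{E}^{\partial\mathcal{I}_n}$; - the component $f_{[i]_n} : B[i]_n \to A[i]_n$ in $\mathcal{E}$; - $\overline{M}_{[i]_n}f : \overline{M}_{[i]_n}B \to \overline{M}_{[i]_n}A$ in $\mathcal{E}$. Then for each $g : C \to B$ in $\mathcal{E}^{\mathrm{Ho}\,\mathcal{I}_\infty}/B$ there is a canonical isomorphism $$\gamma^*(\Pi_B C) \cong \Pi_{\gamma^*B}\gamma^*C \quad \text{in } \mathcal{E}^{\mathcal{I}_\infty}/\gamma^*A,$$ natural in $C$, given by the canonical comparison map $\varphi_C : \gamma^*(\Pi_B C) \to \Pi_{\gamma^*B}\gamma^*C$ over $\gamma^*A$, whose transpose under the adjunction $(\gamma^*f)^* \dashv \Pi_{\gamma^*B}$ is $$\gamma^*B \times_{\gamma^*A} \gamma^*(\Pi_B C) \cong \gamma^*(B \times_A \Pi_B C) \xrightarrow{\gamma^*(\mathrm{ev})} \gamma^*C.$$ In other words, $\gamma^* : \mathcal{E}^{\mathrm{Ho}\,\mathcal{I}_\infty} \to \mathcal{E}^{\mathcal{I}_\infty}$ preserves dependent products along such $f$.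
   Context: *Iterated gluing diagrams.* A *strict inverse category* is a category $\mathcal{N}$ with a function $\deg : \mathrm{ob}\,\mathcal{N} \to \mathbb{N}$ such that every non-identity map $n \to n'$ has $\deg n > \deg n'$. For $n \in \mathcal{N}$ let $(n/\mathcal{N})^\circ$ be the full subcategory of the coslice $n/\mathcal{N}$ on all objects except $\mathrm{id}_n$. The data $(\mathcal{N}, \mathcal{I}, \partial\mathcal{I}, \mathcal{I}^\circ)$ of an *iterated gluing diagram* consists of: a strict inverse category $\mathcal{N}$; a functor $\mathcal{I} : \mathcal{N}^{\mathrm{op}} \to \mathrm{Cat}$, $n \mapsto \mathcal{I}_n$ (so $\alpha : n \to n'$ induces $\mathcal{I}_\alpha : \mathcal{I}_{n'} \to \mathcal{I}_n$); a family of categories $\partial\mathcal{I}_n$, $n \in \mathrm{ob}\,\mathcal{N}$; and a family of profunctors $\mathcal{I}^\circ_n : (\partial\mathcal{I}_n)^{\mathrm{op}} \times \mathcal{I}_{<n} \to \mathrm{Set}$, where $\mathcal{I}_{<n} := \mathrm{colim}\big(((n/\mathcal{N})^\circ)^{\mathrm{op}} \to \mathcal{N}^{\mathrm{op}} \xrightarrow{\mathcal{I}} \mathrm{Cat}\big)$ (equivalently the colimit of $\mathcal{I}$ weighted by $\mathcal{N}(n,-)$ with the identity removed); such that each $\mathcal{I}_n$ is the collage of $\mathcal{I}_n^\circ$: its objects are $\mathrm{ob}\,\mathcal{I}_{<n} \sqcup \mathrm{ob}\,\partial\mathcal{I}_n$, it contains $\mathcal{I}_{<n}$ and $\partial\mathcal{I}_n$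 as full subcategories, $\mathcal{I}_n(i,j) = \mathcal{I}_n^\circ(i,j)$ and $\mathcal{I}_n(j,i) = \emptyset$ for $i \in \partial\mathcal{I}_n$, $j \in \mathcal{I}_{<n}$, with composition given by functoriality of $\mathcal{I}^\circ_n$; and the inclusion $\mathcal{I}_{<n} \hookrightarrow \mathcal{I}_n$ is the canonical map induced by the $\mathcal{I}_\alpha$. The *induced iterated gluing category* is $\mathcal{I}_\infty := \mathrm{colim}_{n \in \mathcal{N}^{\mathrm{op}}} \mathcal{I}_n$. For $i \in \partial\mathcal{I}_n$, $[i]_n$ denotes the image of $i$ in $\mathcal{I}_\infty$ (and in $\mathrm{Ho}\,\mathcal{I}_\infty$). *Notation.* $i/\mathcal{I}_{<n} = \oint_{j \in \mathcal{I}_{<n}} \mathcal{I}^\circ_n(i,j)$ is the category of elements of $\mathcal{I}^\circ_n(i,-)$ (objects: pairs $(j, u)$ with $j \in \mathcal{I}_{<n}$ and $u : i \to j$ in $\mathcal{I}_n$). For a category $\mathbb{C}$ and $c \in \mathbb{C}$, $(c/\mathbb{C})^\circ$ is the full subcategory of the coslice $c/\mathbb{C}$ on all objects except $\mathrm{id}_c$. $\gamma^*$ is precomposition with $\gamma$. For $X$ in $\mathcal{E}^{\mathcal{I}_\infty}$ or $\mathcal{E}^{\mathrm{Ho}\,\mathcal{I}_\infty}$, $X|_{=n}$ is the restriction along $\partial\mathcal{I}_n \hookrightarrow \mathcal{I}_n \to \mathcal{I}_\infty$ (followed by $\gamma$ in the second case). *Matching objects.* For $X \in \mathcal{E}^{\mathcal{I}_\infty}$,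 $M_n X \in \mathcal{E}^{\partial\mathcal{I}_n}$ is given by $(M_n X)i = \lim\big(i/\mathcal{I}_{<n} \to \mathcal{I}_{<n} \to \mathcal{I}_\infty \xrightarrow{X} \mathcal{E}\big)$, functorially in $X$. For $X \in \mathcal{E}^{\mathbb{C}}$ and $c \in \mathbb{C}$, $\overline{M}_c X := \lim\big((c/\mathbb{C})^\circ \to \mathbb{C} \xrightarrow{X} \mathcal{E}\big)$, functorially in $X$ (used for $\mathbb{C} = \mathrm{Ho}\,\mathcal{I}_\infty$). *Dependent products.* A map $f$ is *powerful* if pullbacks along it exist and the pullback functor $f^*$ between slices has a right adjoint; for $f : B \to A$ this right adjoint is the dependent product $\Pi_B$, with counit $\mathrm{ev}$. Under the hypotheses of the claim both $f$ and $\gamma^*f$ are powerful, in $\mathcal{E}^{\mathrm{Ho}\,\mathcal{I}_\infty}$ and $\mathcal{E}^{\mathcal{I}_\infty}$ respectively. *)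

theory Defs
  imports Main "HOL-Library.FuncSet"
begin

section \<open>Categories, functors, natural transformations\<close>

record ('o, 'a) cat =
  Ob :: "'o set"
  Ar :: "'a set"
  Dom :: "'a \<Rightarrow> 'o"
  Cod :: "'a \<Rightarrow> 'o"
  Ident :: "'o \<Rightarrow> 'a"
  Cmp :: "'a \<Rightarrow> 'a \<Rightarrow> 'a" (infixr "\<cdot>\<index>" 70)

definition hom :: "('o, 'a, 'm) cat_scheme \<Rightarrow> 'o \<Rightarrow> 'o \<Rightarrow> 'a set" where
  "hom C x y = {f \<in> Ar C. Dom C f = x \<and> Cod C f = y}"

definition category :: "('o, 'a) cat \<Rightarrow> bool" where
  "category C \<longleftrightarrow>
     (\<forall>f\<in>Ar C. Dom C f \<in> Ob C \<and> Cod C f \<in> Ob C) \<and>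
     (\<forall>x\<in>Ob C. Ident C x \<in> hom C x x) \<and>
     (\<forall>f\<in>Ar C. \<forall>g\<in>Ar C. Dom C g = Cod C f \<longrightarrow> g \<cdot>\<^bsub>C\<^esub> f \<in> hom C (Dom C f) (Cod C g)) \<and>
     (\<forall>f\<in>Ar C. f \<cdot>\<^bsub>C\<^esub> Ident C (Dom C f) = f \<and> Ident C (Cod C f) \<cdot>\<^bsub>C\<^esub> f = f) \<and>
     (\<forall>f\<in>Ar C. \<forall>g\<in>Ar C. \<forall>h\<in>Ar C. Dom C g = Cod C f \<and> Dom C h = Cod C g \<longrightarrow>
        h \<cdot>\<^bsub>C\<^esub> (g \<cdot>\<^bsub>C\<^esub> f) = (h \<cdot>\<^bsub>C\<^esub> g) \<cdot>\<^bsub>C\<^esub> f)"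

definition iso_ar :: "('o, 'a) cat \<Rightarrow> 'a \<Rightarrow> bool" where
  "iso_ar C f \<longleftrightarrow> f \<in> Ar C \<and>
     (\<exists>g\<in>hom C (Cod C f) (Dom C f).
        g \<cdot>\<^bsub>C\<^esub> f = Ident C (Dom C f) \<and> f \<cdot>\<^bsub>C\<^esub> g = Ident C (Cod C f))"

definition inv_ar :: "('o, 'a) cat \<Rightarrow> 'a \<Rightarrow> 'a" where
  "inv_ar C f = (THE g. g \<in> hom C (Cod C f) (Dom C f) \<and>
     g \<cdot>\<^bsub>C\<^esub> f = Ident C (Dom C f) \<and> f \<cdot>\<^bsub>C\<^esub> g = Ident C (Cod C f))"

definition epi :: "('o, 'a) cat \<Rightarrow> 'a \<Rightarrow> bool" where
  "epi C f \<longleftrightarrow> f \<in> Ar C \<and>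
     (\<forall>g\<in>Ar C. \<forall>h\<in>Ar C. Dom C g = Cod C f \<and> Dom C h = Cod C f \<and> Cod C g = Cod C h \<and>
        g \<cdot>\<^bsub>C\<^esub> f = h \<cdot>\<^bsub>C\<^esub> f \<longrightarrow> g = h)"

text \<open>Functors and natural transformations are extensional (undefined off their domain), so that
  equality of records is equality of functors and of natural transformations.\<close>

record ('o, 'a, 'p, 'b) ftor =
  FOb :: "'o \<Rightarrow> 'p"
  FAr :: "'a \<Rightarrow> 'b"

definition is_functor :: "('o, 'a) cat \<Rightarrow> ('p, 'b) cat \<Rightarrow> ('o, 'a, 'p, 'b) ftor \<Rightarrow> bool" where
  "is_functor C D F \<longleftrightarrow> category C \<and> category D \<and>
     FOb F \<in> Ob C \<rightarrow>\<^sub>E Ob D \<and> FAr F \<in> Ar C \<rightarrow>\<^sub>E Ar D \<and>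
     (\<forall>f\<in>Ar C. Dom D (FAr F f) = FOb F (Dom C f) \<and> Cod D (FAr F f) = FOb F (Cod C f)) \<and>
     (\<forall>x\<in>Ob C. FAr F (Ident C x) = Ident D (FOb F x)) \<and>
     (\<forall>f\<in>Ar C. \<forall>g\<in>Ar C. Dom C g = Cod C f \<longrightarrow>
        FAr F (g \<cdot>\<^bsub>C\<^esub> f) = FAr F g \<cdot>\<^bsub>D\<^esub> FAr F f)"

definition id_ftor :: "('o, 'a) cat \<Rightarrow> ('o, 'a, 'o, 'a) ftor" where
  "id_ftor C = \<lparr>FOb = (\<lambda>x\<in>Ob C. x), FAr = (\<lambda>f\<in>Ar C. f)\<rparr>"

definition comp_ftor :: "('o, 'a) cat \<Rightarrow> ('p, 'b, 'q, 'c) ftor \<Rightarrow> ('o, 'a, 'p, 'b) ftor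
    \<Rightarrow> ('o, 'a, 'q, 'c) ftor" where
  "comp_ftor C G F =
     \<lparr>FOb = (\<lambda>x\<in>Ob C. FOb G (FOb F x)), FAr = (\<lambda>f\<in>Ar C. FAr G (FAr F f))\<rparr>"

definition iso_ftor :: "('o, 'a) cat \<Rightarrow> ('p, 'b) cat \<Rightarrow> ('o, 'a, 'p, 'b) ftor \<Rightarrow> bool" where
  "iso_ftor C D F \<longleftrightarrow> is_functor C D F \<and>
     bij_betw (FOb F) (Ob C) (Ob D) \<and> bij_betw (FAr F) (Ar C) (Ar D)"

record ('o, 'a, 'p, 'b) ntrans =
  NDom :: "('o, 'a, 'p, 'b) ftor"
  NCod :: "('o, 'a, 'p, 'b) ftor"
  NComp :: "'o \<Rightarrow> 'b"

definition is_ntrans :: "('o, 'a) cat \<Rightarrow> ('p, 'b) cat \<Rightarrow> ('o, 'a, 'p, 'b) ntrans \<Rightarrow> bool" where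
  "is_ntrans C D t \<longleftrightarrow> is_functor C D (NDom t) \<and> is_functor C D (NCod t) \<and>
     NComp t \<in> (\<Pi>\<^sub>E x\<in>Ob C. hom D (FOb (NDom t) x) (FOb (NCod t) x)) \<and>
     (\<forall>f\<in>Ar C. NComp t (Cod C f) \<cdot>\<^bsub>D\<^esub> FAr (NDom t) f
              = FAr (NCod t) f \<cdot>\<^bsub>D\<^esub> NComp t (Dom C f))"

definition ntrans_between :: "('o, 'a) cat \<Rightarrow> ('p, 'b) cat \<Rightarrow> ('o, 'a, 'p, 'b) ftor
    \<Rightarrow> ('o, 'a, 'p, 'b) ftor \<Rightarrow> ('o, 'a, 'p, 'b) ntrans \<Rightarrow> bool" where
  "ntrans_between C D F G t \<longleftrightarrow> is_ntrans C D t \<and> NDom t = F \<and> NCod t = G"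

definition natural_iso :: "('o, 'a) cat \<Rightarrow> ('p, 'b) cat \<Rightarrow> ('o, 'a, 'p, 'b) ftor
    \<Rightarrow> ('o, 'a, 'p, 'b) ftor \<Rightarrow> ('o, 'a, 'p, 'b) ntrans \<Rightarrow> bool" where
  "natural_iso C D F G t \<longleftrightarrow> ntrans_between C D F G t \<and> (\<forall>x\<in>Ob C. iso_ar D (NComp t x))"

text \<open>The functor category \<open>D\<^sup>C\<close>.\<close>

definition fun_cat :: "('o, 'a) cat \<Rightarrow> ('p, 'b) cat
    \<Rightarrow> (('o, 'a, 'p, 'b) ftor, ('o, 'a, 'p, 'b) ntrans) cat" where
  "fun_cat C D =
     \<lparr>Ob = {F. is_functor C D F}, Ar = {t. is_ntrans C D t}, Dom = NDom, Cod = NCod,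
      Ident = (\<lambda>F. \<lparr>NDom = F, NCod = F, NComp = (\<lambda>x\<in>Ob C. Ident D (FOb F x))\<rparr>),
      Cmp = (\<lambda>t s. \<lparr>NDom = NDom s, NCod = NCod t,
                    NComp = (\<lambda>x\<in>Ob C. NComp t x \<cdot>\<^bsub>D\<^esub> NComp s x)\<rparr>)\<rparr>"

text \<open>Precomposition with \<open>K : C \<rightarrow> D\<close>, as a functor \<open>E\<^sup>D \<rightarrow> E\<^sup>C\<close>.\<close>

definition precomp :: "('o, 'a) cat \<Rightarrow> ('p, 'b) cat \<Rightarrow> ('q, 'c) cat \<Rightarrow> ('o, 'a, 'p, 'b) ftor
    \<Rightarrow> (('p, 'b, 'q, 'c) ftor, ('p, 'b, 'q, 'c) ntrans,
        ('o, 'a, 'q, 'c) ftor, ('o, 'a, 'q, 'c) ntrans) ftor" where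
  "precomp C D E K =
     \<lparr>FOb = (\<lambda>X\<in>Ob (fun_cat D E). comp_ftor C X K),
      FAr = (\<lambda>t\<in>Ar (fun_cat D E).
               \<lparr>NDom = comp_ftor C (NDom t) K, NCod = comp_ftor C (NCod t) K,
                NComp = (\<lambda>x\<in>Ob C. NComp t (FOb K x))\<rparr>)\<rparr>"

lemma category_units:
  assumes "category C" "f \<in> hom C x y"
  shows "Ident C y \<cdot>\<^bsub>C\<^esub> f = f" "f \<cdot>\<^bsub>C\<^esub> Ident C x = f" "x \<in> Ob C" "y \<in> Ob C"
  using assms by (auto simp: category_def hom_def)

lemma category_Ident: "category C \<Longrightarrow> x \<in> Ob C \<Longrightarrow> Ident C x \<in> hom C x x"
  by (simp add: category_def)

lemma functor_hom: "is_functor C D F \<Longrightarrow> f \<in> Ar C \<Longrightarrow>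
    FAr F f \<in> hom D (FOb F (Dom C f)) (FOb F (Cod C f))"
  by (auto simp: is_functor_def hom_def)

lemma functor_Cmp: "is_functor C D F \<Longrightarrow> f \<in> Ar C \<Longrightarrow> g \<in> Ar C \<Longrightarrow> Dom C g = Cod C f \<Longrightarrow>
    FAr F (g \<cdot>\<^bsub>C\<^esub> f) = FAr F g \<cdot>\<^bsub>D\<^esub> FAr F f"
  by (simp add: is_functor_def)

lemma comp_ftor_eq_iff:
  assumes "is_functor C D G"
  shows "comp_ftor C H F = G \<longleftrightarrow>
    (\<forall>x\<in>Ob C. FOb H (FOb F x) = FOb G x) \<and> (\<forall>f\<in>Ar C. FAr H (FAr F f) = FAr G f)"
proof
  assume "comp_ftor C H F = G"
  then show "(\<forall>x\<in>Ob C. FOb H (FOb F x) = FOb G x) \<and> (\<forall>f\<in>Ar C. FAr H (FAr F f) = FAr G f)"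
    by (auto simp: comp_ftor_def)
next
  assume a: "(\<forall>x\<in>Ob C. FOb H (FOb F x) = FOb G x) \<and> (\<forall>f\<in>Ar C. FAr H (FAr F f) = FAr G f)"
  have "FOb (comp_ftor C H F) = FOb G" by (rule extensionalityI[where A = "Ob C"])
      (use a assms in \<open>auto simp: is_functor_def PiE_def comp_ftor_def\<close>)
  moreover have "FAr (comp_ftor C H F) = FAr G" by (rule extensionalityI[where A = "Ar C"])
      (use a assms in \<open>auto simp: is_functor_def PiE_def comp_ftor_def\<close>)
  ultimately show "comp_ftor C H F = G" by simp
qed



section \<open>Constructions on categories\<close>

definition op_cat :: "('o, 'a) cat \<Rightarrow> ('o, 'a) cat" where
  "op_cat C = \<lparr>Ob = Ob C, Ar = Ar C, Dom = Cod C, Cod = Dom C, Ident = Ident C,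
               Cmp = (\<lambda>g f. f \<cdot>\<^bsub>C\<^esub> g)\<rparr>"

definition prod_cat :: "('o, 'a) cat \<Rightarrow> ('p, 'b) cat \<Rightarrow> ('o \<times> 'p, 'a \<times> 'b) cat" where
  "prod_cat C D = \<lparr>Ob = Ob C \<times> Ob D, Ar = Ar C \<times> Ar D,
     Dom = (\<lambda>(f, g). (Dom C f, Dom D g)), Cod = (\<lambda>(f, g). (Cod C f, Cod D g)),
     Ident = (\<lambda>(x, y). (Ident C x, Ident D y)),
     Cmp = (\<lambda>(f', g') (f, g). (f' \<cdot>\<^bsub>C\<^esub> f, g' \<cdot>\<^bsub>D\<^esub> g))\<rparr>"

definition full_subcat :: "('o, 'a) cat \<Rightarrow> 'o set \<Rightarrow> ('o, 'a) cat" where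
  "full_subcat C S = C\<lparr>Ob := Ob C \<inter> S, Ar := {f \<in> Ar C. Dom C f \<in> S \<and> Cod C f \<in> S}\<rparr>"

text \<open>An arrow of a (co)slice is a triple \<open>(f, h, g)\<close> of its source \<open>f\<close>, its target \<open>g\<close> and the
  arrow \<open>h\<close> of the ambient category making the triangle commute.\<close>

definition coslice :: "('o, 'a) cat \<Rightarrow> 'o \<Rightarrow> ('a, 'a \<times> 'a \<times> 'a) cat" where
  "coslice C c = \<lparr>Ob = {f \<in> Ar C. Dom C f = c},
     Ar = {(f, h, g). f \<in> Ar C \<and> g \<in> Ar C \<and> Dom C f = c \<and> Dom C g = c \<and>
                      h \<in> hom C (Cod C f) (Cod C g) \<and> h \<cdot>\<^bsub>C\<^esub> f = g},
     Dom = fst, Cod = (\<lambda>(f, h, g). g), Ident = (\<lambda>f. (f, Ident C (Cod C f), f)),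
     Cmp = (\<lambda>(g, k, l) (f, h, g'). (f, k \<cdot>\<^bsub>C\<^esub> h, l))\<rparr>"

definition proper_coslice :: "('o, 'a) cat \<Rightarrow> 'o \<Rightarrow> ('a, 'a \<times> 'a \<times> 'a) cat" where
  "proper_coslice C c = full_subcat (coslice C c) (- {Ident C c})"

definition slice :: "('o, 'a) cat \<Rightarrow> 'o \<Rightarrow> ('a, 'a \<times> 'a \<times> 'a) cat" where
  "slice C c = \<lparr>Ob = {f \<in> Ar C. Cod C f = c},
     Ar = {(f, h, g). f \<in> Ar C \<and> g \<in> Ar C \<and> Cod C f = c \<and> Cod C g = c \<and>
                      h \<in> hom C (Dom C f) (Dom C g) \<and> g \<cdot>\<^bsub>C\<^esub> h = f},
     Dom = fst, Cod = (\<lambda>(f, h, g). g), Ident = (\<lambda>f. (f, Ident C (Dom C f), f)),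
     Cmp = (\<lambda>(g, k, l) (f, h, g'). (f, k \<cdot>\<^bsub>C\<^esub> h, l))\<rparr>"

text \<open>The functor between slices induced by \<open>F : C \<rightarrow> D\<close>.\<close>

definition slice_ftor :: "('o, 'a) cat \<Rightarrow> ('o, 'a, 'p, 'b) ftor \<Rightarrow> 'o
    \<Rightarrow> ('a, 'a \<times> 'a \<times> 'a, 'b, 'b \<times> 'b \<times> 'b) ftor" where
  "slice_ftor C F c =
     \<lparr>FOb = (\<lambda>f\<in>Ob (slice C c). FAr F f),
      FAr = (\<lambda>t\<in>Ar (slice C c). case t of (f, h, g) \<Rightarrow> (FAr F f, FAr F h, FAr F g))\<rparr>"

text \<open>The category of all sets of elements of type \<open>'h\<close>; an arrow records its domain, its
  underlying (extensional) function and its codomain.\<close>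

definition set_cat :: "('h set, 'h set \<times> ('h \<Rightarrow> 'h) \<times> 'h set) cat" where
  "set_cat = \<lparr>Ob = UNIV, Ar = {(A, f, B). f \<in> A \<rightarrow>\<^sub>E B},
     Dom = fst, Cod = (\<lambda>(A, f, B). B), Ident = (\<lambda>A. (A, \<lambda>x\<in>A. x, A)),
     Cmp = (\<lambda>(B, g, Z) (A, f, B'). (A, compose A g f, Z))\<rparr>"

abbreviation app :: "'h set \<times> ('h \<Rightarrow> 'h) \<times> 'h set \<Rightarrow> 'h \<Rightarrow> 'h" where
  "app t \<equiv> fst (snd t)"

definition elements :: "('o, 'a) cat
    \<Rightarrow> ('o, 'a, 'h set, 'h set \<times> ('h \<Rightarrow> 'h) \<times> 'h set) ftor
    \<Rightarrow> ('o \<times> 'h, ('o \<times> 'h) \<times> 'a \<times> ('o \<times> 'h)) cat" where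
  "elements C F = \<lparr>Ob = {(x, u). x \<in> Ob C \<and> u \<in> FOb F x},
     Ar = {((x, u), a, (y, v)). u \<in> FOb F x \<and> v \<in> FOb F y \<and> a \<in> hom C x y \<and>
                                app (FAr F a) u = v},
     Dom = fst, Cod = (\<lambda>(p, a, q). q), Ident = (\<lambda>(x, u). ((x, u), Ident C x, (x, u))),
     Cmp = (\<lambda>(q, b, r) (p, a, q'). (p, b \<cdot>\<^bsub>C\<^esub> a, r))\<rparr>"

text \<open>The comma category \<open>F \<down> b\<close>.\<close>

definition comma :: "('o, 'a) cat \<Rightarrow> ('p, 'b) cat \<Rightarrow> ('o, 'a, 'p, 'b) ftor \<Rightarrow> 'p
    \<Rightarrow> ('o \<times> 'b, ('o \<times> 'b) \<times> 'a \<times> ('o \<times> 'b)) cat" where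
  "comma A B F b = \<lparr>Ob = {(a, h). a \<in> Ob A \<and> h \<in> hom B (FOb F a) b},
     Ar = {((a, h), k, (a', h')). a \<in> Ob A \<and> a' \<in> Ob A \<and>
             h \<in> hom B (FOb F a) b \<and> h' \<in> hom B (FOb F a') b \<and>
             k \<in> hom A a a' \<and> h' \<cdot>\<^bsub>B\<^esub> FAr F k = h},
     Dom = fst, Cod = (\<lambda>(p, k, q). q), Ident = (\<lambda>(a, h). ((a, h), Ident A a, (a, h))),
     Cmp = (\<lambda>(q, l, r) (p, k, q'). (p, l \<cdot>\<^bsub>A\<^esub> k, r))\<rparr>"

definition nonempty_connected :: "('o, 'a) cat \<Rightarrow> bool" where
  "nonempty_connected C \<longleftrightarrow> Ob C \<noteq> {} \<and>
     (\<forall>x\<in>Ob C. \<forall>y\<in>Ob C.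
        (x, y) \<in> ({(Dom C f, Cod C f) |f. f \<in> Ar C} \<union> {(Cod C f, Dom C f) |f. f \<in> Ar C})\<^sup>*)"

definition initial_ftor :: "('o, 'a) cat \<Rightarrow> ('p, 'b) cat \<Rightarrow> ('o, 'a, 'p, 'b) ftor \<Rightarrow> bool" where
  "initial_ftor A B F \<longleftrightarrow> is_functor A B F \<and> (\<forall>b\<in>Ob B. nonempty_connected (comma A B F b))"


section \<open>Limits\<close>

definition is_cone :: "('j, 'k) cat \<Rightarrow> ('o, 'a) cat \<Rightarrow> ('j, 'k, 'o, 'a) ftor \<Rightarrow> 'o \<Rightarrow> ('j \<Rightarrow> 'a)
    \<Rightarrow> bool" where
  "is_cone J E D L p \<longleftrightarrow> L \<in> Ob E \<and> (\<forall>j\<in>Ob J. p j \<in> hom E L (FOb D j)) \<and>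
     (\<forall>k\<in>Ar J. FAr D k \<cdot>\<^bsub>E\<^esub> p (Dom J k) = p (Cod J k))"

definition is_limit :: "('j, 'k) cat \<Rightarrow> ('o, 'a) cat \<Rightarrow> ('j, 'k, 'o, 'a) ftor \<Rightarrow> 'o \<Rightarrow> ('j \<Rightarrow> 'a)
    \<Rightarrow> bool" where
  "is_limit J E D L p \<longleftrightarrow> is_cone J E D L p \<and>
     (\<forall>L' p'. is_cone J E D L' p' \<longrightarrow> (\<exists>!h. h \<in> hom E L' L \<and> (\<forall>j\<in>Ob J. p j \<cdot>\<^bsub>E\<^esub> h = p' j)))"

definition has_limits_of_shape :: "('o, 'a) cat \<Rightarrow> ('j, 'k) cat \<Rightarrow> bool" where
  "has_limits_of_shape E J \<longleftrightarrow> (\<forall>D. is_functor J E D \<longrightarrow> (\<exists>L p. is_limit J E D L p))"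

text \<open>A chosen limit cone.\<close>

definition lim_cone :: "('j, 'k) cat \<Rightarrow> ('o, 'a) cat \<Rightarrow> ('j, 'k, 'o, 'a) ftor \<Rightarrow> 'o \<times> ('j \<Rightarrow> 'a)"
  where "lim_cone J E D = (SOME (L, p). is_limit J E D L p)"

abbreviation lim_ob :: "('j, 'k) cat \<Rightarrow> ('o, 'a) cat \<Rightarrow> ('j, 'k, 'o, 'a) ftor \<Rightarrow> 'o" where
  "lim_ob J E D \<equiv> fst (lim_cone J E D)"

abbreviation lim_proj :: "('j, 'k) cat \<Rightarrow> ('o, 'a) cat \<Rightarrow> ('j, 'k, 'o, 'a) ftor \<Rightarrow> 'j \<Rightarrow> 'a" where
  "lim_proj J E D \<equiv> snd (lim_cone J E D)"

text \<open>The map into the chosen limit of \<open>D\<close> induced by a cone \<open>(L, p)\<close>.\<close>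

definition lim_map :: "('j, 'k) cat \<Rightarrow> ('o, 'a) cat \<Rightarrow> ('j, 'k, 'o, 'a) ftor \<Rightarrow> 'o \<Rightarrow> ('j \<Rightarrow> 'a)
    \<Rightarrow> 'a" where
  "lim_map J E D L p =
     (THE h. h \<in> hom E L (lim_ob J E D) \<and> (\<forall>j\<in>Ob J. lim_proj J E D j \<cdot>\<^bsub>E\<^esub> h = p j))"


section \<open>Pullbacks, adjunctions, dependent products\<close>

definition is_pullback :: "('o, 'a) cat \<Rightarrow> 'a \<Rightarrow> 'a \<Rightarrow> 'a \<Rightarrow> 'a \<Rightarrow> bool" where
  "is_pullback C f g p q \<longleftrightarrow> f \<in> Ar C \<and> g \<in> Ar C \<and> p \<in> Ar C \<and> q \<in> Ar C \<and>
     Cod C f = Cod C g \<and> Dom C p = Dom C q \<and> Cod C p = Dom C f \<and> Cod C q = Dom C g \<and>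
     f \<cdot>\<^bsub>C\<^esub> p = g \<cdot>\<^bsub>C\<^esub> q \<and>
     (\<forall>p'\<in>Ar C. \<forall>q'\<in>Ar C. Dom C p' = Dom C q' \<and> Cod C p' = Dom C f \<and> Cod C q' = Dom C g \<and>
        f \<cdot>\<^bsub>C\<^esub> p' = g \<cdot>\<^bsub>C\<^esub> q' \<longrightarrow>
        (\<exists>!h. h \<in> hom C (Dom C p') (Dom C p) \<and> p \<cdot>\<^bsub>C\<^esub> h = p' \<and> q \<cdot>\<^bsub>C\<^esub> h = q'))"

definition has_pullbacks_along :: "('o, 'a) cat \<Rightarrow> 'a \<Rightarrow> bool" where
  "has_pullbacks_along C f \<longleftrightarrow> f \<in> Ar C \<and>
     (\<forall>g\<in>Ar C. Cod C g = Cod C f \<longrightarrow> (\<exists>p q. is_pullback C f g p q))"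

definition pullback :: "('o, 'a) cat \<Rightarrow> 'a \<Rightarrow> 'a \<Rightarrow> 'a \<times> 'a" where
  "pullback C f g = (SOME (p, q). is_pullback C f g p q)"

text \<open>For \<open>f : B \<rightarrow> A\<close> and \<open>g : X \<rightarrow> A\<close>: the chosen projections
  \<open>pb_base C f g : B \<times>\<^sub>A X \<rightarrow> B\<close> and \<open>pb_top C f g : B \<times>\<^sub>A X \<rightarrow> X\<close>.\<close>

abbreviation pb_base :: "('o, 'a) cat \<Rightarrow> 'a \<Rightarrow> 'a \<Rightarrow> 'a" where
  "pb_base C f g \<equiv> fst (pullback C f g)"

abbreviation pb_top :: "('o, 'a) cat \<Rightarrow> 'a \<Rightarrow> 'a \<Rightarrow> 'a" where
  "pb_top C f g \<equiv> snd (pullback C f g)"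

text \<open>The pullback functor \<open>f\<^sup>* : C/A \<rightarrow> C/B\<close>.\<close>

definition pb_ftor :: "('o, 'a) cat \<Rightarrow> 'a \<Rightarrow> ('a, 'a \<times> 'a \<times> 'a, 'a, 'a \<times> 'a \<times> 'a) ftor" where
  "pb_ftor C f =
     \<lparr>FOb = (\<lambda>g\<in>Ob (slice C (Cod C f)). pb_base C f g),
      FAr = (\<lambda>t\<in>Ar (slice C (Cod C f)). case t of (g, h, g') \<Rightarrow>
        (pb_base C f g,
         (THE k. k \<in> hom C (Dom C (pb_base C f g)) (Dom C (pb_base C f g')) \<and>
            pb_base C f g' \<cdot>\<^bsub>C\<^esub> k = pb_base C f g \<and>
            pb_top C f g' \<cdot>\<^bsub>C\<^esub> k = h \<cdot>\<^bsub>C\<^esub> pb_top C f g),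
         pb_base C f g'))\<rparr>"

text \<open>\<open>L : C \<rightarrow> D\<close> is left adjoint to \<open>R : D \<rightarrow> C\<close> with unit \<open>eta\<close> and counit \<open>eps\<close>.\<close>

definition adjunction :: "('o, 'a) cat \<Rightarrow> ('p, 'b) cat \<Rightarrow> ('o, 'a, 'p, 'b) ftor
    \<Rightarrow> ('p, 'b, 'o, 'a) ftor \<Rightarrow> ('o, 'a, 'o, 'a) ntrans \<Rightarrow> ('p, 'b, 'p, 'b) ntrans \<Rightarrow> bool" where
  "adjunction C D L R eta eps \<longleftrightarrow> is_functor C D L \<and> is_functor D C R \<and>
     ntrans_between C C (id_ftor C) (comp_ftor C R L) eta \<and>
     ntrans_between D D (comp_ftor D L R) (id_ftor D) eps \<and>
     (\<forall>x\<in>Ob C. NComp eps (FOb L x) \<cdot>\<^bsub>D\<^esub> FAr L (NComp eta x) = Ident D (FOb L x)) \<and>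
     (\<forall>y\<in>Ob D. FAr R (NComp eps y) \<cdot>\<^bsub>C\<^esub> NComp eta (FOb R y) = Ident C (FOb R y))"

text \<open>For \<open>f : B \<rightarrow> A\<close>, \<open>P : C/B \<rightarrow> C/A\<close> is a dependent product functor along \<open>f\<close>, with
  counit \<open>ev\<close>.\<close>

definition dependent_product :: "('o, 'a) cat \<Rightarrow> 'a \<Rightarrow> ('a, 'a \<times> 'a \<times> 'a, 'a, 'a \<times> 'a \<times> 'a) ftor
    \<Rightarrow> ('a, 'a \<times> 'a \<times> 'a, 'a, 'a \<times> 'a \<times> 'a) ntrans
    \<Rightarrow> ('a, 'a \<times> 'a \<times> 'a, 'a, 'a \<times> 'a \<times> 'a) ntrans \<Rightarrow> bool" where
  "dependent_product C f P eta ev \<longleftrightarrow> has_pullbacks_along C f \<and>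
     adjunction (slice C (Cod C f)) (slice C (Dom C f)) (pb_ftor C f) P eta ev"

definition powerful :: "('o, 'a) cat \<Rightarrow> 'a \<Rightarrow> bool" where
  "powerful C f \<longleftrightarrow> (\<exists>P eta ev. dependent_product C f P eta ev)"

text \<open>For a functor \<open>F : C \<rightarrow> D\<close>, \<open>f : B \<rightarrow> A\<close> and \<open>p : X \<rightarrow> A\<close> in \<open>C\<close>: the canonical map
  \<open>F (B \<times>\<^sub>A X) \<rightarrow> F B \<times>\<^bsub>F A\<^esub> F X\<close>, as an arrow of \<open>D / F B\<close>.\<close>

definition pb_compare :: "('o, 'a) cat \<Rightarrow> ('p, 'b) cat \<Rightarrow> ('o, 'a, 'p, 'b) ftor \<Rightarrow> 'a \<Rightarrow> 'a
    \<Rightarrow> 'b \<times> 'b \<times> 'b" where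
  "pb_compare C D F f p =
     (let b = FAr F (pb_base C f p); t = FAr F (pb_top C f p);
          b' = pb_base D (FAr F f) (FAr F p); t' = pb_top D (FAr F f) (FAr F p)
      in (b, (THE k. k \<in> hom D (Dom D b) (Dom D b') \<and> b' \<cdot>\<^bsub>D\<^esub> k = b \<and> t' \<cdot>\<^bsub>D\<^esub> k = t), b'))"


section \<open>Categories presented by generators and relations\<close>

text \<open>A path is a list of generating arrows in the order in which they are traversed.\<close>

fun is_path :: "'v set \<Rightarrow> 'g set \<Rightarrow> ('g \<Rightarrow> 'v) \<Rightarrow> ('g \<Rightarrow> 'v) \<Rightarrow> 'v \<Rightarrow> 'g list \<Rightarrow> 'v \<Rightarrow> bool" where
  "is_path V G s t v [] w \<longleftrightarrow> v \<in> V \<and> w = v"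
| "is_path V G s t v (g # gs) w \<longleftrightarrow> v \<in> V \<and> g \<in> G \<and> s g = v \<and> is_path V G s t (t g) gs w"

text \<open>The least congruence on paths containing \<open>R\<close>.\<close>

inductive path_cong :: "'v set \<Rightarrow> 'g set \<Rightarrow> ('g \<Rightarrow> 'v) \<Rightarrow> ('g \<Rightarrow> 'v) \<Rightarrow> ('g list \<Rightarrow> 'g list \<Rightarrow> bool)
    \<Rightarrow> 'v \<Rightarrow> 'g list \<Rightarrow> 'g list \<Rightarrow> 'v \<Rightarrow> bool"
  for V G s t R where
  rel: "R gs hs \<Longrightarrow> is_path V G s t v gs w \<Longrightarrow> is_path V G s t v hs w
    \<Longrightarrow> path_cong V G s t R v gs hs w"
| refl: "is_path V G s t v gs w \<Longrightarrow> path_cong V G s t R v gs gs w"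
| sym: "path_cong V G s t R v gs hs w \<Longrightarrow> path_cong V G s t R v hs gs w"
| trans: "path_cong V G s t R v gs hs w \<Longrightarrow> path_cong V G s t R v hs ks w
    \<Longrightarrow> path_cong V G s t R v gs ks w"
| append: "path_cong V G s t R u gs gs' v \<Longrightarrow> path_cong V G s t R v hs hs' w
    \<Longrightarrow> path_cong V G s t R u (gs @ hs) (gs' @ hs') w"

definition path_class :: "'v set \<Rightarrow> 'g set \<Rightarrow> ('g \<Rightarrow> 'v) \<Rightarrow> ('g \<Rightarrow> 'v)
    \<Rightarrow> ('g list \<Rightarrow> 'g list \<Rightarrow> bool) \<Rightarrow> 'v \<Rightarrow> 'g list \<Rightarrow> 'v \<Rightarrow> 'v \<times> 'g list set \<times> 'v" where
  "path_class V G s t R v gs w = (v, {hs. path_cong V G s t R v gs hs w}, w)"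

definition presented_cat :: "'v set \<Rightarrow> 'g set \<Rightarrow> ('g \<Rightarrow> 'v) \<Rightarrow> ('g \<Rightarrow> 'v)
    \<Rightarrow> ('g list \<Rightarrow> 'g list \<Rightarrow> bool) \<Rightarrow> ('v, 'v \<times> 'g list set \<times> 'v) cat" where
  "presented_cat V G s t R =
     \<lparr>Ob = V,
      Ar = {path_class V G s t R v gs w |v gs w. is_path V G s t v gs w},
      Dom = fst, Cod = (\<lambda>(v, X, w). w),
      Ident = (\<lambda>v. path_class V G s t R v [] v),
      Cmp = (\<lambda>(w', Y, x) (v, X, w).
               (v, {ks. \<exists>gs\<in>X. \<exists>hs\<in>Y. path_cong V G s t R v (gs @ hs) ks x}, x))\<rparr>"

lemma is_path_ends: "is_path V G s t v gs w \<Longrightarrow> v \<in> V \<and> w \<in> V"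
  by (induction gs arbitrary: v) auto

lemma is_path_append:
  "is_path V G s t u gs v \<Longrightarrow> is_path V G s t v hs w \<Longrightarrow> is_path V G s t u (gs @ hs) w"
  by (induction gs arbitrary: u) auto

lemma path_cong_is_path:
  "path_cong V G s t R v gs hs w \<Longrightarrow> is_path V G s t v gs w \<and> is_path V G s t v hs w"
  by (induction rule: path_cong.induct) (auto intro: is_path_append)

lemma path_class_eq_iff:
  assumes "is_path V G s t v gs w"
  shows "path_class V G s t R v gs w = path_class V G s t R v' gs' w' \<longleftrightarrow>
    v = v' \<and> w = w' \<and> path_cong V G s t R v gs gs' w"
proof
  assume a: "path_class V G s t R v gs w = path_class V G s t R v' gs' w'"
  then have *: "v = v'" "w = w'"
    "{hs. path_cong V G s t R v gs hs w} = {hs. path_cong V G s t R v' gs' hs w'}"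
    using a unfolding path_class_def prod.inject by blast+
  have "gs \<in> {hs. path_cong V G s t R v gs hs w}"
    using assms by (simp add: path_cong.refl)
  then have "path_cong V G s t R v' gs' gs w'"
    unfolding *(3) by simp
  then show "v = v' \<and> w = w' \<and> path_cong V G s t R v gs gs' w"
    using * by (auto intro: path_cong.sym)
next
  assume "v = v' \<and> w = w' \<and> path_cong V G s t R v gs gs' w"
  then show "path_class V G s t R v gs w = path_class V G s t R v' gs' w'"
    unfolding path_class_def by (blast intro: path_cong.sym path_cong.trans)
qed

lemma presented_cat_simps [simp]:
  "Ob (presented_cat V G s t R) = V"
  "Ar (presented_cat V G s t R) =
     {path_class V G s t R v gs w |v gs w. is_path V G s t v gs w}"
  "Dom (presented_cat V G s t R) (path_class V G s t R v gs w) = v"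
  "Cod (presented_cat V G s t R) (path_class V G s t R v gs w) = w"
  "Ident (presented_cat V G s t R) v = path_class V G s t R v [] v"
  by (auto simp: presented_cat_def path_class_def)

lemma presented_cat_Cmp:
  assumes "is_path V G s t u gs v" "is_path V G s t v hs w"
  shows "path_class V G s t R v hs w \<cdot>\<^bsub>presented_cat V G s t R\<^esub> path_class V G s t R u gs v
    = path_class V G s t R u (gs @ hs) w"
proof -
  have "{ks. \<exists>gs'\<in>{k. path_cong V G s t R u gs k v}. \<exists>hs'\<in>{k. path_cong V G s t R v hs k w}.
            path_cong V G s t R u (gs' @ hs') ks w}
      = {ks. path_cong V G s t R u (gs @ hs) ks w}"
    using assms by (blast intro: path_cong.append path_cong.trans path_cong.refl)
  then show ?thesis by (simp add: presented_cat_def path_class_def)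
qed

lemma category_presented_cat: "category (presented_cat V G s t R)"
proof -
  let ?P = "presented_cat V G s t R" and ?c = "path_class V G s t R"
  have A: "\<exists>v gs w. a = ?c v gs w \<and> is_path V G s t v gs w" if "a \<in> Ar ?P" for a
    using that by simp
  have I: "?c v gs w \<in> Ar ?P" if "is_path V G s t v gs w" for v gs w
    using that by auto
  note C = presented_cat_Cmp[where R = R and V = V and G = G and s = s and t = t]
  show ?thesis
    unfolding category_def
  proof (intro conjI ballI impI)
    fix a assume "a \<in> Ar ?P"
    then obtain v gs w where a: "a = ?c v gs w" and p: "is_path V G s t v gs w" using A by blast
    note e = is_path_ends[OF p]
    then have n: "is_path V G s t v [] v" "is_path V G s t w [] w" by auto
    show "Dom ?P a \<in> Ob ?P" "Cod ?P a \<in> Ob ?P" using e by (simp_all add: a)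
    show "a \<cdot>\<^bsub>?P\<^esub> Ident ?P (Dom ?P a) = a" "Ident ?P (Cod ?P a) \<cdot>\<^bsub>?P\<^esub> a = a"
      using C[OF n(1) p] C[OF p n(2)] by (simp_all add: a)
    fix b assume "b \<in> Ar ?P" and "Dom ?P b = Cod ?P a"
    then obtain hs x where b: "b = ?c w hs x" and q: "is_path V G s t w hs x" using A a by force
    show "b \<cdot>\<^bsub>?P\<^esub> a \<in> hom ?P (Dom ?P a) (Cod ?P b)"
      using I[OF is_path_append[OF p q]] unfolding a b C[OF p q] hom_def
      by (simp del: presented_cat_simps(2))
  next
    fix a b d assume "a \<in> Ar ?P" "b \<in> Ar ?P" "d \<in> Ar ?P"
      and m: "Dom ?P b = Cod ?P a \<and> Dom ?P d = Cod ?P b"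
    then obtain v gs w where a: "a = ?c v gs w" and p: "is_path V G s t v gs w" using A by blast
    obtain hs x where b: "b = ?c w hs x" and q: "is_path V G s t w hs x"
      using A[OF \<open>b \<in> Ar ?P\<close>] m a by force
    obtain ks y where d: "d = ?c x ks y" and r: "is_path V G s t x ks y"
      using A[OF \<open>d \<in> Ar ?P\<close>] m b by force
    show "d \<cdot>\<^bsub>?P\<^esub> (b \<cdot>\<^bsub>?P\<^esub> a) = (d \<cdot>\<^bsub>?P\<^esub> b) \<cdot>\<^bsub>?P\<^esub> a"
      unfolding a b d C[OF p q] C[OF q r] C[OF is_path_append[OF p q] r]
        C[OF p is_path_append[OF q r]] by simp
  next
    fix x assume "x \<in> Ob ?P"
    then have "is_path V G s t x [] x" by simp
    from I[OF this] show "Ident ?P x \<in> hom ?P x x"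
      unfolding hom_def by (simp del: presented_cat_simps(2))
  qed
qed

fun path_eval where
  "path_eval T t fo fg v [] = Ident T (fo v)"
| "path_eval T t fo fg v (g # gs) = path_eval T t fo fg (t g) gs \<cdot>\<^bsub>T\<^esub> fg g"

lemma path_eval_hom:
  assumes T: "category T" and fo: "\<And>v. v \<in> V \<Longrightarrow> fo v \<in> Ob T"
    and fg: "\<And>g. g \<in> G \<Longrightarrow> fg g \<in> hom T (fo (s g)) (fo (t g))"
  shows "is_path V G s t v gs w \<Longrightarrow> path_eval T t fo fg v gs \<in> hom T (fo v) (fo w)"
proof (induction gs arbitrary: v)
  case Nil then show ?case using T fo by (auto simp: category_def)
next
  case (Cons g gs)
  then have "path_eval T t fo fg (t g) gs \<in> hom T (fo (t g)) (fo w)" "fg g \<in> hom T (fo v) (fo (t g))"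
    using fg by auto
  then show ?case using T by (auto simp: category_def hom_def)
qed

lemma path_eval_append:
  assumes T: "category T" and fo: "\<And>v. v \<in> V \<Longrightarrow> fo v \<in> Ob T"
    and fg: "\<And>g. g \<in> G \<Longrightarrow> fg g \<in> hom T (fo (s g)) (fo (t g))"
    and hs: "is_path V G s t v hs w"
  shows "is_path V G s t u gs v \<Longrightarrow>
    path_eval T t fo fg u (gs @ hs) = path_eval T t fo fg v hs \<cdot>\<^bsub>T\<^esub> path_eval T t fo fg u gs"
proof (induction gs arbitrary: u)
  case Nil
  then have "u = v" by simp
  then show ?case using T path_eval_hom[where V = V and G = G and s = s and t = t and fo = fo and fg = fg, OF T fo fg hs] by (auto simp: category_def hom_def)
next
  case (Cons g gs)
  have "path_eval T t fo fg v hs \<in> hom T (fo v) (fo w)"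
    using path_eval_hom[where V = V and G = G and s = s and t = t and fo = fo and fg = fg, OF T fo fg hs] .
  moreover have "path_eval T t fo fg (t g) gs \<in> hom T (fo (t g)) (fo v)"
    using path_eval_hom[where V = V and G = G and s = s and t = t and fo = fo and fg = fg, OF T fo fg] Cons.prems by simp
  moreover have "fg g \<in> hom T (fo u) (fo (t g))" using fg Cons.prems by auto
  ultimately show ?case using T Cons by (auto simp: category_def hom_def)
qed

lemma presented_cat_universal:
  assumes T: "category T" and fo: "\<And>v. v \<in> V \<Longrightarrow> fo v \<in> Ob T"
    and fg: "\<And>g. g \<in> G \<Longrightarrow> fg g \<in> hom T (fo (s g)) (fo (t g))"
    and st: "\<And>g. g \<in> G \<Longrightarrow> s g \<in> V \<and> t g \<in> V"
    and R: "\<And>v gs hs w. R gs hs \<Longrightarrow> is_path V G s t v gs w \<Longrightarrow> is_path V G s t v hs w \<Longrightarrow>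
              path_eval T t fo fg v gs = path_eval T t fo fg v hs"
  shows "\<exists>!H. is_functor (presented_cat V G s t R) T H \<and> (\<forall>v\<in>V. FOb H v = fo v) \<and>
              (\<forall>g\<in>G. FAr H (path_class V G s t R (s g) [g] (t g)) = fg g)"
proof -
  let ?P = "presented_cat V G s t R" and ?c = "path_class V G s t R"
  let ?e = "path_eval T t fo fg"
  have cong: "path_cong V G s t R v gs hs w \<Longrightarrow> ?e v gs = ?e v hs" for v gs hs w
  proof (induction rule: path_cong.induct)
    case (append u gs gs' v hs hs' w)
    then show ?case
      using path_cong_is_path[OF append.hyps(1)] path_cong_is_path[OF append.hyps(2)]
      using path_eval_append[where V = V and G = G and s = s and t = t and fo = fo and fg = fg, OF T fo fg]
      by metis
  qed (auto intro: R)
  define H where "H = \<lparr>FOb = (\<lambda>v\<in>V. fo v),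
    FAr = (\<lambda>a\<in>Ar ?P. ?e (fst a) (SOME gs. gs \<in> fst (snd a)))\<rparr>"
  have HA: "FAr H (?c v gs w) = ?e v gs" if p: "is_path V G s t v gs w" for v gs w
  proof -
    have "path_cong V G s t R v gs (SOME hs. path_cong V G s t R v gs hs w) w"
      by (rule someI) (rule path_cong.refl[OF p])
    then have "?e v (SOME hs. path_cong V G s t R v gs hs w) = ?e v gs"
      using cong by metis
    moreover have "?c v gs w \<in> Ar ?P" using p by auto
    ultimately show ?thesis by (simp add: H_def path_class_def)
  qed
  have HO: "FOb H v = fo v" if "v \<in> V" for v using that by (simp add: H_def)
  note eh = path_eval_hom[where V = V and G = G and s = s and t = t and fo = fo and fg = fg, OF T fo fg]
  have gen: "is_path V G s t (s g) [g] (t g)" if "g \<in> G" for g using that st by simp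
  have F: "is_functor ?P T H"
    unfolding is_functor_def
  proof (intro conjI ballI impI)
    show "category ?P" by (rule category_presented_cat)
    show "category T" by fact
    show "FOb H \<in> Ob ?P \<rightarrow>\<^sub>E Ob T" using fo by (auto simp: H_def)
    show "FAr H \<in> Ar ?P \<rightarrow>\<^sub>E Ar T"
    proof (rule PiE_I)
      fix a assume "a \<in> Ar ?P"
      then show "FAr H a \<in> Ar T" using HA eh by (fastforce simp: hom_def)
    qed (simp add: H_def del: presented_cat_simps(2))
    show "FAr H (Ident ?P x) = Ident T (FOb H x)" if "x \<in> Ob ?P" for x
      using that HA[of x "[]" x] HO by simp
  next
    fix a assume "a \<in> Ar ?P"
    then obtain v gs w where a: "a = ?c v gs w" "is_path V G s t v gs w" by auto
    then show "Dom T (FAr H a) = FOb H (Dom ?P a)" "Cod T (FAr H a) = FOb H (Cod ?P a)"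
      using HA HO eh is_path_ends[OF a(2)] by (auto simp: hom_def)
    fix b assume "b \<in> Ar ?P" "Dom ?P b = Cod ?P a"
    then obtain hs x where b: "b = ?c w hs x" "is_path V G s t w hs x" using a by auto
    show "FAr H (b \<cdot>\<^bsub>?P\<^esub> a) = FAr H b \<cdot>\<^bsub>T\<^esub> FAr H a"
      using a b by (simp add: presented_cat_Cmp HA is_path_append path_eval_append[where V = V and G = G and s = s and t = t and fo = fo and fg = fg, OF T fo fg])
  qed
  have Hg: "FAr H (?c (s g) [g] (t g)) = fg g" if "g \<in> G" for g
    using HA[OF gen[OF that]] fg[OF that] T st[OF that] by (auto simp: category_def hom_def)
  have U: "K = H" if K: "is_functor ?P T K" "\<forall>v\<in>V. FOb K v = fo v"
    "\<forall>g\<in>G. FAr K (?c (s g) [g] (t g)) = fg g" for K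
  proof -
    have KA: "is_path V G s t v gs w \<Longrightarrow> FAr K (?c v gs w) = ?e v gs" for v gs w
    proof (induction gs arbitrary: v)
      case Nil
      then have "FAr K (Ident ?P v) = Ident T (FOb K v)" using K(1) by (simp add: is_functor_def)
      then show ?case using K(2) Nil by simp
    next
      case (Cons g gs)
      then have g: "g \<in> G" "s g = v" and p: "is_path V G s t (t g) gs w" by auto
      have c: "?c v (g # gs) w = ?c (t g) gs w \<cdot>\<^bsub>?P\<^esub> ?c v [g] (t g)"
        using presented_cat_Cmp[OF gen[OF g(1)] p, where R = R] g by simp
      have m: "?c (t g) gs w \<in> Ar ?P" "?c v [g] (t g) \<in> Ar ?P"
        using p gen[OF g(1)] g(2) by (auto simp del: is_path.simps)
      have "Dom ?P (?c (t g) gs w) = Cod ?P (?c v [g] (t g))"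
        unfolding presented_cat_simps ..
      then have e: "FAr K (?c v (g # gs) w) = FAr K (?c (t g) gs w) \<cdot>\<^bsub>T\<^esub> FAr K (?c v [g] (t g))"
        unfolding c by (rule functor_Cmp[OF K(1) m(2) m(1)])
      have "FAr K (?c v [g] (t g)) = fg g" using K(3) g(1) unfolding g(2)[symmetric] by blast
      then show ?case unfolding e Cons.IH[OF p] path_eval.simps by (rule arg_cong)
    qed
    have "FOb K = FOb H"
    proof (rule extensionalityI[where A = V])
      show "FOb K \<in> extensional V"
        using K(1) unfolding is_functor_def PiE_def presented_cat_simps by blast
      show "FOb H \<in> extensional V" by (simp add: H_def)
      show "FOb K v = FOb H v" if "v \<in> V" for v using K(2) HO that by metis
    qed
    moreover have "FAr K = FAr H"
    proof (rule extensionalityI[where A = "Ar ?P"])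
      show "FAr K \<in> extensional (Ar ?P)" using K(1) unfolding is_functor_def PiE_def by blast
      show "FAr H \<in> extensional (Ar ?P)" using F unfolding is_functor_def PiE_def by blast
      fix a assume "a \<in> Ar ?P"
      then obtain v gs w where "a = ?c v gs w" "is_path V G s t v gs w"
        unfolding presented_cat_simps by blast
      then show "FAr K a = FAr H a" using KA HA by metis
    qed
    ultimately show ?thesis by simp
  qed
  show ?thesis
    proof (rule ex1I[of _ H])
    show "is_functor ?P T H \<and> (\<forall>v\<in>V. FOb H v = fo v) \<and> (\<forall>g\<in>G. FAr H (?c (s g) [g] (t g)) = fg g)"
      using F HO Hg by blast
  qed (use U in blast)
qed


section \<open>Colimits of categories\<close>

text \<open>Diagrams of categories; the shape is covariant.\<close>

definition cat_diagram :: "('j, 'k) cat \<Rightarrow> ('j \<Rightarrow> ('o, 'a) cat) \<Rightarrow> ('k \<Rightarrow> ('o, 'a, 'o, 'a) ftor)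
    \<Rightarrow> bool" where
  "cat_diagram J D F \<longleftrightarrow> category J \<and> (\<forall>j\<in>Ob J. category (D j)) \<and>
     (\<forall>k\<in>Ar J. is_functor (D (Dom J k)) (D (Cod J k)) (F k)) \<and>
     (\<forall>j\<in>Ob J. F (Ident J j) = id_ftor (D j)) \<and>
     (\<forall>k\<in>Ar J. \<forall>l\<in>Ar J. Dom J l = Cod J k \<longrightarrow>
        F (l \<cdot>\<^bsub>J\<^esub> k) = comp_ftor (D (Dom J k)) (F l) (F k))"

definition colim_step :: "('j, 'k) cat \<Rightarrow> ('j \<Rightarrow> ('o, 'a) cat) \<Rightarrow> ('k \<Rightarrow> ('o, 'a, 'o, 'a) ftor)
    \<Rightarrow> (('j \<times> 'o) \<times> ('j \<times> 'o)) set" where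
  "colim_step J D F =
     {((Dom J k, x), (Cod J k, FOb (F k) x)) |k x. k \<in> Ar J \<and> x \<in> Ob (D (Dom J k))}"

definition colim_ob :: "('j, 'k) cat \<Rightarrow> ('j \<Rightarrow> ('o, 'a) cat) \<Rightarrow> ('k \<Rightarrow> ('o, 'a, 'o, 'a) ftor)
    \<Rightarrow> 'j \<Rightarrow> 'o \<Rightarrow> ('j \<times> 'o) set" where
  "colim_ob J D F j x = (colim_step J D F \<union> (colim_step J D F)\<inverse>)\<^sup>* `` {(j, x)}"

inductive colim_rel :: "('j, 'k) cat \<Rightarrow> ('j \<Rightarrow> ('o, 'a) cat) \<Rightarrow> ('k \<Rightarrow> ('o, 'a, 'o, 'a) ftor)
    \<Rightarrow> ('j \<times> 'a) list \<Rightarrow> ('j \<times> 'a) list \<Rightarrow> bool"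
  for J D F where
  ident: "j \<in> Ob J \<Longrightarrow> x \<in> Ob (D j) \<Longrightarrow> colim_rel J D F [(j, Ident (D j) x)] []"
| comp: "j \<in> Ob J \<Longrightarrow> f \<in> Ar (D j) \<Longrightarrow> g \<in> Ar (D j) \<Longrightarrow> Dom (D j) g = Cod (D j) f
    \<Longrightarrow> colim_rel J D F [(j, f), (j, g)] [(j, g \<cdot>\<^bsub>D j\<^esub> f)]"
| glue: "k \<in> Ar J \<Longrightarrow> f \<in> Ar (D (Dom J k))
    \<Longrightarrow> colim_rel J D F [(Dom J k, f)] [(Cod J k, FAr (F k) f)]"

text \<open>The colimit in \<open>Cat\<close> is computed explicitly: objects are glued along the diagram, arrows are
  paths of arrows of the \<open>D j\<close> modulo the evident relations. Its universal property, with respect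
  to categories over arbitrary types, is \<open>colim_cat_universal\<close> below.\<close>

abbreviation colim_gens :: "('j, 'k) cat \<Rightarrow> ('j \<Rightarrow> ('o, 'a) cat) \<Rightarrow> ('j \<times> 'a) set" where
  "colim_gens J D \<equiv> (SIGMA j:Ob J. Ar (D j))"

abbreviation colim_src :: "('j, 'k) cat \<Rightarrow> ('j \<Rightarrow> ('o, 'a) cat) \<Rightarrow> ('k \<Rightarrow> ('o, 'a, 'o, 'a) ftor)
    \<Rightarrow> 'j \<times> 'a \<Rightarrow> ('j \<times> 'o) set" where
  "colim_src J D F \<equiv> (\<lambda>(j, f). colim_ob J D F j (Dom (D j) f))"

abbreviation colim_tgt :: "('j, 'k) cat \<Rightarrow> ('j \<Rightarrow> ('o, 'a) cat) \<Rightarrow> ('k \<Rightarrow> ('o, 'a, 'o, 'a) ftor)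
    \<Rightarrow> 'j \<times> 'a \<Rightarrow> ('j \<times> 'o) set" where
  "colim_tgt J D F \<equiv> (\<lambda>(j, f). colim_ob J D F j (Cod (D j) f))"

abbreviation colim_obs :: "('j, 'k) cat \<Rightarrow> ('j \<Rightarrow> ('o, 'a) cat) \<Rightarrow> ('k \<Rightarrow> ('o, 'a, 'o, 'a) ftor)
    \<Rightarrow> ('j \<times> 'o) set set" where
  "colim_obs J D F \<equiv> {colim_ob J D F j x |j x. j \<in> Ob J \<and> x \<in> Ob (D j)}"

definition colim_cat :: "('j, 'k) cat \<Rightarrow> ('j \<Rightarrow> ('o, 'a) cat) \<Rightarrow> ('k \<Rightarrow> ('o, 'a, 'o, 'a) ftor)
    \<Rightarrow> (('j \<times> 'o) set, ('j \<times> 'o) set \<times> ('j \<times> 'a) list set \<times> ('j \<times> 'o) set) cat" where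
  "colim_cat J D F = presented_cat (colim_obs J D F) (colim_gens J D)
     (colim_src J D F) (colim_tgt J D F) (colim_rel J D F)"

definition colim_inj :: "('j, 'k) cat \<Rightarrow> ('j \<Rightarrow> ('o, 'a) cat) \<Rightarrow> ('k \<Rightarrow> ('o, 'a, 'o, 'a) ftor) \<Rightarrow> 'j
    \<Rightarrow> ('o, 'a, ('j \<times> 'o) set, ('j \<times> 'o) set \<times> ('j \<times> 'a) list set \<times> ('j \<times> 'o) set) ftor" where
  "colim_inj J D F j =
     \<lparr>FOb = (\<lambda>x\<in>Ob (D j). colim_ob J D F j x),
      FAr = (\<lambda>f\<in>Ar (D j). path_class (colim_obs J D F) (colim_gens J D)
               (colim_src J D F) (colim_tgt J D F) (colim_rel J D F)
               (colim_src J D F (j, f)) [(j, f)] (colim_tgt J D F (j, f)))\<rparr>"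

lemma colim_ob_glue:
  assumes "k \<in> Ar J" "x \<in> Ob (D (Dom J k))"
  shows "colim_ob J D F (Cod J k) (FOb (F k) x) = colim_ob J D F (Dom J k) x"
proof -
  let ?r = "colim_step J D F \<union> (colim_step J D F)\<inverse>"
  have "((Dom J k, x), (Cod J k, FOb (F k) x)) \<in> colim_step J D F"
    unfolding colim_step_def using assms by blast
  then have "((Dom J k, x), (Cod J k, FOb (F k) x)) \<in> ?r" "((Cod J k, FOb (F k) x), (Dom J k, x)) \<in> ?r"
    by blast+
  then show ?thesis
    unfolding colim_ob_def by (auto intro: converse_rtrancl_into_rtrancl)
qed

lemma category_colim_cat: "category (colim_cat J D F)"
  unfolding colim_cat_def by (rule category_presented_cat)

lemma colim_inj_functor:
  assumes diag: "cat_diagram J D F" and j: "j \<in> Ob J"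
  shows "is_functor (D j) (colim_cat J D F) (colim_inj J D F j)"
proof -
  let ?V = "colim_obs J D F" and ?G = "colim_gens J D" and ?s = "colim_src J D F"
    and ?t = "colim_tgt J D F" and ?R = "colim_rel J D F"
  let ?c = "path_class ?V ?G ?s ?t ?R" and ?o = "colim_ob J D F j"
  have Dj: "category (D j)" using diag j by (simp add: cat_diagram_def)
  have o: "?o x \<in> ?V" if "x \<in> Ob (D j)" for x using j that by blast
  have ends: "Dom (D j) f \<in> Ob (D j)" "Cod (D j) f \<in> Ob (D j)" if "f \<in> Ar (D j)" for f
    using Dj that by (auto simp: category_def)
  have p: "is_path ?V ?G ?s ?t (?o (Dom (D j) f)) [(j, f)] (?o (Cod (D j) f))"
    if "f \<in> Ar (D j)" for f
    using that j o[OF ends(1)] o[OF ends(2)] by simp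
  have A: "FAr (colim_inj J D F j) f = ?c (?o (Dom (D j) f)) [(j, f)] (?o (Cod (D j) f))"
    if "f \<in> Ar (D j)" for f
    using that by (simp add: colim_inj_def)
  have O: "FOb (colim_inj J D F j) x = ?o x" if "x \<in> Ob (D j)" for x
    using that by (simp add: colim_inj_def)
  have AA: "?c v gs w \<in> Ar (colim_cat J D F)" if "is_path ?V ?G ?s ?t v gs w" for v gs w
    using that unfolding colim_cat_def presented_cat_simps by blast
  show ?thesis
    unfolding is_functor_def
  proof (intro conjI ballI impI)
    show "category (D j)" by fact
    show "category (colim_cat J D F)" by (rule category_colim_cat)
    show "FOb (colim_inj J D F j) \<in> Ob (D j) \<rightarrow>\<^sub>E Ob (colim_cat J D F)"
      unfolding colim_cat_def presented_cat_simps using o by (auto simp: colim_inj_def)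
    show "FAr (colim_inj J D F j) \<in> Ar (D j) \<rightarrow>\<^sub>E Ar (colim_cat J D F)"
      by (rule PiE_I) (simp_all only: A AA p, simp add: colim_inj_def)
  next
    fix x assume x: "x \<in> Ob (D j)"
    then have i: "Ident (D j) x \<in> Ar (D j)" "Dom (D j) (Ident (D j) x) = x"
      "Cod (D j) (Ident (D j) x) = x"
      using Dj by (auto simp: category_def hom_def)
    have "path_cong ?V ?G ?s ?t ?R (?o x) [(j, Ident (D j) x)] [] (?o x)"
      using p[OF i(1)] o[OF x] unfolding i(2,3)
      by (intro path_cong.rel colim_rel.ident j x) (simp_all only: is_path.simps)
    then show "FAr (colim_inj J D F j) (Ident (D j) x)
        = Ident (colim_cat J D F) (FOb (colim_inj J D F j) x)"
      unfolding A[OF i(1)] O[OF x] colim_cat_def presented_cat_simps i(2,3)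
      using p[OF i(1)] unfolding i(2,3) by (subst path_class_eq_iff) blast+
  next
    fix f assume f: "f \<in> Ar (D j)"
    show "Dom (colim_cat J D F) (FAr (colim_inj J D F j) f) = FOb (colim_inj J D F j) (Dom (D j) f)"
      "Cod (colim_cat J D F) (FAr (colim_inj J D F j) f) = FOb (colim_inj J D F j) (Cod (D j) f)"
      unfolding A[OF f] O[OF ends(1)[OF f]] O[OF ends(2)[OF f]] colim_cat_def presented_cat_simps
      by (rule HOL.refl)+
    fix g assume g: "g \<in> Ar (D j)" and m: "Dom (D j) g = Cod (D j) f"
    have h: "g \<cdot>\<^bsub>D j\<^esub> f \<in> Ar (D j)" "Dom (D j) (g \<cdot>\<^bsub>D j\<^esub> f) = Dom (D j) f"
      "Cod (D j) (g \<cdot>\<^bsub>D j\<^esub> f) = Cod (D j) g"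
      using Dj f g m by (auto simp: category_def hom_def)
    note pf = p[OF f] and pg = p[OF g, unfolded m] and ph = p[OF h(1), unfolded h(2,3)]
    have q: "is_path ?V ?G ?s ?t (?o (Dom (D j) f)) [(j, f), (j, g)] (?o (Cod (D j) g))"
      using is_path_append[OF pf pg] by (simp only: append.simps)
    have "path_cong ?V ?G ?s ?t ?R (?o (Dom (D j) f)) [(j, f), (j, g)] [(j, g \<cdot>\<^bsub>D j\<^esub> f)]
        (?o (Cod (D j) g))"
      by (rule path_cong.rel[where R = ?R and V = ?V and G = ?G and s = ?s and t = ?t, OF colim_rel.comp[where J = J and D = D and F = F, OF j f g m] q ph])
    then have "?c (?o (Dom (D j) f)) [(j, f), (j, g)] (?o (Cod (D j) g))
        = ?c (?o (Dom (D j) f)) [(j, g \<cdot>\<^bsub>D j\<^esub> f)] (?o (Cod (D j) g))"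
      by (intro iffD2[OF path_class_eq_iff[OF q]] conjI HOL.refl)
    then show "FAr (colim_inj J D F j) (g \<cdot>\<^bsub>D j\<^esub> f)
        = FAr (colim_inj J D F j) g \<cdot>\<^bsub>colim_cat J D F\<^esub> FAr (colim_inj J D F j) f"
      unfolding A[OF f] A[OF g] A[OF h(1)] h(2,3) m colim_cat_def presented_cat_Cmp[OF pf pg]
      by (simp only: append.simps)
  qed
qed

lemma colim_inj_cocone:
  assumes diag: "cat_diagram J D F" and k: "k \<in> Ar J"
  shows "comp_ftor (D (Dom J k)) (colim_inj J D F (Cod J k)) (F k) = colim_inj J D F (Dom J k)"
proof -
  let ?V = "colim_obs J D F" and ?G = "colim_gens J D" and ?s = "colim_src J D F"
    and ?t = "colim_tgt J D F" and ?R = "colim_rel J D F"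
  let ?c = "path_class ?V ?G ?s ?t ?R"
  have J: "Dom J k \<in> Ob J" "Cod J k \<in> Ob J" using diag k by (auto simp: cat_diagram_def category_def)
  have Fk: "is_functor (D (Dom J k)) (D (Cod J k)) (F k)" using diag k by (simp add: cat_diagram_def)
  note inj = colim_inj_functor[OF diag J(1)]
  show ?thesis
    unfolding comp_ftor_eq_iff[OF inj]
  proof (intro conjI ballI)
    fix x assume x: "x \<in> Ob (D (Dom J k))"
    have Fx: "FOb (F k) x \<in> Ob (D (Cod J k))" using Fk x by (auto simp: is_functor_def)
    show "FOb (colim_inj J D F (Cod J k)) (FOb (F k) x) = FOb (colim_inj J D F (Dom J k)) x"
      unfolding colim_inj_def ftor.simps restrict_apply'[OF x] restrict_apply'[OF Fx]
      by (rule colim_ob_glue[where D = D and J = J and F = F, OF k x])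
  next
    fix f assume f: "f \<in> Ar (D (Dom J k))"
    have cat: "category (D (Dom J k))" "category (D (Cod J k))" using Fk by (auto simp: is_functor_def)
    have d: "Dom (D (Dom J k)) f \<in> Ob (D (Dom J k))" "Cod (D (Dom J k)) f \<in> Ob (D (Dom J k))"
      using cat f by (auto simp: category_def)
    have Ff: "FAr (F k) f \<in> Ar (D (Cod J k))"
      "Dom (D (Cod J k)) (FAr (F k) f) = FOb (F k) (Dom (D (Dom J k)) f)"
      "Cod (D (Cod J k)) (FAr (F k) f) = FOb (F k) (Cod (D (Dom J k)) f)"
      using Fk f by (auto simp: is_functor_def)
    let ?v = "colim_ob J D F (Dom J k) (Dom (D (Dom J k)) f)"
    let ?w = "colim_ob J D F (Dom J k) (Cod (D (Dom J k)) f)"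
    have src: "?s (Cod J k, FAr (F k) f) = ?v" "?t (Cod J k, FAr (F k) f) = ?w"
      unfolding prod.case Ff(2,3)
      by (rule colim_ob_glue[where D = D and J = J and F = F, OF k d(1)],
          rule colim_ob_glue[where D = D and J = J and F = F, OF k d(2)])
    have V: "?v \<in> ?V" "?w \<in> ?V" using J d by blast+
    have p: "is_path ?V ?G ?s ?t ?v [(Dom J k, f)] ?w" using V J(1) f unfolding is_path.simps prod.case by blast
    have q: "is_path ?V ?G ?s ?t ?v [(Cod J k, FAr (F k) f)] ?w"
      using V J Ff(1) unfolding is_path.simps src by blast
    have "path_cong ?V ?G ?s ?t ?R ?v [(Dom J k, f)] [(Cod J k, FAr (F k) f)] ?w"
      by (rule path_cong.rel[where R = ?R and V = ?V and G = ?G and s = ?s and t = ?t, OF colim_rel.glue[where J = J and D = D and F = F, OF k f] p q])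
    then have "?c ?v [(Dom J k, f)] ?w = ?c ?v [(Cod J k, FAr (F k) f)] ?w"
      by (intro iffD2[OF path_class_eq_iff[OF p]] conjI HOL.refl)
    moreover have "FAr (colim_inj J D F (Cod J k)) (FAr (F k) f) = ?c ?v [(Cod J k, FAr (F k) f)] ?w"
      unfolding colim_inj_def ftor.simps restrict_apply'[OF Ff(1)] src by (rule HOL.refl)
    moreover have "FAr (colim_inj J D F (Dom J k)) f = ?c ?v [(Dom J k, f)] ?w"
      unfolding colim_inj_def ftor.simps restrict_apply'[OF f] prod.case by (rule HOL.refl)
    ultimately show "FAr (colim_inj J D F (Cod J k)) (FAr (F k) f) = FAr (colim_inj J D F (Dom J k)) f"
      by (simp only:)
  qed
qed

theorem colim_cat_universal:
  assumes diag: "cat_diagram J D F" and T: "category T"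
    and K: "\<And>j. j \<in> Ob J \<Longrightarrow> is_functor (D j) T (K j)"
    and cocone: "\<And>k. k \<in> Ar J \<Longrightarrow> comp_ftor (D (Dom J k)) (K (Cod J k)) (F k) = K (Dom J k)"
  shows "\<exists>!H. is_functor (colim_cat J D F) T H \<and>
              (\<forall>j\<in>Ob J. comp_ftor (D j) H (colim_inj J D F j) = K j)"
proof -
  let ?V = "colim_obs J D F" and ?G = "colim_gens J D" and ?s = "colim_src J D F"
    and ?t = "colim_tgt J D F" and ?R = "colim_rel J D F"
  let ?c = "path_class ?V ?G ?s ?t ?R" and ?o = "colim_ob J D F"
  define k0 where "k0 = (\<lambda>(j, x). FOb (K j) x)"
  define fo where "fo = (\<lambda>c. k0 (SOME p. p \<in> c))"
  define fg where "fg = (\<lambda>(j, f). FAr (K j) f)"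
  have J: "Dom J k \<in> Ob J" "Cod J k \<in> Ob J" if "k \<in> Ar J" for k
    using diag that by (auto simp: cat_diagram_def category_def)
  have Dj: "category (D j)" if "j \<in> Ob J" for j using diag that by (simp add: cat_diagram_def)
  have ends: "Dom (D j) f \<in> Ob (D j)" "Cod (D j) f \<in> Ob (D j)" if "j \<in> Ob J" "f \<in> Ar (D j)" for j f
    using Dj that by (auto simp: category_def)
  have coc: "FOb (K (Cod J k)) (FOb (F k) x) = FOb (K (Dom J k)) x"
    if "k \<in> Ar J" "x \<in> Ob (D (Dom J k))" for k x
    using cocone[OF that(1)] that comp_ftor_eq_iff[OF K[OF J(1)[OF that(1)]]] by blast
  have coc': "FAr (K (Cod J k)) (FAr (F k) f) = FAr (K (Dom J k)) f"
    if "k \<in> Ar J" "f \<in> Ar (D (Dom J k))" for k f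
    using cocone[OF that(1)] that comp_ftor_eq_iff[OF K[OF J(1)[OF that(1)]]] by blast
  have step: "k0 p = k0 q" if "(p, q) \<in> colim_step J D F" for p q
    using that coc by (auto simp: colim_step_def k0_def)
  have k0: "k0 p = k0 q" if "(p, q) \<in> (colim_step J D F \<union> (colim_step J D F)\<inverse>)\<^sup>*" for p q
    using that by (induction rule: rtrancl_induct) (auto dest: step)
  have fo: "fo (?o j x) = FOb (K j) x" for j x
  proof -
    have "(j, x) \<in> ?o j x" by (simp add: colim_ob_def)
    then have "(SOME p. p \<in> ?o j x) \<in> ?o j x" by (rule someI)
    then have "k0 (j, x) = k0 (SOME p. p \<in> ?o j x)" by (intro k0) (simp add: colim_ob_def)
    then show ?thesis by (simp add: fo_def k0_def)
  qed
  have foV: "fo v \<in> Ob T" if "v \<in> ?V" for v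
  proof -
    from that obtain j x where j: "v = ?o j x" "j \<in> Ob J" "x \<in> Ob (D j)" by blast
    have "FOb (K j) \<in> Ob (D j) \<rightarrow>\<^sub>E Ob T" using K[OF j(2)] by (simp add: is_functor_def)
    then show ?thesis using j by (auto simp: fo)
  qed
  have fgG: "fg g \<in> hom T (fo (?s g)) (fo (?t g))" if "g \<in> ?G" for g
    using that functor_hom[OF K] by (auto simp: fg_def fo)
  have stV: "?s g \<in> ?V \<and> ?t g \<in> ?V" if "g \<in> ?G" for g
  proof -
    obtain j f where g: "g = (j, f)" "j \<in> Ob J" "f \<in> Ar (D j)"
      using \<open>g \<in> ?G\<close> by (elim SigmaE)
    show ?thesis unfolding g(1) prod.case using g(2) ends[OF g(2,3)] by blast
  qed
  have R: "path_eval T ?t fo fg v gs = path_eval T ?t fo fg v hs"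
    if "?R gs hs" "is_path ?V ?G ?s ?t v gs w" "is_path ?V ?G ?s ?t v hs w" for v gs hs w
    using that(1)
  proof cases
    case (ident j x)
    have v: "v = ?o j x" using that(2) ident Dj[of j] by (auto simp: category_def hom_def)
    have "FAr (K j) (Ident (D j) x) = Ident T (FOb (K j) x)" "FOb (K j) x \<in> Ob T"
      using K[OF ident(3)] ident(4) by (auto simp: is_functor_def)
    then show ?thesis
      using ident Dj[OF ident(3)] T category_units[OF T category_Ident[OF T]]
      by (auto simp: fo fg_def v category_def hom_def)
  next
    case (comp j f g)
    have c: "FAr (K j) (g \<cdot>\<^bsub>D j\<^esub> f) = FAr (K j) g \<cdot>\<^bsub>T\<^esub> FAr (K j) f"
      using K[OF comp(3)] comp(4-6) by (simp add: is_functor_def)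
    have h: "g \<cdot>\<^bsub>D j\<^esub> f \<in> Ar (D j)" "Cod (D j) (g \<cdot>\<^bsub>D j\<^esub> f) = Cod (D j) g"
      using Dj[OF comp(3)] comp(4-6) by (auto simp: category_def hom_def)
    show ?thesis
      using category_units(1)[OF T functor_hom[OF K[OF comp(3)] comp(5)]]
        category_units(1)[OF T functor_hom[OF K[OF comp(3)] h(1)]]
      by (simp add: comp(1,2) fg_def fo c h(2))
  next
    case (glue k f)
    have Fk: "is_functor (D (Dom J k)) (D (Cod J k)) (F k)" using diag glue by (simp add: cat_diagram_def)
    have "FAr (F k) f \<in> Ar (D (Cod J k))" using Fk glue by (auto simp: is_functor_def)
    then show ?thesis
      using category_units(1)[OF T functor_hom[OF K[OF J(1)] glue(4)]]
        category_units(1)[OF T functor_hom[OF K[OF J(2)], of k "FAr (F k) f"]] glue(3)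
      by (simp add: glue(1,2) fg_def fo coc'[OF glue(3,4)])
  qed
  have vV: "(\<forall>v\<in>?V. FOb H v = fo v) \<longleftrightarrow> (\<forall>j\<in>Ob J. \<forall>x\<in>Ob (D j). FOb H (?o j x) = FOb (K j) x)" for H
    unfolding fo[symmetric] by blast
  have gG: "(\<forall>g\<in>?G. FAr H (?c (?s g) [g] (?t g)) = fg g) \<longleftrightarrow>
      (\<forall>j\<in>Ob J. \<forall>f\<in>Ar (D j). FAr H (?c (?s (j, f)) [(j, f)] (?t (j, f))) = FAr (K j) f)" for H
    unfolding fg_def split_paired_Ball_Sigma prod.case by (rule HOL.refl)
  have inj: "comp_ftor (D j) H (colim_inj J D F j) = K j \<longleftrightarrow>
      (\<forall>x\<in>Ob (D j). FOb H (?o j x) = FOb (K j) x) \<and>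
      (\<forall>f\<in>Ar (D j). FAr H (?c (?s (j, f)) [(j, f)] (?t (j, f))) = FAr (K j) f)"
    if "j \<in> Ob J" for H j
    unfolding comp_ftor_eq_iff[OF K[OF that]] colim_inj_def ftor.simps
    by (intro arg_cong2[where f = "(\<and>)"] ball_cong HOL.refl) (simp_all only: restrict_apply')
  have iff: "is_functor (colim_cat J D F) T H \<and>
        (\<forall>j\<in>Ob J. comp_ftor (D j) H (colim_inj J D F j) = K j) \<longleftrightarrow>
      is_functor (colim_cat J D F) T H \<and> (\<forall>v\<in>?V. FOb H v = fo v) \<and>
        (\<forall>g\<in>?G. FAr H (?c (?s g) [g] (?t g)) = fg g)" for H
    unfolding vV gG ball_conj_distrib[symmetric]
    by (intro arg_cong2[where f = "(\<and>)"] ball_cong HOL.refl) (rule inj)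
  have "\<exists>!H. is_functor (colim_cat J D F) T H \<and> (\<forall>v\<in>?V. FOb H v = fo v) \<and>
        (\<forall>g\<in>?G. FAr H (?c (?s g) [g] (?t g)) = fg g)"
    unfolding colim_cat_def
    by (rule presented_cat_universal[where V = ?V and G = ?G and s = ?s and t = ?t and R = ?R
        and fo = fo and fg = fg, OF T foV fgG stV R])
  then show ?thesis unfolding iff .
qed



section \<open>Localisation\<close>

text \<open>Generators: \<open>Inl f\<close> for the arrows \<open>f\<close> of \<open>C\<close>, and formal inverses \<open>Inr w\<close> for \<open>w \<in> W\<close>.
  The universal property is \<open>loc_cat_universal\<close> below.\<close>

inductive loc_rel :: "('o, 'a) cat \<Rightarrow> 'a set \<Rightarrow> ('a + 'a) list \<Rightarrow> ('a + 'a) list \<Rightarrow> bool"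
  for C W where
  ident: "x \<in> Ob C \<Longrightarrow> loc_rel C W [Inl (Ident C x)] []"
| comp: "f \<in> Ar C \<Longrightarrow> g \<in> Ar C \<Longrightarrow> Dom C g = Cod C f
    \<Longrightarrow> loc_rel C W [Inl f, Inl g] [Inl (g \<cdot>\<^bsub>C\<^esub> f)]"
| inv_left: "w \<in> W \<Longrightarrow> loc_rel C W [Inl w, Inr w] []"
| inv_right: "w \<in> W \<Longrightarrow> loc_rel C W [Inr w, Inl w] []"

definition loc_cat :: "('o, 'a) cat \<Rightarrow> 'a set \<Rightarrow> ('o, 'o \<times> ('a + 'a) list set \<times> 'o) cat" where
  "loc_cat C W = presented_cat (Ob C) (Inl ` Ar C \<union> Inr ` W)
     (case_sum (Dom C) (Cod C)) (case_sum (Cod C) (Dom C)) (loc_rel C W)"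

definition loc_ftor :: "('o, 'a) cat \<Rightarrow> 'a set
    \<Rightarrow> ('o, 'a, 'o, 'o \<times> ('a + 'a) list set \<times> 'o) ftor" where
  "loc_ftor C W =
     \<lparr>FOb = (\<lambda>x\<in>Ob C. x),
      FAr = (\<lambda>f\<in>Ar C. path_class (Ob C) (Inl ` Ar C \<union> Inr ` W)
               (case_sum (Dom C) (Cod C)) (case_sum (Cod C) (Dom C)) (loc_rel C W)
               (Dom C f) [Inl f] (Cod C f))\<rparr>"

lemma functor_iso_ar:
  assumes "is_functor C D F" and "iso_ar C f"
  shows "iso_ar D (FAr F f)"
proof -
  obtain g where f: "f \<in> Ar C" and g: "g \<in> hom C (Cod C f) (Dom C f)"
    and e: "g \<cdot>\<^bsub>C\<^esub> f = Ident C (Dom C f)" "f \<cdot>\<^bsub>C\<^esub> g = Ident C (Cod C f)"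
    using assms(2) unfolding iso_ar_def by blast
  have g': "g \<in> Ar C" "Dom C g = Cod C f" "Cod C g = Dom C f" using g by (auto simp: hom_def)
  have o: "Dom C f \<in> Ob C" "Cod C f \<in> Ob C" using assms(1) f by (auto simp: is_functor_def category_def)
  have i: "FAr F (Ident C x) = Ident D (FOb F x)" if "x \<in> Ob C" for x
    using assms(1) that by (simp add: is_functor_def)
  have h: "FAr F f \<in> hom D (FOb F (Dom C f)) (FOb F (Cod C f))"
    "FAr F g \<in> hom D (FOb F (Cod C f)) (FOb F (Dom C f))"
    using functor_hom[OF assms(1) f] functor_hom[OF assms(1) g'(1)] g' by simp_all
  have "FAr F g \<cdot>\<^bsub>D\<^esub> FAr F f = Ident D (FOb F (Dom C f))"
    "FAr F f \<cdot>\<^bsub>D\<^esub> FAr F g = Ident D (FOb F (Cod C f))"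
    using functor_Cmp[OF assms(1) f g'(1) g'(2)] functor_Cmp[OF assms(1) g'(1) f g'(3)[symmetric]] e i o
    by simp_all
  then show ?thesis using h unfolding iso_ar_def hom_def by auto
qed

lemma category_loc_cat: "category (loc_cat C W)"
  unfolding loc_cat_def by (rule category_presented_cat)

context
  fixes C :: "('o, 'a) cat" and W :: "'a set"
  assumes C: "category C" and W: "W \<subseteq> Ar C"
begin

private abbreviation (input) "lG \<equiv> Inl ` Ar C \<union> Inr ` W"
private abbreviation (input) "ls \<equiv> case_sum (Dom C) (Cod C)"
private abbreviation (input) "lt \<equiv> case_sum (Cod C) (Dom C)"
private abbreviation (input) "lpath \<equiv> is_path (Ob C) lG ls lt"
private abbreviation (input) "lclass \<equiv> path_class (Ob C) lG ls lt (loc_rel C W)"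
private abbreviation (input) "lcong \<equiv> path_cong (Ob C) lG ls lt (loc_rel C W)"

private lemma ends: "f \<in> Ar C \<Longrightarrow> Dom C f \<in> Ob C" "f \<in> Ar C \<Longrightarrow> Cod C f \<in> Ob C"
  using C by (auto simp: category_def)

private lemma path_Inl: "f \<in> Ar C \<Longrightarrow> lpath (Dom C f) [Inl f] (Cod C f)"
  using ends by simp

private lemma path_Inr: "w \<in> W \<Longrightarrow> lpath (Cod C w) [Inr w] (Dom C w)"
  using ends W by auto

private lemma path_Nil: "x \<in> Ob C \<Longrightarrow> lpath x [] x"
  by simp

private lemma in_Ar: "lpath v gs w \<Longrightarrow> lclass v gs w \<in> Ar (loc_cat C W)"
  unfolding loc_cat_def presented_cat_simps by blast

private lemma class_eq:
  "loc_rel C W gs hs \<Longrightarrow> lpath v gs w \<Longrightarrow> lpath v hs w \<Longrightarrow> lclass v gs w = lclass v hs w"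
  using path_class_eq_iff path_cong.rel by metis

private lemma FAr_loc: "f \<in> Ar C \<Longrightarrow> FAr (loc_ftor C W) f = lclass (Dom C f) [Inl f] (Cod C f)"
  by (simp add: loc_ftor_def)

private lemma FOb_loc: "x \<in> Ob C \<Longrightarrow> FOb (loc_ftor C W) x = x"
  by (simp add: loc_ftor_def)

lemma loc_ftor_functor: "is_functor C (loc_cat C W) (loc_ftor C W)"
  unfolding is_functor_def
proof (intro conjI ballI impI)
  show "category C" by (rule C)
  show "category (loc_cat C W)" by (rule category_loc_cat)
  show "FOb (loc_ftor C W) \<in> Ob C \<rightarrow>\<^sub>E Ob (loc_cat C W)"
    unfolding loc_cat_def presented_cat_simps by (auto simp: loc_ftor_def)
  show "FAr (loc_ftor C W) \<in> Ar C \<rightarrow>\<^sub>E Ar (loc_cat C W)"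
    by (rule PiE_I) (simp_all only: FAr_loc in_Ar path_Inl, simp add: loc_ftor_def)
next
  fix x assume x: "x \<in> Ob C"
  then have i: "Ident C x \<in> Ar C" "Dom C (Ident C x) = x" "Cod C (Ident C x) = x"
    using C by (auto simp: category_def hom_def)
  show "FAr (loc_ftor C W) (Ident C x) = Ident (loc_cat C W) (FOb (loc_ftor C W) x)"
    unfolding FAr_loc[OF i(1)] FOb_loc[OF x] i(2,3) loc_cat_def presented_cat_simps
    by (rule class_eq[OF loc_rel.ident[OF x] path_Inl[OF i(1), unfolded i(2,3)] path_Nil[OF x]])
next
  fix f assume f: "f \<in> Ar C"
  show "Dom (loc_cat C W) (FAr (loc_ftor C W) f) = FOb (loc_ftor C W) (Dom C f)"
    "Cod (loc_cat C W) (FAr (loc_ftor C W) f) = FOb (loc_ftor C W) (Cod C f)"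
    unfolding FAr_loc[OF f] FOb_loc[OF ends(1)[OF f]] FOb_loc[OF ends(2)[OF f]]
      loc_cat_def presented_cat_simps by (rule HOL.refl)+
  fix g assume g: "g \<in> Ar C" and m: "Dom C g = Cod C f"
  have h: "g \<cdot>\<^bsub>C\<^esub> f \<in> Ar C" "Dom C (g \<cdot>\<^bsub>C\<^esub> f) = Dom C f" "Cod C (g \<cdot>\<^bsub>C\<^esub> f) = Cod C g"
    using C f g m by (auto simp: category_def hom_def)
  note pf = path_Inl[OF f] and pg = path_Inl[OF g, unfolded m] and ph = path_Inl[OF h(1), unfolded h(2,3)]
  have q: "lpath (Dom C f) [Inl f, Inl g] (Cod C g)"
    using is_path_append[OF pf pg] by (simp only: append.simps)
  show "FAr (loc_ftor C W) (g \<cdot>\<^bsub>C\<^esub> f)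
      = FAr (loc_ftor C W) g \<cdot>\<^bsub>loc_cat C W\<^esub> FAr (loc_ftor C W) f"
    unfolding FAr_loc[OF f] FAr_loc[OF g] FAr_loc[OF h(1)] h(2,3) m loc_cat_def
      presented_cat_Cmp[OF pf pg] append.simps
    by (rule class_eq[OF loc_rel.comp[OF f g m] q ph, symmetric])
qed

lemma loc_ftor_inverts: "w \<in> W \<Longrightarrow> iso_ar (loc_cat C W) (FAr (loc_ftor C W) w)"
proof -
  assume w: "w \<in> W"
  then have w': "w \<in> Ar C" using W by blast
  note p = path_Inl[OF w'] and q = path_Inr[OF w] and o = ends[OF w']
  note pq = is_path_append[OF p q, unfolded append.simps] and qp = is_path_append[OF q p, unfolded append.simps]
  let ?L = "loc_cat C W"
  have ep: "Dom ?L (lclass (Dom C w) [Inl w] (Cod C w)) = Dom C w"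
    "Cod ?L (lclass (Dom C w) [Inl w] (Cod C w)) = Cod C w"
    unfolding loc_cat_def presented_cat_simps by (rule HOL.refl)+
  show ?thesis
    unfolding iso_ar_def FAr_loc[OF w'] ep
  proof (intro conjI bexI)
    show "lclass (Dom C w) [Inl w] (Cod C w) \<in> Ar ?L" by (rule in_Ar[OF p])
    show "lclass (Cod C w) [Inr w] (Dom C w) \<in> hom ?L (Cod C w) (Dom C w)"
      using in_Ar[OF q] unfolding hom_def loc_cat_def
      by (simp only: presented_cat_simps(3,4) mem_Collect_eq simp_thms)
    show "lclass (Cod C w) [Inr w] (Dom C w) \<cdot>\<^bsub>?L\<^esub> lclass (Dom C w) [Inl w] (Cod C w)
        = Ident ?L (Dom C w)"
      unfolding loc_cat_def presented_cat_Cmp[OF p q] presented_cat_simps append.simps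
      by (rule class_eq[OF loc_rel.inv_left[OF w] pq path_Nil[OF o(1)]])
    show "lclass (Dom C w) [Inl w] (Cod C w) \<cdot>\<^bsub>?L\<^esub> lclass (Cod C w) [Inr w] (Dom C w)
        = Ident ?L (Cod C w)"
      unfolding loc_cat_def presented_cat_Cmp[OF q p] presented_cat_simps append.simps
      by (rule class_eq[OF loc_rel.inv_right[OF w] qp path_Nil[OF o(2)]])
  qed
qed

lemma inverse_unique:
  assumes "category T" "u \<in> hom T x y" "p \<in> hom T y x" "q \<in> hom T y x"
    and "p \<cdot>\<^bsub>T\<^esub> u = Ident T x" "u \<cdot>\<^bsub>T\<^esub> q = Ident T y"
  shows "p = q"
proof -
  have "p \<cdot>\<^bsub>T\<^esub> (u \<cdot>\<^bsub>T\<^esub> q) = (p \<cdot>\<^bsub>T\<^esub> u) \<cdot>\<^bsub>T\<^esub> q"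
    using assms(1-4) by (auto simp: category_def hom_def)
  then show ?thesis
    using assms category_units(1)[OF assms(1,4)] category_units(2)[OF assms(1,3)] by simp
qed

theorem loc_cat_universal:
  fixes T :: "('p, 'b) cat"
  assumes K: "is_functor C T K" and inv: "\<And>w. w \<in> W \<Longrightarrow> iso_ar T (FAr K w)"
  shows "\<exists>!H. is_functor (loc_cat C W) T H \<and> comp_ftor C H (loc_ftor C W) = K"
proof -
  have T: "category T" using K by (simp add: is_functor_def)
  define i where "i w = (SOME g. g \<in> hom T (Cod T (FAr K w)) (Dom T (FAr K w)) \<and>
     g \<cdot>\<^bsub>T\<^esub> FAr K w = Ident T (Dom T (FAr K w)) \<and>
     FAr K w \<cdot>\<^bsub>T\<^esub> g = Ident T (Cod T (FAr K w)))" for w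
  define fg where "fg = case_sum (FAr K) i"
  note Kh = functor_hom[OF K]
  have WA: "w \<in> Ar C" if "w \<in> W" for w using that W by blast
  have i: "i w \<in> hom T (FOb K (Cod C w)) (FOb K (Dom C w))"
    "i w \<cdot>\<^bsub>T\<^esub> FAr K w = Ident T (FOb K (Dom C w))"
    "FAr K w \<cdot>\<^bsub>T\<^esub> i w = Ident T (FOb K (Cod C w))" if "w \<in> W" for w
  proof -
    have d: "Dom T (FAr K w) = FOb K (Dom C w)" "Cod T (FAr K w) = FOb K (Cod C w)"
      using Kh[OF WA[OF that]] by (auto simp: hom_def)
    have "\<exists>g. g \<in> hom T (Cod T (FAr K w)) (Dom T (FAr K w)) \<and>
     g \<cdot>\<^bsub>T\<^esub> FAr K w = Ident T (Dom T (FAr K w)) \<and>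
     FAr K w \<cdot>\<^bsub>T\<^esub> g = Ident T (Cod T (FAr K w))"
      using inv[OF that] unfolding iso_ar_def by blast
    from someI_ex[OF this, folded i_def] show "i w \<in> hom T (FOb K (Cod C w)) (FOb K (Dom C w))"
      "i w \<cdot>\<^bsub>T\<^esub> FAr K w = Ident T (FOb K (Dom C w))"
      "FAr K w \<cdot>\<^bsub>T\<^esub> i w = Ident T (FOb K (Cod C w))"
      unfolding d by blast+
  qed
  have fo: "FOb K x \<in> Ob T" if "x \<in> Ob C" for x using K that by (auto simp: is_functor_def)
  have KI: "FAr K (Ident C x) = Ident T (FOb K x)" if "x \<in> Ob C" for x
    using K that by (simp add: is_functor_def)
  have fgG: "fg g \<in> hom T (FOb K (ls g)) (FOb K (lt g))" if "g \<in> lG" for g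
    using that Kh i(1) by (auto simp: fg_def)
  have st: "ls g \<in> Ob C \<and> lt g \<in> Ob C" if "g \<in> lG" for g
    using that ends WA by auto
  have eh: "FAr K f \<cdot>\<^bsub>T\<^esub> Ident T (FOb K (Dom C f)) = FAr K f"
    "Ident T (FOb K (Cod C f)) \<cdot>\<^bsub>T\<^esub> FAr K f = FAr K f" if "f \<in> Ar C" for f
    using category_units[OF T Kh[OF that]] by auto
  have ei: "Ident T (FOb K (Dom C w)) \<cdot>\<^bsub>T\<^esub> i w = i w" if "w \<in> W" for w
    using category_units[OF T i(1)[OF that]] by auto
  have R: "path_eval T lt (FOb K) fg v gs = path_eval T lt (FOb K) fg v hs"
    if "loc_rel C W gs hs" "lpath v gs w" "lpath v hs w" for v gs hs w
    using that(1)
  proof cases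
    case (ident x)
    have a: "Ident C x \<in> Ar C" "Dom C (Ident C x) = x" "Cod C (Ident C x) = x"
      using C ident by (auto simp: category_def hom_def)
    then show ?thesis using that(2) ident eh(2)[OF a(1)] KI by (simp add: fg_def)
  next
    case (comp f g)
    have h: "g \<cdot>\<^bsub>C\<^esub> f \<in> Ar C" "Cod C (g \<cdot>\<^bsub>C\<^esub> f) = Cod C g"
      using C comp by (auto simp: category_def hom_def)
    show ?thesis
      using eh(2)[OF comp(4)] eh(2)[OF h(1)] functor_Cmp[OF K comp(3-5)] h(2)
      by (simp add: comp(1,2) fg_def)
  next
    case (inv_left w)
    then have v: "v = Dom C w" using that(2) by auto
    show ?thesis using i(2) ei inv_left by (simp add: fg_def v)
  next
    case (inv_right w)
    then have v: "v = Cod C w" using that(2) by auto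
    show ?thesis using i(3) eh(2)[OF WA] inv_right by (simp add: fg_def v)
  qed
  have ex1: "\<exists>!H. is_functor (loc_cat C W) T H \<and> (\<forall>x\<in>Ob C. FOb H x = FOb K x) \<and>
      (\<forall>g\<in>lG. FAr H (lclass (ls g) [g] (lt g)) = fg g)"
    unfolding loc_cat_def
    by (rule presented_cat_universal[where V = "Ob C" and G = lG and s = ls and t = lt
        and R = "loc_rel C W" and fo = "FOb K" and fg = fg, OF T fo fgG st R])
  have iff: "is_functor (loc_cat C W) T H \<and> comp_ftor C H (loc_ftor C W) = K \<longleftrightarrow>
      is_functor (loc_cat C W) T H \<and> (\<forall>x\<in>Ob C. FOb H x = FOb K x) \<and>
      (\<forall>g\<in>lG. FAr H (lclass (ls g) [g] (lt g)) = fg g)" for H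
  proof
    assume a: "is_functor (loc_cat C W) T H \<and> (\<forall>x\<in>Ob C. FOb H x = FOb K x) \<and>
      (\<forall>g\<in>lG. FAr H (lclass (ls g) [g] (lt g)) = fg g)"
    have "FAr H (FAr (loc_ftor C W) f) = FAr K f" if f: "f \<in> Ar C" for f
    proof -
      have "FAr H (lclass (ls (Inl f)) [Inl f] (lt (Inl f))) = fg (Inl f)" using a f by blast
      then show ?thesis by (simp only: FAr_loc[OF f] fg_def sum.case)
    qed
    then show "is_functor (loc_cat C W) T H \<and> comp_ftor C H (loc_ftor C W) = K"
      using a by (simp add: comp_ftor_eq_iff[OF K] FOb_loc)
  next
    assume a: "is_functor (loc_cat C W) T H \<and> comp_ftor C H (loc_ftor C W) = K"
    then have H: "is_functor (loc_cat C W) T H" by blast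
    have o: "FOb H x = FOb K x" if "x \<in> Ob C" for x
      using a that unfolding comp_ftor_eq_iff[OF K] by (metis FOb_loc)
    have l: "FAr H (FAr (loc_ftor C W) f) = FAr K f" if "f \<in> Ar C" for f
      using a that unfolding comp_ftor_eq_iff[OF K] by blast
    have r: "FAr H (lclass (Cod C w) [Inr w] (Dom C w)) = i w" if w: "w \<in> W" for w
    proof -
      let ?L = "loc_cat C W"
      let ?c = "lclass (Cod C w) [Inr w] (Dom C w)" and ?d = "lclass (Dom C w) [Inl w] (Cod C w)"
      note w' = WA[OF w]
      note p = path_Inl[OF w'] and q = path_Inr[OF w] and e = ends[OF w']
      note pq = is_path_append[OF p q, unfolded append.simps]
      have m: "Dom ?L ?c = Cod C w" "Cod ?L ?c = Dom C w" "Dom ?L ?d = Dom C w" "Cod ?L ?d = Cod C w"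
        unfolding loc_cat_def presented_cat_simps by (rule HOL.refl)+
      have I: "?c \<cdot>\<^bsub>?L\<^esub> ?d = Ident ?L (Dom C w)"
        unfolding loc_cat_def presented_cat_Cmp[OF p q] presented_cat_simps append.simps
        by (rule class_eq[OF loc_rel.inv_left[OF w] pq path_Nil[OF e(1)]])
      have x: "Dom C w \<in> Ob ?L" unfolding loc_cat_def presented_cat_simps by (rule e)
      have "FAr H ?c \<cdot>\<^bsub>T\<^esub> FAr H ?d = FAr H (Ident ?L (Dom C w))"
        unfolding I[symmetric]
        by (rule functor_Cmp[OF H in_Ar[OF p] in_Ar[OF q], symmetric]) (simp only: m)
      also have "\<dots> = Ident T (FOb K (Dom C w))"
        using H x o[OF e(1)] by (simp add: is_functor_def)
      finally have "FAr H ?c \<cdot>\<^bsub>T\<^esub> FAr K w = Ident T (FOb K (Dom C w))"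
        unfolding l[OF w', unfolded FAr_loc[OF w']] .
      moreover have "FAr H ?c \<in> hom T (FOb K (Cod C w)) (FOb K (Dom C w))"
        using functor_hom[OF H in_Ar[OF q]] unfolding m o[OF e(1)] o[OF e(2)] .
      ultimately show ?thesis
        using inverse_unique[OF T Kh[OF w'] _ i(1)[OF w] _ i(3)[OF w]] by blast
    qed
    have "FAr H (lclass (ls g) [g] (lt g)) = fg g" if "g \<in> lG" for g
    proof (cases g)
      case (Inl f)
      then have f: "f \<in> Ar C" using that by auto
      show ?thesis using l[OF f] unfolding FAr_loc[OF f] Inl fg_def sum.case .
    next
      case (Inr w)
      then have w: "w \<in> W" using that by auto
      show ?thesis using r[OF w] unfolding Inr fg_def sum.case .
    qed
    then show "is_functor (loc_cat C W) T H \<and> (\<forall>x\<in>Ob C. FOb H x = FOb K x) \<and>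
      (\<forall>g\<in>lG. FAr H (lclass (ls g) [g] (lt g)) = fg g)"
      using H o by blast
  qed
  show ?thesis unfolding iff by (rule ex1)
qed

end


definition wide_subcategory :: "('o, 'a) cat \<Rightarrow> 'a set \<Rightarrow> bool" where
  "wide_subcategory C W \<longleftrightarrow> W \<subseteq> Ar C \<and> (\<forall>x\<in>Ob C. Ident C x \<in> W) \<and>
     (\<forall>f\<in>W. \<forall>g\<in>W. Dom C g = Cod C f \<longrightarrow> g \<cdot>\<^bsub>C\<^esub> f \<in> W)"

definition two_of_three :: "('o, 'a) cat \<Rightarrow> 'a set \<Rightarrow> bool" where
  "two_of_three C W \<longleftrightarrow> (\<forall>f\<in>Ar C. \<forall>g\<in>Ar C. Dom C g = Cod C f \<longrightarrow>
     (f \<in> W \<and> g \<in> W \<longrightarrow> g \<cdot>\<^bsub>C\<^esub> f \<in> W) \<and>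
     (f \<in> W \<and> g \<cdot>\<^bsub>C\<^esub> f \<in> W \<longrightarrow> g \<in> W) \<and>
     (g \<in> W \<and> g \<cdot>\<^bsub>C\<^esub> f \<in> W \<longrightarrow> f \<in> W))"


section \<open>Profunctors, collages and matching objects\<close>

text \<open>A profunctor \<open>D\<^sup>o\<^sup>p \<times> L \<rightarrow> Set\<close> is a functor \<open>prod_cat (op_cat D) L \<rightarrow> set_cat\<close>.
  \<open>prof_at D L P i\<close> is \<open>P(i, -)\<close>.\<close>

type_synonym ('d, 'e, 'l, 'm, 'h) prof =
  "('d \<times> 'l, 'e \<times> 'm, 'h set, 'h set \<times> ('h \<Rightarrow> 'h) \<times> 'h set) ftor"

definition prof_at :: "('d, 'e) cat \<Rightarrow> ('l, 'm) cat \<Rightarrow> ('d, 'e, 'l, 'm, 'h) prof \<Rightarrow> 'd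
    \<Rightarrow> ('l, 'm, 'h set, 'h set \<times> ('h \<Rightarrow> 'h) \<times> 'h set) ftor" where
  "prof_at D L P i = \<lparr>FOb = (\<lambda>j\<in>Ob L. FOb P (i, j)), FAr = (\<lambda>b\<in>Ar L. FAr P (Ident D i, b))\<rparr>"

datatype ('d, 'e, 'l, 'm, 'h) collage_ar = Up 'e | Lo 'm | Cross 'd 'l 'h

definition collage :: "('d, 'e) cat \<Rightarrow> ('l, 'm) cat \<Rightarrow> ('d, 'e, 'l, 'm, 'h) prof
    \<Rightarrow> ('d + 'l, ('d, 'e, 'l, 'm, 'h) collage_ar) cat" where
  "collage D L P =
     \<lparr>Ob = Inl ` Ob D \<union> Inr ` Ob L,
      Ar = Up ` Ar D \<union> Lo ` Ar L \<union>
           {Cross i j u |i j u. i \<in> Ob D \<and> j \<in> Ob L \<and> u \<in> FOb P (i, j)},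
      Dom = (\<lambda>x. case x of Up a \<Rightarrow> Inl (Dom D a) | Lo b \<Rightarrow> Inr (Dom L b) | Cross i j u \<Rightarrow> Inl i),
      Cod = (\<lambda>x. case x of Up a \<Rightarrow> Inl (Cod D a) | Lo b \<Rightarrow> Inr (Cod L b) | Cross i j u \<Rightarrow> Inr j),
      Ident = (\<lambda>x. case x of Inl i \<Rightarrow> Up (Ident D i) | Inr j \<Rightarrow> Lo (Ident L j)),
      Cmp = (\<lambda>y x. case (y, x) of
          (Up a', Up a) \<Rightarrow> Up (a' \<cdot>\<^bsub>D\<^esub> a)
        | (Lo b', Lo b) \<Rightarrow> Lo (b' \<cdot>\<^bsub>L\<^esub> b)
        | (Lo b, Cross i j u) \<Rightarrow> Cross i (Cod L b) (app (FAr P (Ident D i, b)) u)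
        | (Cross i j u, Up a) \<Rightarrow> Cross (Dom D a) j (app (FAr P (a, Ident L j)) u)
        | _ \<Rightarrow> undefined)\<rparr>"

definition collage_up :: "('d, 'e) cat
    \<Rightarrow> ('d, 'e, 'd + 'l, ('d, 'e, 'l, 'm, 'h) collage_ar) ftor" where
  "collage_up D = \<lparr>FOb = (\<lambda>i\<in>Ob D. Inl i), FAr = (\<lambda>a\<in>Ar D. Up a)\<rparr>"

definition collage_lo :: "('l, 'm) cat
    \<Rightarrow> ('l, 'm, 'd + 'l, ('d, 'e, 'l, 'm, 'h) collage_ar) ftor" where
  "collage_lo L = \<lparr>FOb = (\<lambda>j\<in>Ob L. Inr j), FAr = (\<lambda>b\<in>Ar L. Lo b)\<rparr>"

definition elements_proj :: "('l, 'm) cat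
    \<Rightarrow> ('l, 'm, 'h set, 'h set \<times> ('h \<Rightarrow> 'h) \<times> 'h set) ftor
    \<Rightarrow> ('l \<times> 'h, ('l \<times> 'h) \<times> 'm \<times> ('l \<times> 'h), 'l, 'm) ftor" where
  "elements_proj L F = \<lparr>FOb = (\<lambda>p\<in>Ob (elements L F). fst p),
                        FAr = (\<lambda>t\<in>Ar (elements L F). fst (snd t))\<rparr>"

text \<open>For \<open>Y : L \<rightarrow> E\<close>, the functor \<open>D \<rightarrow> E\<close> sending \<open>i\<close> to the limit of \<open>Y\<close> over the category
  of elements of \<open>P(i, -)\<close>. An arrow \<open>w : i \<rightarrow> i'\<close> acts by reindexing along \<open>u \<mapsto> u \<cdot> w\<close>.\<close>

definition match_diag :: "('d, 'e) cat \<Rightarrow> ('l, 'm) cat \<Rightarrow> ('d, 'e, 'l, 'm, 'h) prof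
    \<Rightarrow> ('l, 'm, 'q, 'c) ftor \<Rightarrow> 'd
    \<Rightarrow> ('l \<times> 'h, ('l \<times> 'h) \<times> 'm \<times> ('l \<times> 'h), 'q, 'c) ftor" where
  "match_diag D L P Y i = comp_ftor (elements L (prof_at D L P i)) Y (elements_proj L (prof_at D L P i))"

definition match_ob :: "('d, 'e) cat \<Rightarrow> ('l, 'm) cat \<Rightarrow> ('d, 'e, 'l, 'm, 'h) prof
    \<Rightarrow> ('q, 'c) cat \<Rightarrow> ('l, 'm, 'q, 'c) ftor \<Rightarrow> ('d, 'e, 'q, 'c) ftor" where
  "match_ob D L P E Y =
     \<lparr>FOb = (\<lambda>i\<in>Ob D. lim_ob (elements L (prof_at D L P i)) E (match_diag D L P Y i)),
      FAr = (\<lambda>w\<in>Ar D.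
        lim_map (elements L (prof_at D L P (Cod D w))) E (match_diag D L P Y (Cod D w))
          (lim_ob (elements L (prof_at D L P (Dom D w))) E (match_diag D L P Y (Dom D w)))
          (\<lambda>(j, u). lim_proj (elements L (prof_at D L P (Dom D w))) E (match_diag D L P Y (Dom D w))
                      (j, app (FAr P (w, Ident L j)) u)))\<rparr>"

definition match_ar :: "('d, 'e) cat \<Rightarrow> ('l, 'm) cat \<Rightarrow> ('d, 'e, 'l, 'm, 'h) prof
    \<Rightarrow> ('q, 'c) cat \<Rightarrow> ('l, 'm, 'q, 'c) ntrans \<Rightarrow> ('d, 'e, 'q, 'c) ntrans" where
  "match_ar D L P E t =
     \<lparr>NDom = match_ob D L P E (NDom t), NCod = match_ob D L P E (NCod t),
      NComp = (\<lambda>i\<in>Ob D.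
        lim_map (elements L (prof_at D L P i)) E (match_diag D L P (NCod t) i)
          (lim_ob (elements L (prof_at D L P i)) E (match_diag D L P (NDom t) i))
          (\<lambda>(j, u). NComp t j \<cdot>\<^bsub>E\<^esub>
             lim_proj (elements L (prof_at D L P i)) E (match_diag D L P (NDom t) i) (j, u)))\<rparr>"

text \<open>The matching object \<open>lim ((c/C)\<^sup>o \<rightarrow> C \<rightarrow> E)\<close> at an object \<open>c\<close>.\<close>

definition coslice_diag :: "('o, 'a) cat \<Rightarrow> ('o, 'a, 'q, 'c) ftor \<Rightarrow> 'o
    \<Rightarrow> ('a, 'a \<times> 'a \<times> 'a, 'q, 'c) ftor" where
  "coslice_diag C X c =
     \<lparr>FOb = (\<lambda>f\<in>Ob (proper_coslice C c). FOb X (Cod C f)),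
      FAr = (\<lambda>t\<in>Ar (proper_coslice C c). FAr X (fst (snd t)))\<rparr>"

definition coslice_match_ob :: "('o, 'a) cat \<Rightarrow> ('q, 'c) cat \<Rightarrow> ('o, 'a, 'q, 'c) ftor \<Rightarrow> 'o \<Rightarrow> 'q" where
  "coslice_match_ob C E X c = lim_ob (proper_coslice C c) E (coslice_diag C X c)"

definition coslice_match_ar :: "('o, 'a) cat \<Rightarrow> ('q, 'c) cat \<Rightarrow> ('o, 'a, 'q, 'c) ntrans \<Rightarrow> 'o \<Rightarrow> 'c"
  where
  "coslice_match_ar C E t c =
     lim_map (proper_coslice C c) E (coslice_diag C (NCod t) c)
       (coslice_match_ob C E (NDom t) c)
       (\<lambda>f. NComp t (Cod C f) \<cdot>\<^bsub>E\<^esub> lim_proj (proper_coslice C c) E (coslice_diag C (NDom t) c) f)"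


section \<open>Iterated gluing diagrams\<close>

definition strict_inverse :: "('o, 'a) cat \<Rightarrow> ('o \<Rightarrow> nat) \<Rightarrow> bool" where
  "strict_inverse N d \<longleftrightarrow> category N \<and>
     (\<forall>a\<in>Ar N. a \<noteq> Ident N (Dom N a) \<longrightarrow> d (Dom N a) > d (Cod N a))"

text \<open>\<open>I_{<n}\<close> and its coprojections \<open>I_{n'} \<rightarrow> I_{<n}\<close>, indexed by the non-identity \<open>n \<rightarrow> n'\<close>.\<close>

abbreviation lower_shape :: "('no, 'na) cat \<Rightarrow> 'no \<Rightarrow> ('na, 'na \<times> 'na \<times> 'na) cat" where
  "lower_shape N n \<equiv> op_cat (proper_coslice N n)"

definition lower_cat :: "('no, 'na) cat \<Rightarrow> ('no \<Rightarrow> ('io, 'ia) cat)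
    \<Rightarrow> ('na \<Rightarrow> ('io, 'ia, 'io, 'ia) ftor) \<Rightarrow> 'no
    \<Rightarrow> (('na \<times> 'io) set, ('na \<times> 'io) set \<times> ('na \<times> 'ia) list set \<times> ('na \<times> 'io) set) cat" where
  "lower_cat N I Ia n =
     colim_cat (lower_shape N n) (\<lambda>\<alpha>. I (Cod N \<alpha>)) (\<lambda>(\<alpha>, h, \<beta>). Ia h)"

definition lower_inj :: "('no, 'na) cat \<Rightarrow> ('no \<Rightarrow> ('io, 'ia) cat)
    \<Rightarrow> ('na \<Rightarrow> ('io, 'ia, 'io, 'ia) ftor) \<Rightarrow> 'no \<Rightarrow> 'na
    \<Rightarrow> ('io, 'ia, ('na \<times> 'io) set, ('na \<times> 'io) set \<times> ('na \<times> 'ia) list set \<times> ('na \<times> 'io) set) ftor"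
  where
  "lower_inj N I Ia n \<alpha> =
     colim_inj (lower_shape N n) (\<lambda>\<alpha>. I (Cod N \<alpha>)) (\<lambda>(\<alpha>, h, \<beta>). Ia h) \<alpha>"

text \<open>The collage structure of \<open>I\<^sub>n\<close> is an isomorphism \<open>G_coll n\<close> from the collage of the
  profunctor \<open>G_prof n\<close> onto \<open>I\<^sub>n\<close>; it supplies the inclusions of \<open>I_{<n}\<close> and of the boundary
  category \<open>G_bd n\<close>.\<close>

record ('no, 'na, 'io, 'ia, 'd, 'e, 'h) gluing =
  G_N :: "('no, 'na) cat"
  G_deg :: "'no \<Rightarrow> nat"
  G_I :: "'no \<Rightarrow> ('io, 'ia) cat"
  G_Iar :: "'na \<Rightarrow> ('io, 'ia, 'io, 'ia) ftor"
  G_bd :: "'no \<Rightarrow> ('d, 'e) cat"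
  G_prof :: "'no \<Rightarrow> ('d, 'e, ('na \<times> 'io) set,
      ('na \<times> 'io) set \<times> ('na \<times> 'ia) list set \<times> ('na \<times> 'io) set, 'h) prof"
  G_coll :: "'no \<Rightarrow> ('d + ('na \<times> 'io) set,
      ('d, 'e, ('na \<times> 'io) set,
       ('na \<times> 'io) set \<times> ('na \<times> 'ia) list set \<times> ('na \<times> 'io) set, 'h) collage_ar, 'io, 'ia) ftor"

abbreviation G_lower :: "('no, 'na, 'io, 'ia, 'd, 'e, 'h) gluing \<Rightarrow> 'no
    \<Rightarrow> (('na \<times> 'io) set, ('na \<times> 'io) set \<times> ('na \<times> 'ia) list set \<times> ('na \<times> 'io) set) cat" where
  "G_lower G n \<equiv> lower_cat (G_N G) (G_I G) (G_Iar G) n"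

definition iterated_gluing :: "('no, 'na, 'io, 'ia, 'd, 'e, 'h) gluing \<Rightarrow> bool" where
  "iterated_gluing G \<longleftrightarrow>
     strict_inverse (G_N G) (G_deg G) \<and>
     cat_diagram (op_cat (G_N G)) (G_I G) (G_Iar G) \<and>
     (\<forall>n\<in>Ob (G_N G).
        category (G_bd G n) \<and>
        is_functor (prod_cat (op_cat (G_bd G n)) (G_lower G n)) set_cat (G_prof G n) \<and>
        iso_ftor (collage (G_bd G n) (G_lower G n) (G_prof G n)) (G_I G n) (G_coll G n) \<and>
        (\<forall>\<alpha>\<in>Ob (proper_coslice (G_N G) n).
           comp_ftor (G_I G (Cod (G_N G) \<alpha>))
             (comp_ftor (G_lower G n) (G_coll G n) (collage_lo (G_lower G n)))
             (lower_inj (G_N G) (G_I G) (G_Iar G) n \<alpha>)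
           = G_Iar G \<alpha>))"

definition G_inf :: "('no, 'na, 'io, 'ia, 'd, 'e, 'h) gluing
    \<Rightarrow> (('no \<times> 'io) set, ('no \<times> 'io) set \<times> ('no \<times> 'ia) list set \<times> ('no \<times> 'io) set) cat" where
  "G_inf G = colim_cat (op_cat (G_N G)) (G_I G) (G_Iar G)"

definition G_inj :: "('no, 'na, 'io, 'ia, 'd, 'e, 'h) gluing \<Rightarrow> 'no
    \<Rightarrow> ('io, 'ia, ('no \<times> 'io) set, ('no \<times> 'io) set \<times> ('no \<times> 'ia) list set \<times> ('no \<times> 'io) set) ftor"
  where
  "G_inj G n = colim_inj (op_cat (G_N G)) (G_I G) (G_Iar G) n"

text \<open>\<open>G_coll_inf G n\<close> is the composite from the collage to \<open>I\<^sub>n\<close> to the gluing category; it is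
  restricted to the boundary (\<open>G_bd_inf\<close>) and to \<open>I_{<n}\<close> (\<open>G_lower_inf\<close>).\<close>

abbreviation G_collage :: "('no, 'na, 'io, 'ia, 'd, 'e, 'h) gluing \<Rightarrow> 'no
    \<Rightarrow> ('d + ('na \<times> 'io) set,
      ('d, 'e, ('na \<times> 'io) set,
       ('na \<times> 'io) set \<times> ('na \<times> 'ia) list set \<times> ('na \<times> 'io) set, 'h) collage_ar) cat" where
  "G_collage G n \<equiv> collage (G_bd G n) (G_lower G n) (G_prof G n)"

definition G_coll_inf where
  "G_coll_inf G n = comp_ftor (G_collage G n) (G_inj G n) (G_coll G n)"

definition G_bd_inf where
  "G_bd_inf G n = comp_ftor (G_bd G n) (G_coll_inf G n) (collage_up (G_bd G n))"

definition G_lower_inf where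
  "G_lower_inf G n = comp_ftor (G_lower G n) (G_coll_inf G n) (collage_lo (G_lower G n))"

text \<open>\<open>G_under G n i\<close> is \<open>i / I_{<n}\<close>.\<close>

definition G_under where
  "G_under G n i = elements (G_lower G n) (prof_at (G_bd G n) (G_lower G n) (G_prof G n) i)"

definition G_Ho where
  "G_Ho G W = loc_cat (G_inf G) W"

definition G_gamma where
  "G_gamma G W = loc_ftor (G_inf G) W"

definition G_bd_Ho where
  "G_bd_Ho G W n = comp_ftor (G_bd G n) (G_gamma G W) (G_bd_inf G n)"

text \<open>The action of the localisation functor on \<open>i / I_{<n}\<close>: an object \<open>(j, u : i \<rightarrow> j)\<close> is sent
  to the image of \<open>u\<close>. Whether the values avoid the identity of \<open>[i]\<^sub>n\<close>, i.e. whether this is a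
  functor into the proper coslice, is a hypothesis where it is used.\<close>

definition G_gamma_at where
  "G_gamma_at G W n i =
     (let K = comp_ftor (G_collage G n) (G_gamma G W) (G_coll_inf G n);
          c = (\<lambda>(j, u). FAr K (Cross i j u))
      in \<lparr>FOb = (\<lambda>p\<in>Ob (G_under G n i). c p),
          FAr = (\<lambda>t\<in>Ar (G_under G n i). case t of (p, b, q) \<Rightarrow> (c p, FAr K (Lo b), c q))\<rparr>)"

text \<open>The matching functor \<open>M\<^sub>n\<close> on a natural transformation of functors out of the gluing
  category.\<close>

definition G_match where
  "G_match G E n t = match_ar (G_bd G n) (G_lower G n) (G_prof G n) E
     (FAr (precomp (G_lower G n) (G_inf G) E (G_lower_inf G n)) t)"

end

theory Submission
  imports Defs
begin

text \<open>Suppose that \<open>f : c \<rightarrow> c'\<close> is a non-identity isomorphism of \<open>Ho I\<^sub>\<infinity>\<close>. Initiality factors \<open>f\<close> through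
  the image of some \<open>u\<close> from \<open>c\<close> into a lower stage; this image is split mono and epi, hence an
  isomorphism between objects of different degrees, and its inverse is a non-identity isomorphism
  out of an object of smaller degree. By descent \<open>Ho I\<^sub>\<infinity>\<close> has no non-identity isomorphisms. Hence
  \<open>\<gamma>\<close> is bijective on objects and full, and it kills every arrow that does not lower the degree;
  initiality says moreover that the fibre of \<open>\<gamma>\<close> over an arrow out of \<open>c\<close> is connected, modulo
  what \<open>\<gamma>\<close> identifies below \<open>c\<close>.

  Let \<open>Q = \<Pi>\<^sub>B C\<close>, let \<open>Q'\<close> be the dependent product of \<open>\<gamma>\<^sup>*C\<close>, and let \<open>\<phi> : \<gamma>\<^sup>*Q \<rightarrow> Q'\<close> be the
  comparison. By induction on the degree of \<open>i\<close> the component \<open>\<phi>\<^sub>i\<close> is invertible: replacing the value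
  \<open>Q\<^sub>i\<close> by \<open>Q'\<^sub>i\<close> gives a functor on \<open>Ho I\<^sub>\<infinity>\<close>, and the universal property of \<open>Q\<close> yields a retraction
  \<open>r\<close> of \<open>\<phi>\<^sub>i\<close>; replacing \<open>Q'\<^sub>i\<close> by \<open>Q\<^sub>i\<close> gives a functor on \<open>I\<^sub>\<infinity>\<close>, and the universal property of \<open>Q'\<close>
  yields a retraction of \<open>r\<close>.\<close>

text \<open>A universal property speaks about whole functors, so a single value of \<open>Q\<close>
  or \<open>Q'\<close> is accessible only through test functors that differ from it at one object.
  Such a change keeps functoriality because nothing that leaves an object for another one comes
  back, which is where degrees enter; when \<open>Q\<close> is changed, the maps out of the new
  value use the inverses of \<open>\<phi>\<close> known in lower degrees. Two mismatches between the
  categories shape the argument. An arrow of the localisation has many preimages, and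
  \<open>Q'\<close> must act in the same way along all of them before its value can be inserted into
  \<open>Q\<close>; connected fibres yield this from the induction hypothesis. And boundary objects
  may have endomorphisms, which \<open>\<gamma>\<close> kills but \<open>Q'\<close> need not; the
  retraction \<open>r\<close> is invariant under them because it is unique. Pullbacks are chosen
  independently in the two functor categories, so the core argument treats maps out of a fibre
  product as operations on generalised elements, where no choice occurs; pullbacks return only when
  the adjunctions are translated into this language.\<close>

section \<open>Dependent products in terms of generalised elements\<close>

lemma category_assoc:
  "category C \<Longrightarrow> f \<in> Ar C \<Longrightarrow> g \<in> Ar C \<Longrightarrow> h \<in> Ar C \<Longrightarrow> Dom C g = Cod C f \<Longrightarrow> Dom C h = Cod C g
    \<Longrightarrow> (h \<cdot>\<^bsub>C\<^esub> g) \<cdot>\<^bsub>C\<^esub> f = h \<cdot>\<^bsub>C\<^esub> (g \<cdot>\<^bsub>C\<^esub> f)"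
  by (simp add: category_def)

lemma category_comp:
  fixes C (structure)
  assumes "category C" "f \<in> Ar C" "g \<in> Ar C" "Dom C g = Cod C f"
  shows "g \<cdot> f \<in> Ar C" "Dom C (g \<cdot> f) = Dom C f" "Cod C (g \<cdot> f) = Cod C g"
  using assms by (auto simp: category_def hom_def)

lemma category_ident:
  assumes "category C" "x \<in> Ob C"
  shows "Ident C x \<in> Ar C" "Dom C (Ident C x) = x" "Cod C (Ident C x) = x"
  using assms by (auto simp: category_def hom_def)

lemma category_comp_ident:
  fixes C (structure)
  assumes "category C" "f \<in> Ar C"
  shows "Dom C f = x \<Longrightarrow> f \<cdot> Ident C x = f" "Cod C f = x \<Longrightarrow> Ident C x \<cdot> f = f"
  using assms by (auto simp: category_def)

lemma category_ends:
  assumes "category C" "f \<in> Ar C"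
  shows "Dom C f \<in> Ob C" "Cod C f \<in> Ob C"
  using assms by (auto simp: category_def)

lemmas category_simps = category_assoc category_comp category_ident category_comp_ident category_ends

lemma functor_simps:
  assumes "is_functor C D F"
  shows "x \<in> Ob C \<Longrightarrow> FOb F x \<in> Ob D"
    and "a \<in> Ar C \<Longrightarrow> FAr F a \<in> Ar D"
    and "a \<in> Ar C \<Longrightarrow> Dom D (FAr F a) = FOb F (Dom C a)"
    and "a \<in> Ar C \<Longrightarrow> Cod D (FAr F a) = FOb F (Cod C a)"
    and "x \<in> Ob C \<Longrightarrow> FAr F (Ident C x) = Ident D (FOb F x)"
  using assms by (auto simp: is_functor_def)

lemma functor_cats: "is_functor C D F \<Longrightarrow> category C" "is_functor C D F \<Longrightarrow> category D"
  by (auto simp: is_functor_def)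

text \<open>Naturality of a bare family. Unlike \<open>ntrans\<close> it records no source and
  target and asks for no extensionality, so families defined by cases on the object qualify as they
  stand.\<close>

definition nat_fam where
  "nat_fam D E F G t \<longleftrightarrow>
     (\<forall>x\<in>Ob D. t x \<in> hom E (FOb F x) (FOb G x)) \<and>
     (\<forall>a\<in>Ar D. t (Cod D a) \<cdot>\<^bsub>E\<^esub> FAr F a = FAr G a \<cdot>\<^bsub>E\<^esub> t (Dom D a))"

lemma nat_fam_simps:
  assumes "nat_fam D E F G t" "x \<in> Ob D"
  shows "t x \<in> Ar E" "Dom E (t x) = FOb F x" "Cod E (t x) = FOb G x"
  using assms by (auto simp: nat_fam_def hom_def)

lemma nat_fam_comm:
  fixes E (structure)
  assumes "nat_fam D E F G t" "a \<in> Ar D" "Dom D a = x" "Cod D a = y"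
  shows "t y \<cdot> FAr F a = FAr G a \<cdot> t x"
  using assms by (auto simp: nat_fam_def)

text \<open>A generalised element, at stage \<open>Dom E b\<close>, of the fibre product of
  \<open>f\<close> and \<open>z\<close>; the fibre product itself need not exist for this to make
  sense.\<close>

definition comm_sq where
  "comm_sq E f z b y \<longleftrightarrow> b \<in> Ar E \<and> y \<in> Ar E \<and> Dom E b = Dom E y \<and>
     Cod E b = Dom E f \<and> Cod E y = Dom E z \<and> f \<cdot>\<^bsub>E\<^esub> b = z \<cdot>\<^bsub>E\<^esub> y"

lemma comm_sq_map:
  fixes E (structure)
  assumes A: "is_functor D E A" and B: "is_functor D E B" and Y: "is_functor D E Y"
    and f: "nat_fam D E B A f" and z: "nat_fam D E Y A z"
    and sq: "comm_sq E (f x) (z x) b y" and a: "a \<in> Ar D" "Dom D a = x"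
  shows "comm_sq E (f (Cod D a)) (z (Cod D a)) (FAr B a \<cdot> b) (FAr Y a \<cdot> y)"
proof -
  have E: "category E" and x: "x \<in> Ob D" "Cod D a \<in> Ob D"
    using a category_ends[OF functor_cats(1)[OF A]] functor_cats(2)[OF A] by auto
  note As = functor_simps[OF A] and Bs = functor_simps[OF B] and Ys = functor_simps[OF Y]
    and fs = nat_fam_simps[OF f] and zs = nat_fam_simps[OF z] and Es = category_simps[OF E]
  have "f (Cod D a) \<cdot> FAr B a \<cdot> b = (FAr A a \<cdot> f x) \<cdot> b"
    using sq a x nat_fam_comm[OF f a HOL.refl] unfolding comm_sq_def
    by (simp add: fs Bs flip: category_assoc[OF E])
  also have "\<dots> = FAr A a \<cdot> z x \<cdot> y"
    using sq a x unfolding comm_sq_def by (simp add: fs As Es)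
  also have "\<dots> = (z (Cod D a) \<cdot> FAr Y a) \<cdot> y"
    using sq a x nat_fam_comm[OF z a HOL.refl] unfolding comm_sq_def by (simp add: zs As Es)
  also have "\<dots> = z (Cod D a) \<cdot> FAr Y a \<cdot> y"
    using sq a x unfolding comm_sq_def by (simp add: zs Ys Es)
  finally show ?thesis
    using sq a x unfolding comm_sq_def by (simp add: zs Ys Es fs Bs)
qed

text \<open>A map \<open>B \<times>\<^sub>A Z \<rightarrow> C\<close> over \<open>B\<close>, given by its action on generalised elements \<open>(b, y)\<close> of the
  fibre product; this avoids choosing pullbacks.\<close>

definition section_op where
  "section_op D E B C Z f g z s \<longleftrightarrow>
     (\<forall>x\<in>Ob D. \<forall>b y. comm_sq E (f x) (z x) b y \<longrightarrow>
        s x b y \<in> hom E (Dom E b) (FOb C x) \<and> g x \<cdot>\<^bsub>E\<^esub> s x b y = b \<and>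
        (\<forall>t\<in>Ar E. Cod E t = Dom E b \<longrightarrow> s x (b \<cdot>\<^bsub>E\<^esub> t) (y \<cdot>\<^bsub>E\<^esub> t) = s x b y \<cdot>\<^bsub>E\<^esub> t) \<and>
        (\<forall>a\<in>Ar D. Dom D a = x \<longrightarrow>
           FAr C a \<cdot>\<^bsub>E\<^esub> s x b y = s (Cod D a) (FAr B a \<cdot>\<^bsub>E\<^esub> b) (FAr Z a \<cdot>\<^bsub>E\<^esub> y)))"

text \<open>\<open>h\<close> is a map over the base whose transpose is \<open>s\<close>: the last
  clause equates \<open>s\<close> with the composite of \<open>ev\<close> and the pullback of
  \<open>h\<close>, tested on generalised elements.\<close>

definition is_lift where
  "is_lift D E Q f p ev Z z s h \<longleftrightarrow> nat_fam D E Z Q h \<and>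
     (\<forall>x\<in>Ob D. p x \<cdot>\<^bsub>E\<^esub> h x = z x \<and>
        (\<forall>b y. comm_sq E (f x) (z x) b y \<longrightarrow> ev x b (h x \<cdot>\<^bsub>E\<^esub> y) = s x b y))"

text \<open>The universal property of a dependent product with evaluation \<open>ev\<close>: each
  section operation is the transpose of exactly one map. Uniqueness is asserted on the objects of
  \<open>D\<close> only, because families are unconstrained elsewhere.\<close>

definition is_dprod where
  "is_dprod D E A B C f g Q p ev \<longleftrightarrow> is_functor D E Q \<and> nat_fam D E Q A p \<and>
     section_op D E B C Q f g p ev \<and>
     (\<forall>Z z s. is_functor D E Z \<longrightarrow> nat_fam D E Z A z \<longrightarrow> section_op D E B C Z f g z s \<longrightarrow>
        (\<exists>h. is_lift D E Q f p ev Z z s h) \<and>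
        (\<forall>h h'. is_lift D E Q f p ev Z z s h \<longrightarrow> is_lift D E Q f p ev Z z s h' \<longrightarrow>
           (\<forall>x\<in>Ob D. h x = h' x)))"

section \<open>Changing the value of a functor at one object\<close>

definition replace_ob where
  "replace_ob D E Q i n m out =
     \<lparr>FOb = (\<lambda>x\<in>Ob D. if x = i then n else FOb Q x),
      FAr = (\<lambda>a\<in>Ar D. if Dom D a = i then if Cod D a = i then Ident E n else out a
                       else if Cod D a = i then m \<cdot>\<^bsub>E\<^esub> FAr Q a else FAr Q a)\<rparr>"

text \<open>The map \<open>m\<close> leads from the old value at \<open>i\<close> to the new one,
  and \<open>out\<close> supplies the action of the arrows that leave \<open>i\<close>.
  Endomorphisms of \<open>i\<close> act on the new value as the identity, hence
  \<open>m_endo\<close> and \<open>out_endo\<close>. A path that leaves \<open>i\<close> for another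
  object and comes back would also have to act as the identity, which \<open>m\<close> and
  \<open>out\<close> cannot guarantee; \<open>no_return\<close> excludes it.\<close>

locale replacement =
  fixes D :: "('o, 'a) cat" and E :: "('p, 'b) cat" (structure) and Q i n m out
  assumes Q: "is_functor D E Q" and i: "i \<in> Ob D"
    and no_return: "\<And>a b. a \<in> Ar D \<Longrightarrow> b \<in> Ar D \<Longrightarrow> Dom D a = i \<Longrightarrow> Dom D b = Cod D a \<Longrightarrow>
          Cod D b = i \<Longrightarrow> Cod D a = i"
    and n: "n \<in> Ob E" and m: "m \<in> Ar E" "Dom E m = FOb Q i" "Cod E m = n"
    and m_endo: "\<And>a. a \<in> Ar D \<Longrightarrow> Dom D a = i \<Longrightarrow> Cod D a = i \<Longrightarrow> m \<cdot> FAr Q a = m"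
    and out: "\<And>a. a \<in> Ar D \<Longrightarrow> Dom D a = i \<Longrightarrow> Cod D a \<noteq> i \<Longrightarrow> out a \<in> hom E n (FOb Q (Cod D a))"
    and out_m: "\<And>a. a \<in> Ar D \<Longrightarrow> Dom D a = i \<Longrightarrow> Cod D a \<noteq> i \<Longrightarrow> out a \<cdot> m = FAr Q a"
    and out_comp: "\<And>a b. a \<in> Ar D \<Longrightarrow> b \<in> Ar D \<Longrightarrow> Dom D a = i \<Longrightarrow> Cod D a \<noteq> i \<Longrightarrow>
          Dom D b = Cod D a \<Longrightarrow> out (b \<cdot>\<^bsub>D\<^esub> a) = FAr Q b \<cdot> out a"
    and out_endo: "\<And>a b. a \<in> Ar D \<Longrightarrow> b \<in> Ar D \<Longrightarrow> Dom D a = i \<Longrightarrow> Cod D a = i \<Longrightarrow> Dom D b = i \<Longrightarrow>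
          Cod D b \<noteq> i \<Longrightarrow> out (b \<cdot>\<^bsub>D\<^esub> a) = out b"
begin

abbreviation "Z \<equiv> replace_ob D E Q i n m out"

lemmas D = functor_cats(1)[OF Q] and E = functor_cats(2)[OF Q]
lemmas Qs = functor_simps[OF Q]
lemmas Ds = category_simps[OF D] and Es = category_simps[OF E]

lemma out_simps:
  assumes "a \<in> Ar D" "Dom D a = i" "Cod D a \<noteq> i"
  shows "out a \<in> Ar E" "Dom E (out a) = n" "Cod E (out a) = FOb Q (Cod D a)"
  using out[OF assms] by (auto simp: hom_def)

lemma functor_Z: "is_functor D E Z"
  unfolding is_functor_def
proof (intro conjI ballI impI)
  show "category D" "category E" using D E by auto
  show "FOb Z \<in> Ob D \<rightarrow>\<^sub>E Ob E" using n Qs by (auto simp: replace_ob_def)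
  show "FAr Z \<in> Ar D \<rightarrow>\<^sub>E Ar E"
    using n m out_simps i by (auto simp: replace_ob_def Qs Es)
next
  fix a assume a: "a \<in> Ar D"
  then show "Dom E (FAr Z a) = FOb Z (Dom D a)" "Cod E (FAr Z a) = FOb Z (Cod D a)"
    using n m out_simps i by (auto simp: replace_ob_def Qs Es Ds)
next
  fix x assume "x \<in> Ob D"
  then show "FAr Z (Ident D x) = Ident E (FOb Z x)"
    using n by (auto simp: replace_ob_def Qs Ds)
next
  fix a b assume a: "a \<in> Ar D" and b: "b \<in> Ar D" and ab: "Dom D b = Cod D a"
  note c = category_comp[OF D a b ab]
  have q: "FAr Q (b \<cdot>\<^bsub>D\<^esub> a) = FAr Q b \<cdot> FAr Q a" using functor_Cmp[OF Q a b ab] .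
  show "FAr Z (b \<cdot>\<^bsub>D\<^esub> a) = FAr Z b \<cdot> FAr Z a"
  proof (cases "Dom D a = i")
    case ai: True
    show ?thesis
    proof (cases "Cod D a = i")
      case True
      then show ?thesis using a b c ab ai n out_simps out_endo[OF a b ai True]
        by (auto simp: replace_ob_def Es)
    next
      case False
      then have "Cod D b \<noteq> i" using no_return[OF a b ai ab] by auto
      then show ?thesis using a b c ab ai False n out_simps out_comp[OF a b ai False ab]
        by (auto simp: replace_ob_def Es)
    qed
  next
    case ai: False
    show ?thesis
    proof (cases "Cod D a = i")
      case True
      \<comment> \<open>For a path that only passes through \<open>i\<close> the new value drops
        out, since \<open>out b \<cdot> m = FAr Q b\<close>.\<close>
      have "FAr Q b \<cdot> FAr Q a = out b \<cdot> (m \<cdot> FAr Q a)" if "Cod D b \<noteq> i"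
        using out_m[OF b _ that] that True ab a b m out_simps[OF b]
          by (simp add: Es Qs flip: category_assoc[OF E])
      moreover have "m \<cdot> (FAr Q b \<cdot> FAr Q a) = m \<cdot> FAr Q a" if "Cod D b = i"
        using m_endo[OF b _ that] that True ab a b m by (simp add: Es Qs flip: category_assoc[OF E])
      ultimately show ?thesis using a b c ab ai True n m q
        by (auto simp: replace_ob_def Es Qs)
    next
      case False
      then show ?thesis using a b c ab ai q m by (auto simp: replace_ob_def Es Qs)
    qed
  qed
qed

end

text \<open>\<open>pn\<close> and \<open>evn\<close> are the structure map and the evaluation at the
  new value. They fit those of \<open>Q\<close> along the arrows out of \<open>i\<close>, so the
  modified functor becomes a test object for the universal property of \<open>Q\<close>;
  \<open>pn_m\<close> and \<open>evn_m\<close> make \<open>m\<close>, completed by identities, a map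
  of such objects.\<close>

locale replacement_dprod = replacement D E Q i n m out
  for D :: "('o, 'a) cat" and E :: "('p, 'b) cat" (structure) and Q i n m out +
  fixes A B C f g p ev pn evn
  assumes dprod: "is_dprod D E A B C f g Q p ev"
    and A: "is_functor D E A" and B: "is_functor D E B" and C: "is_functor D E C"
    and f: "nat_fam D E B A f" and g: "nat_fam D E C B g"
    and pn: "pn \<in> hom E n (FOb A i)" and pn_m: "pn \<cdot> m = p i"
    and pn_endo: "\<And>a. a \<in> Ar D \<Longrightarrow> Dom D a = i \<Longrightarrow> Cod D a = i \<Longrightarrow> FAr A a \<cdot> pn = pn"
    and pn_out: "\<And>a. a \<in> Ar D \<Longrightarrow> Dom D a = i \<Longrightarrow> Cod D a \<noteq> i \<Longrightarrow>
          FAr A a \<cdot> pn = p (Cod D a) \<cdot> out a"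
    and evn: "\<And>b y. comm_sq E (f i) pn b y \<Longrightarrow> evn b y \<in> hom E (Dom E b) (FOb C i)"
      "\<And>b y. comm_sq E (f i) pn b y \<Longrightarrow> g i \<cdot> evn b y = b"
      "\<And>b y t. comm_sq E (f i) pn b y \<Longrightarrow> t \<in> Ar E \<Longrightarrow> Cod E t = Dom E b \<Longrightarrow>
          evn (b \<cdot> t) (y \<cdot> t) = evn b y \<cdot> t"
    and evn_endo: "\<And>b y a. comm_sq E (f i) pn b y \<Longrightarrow> a \<in> Ar D \<Longrightarrow> Dom D a = i \<Longrightarrow> Cod D a = i \<Longrightarrow>
          FAr C a \<cdot> evn b y = evn (FAr B a \<cdot> b) y"
    and evn_out: "\<And>b y a. comm_sq E (f i) pn b y \<Longrightarrow> a \<in> Ar D \<Longrightarrow> Dom D a = i \<Longrightarrow> Cod D a \<noteq> i \<Longrightarrow>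
          FAr C a \<cdot> evn b y = ev (Cod D a) (FAr B a \<cdot> b) (out a \<cdot> y)"
    and evn_m: "\<And>b y. comm_sq E (f i) (p i) b y \<Longrightarrow> evn b (m \<cdot> y) = ev i b y"
begin

abbreviation "pz \<equiv> (\<lambda>x. if x = i then pn else p x)"
abbreviation "sz \<equiv> (\<lambda>x. if x = i then evn else ev x)"

text \<open>What makes \<open>r\<close>, completed by identities away from \<open>i\<close>, a lift
  from the modified functor to \<open>Q\<close>. The clause on \<open>r \<cdot> m\<close> takes care
  of naturality at arrows into \<open>i\<close>, and it is also the retraction that is wanted in the
  comparison.\<close>

definition factors where
  "factors r \<longleftrightarrow> r \<in> hom E n (FOb Q i) \<and> r \<cdot> m = Ident E (FOb Q i) \<and> p i \<cdot> r = pn \<and>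
     (\<forall>a\<in>Ar D. Dom D a = i \<longrightarrow> FAr Q a \<cdot> r = (if Cod D a = i then r else out a)) \<and>
     (\<forall>b y. comm_sq E (f i) pn b y \<longrightarrow> ev i b (r \<cdot> y) = evn b y)"

lemmas As = functor_simps[OF A] and Bs = functor_simps[OF B] and Cs = functor_simps[OF C]
lemmas fs = nat_fam_simps[OF f] and gs = nat_fam_simps[OF g]
lemma p: "nat_fam D E Q A p" and ev: "section_op D E B C Q f g p ev"
  using dprod by (auto simp: is_dprod_def)
lemmas ps = nat_fam_simps[OF p]

lemma pn_simps: "pn \<in> Ar E" "Dom E pn = n" "Cod E pn = FOb A i"
  using pn by (auto simp: hom_def)

lemma pz_nat: "nat_fam D E Z A pz"
  unfolding nat_fam_def
proof (intro conjI ballI)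
  fix x assume "x \<in> Ob D"
  then show "pz x \<in> hom E (FOb Z x) (FOb A x)"
    using pn ps by (auto simp: replace_ob_def hom_def)
next
  fix a assume a: "a \<in> Ar D"
  have c: "p (Cod D a) \<cdot> FAr Q a = FAr A a \<cdot> p (Dom D a)"
    using nat_fam_comm[OF p a] by simp
  show "pz (Cod D a) \<cdot> FAr Z a = FAr A a \<cdot> pz (Dom D a)"
  proof (cases "Dom D a = i")
    case True
    then show ?thesis
      using a n i pn_simps pn_endo[OF a] pn_out[OF a] by (auto simp: replace_ob_def Es)
  next
    case False
    have "pn \<cdot> (m \<cdot> FAr Q a) = FAr A a \<cdot> p (Dom D a)" if "Cod D a = i"
      using c that a m pn_simps by (simp add: Es Qs flip: pn_m)
    then show ?thesis using False a c by (auto simp: replace_ob_def)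
  qed
qed

lemma sz_section: "section_op D E B C Z f g pz sz"
  unfolding section_op_def
proof (intro ballI allI impI)
  fix x b y assume x: "x \<in> Ob D" and sq: "comm_sq E (f x) (pz x) b y"
  show "sz x b y \<in> hom E (Dom E b) (FOb C x) \<and> g x \<cdot> sz x b y = b \<and>
        (\<forall>t\<in>Ar E. Cod E t = Dom E b \<longrightarrow> sz x (b \<cdot> t) (y \<cdot> t) = sz x b y \<cdot> t) \<and>
        (\<forall>a\<in>Ar D. Dom D a = x \<longrightarrow>
           FAr C a \<cdot> sz x b y = sz (Cod D a) (FAr B a \<cdot> b) (FAr Z a \<cdot> y))"
  proof (cases "x = i")
    case True
    with sq have sq: "comm_sq E (f i) pn b y" by simp
    then have y: "y \<in> Ar E" "Cod E y = n" using pn_simps by (auto simp: comm_sq_def)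
    have "FAr C a \<cdot> evn b y = sz (Cod D a) (FAr B a \<cdot> b) (FAr Z a \<cdot> y)"
      if "a \<in> Ar D" "Dom D a = i" for a
      using evn_endo[OF sq that] evn_out[OF sq that] that y by (auto simp: replace_ob_def Es)
    then show ?thesis using True evn[OF sq] by auto
  next
    case False
    with sq have sq: "comm_sq E (f x) (p x) b y" by simp
    have y: "y \<in> Ar E" "Cod E y = FOb Q x" using sq ps[OF x] by (auto simp: comm_sq_def)
    note e = ev[unfolded section_op_def, rule_format, OF x sq]
    have "FAr C a \<cdot> ev x b y = sz (Cod D a) (FAr B a \<cdot> b) (FAr Z a \<cdot> y)"
      if a: "a \<in> Ar D" "Dom D a = x" for a
    proof (cases "Cod D a = i")
      case True
      have "comm_sq E (f i) (p i) (FAr B a \<cdot> b) (FAr Q a \<cdot> y)"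
        using comm_sq_map[OF A B Q f p sq a] True by simp
      from evn_m[OF this] show ?thesis
        using True a e False y m by (auto simp: replace_ob_def Es Qs)
    qed (use a e False in \<open>auto simp: replace_ob_def\<close>)
    then show ?thesis using False e by auto
  qed
qed

lemma lift_of_factors:
  assumes r: "factors r"
  shows "is_lift D E Q f p ev Z pz sz (\<lambda>x. if x = i then r else Ident E (FOb Q x))"
    (is "is_lift D E Q f p ev Z pz sz ?h")
proof -
  have rs: "r \<in> Ar E" "Dom E r = n" "Cod E r = FOb Q i" using r by (auto simp: factors_def hom_def)
  have rm: "r \<cdot> m = Ident E (FOb Q i)" using r by (simp add: factors_def)
  have "nat_fam D E Z Q ?h" unfolding nat_fam_def
  proof (intro conjI ballI)
    fix x assume "x \<in> Ob D"
    then show "?h x \<in> hom E (FOb Z x) (FOb Q x)"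
      using r by (auto simp: factors_def replace_ob_def hom_def Es Qs)
  next
    fix a assume a: "a \<in> Ar D"
    have "r \<cdot> (m \<cdot> FAr Q a) = FAr Q a" if "Cod D a = i"
      using rm that a rs m i by (simp add: Es Qs flip: category_assoc[OF E])
    then show "?h (Cod D a) \<cdot> FAr Z a = FAr Q a \<cdot> ?h (Dom D a)"
      using a r rs out_simps[OF a] n by (auto simp: replace_ob_def Es Qs Ds factors_def)
  qed
  moreover have "ev x b (Ident E (FOb Q x) \<cdot> y) = ev x b y"
    if "x \<in> Ob D" "comm_sq E (f x) (p x) b y" for x b y
    using that ps by (auto simp: comm_sq_def Es)
  ultimately show ?thesis using r ps unfolding is_lift_def factors_def by (auto simp: Es)
qed

lemma ident_lift: "is_lift D E Q f p ev Q p ev (\<lambda>x. Ident E (FOb Q x))"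
  unfolding is_lift_def nat_fam_def using ps by (auto simp: Es Qs Ds hom_def comm_sq_def)

text \<open>Completed by identities, both maps lift the same section operation on the modified
  functor.\<close>

lemma factors_unique: "factors r \<Longrightarrow> factors r' \<Longrightarrow> r = r'"
proof -
  assume r: "factors r" "factors r'"
  have "\<forall>x\<in>Ob D. (if x = i then r else Ident E (FOb Q x)) = (if x = i then r' else Ident E (FOb Q x))"
    using dprod functor_Z pz_nat sz_section lift_of_factors[OF r(1)] lift_of_factors[OF r(2)]
    unfolding is_dprod_def by blast
  then show ?thesis using i by force
qed

text \<open>The universal property gives a lift \<open>h\<close> from the modified functor to
  \<open>Q\<close>. In the other direction there is the map that is \<open>m\<close> at
  \<open>i\<close> and the identity elsewhere. The round trip from \<open>Q\<close> to
  \<open>Q\<close> lifts the evaluation of \<open>Q\<close> itself, as the identity does, so it is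
  the identity: \<open>h i\<close> is a retraction of \<open>m\<close>, and \<open>h\<close> is
  trivial away from \<open>i\<close>.\<close>

lemma ex_factors: "\<exists>r. factors r"
proof -
  obtain h where h: "is_lift D E Q f p ev Z pz sz h"
    using dprod functor_Z pz_nat sz_section unfolding is_dprod_def by blast
  then have hn: "nat_fam D E Z Q h" and hp: "\<And>x. x \<in> Ob D \<Longrightarrow> p x \<cdot> h x = pz x"
    and he: "\<And>x b y. x \<in> Ob D \<Longrightarrow> comm_sq E (f x) (pz x) b y \<Longrightarrow> ev x b (h x \<cdot> y) = sz x b y"
    unfolding is_lift_def by auto
  let ?m = "\<lambda>x. if x = i then m else Ident E (FOb Q x)"
  have hs: "h x \<in> Ar E" "Dom E (h x) = (if x = i then n else FOb Q x)" "Cod E (h x) = FOb Q x"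
    if "x \<in> Ob D" for x
    using nat_fam_simps[OF hn that] that by (auto simp: replace_ob_def)
  have mn: "nat_fam D E Q Z ?m" unfolding nat_fam_def
  proof (intro conjI ballI)
    fix x assume "x \<in> Ob D"
    then show "?m x \<in> hom E (FOb Q x) (FOb Z x)"
      using m by (auto simp: replace_ob_def hom_def Es Qs)
  next
    fix a assume a: "a \<in> Ar D"
    then show "?m (Cod D a) \<cdot> FAr Q a = FAr Z a \<cdot> ?m (Dom D a)"
      using m m_endo[OF a] out_m[OF a] n by (auto simp: replace_ob_def Es Qs Ds)
  qed
  have lift: "is_lift D E Q f p ev Q p ev (\<lambda>x. h x \<cdot> ?m x)"
    unfolding is_lift_def nat_fam_def
  proof (intro conjI ballI allI impI)
    fix x assume x: "x \<in> Ob D"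
    show "h x \<cdot> ?m x \<in> hom E (FOb Q x) (FOb Q x)"
      using hs[OF x] m x by (auto simp: hom_def Es Qs)
    show "p x \<cdot> h x \<cdot> ?m x = p x"
      using hs[OF x] m x hp[OF x] ps[OF x] pn_m by (auto simp: Es Qs simp flip: category_assoc[OF E])
    fix b y assume sq: "comm_sq E (f x) (p x) b y"
    have y: "y \<in> Ar E" "Cod E y = FOb Q x" using sq ps[OF x] by (auto simp: comm_sq_def)
    have "comm_sq E (f x) (pz x) b (?m x \<cdot> y)"
      using sq y m pn_m[symmetric] pn_simps x ps[OF x] fs[OF x] by (auto simp: comm_sq_def Es Qs)
    from he[OF x this] show "ev x b ((h x \<cdot> ?m x) \<cdot> y) = ev x b y"
      using evn_m[of b y] sq y m hs[OF x] x by (auto simp: Es Qs)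
  next
    fix a assume a: "a \<in> Ar D"
    let ?x = "Dom D a" and ?y = "Cod D a"
    have x: "?x \<in> Ob D" "?y \<in> Ob D" using a by (auto simp: Ds)
    note ms = nat_fam_simps[OF mn x(1)] nat_fam_simps[OF mn x(2)]
      and hs = nat_fam_simps[OF hn x(1)] nat_fam_simps[OF hn x(2)]
    note zs = functor_simps[OF functor_Z]
    have "(h ?y \<cdot> ?m ?y) \<cdot> FAr Q a = h ?y \<cdot> ?m ?y \<cdot> FAr Q a"
      by (rule category_assoc[OF E]) (use a ms hs in \<open>simp_all add: Qs\<close>)
    also have "\<dots> = h ?y \<cdot> FAr Z a \<cdot> ?m ?x"
      using nat_fam_comm[OF mn a HOL.refl HOL.refl] by simp
    also have "\<dots> = (h ?y \<cdot> FAr Z a) \<cdot> ?m ?x"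
      by (rule category_assoc[OF E, symmetric]) (use a ms hs in \<open>simp_all add: zs\<close>)
    also have "\<dots> = (FAr Q a \<cdot> h ?x) \<cdot> ?m ?x"
      using nat_fam_comm[OF hn a HOL.refl HOL.refl] by simp
    also have "\<dots> = FAr Q a \<cdot> h ?x \<cdot> ?m ?x"
      by (rule category_assoc[OF E]) (use a ms hs in \<open>simp_all add: Qs\<close>)
    finally show "(h ?y \<cdot> ?m ?y) \<cdot> FAr Q a = FAr Q a \<cdot> h ?x \<cdot> ?m ?x" .
  qed
  \<comment> \<open>Uniqueness for the test object \<open>Q\<close> itself, whose two lifts are the
    round trip and the identity.\<close>
  have hm: "h x \<cdot> ?m x = Ident E (FOb Q x)" if "x \<in> Ob D" for x
    using dprod Q p ev lift ident_lift that unfolding is_dprod_def by blast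
  have h_id: "h x = Ident E (FOb Q x)" if "x \<in> Ob D" "x \<noteq> i" for x
    using hm[OF that(1)] that hs[OF that(1)] by (simp add: Es Qs)
  have "factors (h i)"
    unfolding factors_def
  proof (intro conjI ballI allI impI)
    show "h i \<in> hom E n (FOb Q i)" using hs[OF i] by (simp add: hom_def)
    show "h i \<cdot> m = Ident E (FOb Q i)" using hm[OF i] by simp
    show "p i \<cdot> h i = pn" using hp[OF i] by simp
    show "ev i b (h i \<cdot> y) = evn b y" if "comm_sq E (f i) pn b y" for b y
      using he[OF i, of b y] that by simp
    fix a assume a: "a \<in> Ar D" "Dom D a = i"
    show "FAr Q a \<cdot> h i = (if Cod D a = i then h i else out a)"
      using nat_fam_comm[OF hn a HOL.refl] a hs[OF i] h_id[of "Cod D a"] out_simps[OF a]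
      by (auto simp: replace_ob_def Es Ds)
  qed
  then show ?thesis by blast
qed

end

section \<open>Comparison of dependent products along a quotient functor\<close>

text \<open>If \<open>k\<close> identifies \<open>y\<close> and \<open>y'\<close>, and \<open>v\<close> lowers the degree, then a functor that factors
  through \<open>k\<close> in lower degrees cannot distinguish \<open>y \<cdot> v\<close> and \<open>y' \<cdot> v\<close>.\<close>

inductive cod_step :: "('o, 'a) cat \<Rightarrow> ('a \<Rightarrow> 'b) \<Rightarrow> ('o \<Rightarrow> nat) \<Rightarrow> 'a \<Rightarrow> 'a \<Rightarrow> bool" for C k d where
  "v \<in> Ar C \<Longrightarrow> y \<in> Ar C \<Longrightarrow> y' \<in> Ar C \<Longrightarrow> Dom C y = Cod C v \<Longrightarrow> Dom C y' = Cod C v \<Longrightarrow>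
     k y = k y' \<Longrightarrow> d (Cod C v) < d (Dom C v) \<Longrightarrow> cod_step C k d (y \<cdot>\<^bsub>C\<^esub> v) (y' \<cdot>\<^bsub>C\<^esub> v)"

text \<open>The properties of \<open>\<gamma>\<close> on which the comparison rests, detached from
  gluing diagrams. \<open>conn\<close> governs arrows with equal image: they are linked by steps,
  each of which exchanges only a factor that starts in lower degree, where the induction hypothesis
  is available.\<close>

locale inverse_quotient =
  fixes I :: "('o, 'a) cat" and H :: "('o, 'b) cat" and K :: "('o, 'a, 'o, 'b) ftor" and d :: "'o \<Rightarrow> nat"
  assumes K: "is_functor I H K" and ob: "Ob H = Ob I" and K_ob: "x \<in> Ob I \<Longrightarrow> FOb K x = x"
    and full: "a \<in> Ar H \<Longrightarrow> \<exists>u\<in>Ar I. FAr K u = a"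
    and deg: "u \<in> Ar I \<Longrightarrow> FAr K u = Ident H (Dom I u) \<or> d (Cod I u) < d (Dom I u)"
    and conn: "u \<in> Ar I \<Longrightarrow> u' \<in> Ar I \<Longrightarrow> FAr K u = FAr K u' \<Longrightarrow> d (Cod I u) < d (Dom I u) \<Longrightarrow>
      (cod_step I (FAr K) d)\<^sup>*\<^sup>* u u'"
begin

lemmas I = functor_cats(1)[OF K] and H = functor_cats(2)[OF K]
lemmas Ks = functor_simps[OF K]
lemmas Is = category_simps[OF I] and Hs = category_simps[OF H]

lemma K_ends:
  assumes "u \<in> Ar I"
  shows "FAr K u \<in> Ar H" "Dom H (FAr K u) = Dom I u" "Cod H (FAr K u) = Cod I u"
  using assms Ks K_ob Is by auto

lemma K_eq_ends:
  assumes "u \<in> Ar I" "u' \<in> Ar I" "FAr K u = FAr K u'"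
  shows "Dom I u = Dom I u'" "Cod I u = Cod I u'"
  using K_ends assms by metis+

text \<open>An endomorphism cannot lower the degree, so \<open>deg\<close> leaves only the identity
  as its image; conversely \<open>K\<close> preserves the ends of an arrow.\<close>

lemma K_ident_iff: "u \<in> Ar I \<Longrightarrow> FAr K u = Ident H (Dom I u) \<longleftrightarrow> Cod I u = Dom I u"
  using deg[of u] K_ends[of u] Hs(6)[of "Dom I u"] category_ends[OF I, of u] ob
    by (metis category_ident(3)[OF H] order_less_irrefl)

lemma deg_le: "u \<in> Ar I \<Longrightarrow> d (Cod I u) \<le> d (Dom I u)"
  using deg K_ident_iff by (metis order_less_imp_le order_refl)

lemma deg_less: "u \<in> Ar I \<Longrightarrow> Cod I u \<noteq> Dom I u \<Longrightarrow> d (Cod I u) < d (Dom I u)"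
  using deg K_ident_iff by blast

definition lift where "lift a = (SOME u. u \<in> Ar I \<and> FAr K u = a)"

lemma lift:
  assumes "a \<in> Ar H"
  shows "lift a \<in> Ar I" "FAr K (lift a) = a" "Dom I (lift a) = Dom H a" "Cod I (lift a) = Cod H a"
proof -
  have "\<exists>u. u \<in> Ar I \<and> FAr K u = a" using full[OF assms] by blast
  from someI_ex[OF this] show *: "lift a \<in> Ar I" "FAr K (lift a) = a" unfolding lift_def by auto
  show "Dom I (lift a) = Dom H a" "Cod I (lift a) = Cod H a" using K_ends[OF *(1)] *(2) by auto
qed

lemma H_deg_less: "a \<in> Ar H \<Longrightarrow> Cod H a \<noteq> Dom H a \<Longrightarrow> d (Cod H a) < d (Dom H a)"
  using deg_less[OF lift(1)] lift by metis

lemma H_endo: "a \<in> Ar H \<Longrightarrow> Cod H a = Dom H a \<Longrightarrow> a = Ident H (Dom H a)"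
  using K_ident_iff[OF lift(1)] lift by metis

text \<open>The arrow \<open>b\<close> cannot raise the degree again after \<open>a\<close> has
  lowered it.\<close>

lemma no_return:
  "a \<in> Ar I \<Longrightarrow> b \<in> Ar I \<Longrightarrow> Dom I a = i \<Longrightarrow> Dom I b = Cod I a \<Longrightarrow> Cod I b = i \<Longrightarrow> Cod I a = i"
  using deg_le[of b] deg_less[of a] by force

lemma H_no_return:
  "a \<in> Ar H \<Longrightarrow> b \<in> Ar H \<Longrightarrow> Dom H a = i \<Longrightarrow> Dom H b = Cod H a \<Longrightarrow> Cod H b = i \<Longrightarrow> Cod H a = i"
  using H_deg_less[of a] H_deg_less[of b] by force

lemma comp_K_functor:
  assumes "is_functor H E X"
  shows "is_functor I E (comp_ftor I X K)"
  unfolding is_functor_def comp_ftor_def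
  using functor_simps[OF assms] functor_cats[OF assms] functor_Cmp[OF assms] functor_Cmp[OF K] I Ks Is
  by auto

lemma comp_K_simps:
  "x \<in> Ob I \<Longrightarrow> FOb (comp_ftor I X K) x = FOb X x"
  "u \<in> Ar I \<Longrightarrow> FAr (comp_ftor I X K) u = FAr X (FAr K u)"
  by (auto simp: comp_ftor_def K_ob)

lemma comp_K_nat_fam:
  assumes "nat_fam H E X Y t"
  shows "nat_fam I E (comp_ftor I X K) (comp_ftor I Y K) t"
  unfolding nat_fam_def
proof (intro conjI ballI)
  fix x assume "x \<in> Ob I"
  then show "t x \<in> hom E (FOb (comp_ftor I X K) x) (FOb (comp_ftor I Y K) x)"
    using assms ob by (simp add: nat_fam_def comp_K_simps)
next
  fix u assume "u \<in> Ar I"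
  then show "t (Cod I u) \<cdot>\<^bsub>E\<^esub> FAr (comp_ftor I X K) u = FAr (comp_ftor I Y K) u \<cdot>\<^bsub>E\<^esub> t (Dom I u)"
    using nat_fam_comm[OF assms, of "FAr K u"] K_ends[of u] by (simp add: comp_K_simps)
qed

end

text \<open>The base data over \<open>I\<close> are those over \<open>H\<close> restricted along
  \<open>K\<close>. \<open>lift_\<phi>\<close> says that the transpose of \<open>\<phi>\<close> is
  the evaluation of \<open>Q\<close>, which pins down the canonical comparison map.\<close>

locale dprod_comparison = inverse_quotient I H K d
  for I :: "('o, 'a) cat" and H :: "('o, 'b) cat" and K :: "('o, 'a, 'o, 'b) ftor" and d :: "'o \<Rightarrow> nat" +
  fixes E :: "('p, 'c) cat" (structure) and A B C f g Q p ev Q' p' ev' \<phi>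
  assumes A: "is_functor H E A" and B: "is_functor H E B" and C: "is_functor H E C"
    and f: "nat_fam H E B A f" and g: "nat_fam H E C B g"
    and dprod: "is_dprod H E A B C f g Q p ev"
    and dprod': "is_dprod I E (comp_ftor I A K) (comp_ftor I B K) (comp_ftor I C K) f g Q' p' ev'"
    and lift_\<phi>: "is_lift I E Q' f p' ev' (comp_ftor I Q K) p ev \<phi>"
begin

lemma facts:
  "is_functor H E Q" "nat_fam H E Q A p" "section_op H E B C Q f g p ev"
  "is_functor I E Q'" "nat_fam I E Q' (comp_ftor I A K) p'"
  "section_op I E (comp_ftor I B K) (comp_ftor I C K) Q' f g p' ev'"
  "nat_fam I E (comp_ftor I Q K) Q' \<phi>"
  using dprod dprod' lift_\<phi> by (auto simp: is_dprod_def is_lift_def)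

lemmas E = functor_cats(2)[OF A]
lemmas Es = category_simps[OF E]
lemmas As = functor_simps[OF A] and Bs = functor_simps[OF B] and Cs = functor_simps[OF C]
lemmas fs = nat_fam_simps[OF f] and gs = nat_fam_simps[OF g]
lemmas Qs = functor_simps[OF facts(1)] and Q's = functor_simps[OF facts(4)]
lemmas ps = nat_fam_simps[OF facts(2)]

lemma p's: 
  assumes "x \<in> Ob I"
  shows "p' x \<in> Ar E" "Dom E (p' x) = FOb Q' x" "Cod E (p' x) = FOb A x"
  using nat_fam_simps[OF facts(5) assms] assms by (auto simp: comp_K_simps)

lemma \<phi>s: 
  assumes "x \<in> Ob I"
  shows "\<phi> x \<in> Ar E" "Dom E (\<phi> x) = FOb Q x" "Cod E (\<phi> x) = FOb Q' x" "p' x \<cdot> \<phi> x = p x"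
  using nat_fam_simps[OF facts(7) assms] assms lift_\<phi> by (auto simp: comp_K_simps is_lift_def)

lemma \<phi>_comm: "u \<in> Ar I \<Longrightarrow> \<phi> (Cod I u) \<cdot> FAr Q (FAr K u) = FAr Q' u \<cdot> \<phi> (Dom I u)"
  using nat_fam_comm[OF facts(7) _ HOL.refl HOL.refl] by (simp add: comp_K_simps)

lemma p'_comm: "u \<in> Ar I \<Longrightarrow> p' (Cod I u) \<cdot> FAr Q' u = FAr A (FAr K u) \<cdot> p' (Dom I u)"
  using nat_fam_comm[OF facts(5) _ HOL.refl HOL.refl] by (simp add: comp_K_simps)

lemma ev'_\<phi>: "x \<in> Ob I \<Longrightarrow> comm_sq E (f x) (p x) b y \<Longrightarrow> ev' x b (\<phi> x \<cdot> y) = ev x b y"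
  using lift_\<phi> by (simp add: is_lift_def)

lemma ev_comm:
  assumes "comm_sq E (f (Dom H a)) (p (Dom H a)) b y" "a \<in> Ar H"
  shows "FAr C a \<cdot> ev (Dom H a) b y = ev (Cod H a) (FAr B a \<cdot> b) (FAr Q a \<cdot> y)"
  using facts(3) assms Hs unfolding section_op_def by blast

lemma ev'_comm:
  assumes "comm_sq E (f (Dom I u)) (p' (Dom I u)) b y" "u \<in> Ar I"
  shows "FAr C (FAr K u) \<cdot> ev' (Dom I u) b y = ev' (Cod I u) (FAr B (FAr K u) \<cdot> b) (FAr Q' u \<cdot> y)"
  using facts(6) assms Is unfolding section_op_def by (auto simp: comp_K_simps)

text \<open>In degrees below that of \<open>i\<close> the inverses \<open>\<psi>\<close> of
  \<open>\<phi>\<close> are natural, so there \<open>Q'\<close> agrees with the restriction of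
  \<open>Q\<close> up to isomorphism. The two replacements at \<open>i\<close> then compare the one
  value that is left.\<close>

lemma iso_step:
  assumes i: "i \<in> Ob I" and IH: "\<And>l. l \<in> Ob I \<Longrightarrow> d l < d i \<Longrightarrow> iso_ar E (\<phi> l)"
  shows "iso_ar E (\<phi> i)"
proof -
  have "\<forall>l\<in>{l \<in> Ob I. d l < d i}. \<exists>r. r \<in> hom E (FOb Q' l) (FOb Q l) \<and>
      r \<cdot> \<phi> l = Ident E (FOb Q l) \<and> \<phi> l \<cdot> r = Ident E (FOb Q' l)"
    using IH \<phi>s unfolding iso_ar_def by fastforce
  then obtain \<psi> where \<psi>0: "\<forall>l\<in>{l \<in> Ob I. d l < d i}. \<psi> l \<in> hom E (FOb Q' l) (FOb Q l) \<and>
      \<psi> l \<cdot> \<phi> l = Ident E (FOb Q l) \<and> \<phi> l \<cdot> \<psi> l = Ident E (FOb Q' l)"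
    unfolding bchoice_iff by blast
  have \<psi>: "\<And>l. l \<in> Ob I \<Longrightarrow> d l < d i \<Longrightarrow> \<psi> l \<in> hom E (FOb Q' l) (FOb Q l) \<and>
      \<psi> l \<cdot> \<phi> l = Ident E (FOb Q l) \<and> \<phi> l \<cdot> \<psi> l = Ident E (FOb Q' l)"
    using \<psi>0 by simp
  have \<psi>s: "\<psi> l \<in> Ar E" "Dom E (\<psi> l) = FOb Q' l" "Cod E (\<psi> l) = FOb Q l"
    "\<psi> l \<cdot> \<phi> l = Ident E (FOb Q l)" "\<phi> l \<cdot> \<psi> l = Ident E (FOb Q' l)"
    if "l \<in> Ob I" "d l < d i" for l
    using \<psi>[OF that] by (auto simp: hom_def)
  have \<psi>\<phi>: "\<psi> l \<cdot> \<phi> l \<cdot> t = t"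
    if "l \<in> Ob I" "d l < d i" "t \<in> Ar E" "Cod E t = FOb Q l" for l t
    using that \<psi>s[OF that(1,2)] \<phi>s[OF that(1)]
      by (simp_all add: category_comp_ident[OF E] flip: category_assoc[OF E])
  have \<phi>\<psi>: "\<phi> l \<cdot> \<psi> l \<cdot> t = t"
    if "l \<in> Ob I" "d l < d i" "t \<in> Ar E" "Cod E t = FOb Q' l" for l t
    using that \<psi>s[OF that(1,2)] \<phi>s[OF that(1)]
      by (simp_all add: category_comp_ident[OF E] flip: category_assoc[OF E])
  have \<psi>_comm: "\<psi> (Cod I u) \<cdot> FAr Q' u = FAr Q (FAr K u) \<cdot> \<psi> (Dom I u)"
    if u: "u \<in> Ar I" "d (Dom I u) < d i" for u
  proof -
    have l: "Dom I u \<in> Ob I" "Cod I u \<in> Ob I" "d (Cod I u) < d i"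
      using u deg_le[OF u(1)] Is by auto
    have "\<psi> (Cod I u) \<cdot> FAr Q' u = \<psi> (Cod I u) \<cdot> (FAr Q' u \<cdot> \<phi> (Dom I u)) \<cdot> \<psi> (Dom I u)"
      using u l \<psi>s[OF l(1) u(2)] \<phi>s[OF l(1)] by (simp add: Es Q's)
    also have "\<dots> = FAr Q (FAr K u) \<cdot> \<psi> (Dom I u)"
      unfolding \<phi>_comm[OF u(1), symmetric]
      using u l \<psi>s[OF l(1) u(2)] \<phi>s[OF l(2)] K_ends[OF u(1)] \<psi>\<phi>[OF l(2,3)] by (simp add: Es Qs)
    finally show ?thesis .
  qed
  have step: "FAr Q' u = FAr Q' u' \<and> Dom I u' = Dom I u" if "cod_step I (FAr K) d u u'" "Dom I u = i"
    for u u'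
    using that
  proof cases
    case (1 v y y')
    have v: "Dom I v = i" "d (Cod I v) < d i" using 1 that(2) by (auto simp: Is)
    have c: "Cod I y = Cod I y'" using K_eq_ends 1 by blast
    have l: "Cod I v \<in> Ob I" "Cod I y \<in> Ob I" "d (Cod I y) < d i"
      using 1 v deg_le[of y] by (auto simp: Is)
    \<comment> \<open>Both arrows start below degree \<open>d i\<close>. There
      \<open>FAr Q' y\<close> is recovered by \<open>\<phi>\<close> from
      \<open>\<psi> (Cod I y) \<cdot> FAr Q' y\<close>, which by naturality of \<open>\<psi>\<close>
      depends on the image of \<open>y\<close> in \<open>H\<close> only.\<close>
    have "FAr Q' y = FAr Q' y'"
    proof -
      have "FAr Q' y = \<phi> (Cod I y) \<cdot> \<psi> (Cod I y) \<cdot> FAr Q' y"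
        using \<phi>\<psi>[OF l(2,3)] 1 by (simp add: Q's)
      also have "\<dots> = \<phi> (Cod I y') \<cdot> \<psi> (Cod I y') \<cdot> FAr Q' y'"
        using \<psi>_comm[of y] \<psi>_comm[of y'] 1 v c by simp
      also have "\<dots> = FAr Q' y'"
        using \<phi>\<psi>[OF l(2,3)] 1 c by (simp add: Q's)
      finally show ?thesis .
    qed
    then show ?thesis using 1 functor_Cmp[OF facts(4)] by (simp add: Is)
  qed
  have K_Q': "FAr Q' u = FAr Q' u'"
    if u: "u \<in> Ar I" "u' \<in> Ar I" "FAr K u = FAr K u'" "Dom I u = i" "Cod I u \<noteq> i" for u u'
  proof -
    have "(cod_step I (FAr K) d)\<^sup>*\<^sup>* u u'" using conn u deg_less by metis
    then have "FAr Q' u = FAr Q' u' \<and> Dom I u' = i"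
      by (induction rule: rtranclp_induct) (use u(4) step in auto)
    then show ?thesis by simp
  qed
  \<comment> \<open>To leave the new value along \<open>a\<close>, use a preimage of
    \<open>a\<close> to move within \<open>Q'\<close>, and return to \<open>Q\<close> by
    \<open>\<psi>\<close> at the target, whose degree is smaller.\<close>
  let ?out = "\<lambda>a. \<psi> (Cod H a) \<cdot> FAr Q' (lift a)"
  have lt: "Cod I u \<in> Ob I" "d (Cod I u) < d i" if "u \<in> Ar I" "Dom I u = i" "Cod I u \<noteq> i" for u
    using that deg_less[of u] Is by auto
  have ltH: "Cod H a \<in> Ob I" "d (Cod H a) < d i" if "a \<in> Ar H" "Dom H a = i" "Cod H a \<noteq> i" for a
    using that H_deg_less[of a] Hs ob by auto
  have out_lift: "?out (FAr K u) = \<psi> (Cod I u) \<cdot> FAr Q' u" if "u \<in> Ar I" "Dom I u = i" "Cod I u \<noteq> i"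
    for u
    using K_Q'[OF that(1) lift(1), of "FAr K u"] that K_ends[OF that(1)] lift(2) by simp
  \<comment> \<open>The value of \<open>Q'\<close> at \<open>i\<close> can be inserted into \<open>Q\<close>, because \<open>Q'\<close> does not distinguish arrows out
    of \<open>i\<close> with the same image in \<open>H\<close>.\<close>
  interpret R: replacement_dprod H E Q i "FOb Q' i" "\<phi> i" ?out A B C f g p ev "p' i" "ev' i"
  proof unfold_locales
    show "is_functor H E Q" by (rule facts)
    show "i \<in> Ob H" using i ob by simp
    show "\<And>a b. a \<in> Ar H \<Longrightarrow> b \<in> Ar H \<Longrightarrow> Dom H a = i \<Longrightarrow> Dom H b = Cod H a \<Longrightarrow> Cod H b = i \<Longrightarrow> Cod H a = i"
      by (rule H_no_return)
    show "FOb Q' i \<in> Ob E" using Q's i by blast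
    show "\<phi> i \<in> Ar E" "Dom E (\<phi> i) = FOb Q i" "Cod E (\<phi> i) = FOb Q' i" using \<phi>s[OF i] by auto
    show "\<phi> i \<cdot> FAr Q a = \<phi> i" if "a \<in> Ar H" "Dom H a = i" "Cod H a = i" for a
      using H_endo[OF that(1)] that \<phi>s[OF i] Qs(5) i ob by (simp add: Es)
    show "?out a \<in> hom E (FOb Q' i) (FOb Q (Cod H a))" if "a \<in> Ar H" "Dom H a = i" "Cod H a \<noteq> i" for a
      using that \<psi>s[OF ltH[OF that]] lift[OF that(1)] by (simp add: hom_def Es Q's)
    show "?out a \<cdot> \<phi> i = FAr Q a" if a: "a \<in> Ar H" "Dom H a = i" "Cod H a \<noteq> i" for a
    proof -
      note u = lift[OF a(1)] and l = ltH[OF a]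
      have "?out a \<cdot> \<phi> i = \<psi> (Cod H a) \<cdot> FAr Q' (lift a) \<cdot> \<phi> i"
        using u a \<psi>s[OF l] \<phi>s(1-3)[OF i] by (simp add: Es Q's)
      also have "FAr Q' (lift a) \<cdot> \<phi> i = \<phi> (Cod H a) \<cdot> FAr Q a"
        using \<phi>_comm[OF u(1)] u a by simp
      finally show ?thesis using \<psi>\<phi>[OF l] a by (simp add: Qs)
    qed
    show "?out (b \<cdot>\<^bsub>H\<^esub> a) = FAr Q b \<cdot> ?out a"
      if a: "a \<in> Ar H" "b \<in> Ar H" "Dom H a = i" "Cod H a \<noteq> i" "Dom H b = Cod H a" for a b
    proof -
      let ?u = "lift a" and ?v = "lift b"
      have u: "?u \<in> Ar I" "?v \<in> Ar I" "Dom I ?u = i" "Cod I ?u \<noteq> i" "Dom I ?v = Cod I ?u"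
        "FAr K ?u = a" "FAr K ?v = b" "Cod I ?u = Cod H a" "Cod I ?v = Cod H b"
        using a lift by auto
      have vu: "?v \<cdot>\<^bsub>I\<^esub> ?u \<in> Ar I" "Dom I (?v \<cdot>\<^bsub>I\<^esub> ?u) = i" "Cod I (?v \<cdot>\<^bsub>I\<^esub> ?u) = Cod I ?v"
        using u by (auto simp: Is)
      have ne: "Cod I ?v \<noteq> i" using no_return[OF u(1,2,3,5)] u by auto
      have k: "FAr K (?v \<cdot>\<^bsub>I\<^esub> ?u) = b \<cdot>\<^bsub>H\<^esub> a" using functor_Cmp[OF K u(1,2,5)] u by simp
      note l = lt[OF u(1,3,4)]
      have l2: "Cod I ?v \<in> Ob I" "d (Cod I ?v) < d i" using lt[OF vu(1,2)] ne vu by auto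
      have "?out (b \<cdot>\<^bsub>H\<^esub> a) = \<psi> (Cod I ?v) \<cdot> FAr Q' (?v \<cdot>\<^bsub>I\<^esub> ?u)"
        using out_lift[OF vu(1,2)] ne k vu by simp
      also have "\<dots> = (\<psi> (Cod I ?v) \<cdot> FAr Q' ?v) \<cdot> FAr Q' ?u"
        using functor_Cmp[OF facts(4) u(1,2,5)] u \<psi>s[OF l2] by (simp add: Es Q's)
      also have "\<dots> = FAr Q b \<cdot> \<psi> (Cod I ?u) \<cdot> FAr Q' ?u"
        using \<psi>_comm[OF u(2)] l u \<psi>s[OF l] a by (simp add: Es Q's Qs)
      finally show ?thesis using u by simp
    qed
    show "?out (b \<cdot>\<^bsub>H\<^esub> a) = ?out b"
      if "a \<in> Ar H" "b \<in> Ar H" "Dom H a = i" "Cod H a = i" "Dom H b = i" "Cod H b \<noteq> i" for a b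
      using that H_endo[OF that(1)] Hs by simp
    show "is_dprod H E A B C f g Q p ev" by (rule dprod)
    show "is_functor H E A" "is_functor H E B" "is_functor H E C" by (rule A B C)+
    show "nat_fam H E B A f" "nat_fam H E C B g" by (rule f g)+
    show "p' i \<in> hom E (FOb Q' i) (FOb A i)" using p's[OF i] by (simp add: hom_def)
    show "p' i \<cdot> \<phi> i = p i" using \<phi>s[OF i] by simp
    show "FAr A a \<cdot> p' i = p' i" if "a \<in> Ar H" "Dom H a = i" "Cod H a = i" for a
      using H_endo[OF that(1)] that p's[OF i] i ob by (simp add: Es As)
    show "FAr A a \<cdot> p' i = p (Cod H a) \<cdot> ?out a" if a: "a \<in> Ar H" "Dom H a = i" "Cod H a \<noteq> i" for a
    proof -
      note u = lift[OF a(1)] and l = ltH[OF a]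
      have "p (Cod H a) \<cdot> ?out a = (p' (Cod H a) \<cdot> \<phi> (Cod H a)) \<cdot> ?out a"
        using \<phi>s(4)[OF l(1)] by simp
      also have "\<dots> = p' (Cod H a) \<cdot> \<phi> (Cod H a) \<cdot> ?out a"
        using u a \<psi>s[OF l] \<phi>s(1-3)[OF l(1)] p's[OF l(1)] by (simp add: Es Q's)
      also have "\<phi> (Cod H a) \<cdot> ?out a = FAr Q' (lift a)"
        using \<phi>\<psi>[OF l] u a by (simp add: Q's)
      finally show ?thesis using p'_comm[OF u(1)] u a by simp
    qed
    note e = facts(6)[unfolded section_op_def, rule_format, OF i]
    fix b y assume sq: "comm_sq E (f i) (p' i) b y"
    have bys: "b \<in> Ar E" "y \<in> Ar E" "Cod E b = FOb B i" "Cod E y = FOb Q' i" "Dom E b = Dom E y"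
      using sq fs i ob p's[OF i] by (auto simp: comm_sq_def)
    show "ev' i b y \<in> hom E (Dom E b) (FOb C i)" "g i \<cdot> ev' i b y = b"
      using e[OF sq] i by (auto simp: comp_K_simps)
    then have es: "ev' i b y \<in> Ar E" "Cod E (ev' i b y) = FOb C i" by (auto simp: hom_def)
    show "ev' i (b \<cdot> t) (y \<cdot> t) = ev' i b y \<cdot> t" if "t \<in> Ar E" "Cod E t = Dom E b" for t
      using e[OF sq] that by blast
    show "FAr C a \<cdot> ev' i b y = ev' i (FAr B a \<cdot> b) y" if "a \<in> Ar H" "Dom H a = i" "Cod H a = i" for a
      using H_endo[OF that(1)] that es bys i ob by (simp add: Es Cs Bs)
    show "FAr C a \<cdot> ev' i b y = ev (Cod H a) (FAr B a \<cdot> b) (?out a \<cdot> y)"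
      if a: "a \<in> Ar H" "Dom H a = i" "Cod H a \<noteq> i" for a
    proof -
      note l = ltH[OF a] and u = lift[OF a(1)]
      let ?b = "FAr B a \<cdot> b" and ?y = "?out a \<cdot> y"
      \<comment> \<open>Seen in \<open>Q'\<close>, the element \<open>?y\<close> is the image of
        \<open>y\<close> along the preimage of \<open>a\<close>. So the claim is the naturality of
        \<open>ev'\<close>, transported by \<open>\<phi>\<close> at the target.\<close>
      have y: "\<phi> (Cod H a) \<cdot> ?y = FAr Q' (lift a) \<cdot> y"
        using \<phi>\<psi>[OF l] bys u a \<psi>s[OF l] by (simp add: Es Q's)
      have ys: "?y \<in> Ar E" "Dom E ?y = Dom E y" "Cod E ?y = FOb Q (Cod H a)"
        using \<psi>s[OF l] bys u a by (simp_all add: Es Q's)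
      have "comm_sq E (f (Cod H a)) (p' (Cod H a)) ?b (\<phi> (Cod H a) \<cdot> ?y)"
        using comm_sq_map[OF comp_K_functor[OF A] comp_K_functor[OF B] facts(4) comp_K_nat_fam[OF f]
          facts(5) sq u(1)]
          u a y by (simp add: comp_K_simps)
      moreover have "p' (Cod H a) \<cdot> \<phi> (Cod H a) \<cdot> ?y = p (Cod H a) \<cdot> ?y"
        unfolding \<phi>s(4)[OF l(1), symmetric]
        by (rule category_assoc[OF E, symmetric]) (use \<phi>s(1-3)[OF l(1)] p's[OF l(1)] ys in simp_all)
      ultimately have sq': "comm_sq E (f (Cod H a)) (p (Cod H a)) ?b ?y"
        using l ps ob ys p's[OF l(1)] \<phi>s(1-3)[OF l(1)] by (auto simp: comm_sq_def Es)
      show ?thesis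
        using ev'_\<phi>[OF l(1) sq'] ev'_comm[of "lift a" b y] sq u a y by simp
    qed
  next
    show "ev' i b (\<phi> i \<cdot> y) = ev i b y" if "comm_sq E (f i) (p i) b y" for b y
      using ev'_\<phi>[OF i that] .
  qed
  obtain r where r: "R.factors r" using R.ex_factors by blast
  have rs: "r \<in> Ar E" "Dom E r = FOb Q' i" "Cod E r = FOb Q i"
    and r\<phi>: "r \<cdot> \<phi> i = Ident E (FOb Q i)" and pr: "p i \<cdot> r = p' i"
    and Qr: "\<And>a. a \<in> Ar H \<Longrightarrow> Dom H a = i \<Longrightarrow> Cod H a \<noteq> i \<Longrightarrow> FAr Q a \<cdot> r = ?out a"
    and evr: "\<And>b y. comm_sq E (f i) (p' i) b y \<Longrightarrow> ev i b (r \<cdot> y) = ev' i b y"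
    using r by (auto simp: R.factors_def hom_def)
  have iH: "i \<in> Ob H" using i ob by simp
  have K_endo: "FAr K w = Ident H i" if "w \<in> Ar I" "Dom I w = i" "Cod I w = i" for w
    using K_ident_iff that by metis
  \<comment> \<open>An endomorphism \<open>w\<close> of \<open>i\<close> is killed by
    \<open>K\<close>, hence acts trivially on everything that comes from \<open>H\<close>. Therefore
    \<open>r \<cdot> FAr Q' w\<close> satisfies all conditions that characterise
    \<open>r\<close>.\<close>
  have r_endo: "r \<cdot> FAr Q' w = r" if w: "w \<in> Ar I" "Dom I w = i" "Cod I w = i" for w
  proof (rule R.factors_unique)
    note Kw = K_endo[OF w]
    note ws = Q's(2-4)[OF w(1), unfolded w(2,3)]
    show "R.factors (r \<cdot> FAr Q' w)"
      unfolding R.factors_def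
    proof (intro conjI ballI allI impI)
      show "r \<cdot> FAr Q' w \<in> hom E (FOb Q' i) (FOb Q i)" using rs ws by (simp add: hom_def Es)
      have "FAr Q' w \<cdot> \<phi> i = \<phi> i"
        using \<phi>_comm[OF w(1)] w Kw Qs(5)[OF iH] \<phi>s[OF i] by (simp add: Es)
      then show "(r \<cdot> FAr Q' w) \<cdot> \<phi> i = Ident E (FOb Q i)"
        using rs ws r\<phi> \<phi>s(1-3)[OF i] by (simp add: Es)
      have "p i \<cdot> r \<cdot> FAr Q' w = (p i \<cdot> r) \<cdot> FAr Q' w"
        using rs ws ps[OF iH] by (simp add: Es)
      also have "\<dots> = p' i"
        unfolding pr using p'_comm[OF w(1)] w Kw As(5)[OF iH] p's[OF i] by (simp add: Es)
      finally show "p i \<cdot> r \<cdot> FAr Q' w = p' i" .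
    next
      fix a assume a: "a \<in> Ar H" "Dom H a = i"
      show "FAr Q a \<cdot> r \<cdot> FAr Q' w = (if Cod H a = i then r \<cdot> FAr Q' w else ?out a)"
      proof (cases "Cod H a = i")
        case True
        then show ?thesis using H_endo[OF a(1)] a rs ws Qs(5)[OF iH] by (simp add: Es)
      next
        case False
        note u = lift[OF a(1)] and l = ltH[OF a False]
        \<comment> \<open>The composite is another preimage of \<open>a\<close>, so
          \<open>K_Q'\<close> lets \<open>Q'\<close> treat it like \<open>lift a\<close>.\<close>
        have k: "FAr K (lift a \<cdot>\<^bsub>I\<^esub> w) = FAr K (lift a)"
          using functor_Cmp[OF K w(1) u(1)] u w Kw a by (simp add: Hs)
        have "FAr Q a \<cdot> r \<cdot> FAr Q' w = (FAr Q a \<cdot> r) \<cdot> FAr Q' w"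
          using rs ws a by (simp add: Es Qs)
        also have "\<dots> = \<psi> (Cod H a) \<cdot> FAr Q' (lift a) \<cdot> FAr Q' w"
          unfolding Qr[OF a False] using \<psi>s[OF l] ws u a by (simp add: Es Q's)
        also have "FAr Q' (lift a) \<cdot> FAr Q' w = FAr Q' (lift a \<cdot>\<^bsub>I\<^esub> w)"
          using functor_Cmp[OF facts(4) w(1) u(1)] u w a by simp
        also have "FAr Q' (lift a \<cdot>\<^bsub>I\<^esub> w) = FAr Q' (lift a)"
          using K_Q'[OF _ u(1) k] u w a False by (simp add: Is)
        finally show ?thesis using False by simp
      qed
    next
      fix b y assume sq: "comm_sq E (f i) (p' i) b y"
      have bys: "b \<in> Ar E" "y \<in> Ar E" "Cod E b = FOb B i" "Cod E y = FOb Q' i" "Dom E b = Dom E y"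
        using sq fs i ob p's[OF i] by (auto simp: comm_sq_def)
      have "p' i \<cdot> FAr Q' w = p' i"
        using p'_comm[OF w(1)] w Kw As(5)[OF iH] p's[OF i] by (simp add: Es)
      then have pw: "p' i \<cdot> FAr Q' w \<cdot> y = p' i \<cdot> y"
        using p's[OF i] bys ws by (simp flip: category_assoc[OF E])
      have sq': "comm_sq E (f i) (p' i) b (FAr Q' w \<cdot> y)"
        using sq bys ws pw p's[OF i] unfolding comm_sq_def by (simp add: Es)
      have "ev' i b y \<in> hom E (Dom E b) (FOb C i)"
        using facts(6)[unfolded section_op_def, rule_format, OF i sq] i by (simp add: comp_K_simps)
      then have "ev' i b y = ev' i b (FAr Q' w \<cdot> y)"
        using ev'_comm[of w b y] w sq Kw Cs(5)[OF iH] Bs(5)[OF iH] bys by (simp add: Es hom_def)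
      moreover have "ev i b ((r \<cdot> FAr Q' w) \<cdot> y) = ev i b (r \<cdot> FAr Q' w \<cdot> y)"
        using rs ws bys by (simp add: Es)
      ultimately show "ev i b ((r \<cdot> FAr Q' w) \<cdot> y) = ev' i b y"
        using evr[OF sq'] by simp
    qed
  qed (rule r)
  \<comment> \<open>Conversely, \<open>r\<close> is invariant under the endomorphisms of \<open>i\<close>, so \<open>Q i\<close>, on which these act
    trivially, can be inserted into \<open>Q'\<close>.\<close>
  let ?out' = "\<lambda>u. \<phi> (Cod I u) \<cdot> FAr Q (FAr K u)"
  interpret R': replacement_dprod I E Q' i "FOb Q i" r ?out' "comp_ftor I A K" "comp_ftor I B K"
    "comp_ftor I C K" f g p' ev' "p i" "ev i"
  proof unfold_locales
    show "is_functor I E Q'" by (rule facts)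
    show "i \<in> Ob I" by (rule i)
    show "\<And>a b. a \<in> Ar I \<Longrightarrow> b \<in> Ar I \<Longrightarrow> Dom I a = i \<Longrightarrow> Dom I b = Cod I a \<Longrightarrow> Cod I b = i \<Longrightarrow> Cod I a = i"
      by (rule no_return)
    show "FOb Q i \<in> Ob E" using Qs iH by blast
    show "r \<in> Ar E" "Dom E r = FOb Q' i" "Cod E r = FOb Q i" by (rule rs)+
    show "\<And>a. a \<in> Ar I \<Longrightarrow> Dom I a = i \<Longrightarrow> Cod I a = i \<Longrightarrow> r \<cdot> FAr Q' a = r"
      by (rule r_endo)
    show "?out' u \<in> hom E (FOb Q i) (FOb Q' (Cod I u))" if "u \<in> Ar I" "Dom I u = i" "Cod I u \<noteq> i" for u
      using that \<phi>s[OF lt(1)[OF that]] K_ends[OF that(1)] by (simp add: hom_def Es Qs)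
    show "?out' u \<cdot> r = FAr Q' u" if u: "u \<in> Ar I" "Dom I u = i" "Cod I u \<noteq> i" for u
    proof -
      note k = K_ends[OF u(1)] and l = lt[OF u]
      have "?out' u \<cdot> r = \<phi> (Cod I u) \<cdot> FAr Q (FAr K u) \<cdot> r"
        using rs k \<phi>s(1-3)[OF l(1)] u by (simp add: Es Qs)
      also have "FAr Q (FAr K u) \<cdot> r = \<psi> (Cod I u) \<cdot> FAr Q' u"
        using Qr[OF k(1)] k u out_lift[OF u] by simp
      finally show ?thesis using \<phi>\<psi>[OF l] u by (simp add: Q's)
    qed
    show "?out' (v \<cdot>\<^bsub>I\<^esub> u) = FAr Q' v \<cdot> ?out' u"
      if u: "u \<in> Ar I" "v \<in> Ar I" "Dom I u = i" "Cod I u \<noteq> i" "Dom I v = Cod I u" for u v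
    proof -
      note k = K_ends[OF u(1)] K_ends[OF u(2)] and l = lt[OF u(1,3,4)]
      have lv: "Cod I v \<in> Ob I" using u Is by simp
      have "?out' (v \<cdot>\<^bsub>I\<^esub> u) = \<phi> (Cod I v) \<cdot> FAr Q (FAr K v) \<cdot> FAr Q (FAr K u)"
        using functor_Cmp[OF K u(1,2,5)] functor_Cmp[OF facts(1) k(1,4)] k u by (simp add: Is)
      also have "\<dots> = (\<phi> (Cod I v) \<cdot> FAr Q (FAr K v)) \<cdot> FAr Q (FAr K u)"
        using k u \<phi>s(1-3)[OF lv] by (simp add: Es Qs)
      also have "\<dots> = (FAr Q' v \<cdot> \<phi> (Cod I u)) \<cdot> FAr Q (FAr K u)"
        using \<phi>_comm[OF u(2)] u by simp
      also have "\<dots> = FAr Q' v \<cdot> ?out' u"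
        using k u \<phi>s(1-3)[OF l(1)] by (simp add: Es Qs Q's)
      finally show ?thesis .
    qed
    show "?out' (v \<cdot>\<^bsub>I\<^esub> u) = ?out' v"
      if u: "u \<in> Ar I" "v \<in> Ar I" "Dom I u = i" "Cod I u = i" "Dom I v = i" "Cod I v \<noteq> i" for u v
      using functor_Cmp[OF K u(1,2)] K_endo[OF u(1,3,4)] u K_ends[OF u(2)] by (simp add: Is Hs)
    show "is_dprod I E (comp_ftor I A K) (comp_ftor I B K) (comp_ftor I C K) f g Q' p' ev'"
      by (rule dprod')
    show "is_functor I E (comp_ftor I A K)" "is_functor I E (comp_ftor I B K)"
      "is_functor I E (comp_ftor I C K)"
      by (rule comp_K_functor A B C)+
    show "nat_fam I E (comp_ftor I B K) (comp_ftor I A K) f"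
      "nat_fam I E (comp_ftor I C K) (comp_ftor I B K) g"
      by (rule comp_K_nat_fam f g)+
    show "p i \<in> hom E (FOb Q i) (FOb (comp_ftor I A K) i)"
      using ps[OF iH] i by (simp add: hom_def comp_K_simps)
    show "p i \<cdot> r = p' i" by (rule pr)
    show "FAr (comp_ftor I A K) u \<cdot> p i = p i" if u: "u \<in> Ar I" "Dom I u = i" "Cod I u = i" for u
      using K_endo[OF u] u ps[OF iH] As(5)[OF iH] by (simp add: comp_K_simps Es)
    show "FAr (comp_ftor I A K) u \<cdot> p i = p' (Cod I u) \<cdot> ?out' u"
      if u: "u \<in> Ar I" "Dom I u = i" "Cod I u \<noteq> i" for u
    proof -
      note k = K_ends[OF u(1)] and l = lt[OF u]
      have "p' (Cod I u) \<cdot> ?out' u = (p' (Cod I u) \<cdot> \<phi> (Cod I u)) \<cdot> FAr Q (FAr K u)"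
        using k u \<phi>s(1-3)[OF l(1)] p's[OF l(1)] by (simp add: Es Qs)
      also have "\<dots> = FAr A (FAr K u) \<cdot> p i"
        using nat_fam_comm[OF facts(2) k(1)] \<phi>s(4)[OF l(1)] k u by simp
      finally show ?thesis using u by (simp add: comp_K_simps)
    qed
    note e = facts(3)[unfolded section_op_def, rule_format, OF iH]
    fix b y assume sq: "comm_sq E (f i) (p i) b y"
    have bys: "b \<in> Ar E" "y \<in> Ar E" "Cod E b = FOb B i" "Cod E y = FOb Q i" "Dom E b = Dom E y"
      using sq fs iH ps by (auto simp: comm_sq_def)
    show "ev i b y \<in> hom E (Dom E b) (FOb (comp_ftor I C K) i)" "g i \<cdot> ev i b y = b"
      using e[OF sq] i by (auto simp: comp_K_simps)
    then have es: "ev i b y \<in> Ar E" "Cod E (ev i b y) = FOb C i" using i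
      by (auto simp: hom_def comp_K_simps)
    show "ev i (b \<cdot> t) (y \<cdot> t) = ev i b y \<cdot> t" if "t \<in> Ar E" "Cod E t = Dom E b" for t
      using e[OF sq] that by blast
    show "FAr (comp_ftor I C K) u \<cdot> ev i b y = ev i (FAr (comp_ftor I B K) u \<cdot> b) y"
      if u: "u \<in> Ar I" "Dom I u = i" "Cod I u = i" for u
      using K_endo[OF u] u es bys Cs(5)[OF iH] Bs(5)[OF iH] by (simp add: Es comp_K_simps)
    show "FAr (comp_ftor I C K) u \<cdot> ev i b y =
        ev' (Cod I u) (FAr (comp_ftor I B K) u \<cdot> b) (?out' u \<cdot> y)"
      if u: "u \<in> Ar I" "Dom I u = i" "Cod I u \<noteq> i" for u
    proof -
      note k = K_ends[OF u(1)] and l = lt[OF u]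
      let ?b = "FAr B (FAr K u) \<cdot> b" and ?y = "FAr Q (FAr K u) \<cdot> y"
      have sq': "comm_sq E (f (Cod I u)) (p (Cod I u)) ?b ?y"
        using comm_sq_map[OF A B facts(1) f facts(2) sq k(1)] k u by simp
      have "FAr C (FAr K u) \<cdot> ev i b y = ev (Cod I u) ?b ?y"
        using ev_comm[of "FAr K u" b y] sq k u by simp
      also have "\<dots> = ev' (Cod I u) ?b (\<phi> (Cod I u) \<cdot> ?y)"
        using ev'_\<phi>[OF l(1) sq'] by simp
      also have "\<phi> (Cod I u) \<cdot> ?y = ?out' u \<cdot> y"
        using \<phi>s[OF l(1)] bys k u by (simp add: Es Qs)
      finally show ?thesis using u by (simp add: comp_K_simps)
    qed
  next
    show "ev i b (r \<cdot> y) = ev' i b y" if "comm_sq E (f i) (p' i) b y" for b y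
      by (rule evr[OF that])
  qed
  obtain s where s: "R'.factors s" using R'.ex_factors by blast
  then have ss: "s \<in> Ar E" "Dom E s = FOb Q i" "Cod E s = FOb Q' i"
    and sr: "s \<cdot> r = Ident E (FOb Q' i)"
    by (auto simp: R'.factors_def hom_def)
  \<comment> \<open>\<open>s\<close> is a left inverse of \<open>r\<close> and
    \<open>\<phi> i\<close> is a right inverse, so the two coincide and \<open>r\<close> is
    invertible.\<close>
  have "s = s \<cdot> r \<cdot> \<phi> i" using r\<phi> ss by (simp add: Es)
  also have "\<dots> = (s \<cdot> r) \<cdot> \<phi> i" using ss rs \<phi>s[OF i] by (simp add: Es)
  also have "\<dots> = \<phi> i" using sr \<phi>s[OF i] by (simp add: Es)
  finally have "\<phi> i \<cdot> r = Ident E (FOb Q' i)" using sr by simp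
  then show ?thesis using r\<phi> rs \<phi>s[OF i] unfolding iso_ar_def by (auto simp: hom_def)
qed

theorem iso_comparison:
  assumes "x \<in> Ob I"
  shows "iso_ar E (\<phi> x)"
  using assms by (induction "d x" arbitrary: x rule: less_induct) (rule iso_step)

end

section \<open>Structure of iterated gluing categories\<close>

lemma comp_ftor_functor:
  assumes F: "is_functor C D F" and G: "is_functor D E G"
  shows "is_functor C E (comp_ftor C G F)"
  unfolding is_functor_def comp_ftor_def
  using functor_cats[OF F] functor_cats(2)[OF G] functor_simps[OF F] functor_simps[OF G]
    category_simps[OF functor_cats(1)[OF F]]
  by (auto simp: functor_Cmp[OF F] functor_Cmp[OF G])

lemma comp_ftor_simps:
  "x \<in> Ob C \<Longrightarrow> FOb (comp_ftor C G F) x = FOb G (FOb F x)"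
  "a \<in> Ar C \<Longrightarrow> FAr (comp_ftor C G F) a = FAr G (FAr F a)"
  by (auto simp: comp_ftor_def)

lemma category_coslice:
  fixes C (structure)
  assumes "category C"
  shows "category (coslice C c)"
proof -
  have A: "u \<in> Ar (coslice C c) \<longleftrightarrow> (\<exists>f h. u = (f, h, h \<cdot> f) \<and> f \<in> Ar C \<and> h \<in> Ar C \<and>
      Dom C f = c \<and> Dom C h = Cod C f)" for u
    using category_simps(2-4)[OF assms] by (auto simp: coslice_def hom_def)
  have S: "Ob (coslice C c) = {f \<in> Ar C. Dom C f = c}" "Dom (coslice C c) (f, h, g) = f"
    "Cod (coslice C c) (f, h, g) = g" "Ident (coslice C c) f = (f, Ident C (Cod C f), f)"
    "(g', k, l) \<cdot>\<^bsub>coslice C c\<^esub> (f, h, g) = (f, k \<cdot> h, l)" for f h g g' k l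
    by (auto simp: coslice_def)
  show ?thesis
    unfolding category_def
  proof (intro conjI ballI impI)
    fix u assume "u \<in> Ar (coslice C c)"
    then obtain f h where u: "u = (f, h, h \<cdot> f)" "f \<in> Ar C" "h \<in> Ar C" "Dom C f = c" "Dom C h = Cod C f"
      unfolding A by blast
    then show "Dom (coslice C c) u \<in> Ob (coslice C c)" "Cod (coslice C c) u \<in> Ob (coslice C c)"
      "u \<cdot>\<^bsub>coslice C c\<^esub> Ident (coslice C c) (Dom (coslice C c) u) = u"
      "Ident (coslice C c) (Cod (coslice C c) u) \<cdot>\<^bsub>coslice C c\<^esub> u = u"
      by (simp_all add: S category_simps[OF assms])
    fix v assume "v \<in> Ar (coslice C c)" and vu: "Dom (coslice C c) v = Cod (coslice C c) u"
    then obtain k where v: "v = (h \<cdot> f, k, k \<cdot> h \<cdot> f)" "k \<in> Ar C" "Dom C k = Cod C h"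
    proof -
      obtain g k where v: "v = (g, k, k \<cdot> g)" "k \<in> Ar C" "Dom C k = Cod C g"
        using \<open>v \<in> Ar (coslice C c)\<close> unfolding A by blast
      moreover have "g = h \<cdot> f" using vu by (simp add: u v S)
      ultimately show ?thesis using that u category_simps(4)[OF assms] by simp
    qed
    show "v \<cdot>\<^bsub>coslice C c\<^esub> u \<in> hom (coslice C c) (Dom (coslice C c) u) (Cod (coslice C c) v)"
      unfolding hom_def mem_Collect_eq A
      using u v by (auto simp: S category_simps[OF assms] intro!: exI[of _ f] exI[of _ "k \<cdot> h"])
  next
    fix u v w assume u: "u \<in> Ar (coslice C c)" "v \<in> Ar (coslice C c)" "w \<in> Ar (coslice C c)"
      and e: "Dom (coslice C c) v = Cod (coslice C c) u \<and> Dom (coslice C c) w = Cod (coslice C c) v"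
    obtain f h g k l m where "u = (f, h, h \<cdot> f)" "v = (g, k, k \<cdot> g)" "w = (l, m, m \<cdot> l)"
      "h \<in> Ar C" "Dom C h = Cod C f" "k \<in> Ar C" "m \<in> Ar C" "Dom C k = Cod C g" "Dom C m = Cod C l"
      "f \<in> Ar C" "g \<in> Ar C"
      using u unfolding A by blast
    then show "w \<cdot>\<^bsub>coslice C c\<^esub> v \<cdot>\<^bsub>coslice C c\<^esub> u = (w \<cdot>\<^bsub>coslice C c\<^esub> v) \<cdot>\<^bsub>coslice C c\<^esub> u"
      using e by (simp add: S category_simps[OF assms])
  next
    fix f assume "f \<in> Ob (coslice C c)"
    then show "Ident (coslice C c) f \<in> hom (coslice C c) f f"
      unfolding hom_def mem_Collect_eq A by (simp add: S category_simps[OF assms])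
  qed
qed

lemma category_full_subcat:
  assumes "category C"
  shows "category (full_subcat C S)"
  unfolding category_def full_subcat_def
  by (auto simp: hom_def category_simps[OF assms])

lemma category_op:
  assumes "category C"
  shows "category (op_cat C)"
  unfolding category_def op_cat_def
  by (auto simp: hom_def category_simps[OF assms])

lemma op_simps [simp]:
  "Ob (op_cat C) = Ob C" "Ar (op_cat C) = Ar C" "Dom (op_cat C) = Cod C" "Cod (op_cat C) = Dom C"
  "Ident (op_cat C) = Ident C" "g \<cdot>\<^bsub>op_cat C\<^esub> f = f \<cdot>\<^bsub>C\<^esub> g"
  by (auto simp: op_cat_def)

lemma proper_coslice_simps [simp]:
  "Ob (proper_coslice C c) = {f \<in> Ar C. Dom C f = c \<and> f \<noteq> Ident C c}"
  "Ar (proper_coslice C c) = {(f, h, g). f \<in> Ar C \<and> g \<in> Ar C \<and> Dom C f = c \<and> Dom C g = c \<and>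
     h \<in> hom C (Cod C f) (Cod C g) \<and> h \<cdot>\<^bsub>C\<^esub> f = g \<and> f \<noteq> Ident C c \<and> g \<noteq> Ident C c}"
  "Dom (proper_coslice C c) = fst" "Cod (proper_coslice C c) = (\<lambda>(f, h, g). g)"
  "Ident (proper_coslice C c) = (\<lambda>f. (f, Ident C (Cod C f), f))"
  "Cmp (proper_coslice C c) = (\<lambda>(g, k, l) (f, h, g'). (f, k \<cdot>\<^bsub>C\<^esub> h, l))"
  by (auto simp: proper_coslice_def coslice_def full_subcat_def)

text \<open>Induction on words that removes the generator traversed first. This suits statements
  indexed by the source of an arrow: the generator shares its source with the whole word.\<close>

lemma presented_cat_induct [consumes 1, case_names Ident Cmp]:
  assumes "a \<in> Ar (presented_cat V G s t R)"
    and "\<And>v. v \<in> V \<Longrightarrow> P (path_class V G s t R v [] v)"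
    and "\<And>g b. g \<in> G \<Longrightarrow> s g \<in> V \<Longrightarrow> t g \<in> V \<Longrightarrow> b \<in> Ar (presented_cat V G s t R) \<Longrightarrow>
      Dom (presented_cat V G s t R) b = t g \<Longrightarrow> P b \<Longrightarrow>
      P (b \<cdot>\<^bsub>presented_cat V G s t R\<^esub> path_class V G s t R (s g) [g] (t g))"
  shows "P a"
proof -
  have "P (path_class V G s t R v gs w)" if "is_path V G s t v gs w" for v gs w
    using that
  proof (induction gs arbitrary: v)
    case Nil
    then show ?case using assms(2) by simp
  next
    case (Cons g gs)
    then have g: "g \<in> G" "s g = v" "v \<in> V" and p: "is_path V G s t (t g) gs w" by auto
    have t: "t g \<in> V" using is_path_ends[OF p] by blast
    have q: "is_path V G s t v [g] (t g)" using g t by simp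
    have "P (path_class V G s t R (t g) gs w \<cdot>\<^bsub>presented_cat V G s t R\<^esub> path_class V G s t R (s g) [g]
      (t g))"
      using g t p Cons.IH[OF p] by (intro assms(3)) auto
    then show ?case using presented_cat_Cmp[OF q p, where R = R] g by simp
  qed
  then show ?thesis using assms(1) by auto
qed

lemma colim_cat_induct [consumes 2, case_names Ident Cmp]:
  assumes "cat_diagram J D F" "a \<in> Ar (colim_cat J D F)"
    and "\<And>c. c \<in> Ob (colim_cat J D F) \<Longrightarrow> P (Ident (colim_cat J D F) c)"
    and "\<And>j f b. j \<in> Ob J \<Longrightarrow> f \<in> Ar (D j) \<Longrightarrow> b \<in> Ar (colim_cat J D F) \<Longrightarrow>
      Dom (colim_cat J D F) b = colim_ob J D F j (Cod (D j) f) \<Longrightarrow> P b \<Longrightarrow>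
      P (b \<cdot>\<^bsub>colim_cat J D F\<^esub> FAr (colim_inj J D F j) f)"
  shows "P a"
  using assms(2) unfolding colim_cat_def
proof (induction rule: presented_cat_induct)
  case (Ident v)
  then show ?case using assms(3)[of v] by (simp add: colim_cat_def)
next
  case (Cmp g b)
  obtain j f where g: "g = (j, f)" "j \<in> Ob J" "f \<in> Ar (D j)" using Cmp(1) by auto
  show ?case
    using assms(4)[OF g(2,3)] Cmp(4-) g
    by (simp add: colim_cat_def colim_inj_def del: presented_cat_simps(2))
qed

lemma colim_cat_Ob: "Ob (colim_cat J D F) = colim_obs J D F"
  by (simp add: colim_cat_def)

lemma colim_inj_FOb: "x \<in> Ob (D j) \<Longrightarrow> FOb (colim_inj J D F j) x = colim_ob J D F j x"
  by (simp add: colim_inj_def)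

text \<open>Objects of the colimit are classes of zigzags of gluing steps, so a function that is
  constant along single steps descends to them.\<close>

lemma colim_ob_invariant:
  assumes "colim_ob J D F j x = colim_ob J D F j' x'"
    and step: "\<And>k y. k \<in> Ar J \<Longrightarrow> y \<in> Ob (D (Dom J k)) \<Longrightarrow> \<beta> (Cod J k) (FOb (F k) y) = \<beta> (Dom J k) y"
  shows "\<beta> j x = \<beta> j' x'"
proof -
  have "(j', x') \<in> colim_ob J D F j x" unfolding assms(1) by (simp add: colim_ob_def)
  then have "((j, x), (j', x')) \<in> (colim_step J D F \<union> (colim_step J D F)\<inverse>)\<^sup>*"
    by (simp add: colim_ob_def)
  then have "case_prod \<beta> (j, x) = case_prod \<beta> (j', x')"
  proof (induction rule: rtrancl_induct)
    case (step p q)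
    then show ?case using assms(2) by (auto simp: colim_step_def)
  qed simp
  then show ?thesis by simp
qed

lemma collage_simps [simp]:
  "Ob (collage D L P) = Inl ` Ob D \<union> Inr ` Ob L"
  "Ar (collage D L P) = Up ` Ar D \<union> Lo ` Ar L \<union>
     {Cross i j u |i j u. i \<in> Ob D \<and> j \<in> Ob L \<and> u \<in> FOb P (i, j)}"
  "Dom (collage D L P) (Up a) = Inl (Dom D a)" "Cod (collage D L P) (Up a) = Inl (Cod D a)"
  "Dom (collage D L P) (Lo b) = Inr (Dom L b)" "Cod (collage D L P) (Lo b) = Inr (Cod L b)"
  "Dom (collage D L P) (Cross i j u) = Inl i" "Cod (collage D L P) (Cross i j u) = Inr j"
  "Ident (collage D L P) (Inl i) = Up (Ident D i)" "Ident (collage D L P) (Inr j) = Lo (Ident L j)"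
  "Up a' \<cdot>\<^bsub>collage D L P\<^esub> Up a = Up (a' \<cdot>\<^bsub>D\<^esub> a)"
  "Lo b' \<cdot>\<^bsub>collage D L P\<^esub> Lo b = Lo (b' \<cdot>\<^bsub>L\<^esub> b)"
  "Lo b \<cdot>\<^bsub>collage D L P\<^esub> Cross i j u = Cross i (Cod L b) (app (FAr P (Ident D i, b)) u)"
  "Cross i j u \<cdot>\<^bsub>collage D L P\<^esub> Up a = Cross (Dom D a) j (app (FAr P (a, Ident L j)) u)"
  by (auto simp: collage_def)

lemma collage_lo_functor:
  assumes "category (collage D L P)" "category L"
  shows "is_functor L (collage D L P) (collage_lo L)"
  using assms unfolding is_functor_def collage_lo_def by (auto simp: category_simps[OF assms(2)])

lemma collage_up_functor:
  assumes "category (collage D L P)" "category D"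
  shows "is_functor D (collage D L P) (collage_up D)"
  using assms unfolding is_functor_def collage_up_def by (auto simp: category_simps[OF assms(2)])

locale gluing =
  fixes G :: "('no, 'na, 'io, 'ia, 'd, 'e, 'h) gluing"
  assumes G: "iterated_gluing G"
begin

abbreviation "N \<equiv> G_N G"
abbreviation "dg \<equiv> G_deg G"
abbreviation "I \<equiv> G_I G"
abbreviation "Ia \<equiv> G_Iar G"
abbreviation "bd \<equiv> G_bd G"
abbreviation "lw \<equiv> G_lower G"
abbreviation "coll \<equiv> G_coll G"
abbreviation "pf \<equiv> G_prof G"
abbreviation "X \<equiv> G_inf G"

lemma diag: "cat_diagram (op_cat N) I Ia"
  using G by (simp add: iterated_gluing_def)

lemma N: "category N"
  using G by (simp add: iterated_gluing_def strict_inverse_def)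

lemmas Ns = category_simps[OF N] and N_ends = category_ends[OF N]

lemma dg_less: "\<alpha> \<in> Ar N \<Longrightarrow> \<alpha> \<noteq> Ident N (Dom N \<alpha>) \<Longrightarrow> dg (Cod N \<alpha>) < dg (Dom N \<alpha>)"
  using G by (auto simp: iterated_gluing_def strict_inverse_def)

lemma dg_le: "\<alpha> \<in> Ar N \<Longrightarrow> dg (Cod N \<alpha>) \<le> dg (Dom N \<alpha>)"
  using dg_less[of \<alpha>] category_ident(3)[OF N category_ends(1)[OF N, of \<alpha>]]
  by (cases "\<alpha> = Ident N (Dom N \<alpha>)") auto

lemma I_cat: "n \<in> Ob N \<Longrightarrow> category (I n)"
  using diag by (simp add: cat_diagram_def)

lemma Ia_functor: "\<alpha> \<in> Ar N \<Longrightarrow> is_functor (I (Cod N \<alpha>)) (I (Dom N \<alpha>)) (Ia \<alpha>)"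
  using diag by (simp add: cat_diagram_def)

lemma Ia_Ident: "n \<in> Ob N \<Longrightarrow> Ia (Ident N n) = id_ftor (I n)"
  using diag by (simp add: cat_diagram_def)

lemma Ia_Cmp:
  "\<alpha> \<in> Ar N \<Longrightarrow> \<beta> \<in> Ar N \<Longrightarrow> Dom N \<beta> = Cod N \<alpha> \<Longrightarrow>
    Ia (\<beta> \<cdot>\<^bsub>N\<^esub> \<alpha>) = comp_ftor (I (Cod N \<beta>)) (Ia \<alpha>) (Ia \<beta>)"
  using diag by (simp add: cat_diagram_def)

lemma bd_cat: "n \<in> Ob N \<Longrightarrow> category (bd n)"
  using G by (simp add: iterated_gluing_def)

lemma coll_iso: "n \<in> Ob N \<Longrightarrow> iso_ftor (G_collage G n) (I n) (coll n)"
  using G by (simp add: iterated_gluing_def)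

lemma coll_functor: "n \<in> Ob N \<Longrightarrow> is_functor (G_collage G n) (I n) (coll n)"
  using coll_iso by (simp add: iso_ftor_def)

lemma lower_diag:
  assumes "n \<in> Ob N"
  shows "cat_diagram (lower_shape N n) (\<lambda>\<alpha>. I (Cod N \<alpha>)) (\<lambda>(\<alpha>, h, \<beta>). Ia h)"
  unfolding cat_diagram_def
proof (intro conjI ballI impI)
  show "category (lower_shape N n)"
    unfolding proper_coslice_def by (intro category_op category_full_subcat category_coslice N)
qed (auto simp: I_cat Ns hom_def Ia_Ident Ia_Cmp[symmetric] intro: Ia_functor dest: Ia_functor)

lemma lower_cat: "category (lw n)"
  unfolding lower_cat_def by (rule category_colim_cat)

lemma X_cat: "category X"
  unfolding G_inf_def by (rule category_colim_cat)

lemmas Xs = category_simps[OF X_cat]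

lemma inj_functor: "n \<in> Ob N \<Longrightarrow> is_functor (I n) X (G_inj G n)"
  unfolding G_inf_def G_inj_def using colim_inj_functor[OF diag] by simp

lemma inj_glue:
  assumes "\<alpha> \<in> Ar N"
  shows "x \<in> Ob (I (Cod N \<alpha>)) \<Longrightarrow> FOb (G_inj G (Dom N \<alpha>)) (FOb (Ia \<alpha>) x) = FOb (G_inj G (Cod N \<alpha>)) x"
    and "g \<in> Ar (I (Cod N \<alpha>)) \<Longrightarrow> FAr (G_inj G (Dom N \<alpha>)) (FAr (Ia \<alpha>) g) = FAr (G_inj G (Cod N \<alpha>)) g"
proof -
  have "comp_ftor (I (Cod N \<alpha>)) (G_inj G (Dom N \<alpha>)) (Ia \<alpha>) = G_inj G (Cod N \<alpha>)"
    using colim_inj_cocone[OF diag, of \<alpha>] assms by (simp add: G_inj_def)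
  then show "x \<in> Ob (I (Cod N \<alpha>)) \<Longrightarrow> FOb (G_inj G (Dom N \<alpha>)) (FOb (Ia \<alpha>) x) = FOb (G_inj G (Cod N \<alpha>)) x"
    "g \<in> Ar (I (Cod N \<alpha>)) \<Longrightarrow> FAr (G_inj G (Dom N \<alpha>)) (FAr (Ia \<alpha>) g) = FAr (G_inj G (Cod N \<alpha>)) g"
    by (metis comp_ftor_simps(1), metis comp_ftor_simps(2))
qed

lemma inj_FOb: "x \<in> Ob (I n) \<Longrightarrow> FOb (G_inj G n) x = colim_ob (op_cat N) I Ia n x"
  unfolding G_inj_def by (rule colim_inj_FOb)

abbreviation "up_ob n i \<equiv> FOb (coll n) (Inl i)"
abbreviation "lo_ob n l \<equiv> FOb (coll n) (Inr l)"

lemma up_ob: "n \<in> Ob N \<Longrightarrow> i \<in> Ob (bd n) \<Longrightarrow> up_ob n i \<in> Ob (I n)"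
  using functor_simps(1)[OF coll_functor] by simp

lemma lo_ob: "n \<in> Ob N \<Longrightarrow> l \<in> Ob (lw n) \<Longrightarrow> lo_ob n l \<in> Ob (I n)"
  using functor_simps(1)[OF coll_functor] by simp

lemma lower_inj_glue:
  assumes "\<alpha> \<in> Ar N" "\<alpha> \<noteq> Ident N (Dom N \<alpha>)"
  shows "x \<in> Ob (I (Cod N \<alpha>)) \<Longrightarrow>
      lo_ob (Dom N \<alpha>) (FOb (lower_inj N I Ia (Dom N \<alpha>) \<alpha>) x) = FOb (Ia \<alpha>) x"
    and "g \<in> Ar (I (Cod N \<alpha>)) \<Longrightarrow>
      FAr (coll (Dom N \<alpha>)) (Lo (FAr (lower_inj N I Ia (Dom N \<alpha>) \<alpha>) g)) = FAr (Ia \<alpha>) g"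
proof -
  let ?n = "Dom N \<alpha>"
  have n: "?n \<in> Ob N" using assms N_ends by blast
  have a: "\<alpha> \<in> Ob (lower_shape N ?n)" using assms by simp
  have F: "is_functor (I (Cod N \<alpha>)) (lw ?n) (lower_inj N I Ia ?n \<alpha>)"
    unfolding lower_inj_def lower_cat_def using colim_inj_functor[OF lower_diag[OF n] a] by simp
  have e: "comp_ftor (I (Cod N \<alpha>)) (comp_ftor (lw ?n) (coll ?n) (collage_lo (lw ?n)))
             (lower_inj N I Ia ?n \<alpha>) = Ia \<alpha>"
    using G n a by (simp add: iterated_gluing_def)
  have "FOb (comp_ftor (I (Cod N \<alpha>)) (comp_ftor (lw ?n) (coll ?n) (collage_lo (lw ?n)))
             (lower_inj N I Ia ?n \<alpha>)) x = lo_ob ?n (FOb (lower_inj N I Ia ?n \<alpha>) x)"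
    if "x \<in> Ob (I (Cod N \<alpha>))" for x
    using functor_simps(1)[OF F that] that by (simp add: comp_ftor_def collage_lo_def)
  then show "x \<in> Ob (I (Cod N \<alpha>)) \<Longrightarrow> lo_ob ?n (FOb (lower_inj N I Ia ?n \<alpha>) x) = FOb (Ia \<alpha>) x"
    unfolding e by simp
  have "FAr (comp_ftor (I (Cod N \<alpha>)) (comp_ftor (lw ?n) (coll ?n) (collage_lo (lw ?n)))
             (lower_inj N I Ia ?n \<alpha>)) g = FAr (coll ?n) (Lo (FAr (lower_inj N I Ia ?n \<alpha>) g))"
    if "g \<in> Ar (I (Cod N \<alpha>))" for g
    using functor_simps(2)[OF F that] that by (simp add: comp_ftor_def collage_lo_def)
  then show "g \<in> Ar (I (Cod N \<alpha>)) \<Longrightarrow> FAr (coll ?n) (Lo (FAr (lower_inj N I Ia ?n \<alpha>) g)) = FAr (Ia \<alpha>) g"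
    unfolding e by simp
qed

section \<open>The stage at which an object first appears\<close>

abbreviation "low_ob n \<equiv> colim_ob (lower_shape N n) (\<lambda>\<alpha>. I (Cod N \<alpha>)) (\<lambda>(\<alpha>, h, \<beta>). Ia h)"

lemma lower_inj_FOb: "x \<in> Ob (I (Cod N \<alpha>)) \<Longrightarrow> FOb (lower_inj N I Ia n \<alpha>) x = low_ob n \<alpha> x"
  unfolding lower_inj_def by (rule colim_inj_FOb)

lemma lower_Ob_cases:
  assumes "l \<in> Ob (lw n)"
  obtains \<alpha> x where "\<alpha> \<in> Ar N" "Dom N \<alpha> = n" "\<alpha> \<noteq> Ident N n" "x \<in> Ob (I (Cod N \<alpha>))" "l = low_ob n \<alpha> x"
  using assms unfolding lower_cat_def colim_cat_Ob by auto

text \<open>Every object of \<open>I\<^sub>m\<close> comes from a unique boundary object \<open>i\<close> of a unique stage \<open>n\<close>; \<open>births\<close> is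
  the set of candidates \<open>(n, i)\<close>.\<close>

definition births :: "'no \<Rightarrow> 'io \<Rightarrow> ('no \<times> 'd) set" where
  "births m x = {(n, i). i \<in> Ob (bd n) \<and> (\<exists>\<alpha>\<in>Ar N. Dom N \<alpha> = m \<and> Cod N \<alpha> = n \<and> x = FOb (Ia \<alpha>) (up_ob n
    i))}"

text \<open>A path in \<open>N\<close> that exhibits \<open>x\<close> as the image of a boundary
  object can be precomposed with \<open>\<alpha>\<close>.\<close>

lemma births_mono:
  assumes "\<alpha> \<in> Ar N" "x \<in> Ob (I (Cod N \<alpha>))"
  shows "births (Cod N \<alpha>) x \<subseteq> births (Dom N \<alpha>) (FOb (Ia \<alpha>) x)"
proof (rule subrelI)
  fix n i assume "(n, i) \<in> births (Cod N \<alpha>) x"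
  then obtain \<beta> where b: "i \<in> Ob (bd n)" "\<beta> \<in> Ar N" "Dom N \<beta> = Cod N \<alpha>" "Cod N \<beta> = n"
    "x = FOb (Ia \<beta>) (up_ob n i)"
    by (auto simp: births_def)
  have n: "n \<in> Ob N" using b N_ends by blast
  have "FOb (Ia \<alpha>) x = FOb (Ia (\<beta> \<cdot>\<^bsub>N\<^esub> \<alpha>)) (up_ob n i)"
    using Ia_Cmp[OF assms(1) b(2,3)] b up_ob[OF n b(1)] by (simp add: comp_ftor_simps)
  then show "(n, i) \<in> births (Dom N \<alpha>) (FOb (Ia \<alpha>) x)"
    using b assms unfolding births_def by (auto simp: Ns intro!: bexI[of _ "\<beta> \<cdot>\<^bsub>N\<^esub> \<alpha>"])
qed

lemma births_up_ob: "n \<in> Ob N \<Longrightarrow> i \<in> Ob (bd n) \<Longrightarrow> (n, i) \<in> births n (up_ob n i)"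
  unfolding births_def using up_ob
  by (auto intro!: bexI[of _ "Ident N n"] simp: Ia_Ident id_ftor_def Ns)

text \<open>By the collage an object of \<open>I m\<close> is either a boundary object of stage
  \<open>m\<close> or the image of an object at a stage of smaller degree; the second case can occur
  only finitely often in a row.\<close>

lemma births_nonempty: "m \<in> Ob N \<Longrightarrow> x \<in> Ob (I m) \<Longrightarrow> births m x \<noteq> {}"
proof (induction "dg m" arbitrary: m x rule: less_induct)
  case less
  have "x \<in> FOb (coll m) ` Ob (G_collage G m)"
    using coll_iso[OF less(2)] less(3) by (simp add: iso_ftor_def bij_betw_def)
  then consider i where "i \<in> Ob (bd m)" "x = up_ob m i" | l where "l \<in> Ob (lw m)" "x = lo_ob m l"
    by auto
  then show ?case
  proof cases
    case 1
    then show ?thesis using births_up_ob less(2) by blast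
  next
    case 2
    obtain \<alpha> y where a: "\<alpha> \<in> Ar N" "Dom N \<alpha> = m" "\<alpha> \<noteq> Ident N m" "y \<in> Ob (I (Cod N \<alpha>))"
      "l = low_ob m \<alpha> y"
      using lower_Ob_cases[OF 2(1)] by blast
    have "x = FOb (Ia \<alpha>) y" using lower_inj_glue(1)[OF a(1), of y] a 2 lower_inj_FOb by simp
    moreover have "births (Cod N \<alpha>) y \<noteq> {}" using less(1)[of "Cod N \<alpha>" y] dg_less[OF a(1)] a N_ends
      by auto
    ultimately show ?thesis using births_mono[OF a(1,4)] a by auto
  qed
qed

text \<open>The collage is injective on objects and separates its two parts, so a boundary object of
  stage \<open>m\<close> never comes from below. If both candidates come from below, they yield the
  same object of the colimit \<open>lw m\<close>. There the set \<open>births\<close> is invariant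
  under gluing, by induction on the degree, and both candidates end up in \<open>births\<close> of
  one object at a smaller stage.\<close>

lemma births_unique:
  "m \<in> Ob N \<Longrightarrow> x \<in> Ob (I m) \<Longrightarrow> q \<in> births m x \<Longrightarrow> q' \<in> births m x \<Longrightarrow> q = q'"
proof (induction "dg m" arbitrary: m x q q' rule: less_induct)
  case less
  obtain n i \<alpha> where a: "q = (n, i)" "i \<in> Ob (bd n)" "\<alpha> \<in> Ar N" "Dom N \<alpha> = m" "Cod N \<alpha> = n"
    "x = FOb (Ia \<alpha>) (up_ob n i)"
    using less(4) by (auto simp: births_def)
  obtain n' i' \<alpha>' where a': "q' = (n', i')" "i' \<in> Ob (bd n')" "\<alpha>' \<in> Ar N" "Dom N \<alpha>' = m" "Cod N \<alpha>' = n'"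
    "x = FOb (Ia \<alpha>') (up_ob n' i')"
    using less(5) by (auto simp: births_def)
  have nn: "n \<in> Ob N" "n' \<in> Ob N" using a a' N_ends by blast+
  note e = up_ob[OF nn(1) a(2)] up_ob[OF nn(2) a'(2)]
  have inj: "inj_on (FOb (coll m)) (Ob (G_collage G m))"
    using coll_iso[OF less(2)] by (simp add: iso_ftor_def bij_betw_def)
  have id: "n = m \<and> x = up_ob n i" if "\<alpha> = Ident N m" 
    using that a less(2) e by (auto simp: Ia_Ident id_ftor_def Ns)
  have id': "n' = m \<and> x = up_ob n' i'" if "\<alpha>' = Ident N m" 
    using that a' less(2) e by (auto simp: Ia_Ident id_ftor_def Ns)
  have lo: "x = lo_ob m (low_ob m \<alpha> (up_ob n i)) \<and> low_ob m \<alpha> (up_ob n i) \<in> Ob (lw m)"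
    if "\<alpha> \<noteq> Ident N m"
    using lower_inj_glue(1)[OF a(3), of "up_ob n i"] that a e lower_inj_FOb
    by (auto simp: lower_cat_def colim_cat_Ob)
  have lo': "x = lo_ob m (low_ob m \<alpha>' (up_ob n' i')) \<and> low_ob m \<alpha>' (up_ob n' i') \<in> Ob (lw m)"
    if "\<alpha>' \<noteq> Ident N m"
    using lower_inj_glue(1)[OF a'(3), of "up_ob n' i'"] that a' e lower_inj_FOb
    by (auto simp: lower_cat_def colim_cat_Ob)
  show ?case
  proof (cases "\<alpha> = Ident N m")
    case True
    show ?thesis
    proof (cases "\<alpha>' = Ident N m")
      case True
      then show ?thesis using id[OF \<open>\<alpha> = _\<close>] id'[OF True] a a' inj by (auto simp: inj_on_def)
    next
      case False
      then show ?thesis using id[OF True] lo'[OF False] a inj by (auto simp: inj_on_def)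
    qed
  next
    case False
    show ?thesis
    proof (cases "\<alpha>' = Ident N m")
      case True
      then show ?thesis using id'[OF True] lo[OF False] a' inj by (auto simp: inj_on_def)
    next
      case f': False
      have l: "low_ob m \<alpha> (up_ob n i) = low_ob m \<alpha>' (up_ob n' i')"
        using lo[OF False] lo'[OF f'] inj by (auto simp: inj_on_def)
      \<comment> \<open>Along a gluing step one inclusion is \<open>births_mono\<close>. The smaller
        set is non-empty and, by induction, the larger one has at most one element, so the two are
        equal.\<close>
      have "births (Cod N \<alpha>) (up_ob n i) = births (Cod N \<alpha>') (up_ob n' i')"
      proof (rule colim_ob_invariant[OF l])
        fix k y assume k: "k \<in> Ar (lower_shape N m)"
          and y: "y \<in> Ob (I (Cod N (Dom (lower_shape N m) k)))"
        obtain \<beta>1 h \<beta>2 where kk: "k = (\<beta>1, h, \<beta>2)" "\<beta>1 \<in> Ar N" "\<beta>2 \<in> Ar N" "Dom N \<beta>1 = m" "Dom N \<beta>2 = m"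
          "h \<in> Ar N" "Dom N h = Cod N \<beta>1" "Cod N h = Cod N \<beta>2" "\<beta>1 \<noteq> Ident N m" "\<beta>2 \<noteq> Ident N m"
          using k by (auto simp: hom_def)
        have y: "y \<in> Ob (I (Cod N \<beta>2))" using y kk by simp
        have y': "FOb (Ia h) y \<in> Ob (I (Cod N \<beta>1))"
          using functor_simps(1)[OF Ia_functor[OF kk(6)]] y kk by simp
        have sub: "births (Cod N \<beta>2) y \<subseteq> births (Cod N \<beta>1) (FOb (Ia h) y)"
          using births_mono[OF kk(6)] kk y by simp
        have "Cod N \<beta>1 \<in> Ob N" "Cod N \<beta>2 \<in> Ob N" "dg (Cod N \<beta>1) < dg m"
          using kk N_ends dg_less[OF kk(2)] by auto
        then have "births (Cod N \<beta>1) (FOb (Ia h) y) = births (Cod N \<beta>2) y"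
          using births_nonempty[of "Cod N \<beta>2" y] sub less(1)[of "Cod N \<beta>1" "FOb (Ia h) y"] y y' by blast
        then show "births (Cod N (Cod (lower_shape N m) k)) (FOb ((\<lambda>(\<alpha>, h, \<beta>). Ia h) k) y) =
            births (Cod N (Dom (lower_shape N m) k)) y"
          using kk by simp
      qed
      then have "(n, i) \<in> births n' (up_ob n' i')" "(n', i') \<in> births n' (up_ob n' i')"
        using births_up_ob nn a a' by auto
      moreover have "dg n' < dg m" using dg_less[OF a'(3)] a' f' by auto
      ultimately show ?thesis using less(1)[of n' "up_ob n' i'"] nn e a a' by blast
    qed
  qed
qed

definition birth :: "'no \<Rightarrow> 'io \<Rightarrow> 'no \<times> 'd" where
  "birth m x = (THE q. q \<in> births m x)"

lemma birth_eqI: "m \<in> Ob N \<Longrightarrow> x \<in> Ob (I m) \<Longrightarrow> q \<in> births m x \<Longrightarrow> birth m x = q"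
  unfolding birth_def using births_unique by blast

lemma birth_in: "m \<in> Ob N \<Longrightarrow> x \<in> Ob (I m) \<Longrightarrow> birth m x \<in> births m x"
  using births_nonempty birth_eqI by blast

lemma birth_glue:
  assumes "\<alpha> \<in> Ar N" "x \<in> Ob (I (Cod N \<alpha>))"
  shows "birth (Dom N \<alpha>) (FOb (Ia \<alpha>) x) = birth (Cod N \<alpha>) x"
  using births_mono[OF assms] birth_in[OF _ assms(2)] N_ends[OF assms(1)]
    functor_simps(1)[OF Ia_functor[OF assms(1)] assms(2)] by (intro birth_eqI) auto

lemma birth_up_ob: "n \<in> Ob N \<Longrightarrow> i \<in> Ob (bd n) \<Longrightarrow> birth n (up_ob n i) = (n, i)"
  by (intro birth_eqI births_up_ob up_ob)

lemma birth_dg_le: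
  assumes "m \<in> Ob N" "x \<in> Ob (I m)"
  shows "dg (fst (birth m x)) \<le> dg m"
  using birth_in[OF assms] dg_le unfolding births_def by auto

text \<open>\<open>birth\<close> is constant along the gluing functors and hence descends to the
  objects of the colimit.\<close>

lemma inj_birth:
  assumes "n \<in> Ob N" "n' \<in> Ob N" "x \<in> Ob (I n)" "x' \<in> Ob (I n')"
    "FOb (G_inj G n) x = FOb (G_inj G n') x'"
  shows "birth n x = birth n' x'"
proof -
  have "colim_ob (op_cat N) I Ia n x = colim_ob (op_cat N) I Ia n' x'"
    using assms inj_FOb by metis
  then show ?thesis
    by (rule colim_ob_invariant) (simp add: birth_glue)
qed

section \<open>Objects and degrees of the gluing category\<close>

abbreviation "bdX n \<equiv> G_bd_inf G n"
abbreviation "loX n \<equiv> G_lower_inf G n"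
abbreviation "cX n \<equiv> G_coll_inf G n"

lemma coll_inf_functor: "n \<in> Ob N \<Longrightarrow> is_functor (G_collage G n) X (cX n)"
  unfolding G_coll_inf_def by (rule comp_ftor_functor[OF coll_functor inj_functor])

lemma bd_inf_functor: "n \<in> Ob N \<Longrightarrow> is_functor (bd n) X (bdX n)"
  unfolding G_bd_inf_def
  by (rule comp_ftor_functor[OF collage_up_functor[OF functor_cats(1)[OF coll_inf_functor] bd_cat]
    coll_inf_functor])

lemma lower_inf_functor: "n \<in> Ob N \<Longrightarrow> is_functor (lw n) X (loX n)"
  unfolding G_lower_inf_def
  by (rule comp_ftor_functor[OF collage_lo_functor[OF functor_cats(1)[OF coll_inf_functor] lower_cat]
    coll_inf_functor])

lemma coll_inf_simps:
  "i \<in> Ob (bd n) \<Longrightarrow> FOb (cX n) (Inl i) = FOb (bdX n) i"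
  "l \<in> Ob (lw n) \<Longrightarrow> FOb (cX n) (Inr l) = FOb (loX n) l"
  "e \<in> Ar (bd n) \<Longrightarrow> FAr (cX n) (Up e) = FAr (bdX n) e"
  "b \<in> Ar (lw n) \<Longrightarrow> FAr (cX n) (Lo b) = FAr (loX n) b"
  by (auto simp: G_bd_inf_def G_lower_inf_def comp_ftor_def collage_up_def collage_lo_def)

lemma inf_FOb:
  "i \<in> Ob (bd n) \<Longrightarrow> FOb (bdX n) i = FOb (G_inj G n) (up_ob n i)"
  "l \<in> Ob (lw n) \<Longrightarrow> FOb (loX n) l = FOb (G_inj G n) (lo_ob n l)"
  by (auto simp: G_bd_inf_def G_lower_inf_def G_coll_inf_def comp_ftor_def collage_up_def
    collage_lo_def)

lemma coll_inf_FAr: "a \<in> Ar (G_collage G n) \<Longrightarrow> FAr (cX n) a = FAr (G_inj G n) (FAr (coll n) a)"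
  by (simp add: G_coll_inf_def comp_ftor_def)

lemma bd_inf_cases:
  assumes "c \<in> Ob X"
  obtains n i where "n \<in> Ob N" "i \<in> Ob (bd n)" "c = FOb (bdX n) i"
proof -
  obtain m x where m: "m \<in> Ob N" "x \<in> Ob (I m)" "c = FOb (G_inj G m) x"
    using assms inj_FOb unfolding G_inf_def colim_cat_Ob by auto
  obtain n i \<alpha> where a: "i \<in> Ob (bd n)" "\<alpha> \<in> Ar N" "Dom N \<alpha> = m" "Cod N \<alpha> = n"
    "x = FOb (Ia \<alpha>) (up_ob n i)"
    using births_nonempty[OF m(1,2)] by (auto simp: births_def)
  have n: "n \<in> Ob N" using N_ends[OF a(2)] a by simp
  have "c = FOb (bdX n) i"
    using m a inj_glue(1)[OF a(2), of "up_ob n i"] up_ob[OF n a(1)] inf_FOb by simp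
  then show ?thesis using that n a by blast
qed

text \<open>Together with \<open>bd_inf_cases\<close> this identifies the objects of
  \<open>X\<close> with the pairs of a stage and a boundary object of it; thus an object of
  \<open>X\<close> has a well-defined degree, namely that of its stage.\<close>

lemma bd_inf_inj:
  assumes "n \<in> Ob N" "n' \<in> Ob N" "i \<in> Ob (bd n)" "i' \<in> Ob (bd n')" "FOb (bdX n) i = FOb (bdX n') i'"
  shows "n = n' \<and> i = i'"
proof -
  have "birth n (up_ob n i) = birth n' (up_ob n' i')"
    using assms inf_FOb by (intro inj_birth up_ob) auto
  then show ?thesis using assms birth_up_ob by simp
qed

definition d :: "('no \<times> 'io) set \<Rightarrow> nat" where
  "d c = (THE k. \<exists>n\<in>Ob N. \<exists>i\<in>Ob (bd n). c = FOb (bdX n) i \<and> k = dg n)"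

lemma d_bd: "n \<in> Ob N \<Longrightarrow> i \<in> Ob (bd n) \<Longrightarrow> d (FOb (bdX n) i) = dg n"
  unfolding d_def by (rule the_equality) (use bd_inf_inj in blast)+

lemma d_inj:
  assumes "m \<in> Ob N" "x \<in> Ob (I m)"
  shows "d (FOb (G_inj G m) x) = dg (fst (birth m x))"
proof -
  obtain n i where n: "n \<in> Ob N" "i \<in> Ob (bd n)" "FOb (G_inj G m) x = FOb (bdX n) i"
    using bd_inf_cases functor_simps(1)[OF inj_functor[OF assms(1)] assms(2)] by metis
  then have "birth m x = birth n (up_ob n i)"
    using assms inf_FOb by (intro inj_birth up_ob) auto
  then show ?thesis using n d_bd birth_up_ob by simp
qed

text \<open>An object of \<open>lw n\<close> comes from a stage of smaller degree than
  \<open>n\<close>, and its birth cannot lie in a stage of larger degree than that.\<close>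

lemma d_lower:
  assumes "n \<in> Ob N" "l \<in> Ob (lw n)"
  shows "d (FOb (loX n) l) < dg n"
proof -
  obtain \<alpha> x where a: "\<alpha> \<in> Ar N" "Dom N \<alpha> = n" "\<alpha> \<noteq> Ident N n" "x \<in> Ob (I (Cod N \<alpha>))" "l = low_ob n \<alpha> x"
    using lower_Ob_cases[OF assms(2)] by blast
  have "lo_ob n l = FOb (Ia \<alpha>) x" using lower_inj_glue(1)[OF a(1), of x] a lower_inj_FOb by simp
  then have "FOb (loX n) l = FOb (G_inj G (Cod N \<alpha>)) x"
    using inf_FOb(2)[OF assms(2)] inj_glue(1)[OF a(1,4)] a by simp
  then show ?thesis
    using d_inj[of "Cod N \<alpha>" x] birth_dg_le[of "Cod N \<alpha>" x] a N_ends[OF a(1)] dg_less[OF a(1)] by simp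
qed

section \<open>Normal forms of arrows that leave a boundary object\<close>

definition standard where
  "standard n i a \<longleftrightarrow>
     (\<exists>e\<in>Ar (bd n). Dom (bd n) e = i \<and> a = FAr (bdX n) e) \<or>
     (\<exists>l v y. l \<in> Ob (lw n) \<and> v \<in> FOb (pf n) (i, l) \<and> y \<in> Ar X \<and> Dom X y = FOb (loX n) l \<and>
        a = y \<cdot>\<^bsub>X\<^esub> FAr (cX n) (Cross i l v))"

lemma cross_simps:
  assumes "n \<in> Ob N" "i \<in> Ob (bd n)" "l \<in> Ob (lw n)" "v \<in> FOb (pf n) (i, l)"
  shows "FAr (cX n) (Cross i l v) \<in> Ar X" "Dom X (FAr (cX n) (Cross i l v)) = FOb (bdX n) i"
    "Cod X (FAr (cX n) (Cross i l v)) = FOb (loX n) l"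
  using functor_simps[OF coll_inf_functor[OF assms(1)]] assms by (auto simp: coll_inf_simps)

text \<open>The contravariant action of boundary arrows on the profunctor lets a cross arrow absorb
  a boundary arrow that precedes it.\<close>

lemma cross_up:
  assumes n: "n \<in> Ob N" and e: "e \<in> Ar (bd n)" "l \<in> Ob (lw n)" "v \<in> FOb (pf n) (Cod (bd n) e, l)"
  obtains v' where "v' \<in> FOb (pf n) (Dom (bd n) e, l)"
    "FAr (cX n) (Cross (Cod (bd n) e) l v) \<cdot>\<^bsub>X\<^esub> FAr (bdX n) e = FAr (cX n) (Cross (Dom (bd n) e) l v')"
proof -
  let ?i = "Cod (bd n) e" and ?v = "app (FAr (pf n) (e, Ident (lw n) l)) v"
  have C: "Cross ?i l v \<in> Ar (G_collage G n)" "Up e \<in> Ar (G_collage G n)"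
    using e category_ends[OF bd_cat[OF n]] by auto
  have "Cross ?i l v \<cdot>\<^bsub>G_collage G n\<^esub> Up e \<in> Ar (G_collage G n)"
    using category_comp(1)[OF functor_cats(1)[OF coll_functor[OF n]] C(2,1)] by simp
  then have "?v \<in> FOb (pf n) (Dom (bd n) e, l)" by auto
  moreover have "FAr (cX n) (Cross ?i l v) \<cdot>\<^bsub>X\<^esub> FAr (bdX n) e = FAr (cX n) (Cross (Dom (bd n) e) l ?v)"
    using functor_Cmp[OF coll_inf_functor[OF n] C(2,1)] e by (simp add: coll_inf_simps)
  ultimately show ?thesis using that by blast
qed

text \<open>The normal form records only how an arrow leaves the boundary. If \<open>a\<close> has
  already left it, \<open>b\<close> is absorbed into the unrestricted factor. If \<open>a\<close> is
  a boundary arrow, \<open>b\<close> starts at a boundary object of the same stage, so its own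
  normal form can be combined with \<open>a\<close>, by composition in \<open>bd n\<close> or by
  \<open>cross_up\<close>.\<close>

lemma standard_comp:
  assumes n: "n \<in> Ob N" and i: "i \<in> Ob (bd n)" and a: "standard n i a"
    and b: "b \<in> Ar X" "Dom X b = Cod X a"
    and IH: "\<And>n' i'. n' \<in> Ob N \<Longrightarrow> i' \<in> Ob (bd n') \<Longrightarrow> Dom X b = FOb (bdX n') i' \<Longrightarrow> standard n' i' b"
  shows "standard n i (b \<cdot>\<^bsub>X\<^esub> a)"
  using a unfolding standard_def[of n i a]
proof (elim disjE bexE exE conjE)
  fix l v y assume y: "l \<in> Ob (lw n)" "v \<in> FOb (pf n) (i, l)" "y \<in> Ar X" "Dom X y = FOb (loX n) l"
        "a = y \<cdot>\<^bsub>X\<^esub> FAr (cX n) (Cross i l v)"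
  note c = cross_simps[OF n i y(1,2)]
  have "b \<cdot>\<^bsub>X\<^esub> a = (b \<cdot>\<^bsub>X\<^esub> y) \<cdot>\<^bsub>X\<^esub> FAr (cX n) (Cross i l v)"
    using c y b by (simp add: Xs)
  moreover have "b \<cdot>\<^bsub>X\<^esub> y \<in> Ar X" "Dom X (b \<cdot>\<^bsub>X\<^esub> y) = FOb (loX n) l"
    using c y b by (simp_all add: Xs)
  ultimately show ?thesis using y unfolding standard_def by blast
next
  fix e assume e: "e \<in> Ar (bd n)" "Dom (bd n) e = i" "a = FAr (bdX n) e"
  let ?i = "Cod (bd n) e"
  note F = functor_simps[OF bd_inf_functor[OF n]] and ei = category_ends[OF bd_cat[OF n] e(1)]
  have "Dom X b = FOb (bdX n) ?i" using b e F by simp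
  from IH[OF n ei(2) this] show ?thesis unfolding standard_def[of n ?i b]
  proof (elim disjE bexE exE conjE)
    fix e' assume e': "e' \<in> Ar (bd n)" "Dom (bd n) e' = ?i" "b = FAr (bdX n) e'"
    then have "b \<cdot>\<^bsub>X\<^esub> a = FAr (bdX n) (e' \<cdot>\<^bsub>bd n\<^esub> e)"
      using functor_Cmp[OF bd_inf_functor[OF n] e(1) e'(1)] e by simp
    moreover have "e' \<cdot>\<^bsub>bd n\<^esub> e \<in> Ar (bd n)" "Dom (bd n) (e' \<cdot>\<^bsub>bd n\<^esub> e) = i"
      using category_comp[OF bd_cat[OF n] e(1) e'(1)] e e' by auto
    ultimately show ?thesis unfolding standard_def by blast
  next
    fix l v y assume y: "l \<in> Ob (lw n)" "v \<in> FOb (pf n) (?i, l)" "y \<in> Ar X" "Dom X y = FOb (loX n) l"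
        "b = y \<cdot>\<^bsub>X\<^esub> FAr (cX n) (Cross ?i l v)"
    note c = cross_simps[OF n ei(2) y(1,2)]
    obtain v' where v': "v' \<in> FOb (pf n) (i, l)"
      "FAr (cX n) (Cross ?i l v) \<cdot>\<^bsub>X\<^esub> FAr (bdX n) e = FAr (cX n) (Cross i l v')"
      using cross_up[OF n e(1) y(1,2)] e(2) by auto
    have "b \<cdot>\<^bsub>X\<^esub> a = y \<cdot>\<^bsub>X\<^esub> FAr (cX n) (Cross ?i l v) \<cdot>\<^bsub>X\<^esub> FAr (bdX n) e"
      using c y e F by (simp add: Xs)
    then have "b \<cdot>\<^bsub>X\<^esub> a = y \<cdot>\<^bsub>X\<^esub> FAr (cX n) (Cross i l v')" using v'(2) by simp
    then show ?thesis using v'(1) y(1,3,4) unfolding standard_def by blast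
  qed
qed

lemma standard_Ident:
  assumes "n \<in> Ob N" "i \<in> Ob (bd n)"
  shows "standard n i (Ident X (FOb (bdX n) i))"
  using functor_simps(5)[OF bd_inf_functor[OF assms(1)] assms(2)] category_ident[OF bd_cat[OF assms(1)]
    assms(2)]
  unfolding standard_def by metis

text \<open>The pair \<open>(n, i)\<close> is the birth of the source, since \<open>g\<close> may
  live at a much later stage than its source. In the collage, boundary arrows and cross arrows are
  already in normal form. An arrow from \<open>lw m\<close> is a word in arrows of stages of smaller
  degree, to which the induction hypothesis and \<open>standard_comp\<close> apply.\<close>

lemma standard_inj:
  "m \<in> Ob N \<Longrightarrow> g \<in> Ar (I m) \<Longrightarrow> birth m (Dom (I m) g) = (n, i) \<Longrightarrow> standard n i (FAr (G_inj G m) g)"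
proof (induction "dg m" arbitrary: m g n i rule: less_induct)
  case less
  note m = less(2)
  note CF = functor_simps[OF coll_functor[OF m]]
  have "g \<in> FAr (coll m) ` Ar (G_collage G m)"
    using coll_iso[OF m] less(3) by (simp add: iso_ftor_def bij_betw_def)
  then obtain g' where g': "g' \<in> Ar (G_collage G m)" "g = FAr (coll m) g'" by blast
  have inj: "FAr (G_inj G m) g = FAr (cX m) g'" using coll_inf_FAr[OF g'(1)] g' by simp
  have dom: "Dom (I m) g = FOb (coll m) (Dom (G_collage G m) g')" using CF g' by simp
  from g'(1) consider e where "g' = Up e" "e \<in> Ar (bd m)" | b where "g' = Lo b" "b \<in> Ar (lw m)"
    | j l v where "g' = Cross j l v" "j \<in> Ob (bd m)" "l \<in> Ob (lw m)" "v \<in> FOb (pf m) (j, l)"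
    by auto
  then show ?case
  proof cases
    case 1
    then have "n = m" "i = Dom (bd m) e"
      using less(4) birth_up_ob[OF m] category_ends[OF bd_cat[OF m] 1(2)] dom by auto
    then show ?thesis using 1 inj coll_inf_simps(3)[OF 1(2)] unfolding standard_def by auto
  next
    case 3
    then have ni: "n = m" "i = j" using less(4) birth_up_ob[OF m] dom by auto
    note c = cross_simps[OF m 3(2-4)]
    have "FAr (G_inj G m) g = Ident X (FOb (loX m) l) \<cdot>\<^bsub>X\<^esub> FAr (cX m) (Cross j l v)"
      using inj 3 c by (simp add: Xs)
    moreover have "FOb (loX m) l \<in> Ob X" using functor_simps(1)[OF lower_inf_functor[OF m] 3(3)] .
    ultimately show ?thesis using 3 ni Xs(5,6) unfolding standard_def by blast
  next
    case 2
    have LF: "is_functor (lw m) X (loX m)" by (rule lower_inf_functor[OF m])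
    \<comment> \<open>An inner induction along the word. The statement ranges over all pairs
      \<open>(n, i)\<close> because the rest of the word starts at a different object.\<close>
    have key: "\<forall>n\<in>Ob N. \<forall>i\<in>Ob (bd n). Dom X (FAr (loX m) b) = FOb (bdX n) i \<longrightarrow> standard n i (FAr (loX m)
      b)"
      using 2(2)
    proof (induction rule: colim_cat_induct[OF lower_diag[OF m], folded lower_cat_def lower_inj_def,
      consumes 1, case_names Ident Cmp])
      case (Ident c)
      then show ?case
        using functor_simps(5)[OF LF Ident] functor_simps(1)[OF LF Ident] Xs(6) standard_Ident by simp
    next
      case (Cmp \<alpha> g b)
      then have a: "\<alpha> \<in> Ar N" "Dom N \<alpha> = m" "\<alpha> \<noteq> Ident N m" and gI: "g \<in> Ar (I (Cod N \<alpha>))" by auto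
      let ?n = "Cod N \<alpha>"
      have n: "?n \<in> Ob N" using N_ends a by simp
      have JF: "is_functor (I ?n) (lw m) (lower_inj N I Ia m \<alpha>)"
        unfolding lower_inj_def lower_cat_def using colim_inj_functor[OF lower_diag[OF m]] Cmp(1)
          by simp
      note ends = category_ends[OF I_cat[OF n] gI]
      let ?g = "FAr (lower_inj N I Ia m \<alpha>) g"
      have gs: "?g \<in> Ar (lw m)" "Cod (lw m) ?g = low_ob m \<alpha> (Cod (I ?n) g)"
        using functor_simps[OF JF] gI ends lower_inj_FOb by auto
      have bs: "b \<in> Ar (lw m)" "Dom (lw m) b = Cod (lw m) ?g" using Cmp gs by auto
      have lo_g: "FAr (loX m) ?g = FAr (G_inj G ?n) g"
        using coll_inf_simps(4)[OF gs(1)] coll_inf_FAr[of "Lo ?g" m] gs lower_inj_glue(2)[OF a(1), of g]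
          inj_glue(2)[OF a(1) gI] a gI by simp
      have eq: "FAr (loX m) (b \<cdot>\<^bsub>lw m\<^esub> ?g) = FAr (loX m) b \<cdot>\<^bsub>X\<^esub> FAr (G_inj G ?n) g"
        using functor_Cmp[OF LF gs(1) bs] lo_g by simp
      note LFs = functor_simps[OF LF] and IFs = functor_simps[OF inj_functor[OF n]]
      have ee: "FAr (loX m) b \<in> Ar X" "Dom X (FAr (loX m) b) = Cod X (FAr (G_inj G ?n) g)"
        using LFs(2,3)[OF bs(1)] LFs(4)[OF gs(1)] bs(2) lo_g by simp_all
      show ?case
      proof (intro ballI impI)
        fix n' i' assume ni: "n' \<in> Ob N" "i' \<in> Ob (bd n')"
          and D: "Dom X (FAr (loX m) (b \<cdot>\<^bsub>lw m\<^esub> ?g)) = FOb (bdX n') i'"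
        have "FOb (G_inj G ?n) (Dom (I ?n) g) = FOb (G_inj G n') (up_ob n' i')"
          using D eq ee IFs gI inf_FOb(1)[OF ni(2)] by (simp add: Xs)
        \<comment> \<open>The letter \<open>g\<close> lives at a stage of smaller degree; knowing
          the birth of its source makes the outer induction hypothesis applicable.\<close>
        then have "birth ?n (Dom (I ?n) g) = (n', i')"
          using inj_birth[OF n ni(1) ends(1) up_ob[OF ni]] birth_up_ob[OF ni] by simp
        then have "standard n' i' (FAr (G_inj G ?n) g)"
          using less(1)[of ?n g n' i'] dg_less[OF a(1)] a n gI by simp
        then show "standard n' i' (FAr (loX m) (b \<cdot>\<^bsub>lw m\<^esub> ?g))"
          unfolding eq using Cmp(5) ee by (intro standard_comp ni) auto
      qed
    qed
    have ni: "n \<in> Ob N" "i \<in> Ob (bd n)" "Dom X (FAr (G_inj G m) g) = FOb (bdX n) i"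
    proof -
      have x: "Dom (I m) g \<in> Ob (I m)" using category_ends[OF I_cat[OF m] less(3)] by simp
      have "(n, i) \<in> births m (Dom (I m) g)" using birth_in[OF m x] less(4) by simp
      then obtain \<alpha> where a: "i \<in> Ob (bd n)" "\<alpha> \<in> Ar N" "Dom N \<alpha> = m" "Cod N \<alpha> = n"
        "Dom (I m) g = FOb (Ia \<alpha>) (up_ob n i)" by (auto simp: births_def)
      show n: "n \<in> Ob N" "i \<in> Ob (bd n)" using a N_ends by auto
      show "Dom X (FAr (G_inj G m) g) = FOb (bdX n) i"
        using functor_simps(3)[OF inj_functor[OF m] less(3)] a inj_glue(1)[OF a(2), of "up_ob n i"]
          up_ob[OF n] inf_FOb(1)[OF n(2)] by simp
    qed
    then show ?thesis using key inj 2 coll_inf_simps(4) by simp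
  qed
qed

text \<open>Arrows of the colimit are words whose letters are arrows of single stages, which
  \<open>standard_inj\<close> covers.\<close>

lemma standard_Ar:
  assumes "a \<in> Ar X"
  shows "\<forall>n\<in>Ob N. \<forall>i\<in>Ob (bd n). Dom X a = FOb (bdX n) i \<longrightarrow> standard n i a"
  using assms
proof (induction rule: colim_cat_induct[OF diag, folded G_inf_def G_inj_def, consumes 1, case_names
  Ident Cmp])
  case (Ident c)
  then show ?case using Xs(6) standard_Ident by simp
next
  case (Cmp m g b)
  then have m: "m \<in> Ob N" and b: "b \<in> Ar X" by auto
  note F = functor_simps[OF inj_functor[OF m]] and ends = category_ends[OF I_cat[OF m] Cmp(2)]
  have bg: "Dom X b = Cod X (FAr (G_inj G m) g)" using Cmp F ends inj_FOb by simp
  show ?case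
  proof (intro ballI impI)
    fix n' i' assume ni: "n' \<in> Ob N" "i' \<in> Ob (bd n')"
      and D: "Dom X (b \<cdot>\<^bsub>X\<^esub> FAr (G_inj G m) g) = FOb (bdX n') i'"
    have "FOb (G_inj G m) (Dom (I m) g) = FOb (G_inj G n') (up_ob n' i')"
      using D F Cmp b bg inf_FOb(1)[OF ni(2)] by (simp add: Xs)
    then have "birth m (Dom (I m) g) = (n', i')"
      using inj_birth[OF m ni(1) ends(1) up_ob[OF ni]] birth_up_ob[OF ni] by simp
    then have "standard n' i' (FAr (G_inj G m) g)" using standard_inj[OF m Cmp(2)] by simp
    then show "standard n' i' (b \<cdot>\<^bsub>X\<^esub> FAr (G_inj G m) g)"
      using Cmp(5) bg b by (intro standard_comp ni) auto
  qed
qed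

text \<open>In normal form a boundary arrow keeps the degree. A cross arrow lowers it, and the arrow
  that follows starts in lower degree, where induction applies.\<close>

lemma d_le: "a \<in> Ar X \<Longrightarrow> d (Cod X a) \<le> d (Dom X a)"
proof (induction "d (Dom X a)" arbitrary: a rule: less_induct)
  case less
  obtain n i where n: "n \<in> Ob N" "i \<in> Ob (bd n)" "Dom X a = FOb (bdX n) i"
    using bd_inf_cases Xs less(2) by metis
  from standard_Ar[OF less(2)] n have "standard n i a" by blast
  then show ?case unfolding standard_def
  proof (elim disjE bexE exE conjE)
    fix e assume "e \<in> Ar (bd n)" "Dom (bd n) e = i" "a = FAr (bdX n) e"
    then show ?thesis
      using functor_simps[OF bd_inf_functor[OF n(1)]] category_ends[OF bd_cat[OF n(1)]] d_bd[OF n(1)] n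
        by simp
  next
    fix l v y assume y: "l \<in> Ob (lw n)" "v \<in> FOb (pf n) (i, l)" "y \<in> Ar X" "Dom X y = FOb (loX n) l"
        "a = y \<cdot>\<^bsub>X\<^esub> FAr (cX n) (Cross i l v)"
    note c = cross_simps[OF n(1,2) y(1,2)]
    have "d (Dom X y) < d (Dom X a)" using d_lower[OF n(1) y(1)] d_bd n y by simp
    moreover have "Cod X a = Cod X y" using y c by (simp add: Xs)
    ultimately show ?thesis using less(1)[of y] y by simp
  qed
qed

end

section \<open>The localised gluing category\<close>

lemma inv_ar:
  fixes C (structure)
  assumes "category C" "iso_ar C f"
  shows "inv_ar C f \<in> Ar C" "Dom C (inv_ar C f) = Cod C f" "Cod C (inv_ar C f) = Dom C f"
    "inv_ar C f \<cdot> f = Ident C (Dom C f)" "f \<cdot> inv_ar C f = Ident C (Cod C f)"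
proof -
  let ?P = "\<lambda>g. g \<in> hom C (Cod C f) (Dom C f) \<and> g \<cdot> f = Ident C (Dom C f) \<and> f \<cdot> g = Ident C (Cod C f)"
  have f: "f \<in> hom C (Dom C f) (Cod C f)" using assms by (simp add: iso_ar_def hom_def)
  \<comment> \<open>\<open>inverse_unique\<close> carries the two assumptions of the localisation, a
    category with a set of its arrows; the empty set serves here.\<close>
  have "\<exists>!g. ?P g"
    using assms inverse_unique[OF assms(1) empty_subsetI assms(1) f] unfolding iso_ar_def by blast
  from theI'[OF this] have "?P (inv_ar C f)" unfolding inv_ar_def .
  then show "inv_ar C f \<in> Ar C" "Dom C (inv_ar C f) = Cod C f" "Cod C (inv_ar C f) = Dom C f"
    "inv_ar C f \<cdot> f = Ident C (Dom C f)" "f \<cdot> inv_ar C f = Ident C (Cod C f)"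
    by (auto simp: hom_def)
qed

lemma iso_arI:
  fixes C (structure)
  assumes "f \<in> Ar C" "g \<in> Ar C" "Dom C g = Cod C f" "Cod C g = Dom C f"
    "g \<cdot> f = Ident C (Dom C f)" "f \<cdot> g = Ident C (Cod C f)"
  shows "iso_ar C f"
  using assms unfolding iso_ar_def hom_def by blast

text \<open>From \<open>r \<cdot> f\<close> being an identity it follows that
  \<open>(f \<cdot> r) \<cdot> f = f\<close>, and \<open>f\<close> can be cancelled on the
  right.\<close>

lemma split_mono_epi_iso:
  fixes C (structure)
  assumes C: "category C" and f: "epi C f" and r: "r \<in> Ar C" "Dom C r = Cod C f" "Cod C r = Dom C f"
    "r \<cdot> f = Ident C (Dom C f)"
  shows "iso_ar C f" "inv_ar C f = r"
proof -
  have fA: "f \<in> Ar C" using f by (simp add: epi_def)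
  note Cs = category_simps[OF C]
  have "(f \<cdot> r) \<cdot> f = Ident C (Cod C f) \<cdot> f"
    using fA r by (simp add: Cs)
  then have fr: "f \<cdot> r = Ident C (Cod C f)"
    using f fA r unfolding epi_def by (simp add: Cs)
  then show i: "iso_ar C f" using fA r by (intro iso_arI)
  show "inv_ar C f = r"
    using inverse_unique[OF C empty_subsetI C, of f "Dom C f" "Cod C f" "inv_ar C f" r] inv_ar[OF C i]
      fA r fr by (simp add: hom_def)
qed

section \<open>Initiality and the functor to the localisation\<close>

locale initial_gluing = gluing G for G :: "('no, 'na, 'io, 'ia, 'd, 'e, 'h) gluing" +
  fixes W
  assumes W: "W \<subseteq> Ar X"
    and all_epi: "a \<in> Ar (G_Ho G W) \<Longrightarrow> epi (G_Ho G W) a"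
    and initial: "n \<in> Ob N \<Longrightarrow> i \<in> Ob (bd n) \<Longrightarrow>
        initial_ftor (G_under G n i) (proper_coslice (G_Ho G W) (FOb (G_bd_Ho G W n) i)) (G_gamma_at G W
          n i)"
begin

abbreviation "H \<equiv> G_Ho G W"
abbreviation "\<gamma> \<equiv> G_gamma G W"

lemma \<gamma>: "is_functor X H \<gamma>"
  unfolding G_Ho_def G_gamma_def by (rule loc_ftor_functor[OF X_cat W])

lemmas H = functor_cats(2)[OF \<gamma>]
lemmas Hs = category_simps[OF H]

lemma H_Ob: "Ob H = Ob X"
  by (simp add: G_Ho_def loc_cat_def)

lemma \<gamma>_Ob: "c \<in> Ob X \<Longrightarrow> FOb \<gamma> c = c"
  by (simp add: G_gamma_def loc_ftor_def)

lemma \<gamma>s: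
  assumes "a \<in> Ar X"
  shows "FAr \<gamma> a \<in> Ar H" "Dom H (FAr \<gamma> a) = Dom X a" "Cod H (FAr \<gamma> a) = Cod X a"
  using functor_simps[OF \<gamma>] assms \<gamma>_Ob category_ends[OF X_cat assms] by auto

lemma bd_Ho_FOb: "n \<in> Ob N \<Longrightarrow> i \<in> Ob (bd n) \<Longrightarrow> FOb (G_bd_Ho G W n) i = FOb (bdX n) i"
  using functor_simps(1)[OF bd_inf_functor] by (simp add: G_bd_Ho_def comp_ftor_simps \<gamma>_Ob)

abbreviation "cr n i l v \<equiv> FAr \<gamma> (FAr (cX n) (Cross i l v))"

lemma cr_simps:
  assumes "n \<in> Ob N" "i \<in> Ob (bd n)" "l \<in> Ob (lw n)" "v \<in> FOb (pf n) (i, l)"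
  shows "cr n i l v \<in> Ar H" "Dom H (cr n i l v) = FOb (bdX n) i" "Cod H (cr n i l v) = FOb (loX n) l"
  using \<gamma>s[OF cross_simps(1)[OF assms]] cross_simps[OF assms] by auto

lemma under_Ob: "(l, v) \<in> Ob (G_under G n i) \<longleftrightarrow> l \<in> Ob (lw n) \<and> v \<in> FOb (pf n) (i, l)"
  by (auto simp: G_under_def elements_def prof_at_def)

lemma gamma_at_FOb:
  assumes "n \<in> Ob N" "i \<in> Ob (bd n)" "(l, v) \<in> Ob (G_under G n i)"
  shows "FOb (G_gamma_at G W n i) (l, v) = cr n i l v"
  using assms under_Ob by (simp add: G_gamma_at_def Let_def comp_ftor_def)

lemma gamma_at_FAr:
  assumes "n \<in> Ob N" "i \<in> Ob (bd n)" "((l, v), b, (l', v')) \<in> Ar (G_under G n i)"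
  shows "FAr (G_gamma_at G W n i) ((l, v), b, (l', v')) = (cr n i l v, FAr \<gamma> (FAr (loX n) b), cr n i l'
    v')"
proof -
  have "b \<in> Ar (lw n)" "Dom (lw n) b = l" "Cod (lw n) b = l'"
    using assms(3) by (auto simp: G_under_def elements_def hom_def)
  with category_ends[OF lower_cat this(1)] have
    "b \<in> Ar (lw n)" "l \<in> Ob (lw n)" "v \<in> FOb (pf n) (i, l)" "l' \<in> Ob (lw n)" "v' \<in> FOb (pf n) (i, l')"
    using assms(3) by (auto simp: G_under_def elements_def prof_at_def)
  then show ?thesis using assms
    by (simp add: G_gamma_at_def Let_def comp_ftor_def coll_inf_simps[symmetric])
qed

text \<open>An object over \<open>b\<close> is a factorisation of \<open>b\<close> through the image
  of some \<open>Cross i l v\<close>. Hence non-emptiness of the comma category means that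
  \<open>b\<close> passes through \<open>lw n\<close>, and connectedness relates the different ways
  in which it does.\<close>

lemma comma_Ob:
  assumes n: "n \<in> Ob N" "i \<in> Ob (bd n)" and b: "b \<in> Ob (proper_coslice H (FOb (bdX n) i))"
  shows "o' \<in> Ob (comma (G_under G n i) (proper_coslice H (FOb (bdX n) i)) (G_gamma_at G W n i) b) \<longleftrightarrow>
    (\<exists>l v k. o' = ((l, v), (cr n i l v, k, b)) \<and> l \<in> Ob (lw n) \<and> v \<in> FOb (pf n) (i, l) \<and>
       k \<in> Ar H \<and> Dom H k = FOb (loX n) l \<and> Cod H k = Cod H b \<and> k \<cdot>\<^bsub>H\<^esub> cr n i l v = b)"
    (is "?L \<longleftrightarrow> ?R")
proof
  assume ?L
  then obtain l v h where o: "o' = ((l, v), h)" and lv: "(l, v) \<in> Ob (G_under G n i)"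
    and h: "h \<in> hom (proper_coslice H (FOb (bdX n) i)) (cr n i l v) b"
    by (auto simp: comma_def gamma_at_FOb[OF n])
  note lv' = lv[unfolded under_Ob]
  then show ?R using o h cr_simps[OF n, of l v] by (auto simp: hom_def)
next
  assume ?R
  then obtain l v k where o: "o' = ((l, v), (cr n i l v, k, b))" "l \<in> Ob (lw n)" "v \<in> FOb (pf n) (i, l)"
    "k \<in> Ar H" "Dom H k = FOb (loX n) l" "Cod H k = Cod H b" "k \<cdot>\<^bsub>H\<^esub> cr n i l v = b"
    by blast
  note c = cr_simps[OF n o(2,3)]
  have lv: "(l, v) \<in> Ob (G_under G n i)" using o under_Ob by simp
  have F: "FOb (G_gamma_at G W n i) (l, v) \<in> Ob (proper_coslice H (FOb (bdX n) i))"
    using initial[OF n] lv unfolding initial_ftor_def bd_Ho_FOb[OF n] by (blast dest: functor_simps(1))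
  then show ?L
    using o c b lv gamma_at_FOb[OF n lv] unfolding comma_def by (auto simp: hom_def)
qed

lemma comma_connected:
  assumes "n \<in> Ob N" "i \<in> Ob (bd n)" "b \<in> Ob (proper_coslice H (FOb (bdX n) i))"
  shows "nonempty_connected (comma (G_under G n i) (proper_coslice H (FOb (bdX n) i)) (G_gamma_at G W n
    i) b)"
  using initial[OF assms(1,2)] assms(3) unfolding initial_ftor_def bd_Ho_FOb[OF assms(1,2)] by blast

lemma factorisation:
  assumes n: "n \<in> Ob N" "i \<in> Ob (bd n)"
    and b: "b \<in> Ar H" "Dom H b = FOb (bdX n) i" "b \<noteq> Ident H (FOb (bdX n) i)"
  obtains l v k where "l \<in> Ob (lw n)" "v \<in> FOb (pf n) (i, l)" "k \<in> Ar H" "Dom H k = FOb (loX n) l"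
    "Cod H k = Cod H b" "k \<cdot>\<^bsub>H\<^esub> cr n i l v = b"
proof -
  have b: "b \<in> Ob (proper_coslice H (FOb (bdX n) i))" using b by simp
  obtain o' where "o' \<in> Ob (comma (G_under G n i) (proper_coslice H (FOb (bdX n) i)) (G_gamma_at G W n
    i) b)"
    using comma_connected[OF n b] unfolding nonempty_connected_def by blast
  then show ?thesis using that unfolding comma_Ob[OF n b] by blast
qed

lemma H_iso_trivial:
  "iso_ar H b \<Longrightarrow> b = Ident H (Dom H b)"
proof (induction "d (Dom H b)" arbitrary: b rule: less_induct)
  case less
  have bA: "b \<in> Ar H" using less(2) by (simp add: iso_ar_def)
  then obtain n i where n: "n \<in> Ob N" "i \<in> Ob (bd n)" and c: "Dom H b = FOb (bdX n) i"
    using bd_inf_cases category_ends(1)[OF H bA] H_Ob by metis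
  show ?case
  proof (rule ccontr)
    assume "b \<noteq> Ident H (Dom H b)"
    then obtain l v k where o: "l \<in> Ob (lw n)" "v \<in> FOb (pf n) (i, l)" "k \<in> Ar H"
      "Dom H k = FOb (loX n) l"
      "Cod H k = Cod H b" "k \<cdot>\<^bsub>H\<^esub> cr n i l v = b"
      using factorisation[OF n bA c] c by metis
    note r = cr_simps[OF n o(1,2)] and B = inv_ar[OF H less(2)]
    \<comment> \<open>Since \<open>b\<close> is invertible and factors as \<open>k\<close> after the
      image of a cross arrow, undoing \<open>b\<close> after \<open>k\<close> gives a retraction of
      that image.\<close>
    let ?r = "inv_ar H b \<cdot>\<^bsub>H\<^esub> k"
    have r': "?r \<in> Ar H" "Dom H ?r = FOb (loX n) l" "Cod H ?r = FOb (bdX n) i"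
      using B o c by (simp_all add: Hs)
    have "?r \<cdot>\<^bsub>H\<^esub> cr n i l v = Ident H (FOb (bdX n) i)"
      using B o c r by (simp add: Hs)
    then have iso: "iso_ar H (cr n i l v)" and inv: "inv_ar H (cr n i l v) = ?r"
      using split_mono_epi_iso[OF H all_epi[OF r(1)], of ?r] r r' by auto
    have "iso_ar H ?r"
      using inv_ar[OF H iso] r r' unfolding inv by (intro iso_arI[of _ _ "cr n i l v"]) auto
    then have "?r = Ident H (FOb (loX n) l)"
      using less(1)[of ?r] d_lower[OF n(1) o(1)] d_bd[OF n] c r' by simp
    then have "FOb (loX n) l = FOb (bdX n) i"
      using r'(3) category_ident(3)[OF H, of "FOb (loX n) l"] functor_simps(1)[OF lower_inf_functor[OF
        n(1)] o(1)] H_Ob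
      by simp
    then show False using d_lower[OF n(1) o(1)] d_bd[OF n] by simp
  qed
qed

text \<open>\<open>\<gamma>\<close> inverts \<open>w\<close>, and the localisation has no
  isomorphisms other than identities.\<close>

lemma \<gamma>_W:
  assumes "w \<in> W"
  shows "FAr \<gamma> w = Ident H (Dom X w)" "Cod X w = Dom X w"
proof -
  have w: "w \<in> Ar X" using W assms by blast
  have "iso_ar H (FAr \<gamma> w)"
    unfolding G_Ho_def G_gamma_def by (rule loc_ftor_inverts[OF X_cat W assms])
  then show *: "FAr \<gamma> w = Ident H (Dom X w)" using H_iso_trivial \<gamma>s[OF w] by metis
  then show "Cod X w = Dom X w"
    using \<gamma>s[OF w] category_ident(3)[OF H, of "Dom X w"] category_ends(1)[OF X_cat w] H_Ob by simp
qed

text \<open>Each weak equivalence becomes an identity, and so does its formal inverse. Formal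
  inverses can therefore be deleted from a word, and what remains is a composite of arrows of
  \<open>X\<close>.\<close>

lemma \<gamma>_full:
  assumes "a \<in> Ar H"
  shows "\<exists>u\<in>Ar X. FAr \<gamma> u = a"
  using assms unfolding G_Ho_def loc_cat_def
proof (induction rule: presented_cat_induct)
  case (Ident c)
  then have "FAr \<gamma> (Ident X c) = Ident H c"
    using functor_simps(5)[OF \<gamma>] \<gamma>_Ob by simp
  then show ?case
    using category_ident(1)[OF X_cat Ident] unfolding G_Ho_def loc_cat_def by auto
next
  case (Cmp g b)
  let ?s = "case_sum (Dom X) (Cod X)" and ?t = "case_sum (Cod X) (Dom X)"
  let ?p = "is_path (Ob X) (Inl ` Ar X \<union> Inr ` W) ?s ?t"
  let ?c = "path_class (Ob X) (Inl ` Ar X \<union> Inr ` W) ?s ?t (loc_rel X W)"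
  have b: "b \<in> Ar H" "Dom H b = ?t g" using Cmp(4,5) unfolding G_Ho_def loc_cat_def by auto
  obtain u where u: "u \<in> Ar X" "FAr \<gamma> u = b" using Cmp(6) by blast
  have du: "Dom X u = ?t g" using \<gamma>s[OF u(1)] u b by simp
  have "\<exists>u\<in>Ar X. FAr \<gamma> u = b \<cdot>\<^bsub>H\<^esub> ?c (?s g) [g] (?t g)"
  proof (cases g)
    case (Inl a)
    then have a: "a \<in> Ar X" using Cmp(1) by auto
    have "?c (?s g) [g] (?t g) = FAr \<gamma> a" using a Inl by (simp add: G_gamma_def loc_ftor_def)
    then show ?thesis
      using functor_Cmp[OF \<gamma> a u(1)] category_comp(1)[OF X_cat a u(1)] du u Inl
        by (intro bexI[of _ "u \<cdot>\<^bsub>X\<^esub> a"]) auto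
  next
    case (Inr w)
    then have w: "w \<in> W" using Cmp(1) by auto
    then have wX: "w \<in> Ar X" using W by blast
    note e = category_ends[OF X_cat wX]
    have q: "?p (Dom X w) [Inl w] (Cod X w)" "?p (Cod X w) [Inr w] (Dom X w)" using wX w e by auto
    have q2: "?p (Dom X w) ([Inl w] @ [Inr w]) (Dom X w)" using is_path_append[OF q] .
    have c: "?c (Cod X w) [Inr w] (Dom X w) \<in> Ar H"
      "Dom H (?c (Cod X w) [Inr w] (Dom X w)) = Cod X w"
      using q(2) unfolding G_Ho_def loc_cat_def presented_cat_simps by blast+
    have "FAr \<gamma> w = ?c (Dom X w) [Inl w] (Cod X w)"
      using wX by (simp add: G_gamma_def loc_ftor_def)
    then have "?c (Cod X w) [Inr w] (Dom X w) \<cdot>\<^bsub>H\<^esub> FAr \<gamma> w = ?c (Dom X w) ([Inl w] @ [Inr w]) (Dom X w)"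
      using presented_cat_Cmp[OF q, where R = "loc_rel X W"] unfolding G_Ho_def loc_cat_def by simp
    also have "\<dots> = ?c (Dom X w) [] (Dom X w)"
      unfolding path_class_eq_iff[OF q2] using q2 e w
      by (auto intro!: path_cong.rel loc_rel.inv_left)
    finally have "?c (Cod X w) [Inr w] (Dom X w) \<cdot>\<^bsub>H\<^esub> FAr \<gamma> w = Ident H (Dom X w)"
      unfolding G_Ho_def loc_cat_def by simp
    then have "?c (?s g) [g] (?t g) = Ident H (Dom X w)"
      using \<gamma>_W[OF w] c Inr by (simp add: category_comp_ident[OF H])
    then have "b \<cdot>\<^bsub>H\<^esub> ?c (?s g) [g] (?t g) = b" using b Inr by (simp add: category_comp_ident[OF H])
    then show ?thesis using u by auto
  qed
  then show ?case unfolding G_Ho_def loc_cat_def .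
qed

text \<open>If the image of \<open>u\<close> is not an identity, it factors through an object coming
  from \<open>lw n\<close>, which has smaller degree. The remaining factor lifts to \<open>X\<close>
  by fullness, and arrows of \<open>X\<close> do not raise the degree.\<close>

lemma \<gamma>_deg:
  assumes u: "u \<in> Ar X"
  shows "FAr \<gamma> u = Ident H (Dom X u) \<or> d (Cod X u) < d (Dom X u)"
proof -
  obtain n i where n: "n \<in> Ob N" "i \<in> Ob (bd n)" and c: "Dom X u = FOb (bdX n) i"
    using bd_inf_cases category_ends(1)[OF X_cat u] by metis
  note us = \<gamma>s[OF u]
  have "d (Cod X u) < d (Dom X u)" if "FAr \<gamma> u \<noteq> Ident H (Dom X u)"
  proof -
    have "Dom H (FAr \<gamma> u) = FOb (bdX n) i" "FAr \<gamma> u \<noteq> Ident H (FOb (bdX n) i)" using us c that by auto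
    then obtain l v k where o: "l \<in> Ob (lw n)" "v \<in> FOb (pf n) (i, l)" "k \<in> Ar H"
      "Dom H k = FOb (loX n) l"
      "Cod H k = Cod H (FAr \<gamma> u)" "k \<cdot>\<^bsub>H\<^esub> cr n i l v = FAr \<gamma> u"
      by (rule factorisation[OF n us(1)])
    obtain y where y: "y \<in> Ar X" "FAr \<gamma> y = k" using \<gamma>_full[OF o(3)] by blast
    have "d (Cod X u) \<le> d (FOb (loX n) l)"
      using d_le[OF y(1)] \<gamma>s[OF y(1)] y o us by simp
    then show ?thesis using d_lower[OF n(1) o(1)] d_bd[OF n] c by simp
  qed
  then show ?thesis by blast
qed

text \<open>To a factorisation of the common image, that is, to an object of the comma category,
  belongs the set \<open>R\<close> of its liftings to composites \<open>y\<close> after a cross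
  arrow of \<open>X\<close>. Two members of one such set differ by a single \<open>cod_step\<close>.
  Connectedness of the comma category links the sets belonging to \<open>u\<close> and to
  \<open>u'\<close>.\<close>

lemma \<gamma>_conn:
  assumes u: "u \<in> Ar X" "u' \<in> Ar X" "FAr \<gamma> u = FAr \<gamma> u'" and lt: "d (Cod X u) < d (Dom X u)"
  shows "(cod_step X (FAr \<gamma>) d)\<^sup>*\<^sup>* u u'"
proof -
  obtain n i where n: "n \<in> Ob N" "i \<in> Ob (bd n)" and c: "Dom X u = FOb (bdX n) i"
    using bd_inf_cases category_ends(1)[OF X_cat u(1)] by metis
  let ?b = "FAr \<gamma> u"
  let ?cm = "comma (G_under G n i) (proper_coslice H (FOb (bdX n) i)) (G_gamma_at G W n i) ?b"
  have "?b \<noteq> Ident H (FOb (bdX n) i)"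
    using \<gamma>s[OF u(1)] c lt category_ident(3)[OF H, of "Dom X u"] category_ends(1)[OF X_cat u(1)] H_Ob
      by auto
  then have b: "?b \<in> Ob (proper_coslice H (FOb (bdX n) i))" using \<gamma>s[OF u(1)] c by simp
  define R where "R o' = (case o' of ((l, v), (s, k, t)) \<Rightarrow>
    {y \<cdot>\<^bsub>X\<^esub> FAr (cX n) (Cross i l v) |y. y \<in> Ar X \<and> Dom X y = FOb (loX n) l \<and>
       FAr \<gamma> y = k \<and> s = cr n i l v \<and> t = ?b})" for o'
  have R_I: "y \<cdot>\<^bsub>X\<^esub> FAr (cX n) (Cross i l v) \<in> R ((l, v), (cr n i l v, k, ?b))"
    if "y \<in> Ar X" "Dom X y = FOb (loX n) l" "FAr \<gamma> y = k" for y l k v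
    unfolding R_def prod.case mem_Collect_eq using that by (intro exI[of _ y] conjI HOL.refl)
  have R_step: "cod_step X (FAr \<gamma>) d x x'" if o': "o' \<in> Ob ?cm" "x \<in> R o'" "x' \<in> R o'" for o' x x'
  proof -
    obtain l v k where o: "o' = ((l, v), (cr n i l v, k, ?b))" "l \<in> Ob (lw n)" "v \<in> FOb (pf n) (i, l)"
      using o'(1) unfolding comma_Ob[OF n b] by blast
    note cs = cross_simps[OF n o(2,3)]
    obtain y y' where y: "x = y \<cdot>\<^bsub>X\<^esub> FAr (cX n) (Cross i l v)" "y \<in> Ar X" "Dom X y = FOb (loX n) l"
      "FAr \<gamma> y = k"
      "x' = y' \<cdot>\<^bsub>X\<^esub> FAr (cX n) (Cross i l v)" "y' \<in> Ar X" "Dom X y' = FOb (loX n) l" "FAr \<gamma> y' = k"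
      using o'(2,3) unfolding R_def o by auto
    show ?thesis unfolding y(1,5)
      using y cs d_lower[OF n(1) o(2)] d_bd[OF n] by (intro cod_step.intros) auto
  qed
  have R_ne: "R o' \<noteq> {}" if o': "o' \<in> Ob ?cm" for o'
  proof -
    obtain l v k where o: "o' = ((l, v), (cr n i l v, k, ?b))" "k \<in> Ar H" "Dom H k = FOb (loX n) l"
      using o' unfolding comma_Ob[OF n b] by blast
    obtain y where "y \<in> Ar X" "FAr \<gamma> y = k" using \<gamma>_full[OF o(2)] by blast
    then show ?thesis using R_I[of y l k v] \<gamma>s(2)[of y] o by auto
  qed
  \<comment> \<open>An arrow \<open>e\<close> of \<open>lw n\<close> between two factorisations
    carries one cross arrow to the other. It can be moved from the cross arrow into
    \<open>y\<close>, so liftings of the target factorisation are also liftings of the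
    source.\<close>
  have R_sub: "Dom ?cm a \<in> Ob ?cm \<and> Cod ?cm a \<in> Ob ?cm \<and> R (Cod ?cm a) \<subseteq> R (Dom ?cm a)"
    if aA: "a \<in> Ar ?cm" for a
  proof -
    obtain l v h \<kappa> l' v' h' where a: "a = (((l, v), h), \<kappa>, ((l', v'), h'))"
      "((l, v), h) \<in> Ob ?cm" "((l', v'), h') \<in> Ob ?cm" "\<kappa> \<in> hom (G_under G n i) (l, v) (l', v')"
      "h' \<cdot>\<^bsub>proper_coslice H (FOb (bdX n) i)\<^esub> FAr (G_gamma_at G W n i) \<kappa> = h"
      using aA unfolding comma_def by auto
    obtain k where k: "h = (cr n i l v, k, ?b)" "l \<in> Ob (lw n)" "v \<in> FOb (pf n) (i, l)"
      using a(2) unfolding comma_Ob[OF n b] by blast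
    obtain k' where k': "h' = (cr n i l' v', k', ?b)" "l' \<in> Ob (lw n)" "v' \<in> FOb (pf n) (i, l')"
      using a(3) unfolding comma_Ob[OF n b] by blast
    obtain e where \<kappa>: "\<kappa> = ((l, v), e, (l', v'))" "e \<in> Ar (lw n)" "Dom (lw n) e = l" "Cod (lw n) e = l'"
      "app (FAr (prof_at (bd n) (lw n) (pf n) i) e) v = v'" "\<kappa> \<in> Ar (G_under G n i)"
      using a(4) by (auto simp: hom_def G_under_def elements_def)
    have kk: "k' \<cdot>\<^bsub>H\<^esub> FAr \<gamma> (FAr (loX n) e) = k"
      using a(5) k k' gamma_at_FAr[OF n \<kappa>(6)[unfolded \<kappa>(1)]] \<kappa>(1) by simp
    have v': "app (FAr (pf n) (Ident (bd n) i, e)) v = v'"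
      using \<kappa>(2,5) by (simp add: prof_at_def)
    have C: "Cross i l v \<in> Ar (G_collage G n)" "Lo e \<in> Ar (G_collage G n)" using k \<kappa> n by auto
    have lo_cr: "FAr (loX n) e \<cdot>\<^bsub>X\<^esub> FAr (cX n) (Cross i l v) = FAr (cX n) (Cross i l' v')"
      using functor_Cmp[OF coll_inf_functor[OF n(1)] C] v' \<kappa> by (simp add: coll_inf_simps)
    note cs = cross_simps[OF n k(2,3)] and L = functor_simps[OF lower_inf_functor[OF n(1)]]
    have "R ((l', v'), h') \<subseteq> R ((l, v), h)"
    proof
      fix x assume "x \<in> R ((l', v'), h')"
      then obtain y where y: "x = y \<cdot>\<^bsub>X\<^esub> FAr (cX n) (Cross i l' v')" "y \<in> Ar X"
        "Dom X y = FOb (loX n) l'" "FAr \<gamma> y = k'"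
        unfolding R_def k' by auto
      let ?y = "y \<cdot>\<^bsub>X\<^esub> FAr (loX n) e"
      have eX: "FAr (loX n) e \<in> Ar X" "Dom X (FAr (loX n) e) = FOb (loX n) l"
        "Cod X (FAr (loX n) e) = FOb (loX n) l'"
        using L \<kappa> by auto
      have "x = ?y \<cdot>\<^bsub>X\<^esub> FAr (cX n) (Cross i l v)"
        unfolding y(1) lo_cr[symmetric] using y eX cs by (simp add: Xs)
      moreover have "?y \<in> Ar X" "Dom X ?y = FOb (loX n) l" using y eX by (simp_all add: Xs)
      moreover have "FAr \<gamma> ?y = k" using functor_Cmp[OF \<gamma> eX(1) y(2)] y eX kk by simp
      ultimately show "x \<in> R ((l, v), h)" unfolding k(1) using R_I by simp
    qed
    then show ?thesis using a by (simp add: comma_def)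
  qed
  let ?E = "{(Dom ?cm f, Cod ?cm f) |f. f \<in> Ar ?cm} \<union> {(Cod ?cm f, Dom ?cm f) |f. f \<in> Ar ?cm}"
  \<comment> \<open>Neighbours in a zigzag have nested sets, and none of the sets is empty, so a
    chain of steps can pass from one to the next.\<close>
  have zz: "o2 \<in> Ob ?cm \<and> (\<forall>x\<in>R o1. \<forall>x'\<in>R o2. (cod_step X (FAr \<gamma>) d)\<^sup>*\<^sup>* x x')"
    if "(o1, o2) \<in> ?E\<^sup>*" "o1 \<in> Ob ?cm" for o1 o2
    using that(1)
  proof (induction rule: rtrancl_induct)
    case base
    then show ?case using that(2) R_step by blast
  next
    case (step o2 o3)
    have o3: "o3 \<in> Ob ?cm" "R o3 \<subseteq> R o2 \<or> R o2 \<subseteq> R o3" using step(2) R_sub by blast+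
    have "(cod_step X (FAr \<gamma>) d)\<^sup>*\<^sup>* x x'" if x: "x \<in> R o1" "x' \<in> R o3" for x x'
    proof (cases "R o3 \<subseteq> R o2")
      case True
      then have "x' \<in> R o2" using x(2) by (rule subsetD)
      then show ?thesis using step(3) x(1) by blast
    next
      case False
      obtain z where z: "z \<in> R o2" using R_ne step(3) by blast
      then have "z \<in> R o3" using False o3(2) by (meson subsetD)
      then have "cod_step X (FAr \<gamma>) d z x'" using R_step[OF o3(1)] x(2) by blast
      moreover have "(cod_step X (FAr \<gamma>) d)\<^sup>*\<^sup>* x z" using step(3) x(1) z by blast
      ultimately show ?thesis by (meson rtranclp.rtrancl_into_rtrancl)
    qed
    then show ?case using o3(1) by blast
  qed
  \<comment> \<open>By the normal form, \<open>x\<close> leaves the boundary through a cross arrow: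
    a boundary arrow would keep the degree, contrary to \<open>lt\<close>.\<close>
  have obj: "\<exists>o'\<in>Ob ?cm. x \<in> R o'" if x: "x \<in> Ar X" "FAr \<gamma> x = ?b" for x
  proof -
    have ex: "Dom X x = Dom X u" "Cod X x = Cod X u" using \<gamma>s[OF u(1)] \<gamma>s[OF x(1)] x(2) by auto
    have "standard n i x" using standard_Ar[OF x(1)] n c ex by simp
    then show ?thesis unfolding standard_def
    proof (elim disjE bexE exE conjE)
      fix e assume "e \<in> Ar (bd n)" "Dom (bd n) e = i" "x = FAr (bdX n) e"
      then have "d (Cod X x) = d (Dom X x)"
        using functor_simps[OF bd_inf_functor[OF n(1)]] category_ends[OF bd_cat[OF n(1)]] d_bd[OF n(1)]
          n by simp
      then show ?thesis using lt ex by simp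
    next
      fix l v y assume y: "l \<in> Ob (lw n)" "v \<in> FOb (pf n) (i, l)" "y \<in> Ar X" "Dom X y = FOb (loX n) l"
        "x = y \<cdot>\<^bsub>X\<^esub> FAr (cX n) (Cross i l v)"
      note cs = cross_simps[OF n y(1,2)]
      have "FAr \<gamma> y \<cdot>\<^bsub>H\<^esub> cr n i l v = ?b"
        using functor_Cmp[OF \<gamma> cs(1) y(3)] cs y x by simp
      moreover have "Cod X y = Cod X u" using cs y ex by (simp add: Xs)
      ultimately have "((l, v), (cr n i l v, FAr \<gamma> y, ?b)) \<in> Ob ?cm"
        unfolding comma_Ob[OF n b] using y \<gamma>s[OF y(3)] \<gamma>s[OF u(1)] by simp
      moreover have "x \<in> R ((l, v), (cr n i l v, FAr \<gamma> y, ?b))" unfolding y(5)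
        by (rule R_I[OF y(3,4) HOL.refl])
      ultimately show ?thesis by blast
    qed
  qed
  obtain o1 o2 where "o1 \<in> Ob ?cm" "u \<in> R o1" "o2 \<in> Ob ?cm" "u' \<in> R o2"
    using obj[OF u(1)] obj[OF u(2)] u(3) by auto
  then show ?thesis
    using zz[of o1 o2] comma_connected[OF n b] unfolding nonempty_connected_def by blast
qed

sublocale inverse_quotient X H \<gamma> d
  using \<gamma> H_Ob \<gamma>_Ob \<gamma>_full \<gamma>_deg \<gamma>_conn by unfold_locales auto

end

section \<open>Functor categories and pullbacks\<close>

lemma fun_cat_simps [simp]:
  "Ob (fun_cat D E) = {F. is_functor D E F}" "Ar (fun_cat D E) = {t. is_ntrans D E t}"
  "Dom (fun_cat D E) = NDom" "Cod (fun_cat D E) = NCod"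
  "NDom (Ident (fun_cat D E) F) = F" "NCod (Ident (fun_cat D E) F) = F"
  "NDom (t \<cdot>\<^bsub>fun_cat D E\<^esub> s) = NDom s" "NCod (t \<cdot>\<^bsub>fun_cat D E\<^esub> s) = NCod t"
  "x \<in> Ob D \<Longrightarrow> NComp (Ident (fun_cat D E) F) x = Ident E (FOb F x)"
  "x \<in> Ob D \<Longrightarrow> NComp (t \<cdot>\<^bsub>fun_cat D E\<^esub> s) x = NComp t x \<cdot>\<^bsub>E\<^esub> NComp s x"
  by (auto simp: fun_cat_def)

lemma is_ntrans_iff:
  "is_ntrans D E t \<longleftrightarrow> is_functor D E (NDom t) \<and> is_functor D E (NCod t) \<and>
     nat_fam D E (NDom t) (NCod t) (NComp t) \<and> NComp t \<in> extensional (Ob D)"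
  unfolding is_ntrans_def nat_fam_def by (auto simp: PiE_def)

lemma ntrans_eqI:
  assumes "is_ntrans D E s" "is_ntrans D E t" "NDom s = NDom t" "NCod s = NCod t"
    and "\<And>x. x \<in> Ob D \<Longrightarrow> NComp s x = NComp t x"
  shows "s = t"
proof -
  have "NComp s = NComp t"
    by (rule extensionalityI[where A = "Ob D"]) (use assms in \<open>auto simp: is_ntrans_iff\<close>)
  then show ?thesis using assms(3,4) by (simp add: ntrans.equality)
qed

lemma nat_fam_comp:
  fixes E (structure)
  assumes "category E" "is_functor D E F" "is_functor D E G" "is_functor D E H"
    and s: "nat_fam D E F G s" and t: "nat_fam D E G H t"
  shows "nat_fam D E F H (\<lambda>x. t x \<cdot> s x)"
  unfolding nat_fam_def
proof (intro conjI ballI)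
  note E = assms(1)
  note Es = category_simps[OF E]
  fix x assume "x \<in> Ob D"
  then show "t x \<cdot> s x \<in> hom E (FOb F x) (FOb H x)"
    using nat_fam_simps[OF s] nat_fam_simps[OF t] by (simp add: hom_def Es)
next
  note E = assms(1)
  note Es = category_simps[OF E]
  fix a assume a: "a \<in> Ar D"
  let ?x = "Dom D a" and ?y = "Cod D a"
  have x: "?x \<in> Ob D" "?y \<in> Ob D" using category_ends[OF functor_cats(1)[OF assms(2)] a] by auto
  note ss = nat_fam_simps[OF s x(1)] nat_fam_simps[OF s x(2)]
    and ts = nat_fam_simps[OF t x(1)] nat_fam_simps[OF t x(2)]
  note Fa = functor_simps(2-4)[OF assms(2) a] functor_simps(2-4)[OF assms(3) a] functor_simps(2-4)[OF
    assms(4) a]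
  have "(t ?y \<cdot> s ?y) \<cdot> FAr F a = t ?y \<cdot> s ?y \<cdot> FAr F a"
    using ss ts Fa by (simp add: Es)
  also have "\<dots> = t ?y \<cdot> FAr G a \<cdot> s ?x"
    using nat_fam_comm[OF s a HOL.refl HOL.refl] by simp
  also have "\<dots> = (t ?y \<cdot> FAr G a) \<cdot> s ?x"
    using ss ts Fa by (simp add: Es)
  also have "\<dots> = (FAr H a \<cdot> t ?x) \<cdot> s ?x"
    using nat_fam_comm[OF t a HOL.refl HOL.refl] by simp
  also have "\<dots> = FAr H a \<cdot> t ?x \<cdot> s ?x"
    using ss ts Fa by (simp add: Es)
  finally show "(t ?y \<cdot> s ?y) \<cdot> FAr F a = FAr H a \<cdot> t ?x \<cdot> s ?x" .
qed

lemma nat_fam_cong: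
  assumes "category D" "\<And>x. x \<in> Ob D \<Longrightarrow> s x = t x"
  shows "nat_fam D E F G s \<longleftrightarrow> nat_fam D E F G t"
  unfolding nat_fam_def using assms category_ends[OF assms(1)] by auto

lemma is_ntrans_Cmp:
  assumes "is_ntrans D E s" "is_ntrans D E t" "NDom t = NCod s"
  shows "is_ntrans D E (t \<cdot>\<^bsub>fun_cat D E\<^esub> s)"
proof -
  have s: "is_functor D E (NDom s)" "is_functor D E (NCod s)" "is_functor D E (NCod t)"
    "nat_fam D E (NDom s) (NCod s) (NComp s)" "nat_fam D E (NCod s) (NCod t) (NComp t)"
    using assms by (auto simp: is_ntrans_iff)
  have "nat_fam D E (NDom s) (NCod t) (NComp (t \<cdot>\<^bsub>fun_cat D E\<^esub> s))"
    using nat_fam_comp[OF functor_cats(2)[OF s(1)] s]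
      by (subst nat_fam_cong[OF functor_cats(1)[OF s(1)]]) auto
  then show ?thesis using s by (simp add: is_ntrans_iff) (simp add: fun_cat_def)
qed

lemma is_ntrans_Ident:
  assumes "is_functor D E F"
  shows "is_ntrans D E (Ident (fun_cat D E) F)"
proof -
  note c = functor_cats[OF assms]
  have "nat_fam D E F F (NComp (Ident (fun_cat D E) F))"
    unfolding nat_fam_def using functor_simps[OF assms] category_ends[OF c(1)] category_ident[OF c(2)]
      category_comp_ident[OF c(2)] by (simp add: hom_def)
  then show ?thesis using assms by (simp add: is_ntrans_iff) (simp add: fun_cat_def)
qed

lemma category_fun_cat:
  assumes "category D" "category E"
  shows "category (fun_cat D E)"
  unfolding category_def
proof (intro conjI ballI impI)
  note Es = category_simps[OF assms(2)]
  fix t assume t: "t \<in> Ar (fun_cat D E)"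
  then have t': "is_ntrans D E t" "nat_fam D E (NDom t) (NCod t) (NComp t)" "is_functor D E (NDom t)"
    "is_functor D E (NCod t)"
    by (auto simp: is_ntrans_iff)
  then show "Dom (fun_cat D E) t \<in> Ob (fun_cat D E)" "Cod (fun_cat D E) t \<in> Ob (fun_cat D E)"
    by (auto simp: is_ntrans_iff)
  show "t \<cdot>\<^bsub>fun_cat D E\<^esub> Ident (fun_cat D E) (Dom (fun_cat D E) t) = t"
    using t' nat_fam_simps[OF t'(2)]
    by (intro ntrans_eqI[of D E] is_ntrans_Cmp is_ntrans_Ident) (auto simp: Es)
  show "Ident (fun_cat D E) (Cod (fun_cat D E) t) \<cdot>\<^bsub>fun_cat D E\<^esub> t = t"
    using t' nat_fam_simps[OF t'(2)]
    by (intro ntrans_eqI[of D E] is_ntrans_Cmp is_ntrans_Ident) (auto simp: Es)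
  fix s assume s: "s \<in> Ar (fun_cat D E)" and e: "Dom (fun_cat D E) s = Cod (fun_cat D E) t"
  then show "s \<cdot>\<^bsub>fun_cat D E\<^esub> t \<in> hom (fun_cat D E) (Dom (fun_cat D E) t) (Cod (fun_cat D E) s)"
    using t is_ntrans_Cmp[of D E t s] by (simp add: hom_def)
next
  fix r s t assume a: "r \<in> Ar (fun_cat D E)" "s \<in> Ar (fun_cat D E)" "t \<in> Ar (fun_cat D E)"
    and e: "Dom (fun_cat D E) s = Cod (fun_cat D E) r \<and> Dom (fun_cat D E) t = Cod (fun_cat D E) s"
  then have n: "nat_fam D E (NDom r) (NCod r) (NComp r)" "nat_fam D E (NDom s) (NCod s) (NComp s)"
    "nat_fam D E (NDom t) (NCod t) (NComp t)" by (auto simp: is_ntrans_iff)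
  show "t \<cdot>\<^bsub>fun_cat D E\<^esub> s \<cdot>\<^bsub>fun_cat D E\<^esub> r = (t \<cdot>\<^bsub>fun_cat D E\<^esub> s) \<cdot>\<^bsub>fun_cat D E\<^esub> r"
    using a e nat_fam_simps[OF n(1)] nat_fam_simps[OF n(2)] nat_fam_simps[OF n(3)]
    by (intro ntrans_eqI[of D E] is_ntrans_Cmp) (auto simp: category_assoc[OF assms(2)])
next
  fix F assume "F \<in> Ob (fun_cat D E)"
  then show "Ident (fun_cat D E) F \<in> hom (fun_cat D E) F F"
    using is_ntrans_Ident by (auto simp: hom_def)
qed

definition mk_ntrans where
  "mk_ntrans D F G h = \<lparr>NDom = F, NCod = G, NComp = restrict h (Ob D)\<rparr>"

lemma mk_ntrans_simps [simp]:
  "NDom (mk_ntrans D F G h) = F" "NCod (mk_ntrans D F G h) = G"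
  "x \<in> Ob D \<Longrightarrow> NComp (mk_ntrans D F G h) x = h x"
  by (auto simp: mk_ntrans_def)

lemma is_ntrans_mk:
  assumes "is_functor D E F" "is_functor D E G" "nat_fam D E F G h"
  shows "is_ntrans D E (mk_ntrans D F G h)"
proof -
  have "nat_fam D E F G (NComp (mk_ntrans D F G h))"
    using assms(3) by (subst nat_fam_cong[OF functor_cats(1)[OF assms(1)]]) auto
  then show ?thesis using assms(1,2) by (simp add: is_ntrans_iff) (simp add: mk_ntrans_def)
qed

lemma slice_simps [simp]:
  "Ob (slice C c) = {f \<in> Ar C. Cod C f = c}" "Dom (slice C c) = fst" "Cod (slice C c) = (\<lambda>(f, h, g). g)"
  "Ident (slice C c) f = (f, Ident C (Dom C f), f)"
  "(g, k, l) \<cdot>\<^bsub>slice C c\<^esub> (f, h, g') = (f, k \<cdot>\<^bsub>C\<^esub> h, l)"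
  by (auto simp: slice_def)

lemma slice_Ar:
  "(f, h, g) \<in> Ar (slice C c) \<longleftrightarrow> f \<in> Ar C \<and> g \<in> Ar C \<and> Cod C f = c \<and> Cod C g = c \<and>
     h \<in> Ar C \<and> Dom C h = Dom C f \<and> Cod C h = Dom C g \<and> g \<cdot>\<^bsub>C\<^esub> h = f"
  by (auto simp: slice_def hom_def)

lemma category_slice:
  fixes C (structure)
  assumes "category C"
  shows "category (slice C c)"
  unfolding category_def
proof (intro conjI ballI impI)
  note Cs = category_simps[OF assms]
  fix u assume u: "u \<in> Ar (slice C c)"
  obtain f h g where u': "u = (f, h, g)" by (cases u)
  note us = u[unfolded u' slice_Ar]
  show "Dom (slice C c) u \<in> Ob (slice C c)" "Cod (slice C c) u \<in> Ob (slice C c)"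
    "u \<cdot>\<^bsub>slice C c\<^esub> Ident (slice C c) (Dom (slice C c) u) = u"
    "Ident (slice C c) (Cod (slice C c) u) \<cdot>\<^bsub>slice C c\<^esub> u = u"
    using us by (auto simp: u' Cs)
  fix v assume v: "v \<in> Ar (slice C c)" and vu: "Dom (slice C c) v = Cod (slice C c) u"
  then obtain k l where v': "v = (g, k, l)" using u' by (cases v) auto
  note vs = v[unfolded v' slice_Ar]
  show "v \<cdot>\<^bsub>slice C c\<^esub> u \<in> hom (slice C c) (Dom (slice C c) u) (Cod (slice C c) v)"
  proof -
    have "l \<cdot> k \<cdot> h = f"
      using us vs category_assoc[OF assms, of h k l] by simp
    then show ?thesis
      using us vs category_comp[OF assms, of h k] by (simp add: u' v' hom_def slice_Ar)
  qed
next
  fix u v w assume a: "u \<in> Ar (slice C c)" "v \<in> Ar (slice C c)" "w \<in> Ar (slice C c)"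
    and e: "Dom (slice C c) v = Cod (slice C c) u \<and> Dom (slice C c) w = Cod (slice C c) v"
  then show "w \<cdot>\<^bsub>slice C c\<^esub> v \<cdot>\<^bsub>slice C c\<^esub> u = (w \<cdot>\<^bsub>slice C c\<^esub> v) \<cdot>\<^bsub>slice C c\<^esub> u"
    by (cases u, cases v, cases w) (auto simp: slice_Ar category_assoc[OF assms])
next
  fix f assume "f \<in> Ob (slice C c)"
  then show "Ident (slice C c) f \<in> hom (slice C c) f f"
    using category_simps[OF assms] by (auto simp: hom_def slice_Ar)
qed

section \<open>Pullbacks, their mediating maps, and transposition\<close>

definition pairing where
  "pairing C p q b y = (THE h. h \<in> hom C (Dom C b) (Dom C p) \<and> p \<cdot>\<^bsub>C\<^esub> h = b \<and> q \<cdot>\<^bsub>C\<^esub> h = y)"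

lemma pullback_comm_sq: "is_pullback C f g p q \<Longrightarrow> comm_sq C f g p q"
  by (auto simp: is_pullback_def comm_sq_def)

lemma pullback_ex1:
  fixes C (structure)
  assumes "is_pullback C f g p q" "comm_sq C f g b y"
  shows "\<exists>!h. h \<in> hom C (Dom C b) (Dom C p) \<and> p \<cdot> h = b \<and> q \<cdot> h = y"
  using assms unfolding is_pullback_def comm_sq_def by blast

lemma pairing:
  fixes C (structure)
  assumes "is_pullback C f g p q" "comm_sq C f g b y"
  shows "pairing C p q b y \<in> Ar C" "Dom C (pairing C p q b y) = Dom C b"
    "Cod C (pairing C p q b y) = Dom C p" "p \<cdot> pairing C p q b y = b" "q \<cdot> pairing C p q b y = y"
  using theI'[OF pullback_ex1[OF assms]] unfolding pairing_def by (auto simp: hom_def)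

lemma pairing_eqI:
  fixes C (structure)
  assumes "is_pullback C f g p q" "comm_sq C f g b y"
    and "h \<in> Ar C" "Dom C h = Dom C b" "Cod C h = Dom C p" "p \<cdot> h = b" "q \<cdot> h = y"
  shows "pairing C p q b y = h"
  unfolding pairing_def
  by (rule the1_equality[OF pullback_ex1[OF assms(1,2)]]) (use assms in \<open>auto simp: hom_def\<close>)

lemma pullback_mono:
  fixes C (structure)
  assumes "category C" "is_pullback C f g p q" "h \<in> Ar C" "k \<in> Ar C" "Dom C h = Dom C k"
    "Cod C h = Dom C p"
    "Cod C k = Dom C p" "p \<cdot> h = p \<cdot> k" "q \<cdot> h = q \<cdot> k"
  shows "h = k"
proof -
  note pq = assms(2)[unfolded is_pullback_def]
  have "f \<cdot> p \<cdot> k = g \<cdot> q \<cdot> k"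
    using pq assms(1,3-7) by (metis category_assoc)
  then have sq: "comm_sq C f g (p \<cdot> k) (q \<cdot> k)"
    using pq assms(3-7) by (auto simp: comm_sq_def category_comp[OF assms(1)])
  have "pairing C p q (p \<cdot> k) (q \<cdot> k) = h" "pairing C p q (p \<cdot> k) (q \<cdot> k) = k"
    using pq assms by (auto intro!: pairing_eqI[OF assms(2) sq] simp: category_comp[OF assms(1)])
  then show ?thesis by simp
qed

lemma comm_sq_precomp:
  fixes C (structure)
  assumes "category C" "comm_sq C f g b y" "t \<in> Ar C" "Cod C t = Dom C b" "f \<in> Ar C" "g \<in> Ar C"
  shows "comm_sq C f g (b \<cdot> t) (y \<cdot> t)"
proof -
  have "f \<cdot> b \<cdot> t = (f \<cdot> b) \<cdot> t" "g \<cdot> y \<cdot> t = (g \<cdot> y) \<cdot> t"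
    using assms unfolding comm_sq_def by (metis category_assoc)+
  then show ?thesis using assms by (auto simp: comm_sq_def category_comp[OF assms(1)])
qed

lemma pairing_precomp:
  fixes C (structure)
  assumes "category C" "is_pullback C f g p q" "comm_sq C f g b y" "t \<in> Ar C" "Cod C t = Dom C b"
  shows "pairing C p q (b \<cdot> t) (y \<cdot> t) = pairing C p q b y \<cdot> t"
proof (rule pairing_eqI[OF assms(2)])
  note h = pairing[OF assms(2,3)] and Cs = category_simps[OF assms(1)]
  have pq: "p \<in> Ar C" "q \<in> Ar C" "Dom C q = Dom C p" "f \<in> Ar C" "g \<in> Ar C" "b \<in> Ar C"
    using assms(2,3) by (auto simp: is_pullback_def comm_sq_def)
  show "comm_sq C f g (b \<cdot> t) (y \<cdot> t)"
    using comm_sq_precomp[OF assms(1,3,4,5)] pq by blast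
  let ?h = "pairing C p q b y"
  show "?h \<cdot> t \<in> Ar C" "Dom C (?h \<cdot> t) = Dom C (b \<cdot> t)" "Cod C (?h \<cdot> t) = Dom C p"
    using h(1-3) pq assms(4,5) by (simp_all add: Cs)
  have "p \<cdot> ?h \<cdot> t = (p \<cdot> ?h) \<cdot> t" "q \<cdot> ?h \<cdot> t = (q \<cdot> ?h) \<cdot> t"
    using h(1-3) pq assms(4,5) by (simp_all add: category_assoc[OF assms(1)])
  then show "p \<cdot> ?h \<cdot> t = b \<cdot> t" "q \<cdot> ?h \<cdot> t = y \<cdot> t"
    using h(4,5) by simp_all
qed

lemma chosen_pullback:
  assumes "has_pullbacks_along C f" "g \<in> Ar C" "Cod C g = Cod C f"
  shows "is_pullback C f g (pb_base C f g) (pb_top C f g)"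
proof -
  have "\<exists>pq. case_prod (is_pullback C f g) pq" using assms unfolding has_pullbacks_along_def by auto
  from someI_ex[OF this] have "case_prod (is_pullback C f g) (pullback C f g)"
    unfolding pullback_def .
  then show ?thesis by (cases "pullback C f g") simp
qed

text \<open>Adjunctions are given by unit, counit and triangle identities; the bijection of hom sets
  is recovered from them, with \<open>R e\<close> after the unit as the transpose of
  \<open>e\<close>.\<close>

lemma adjunction_transpose:
  fixes D (structure)
  assumes adj: "adjunction C D L R eta eps" and x: "x \<in> Ob C" and y: "y \<in> Ob D"
    and e: "e \<in> hom D (FOb L x) y"
  shows "\<exists>!h. h \<in> hom C x (FOb R y) \<and> NComp eps y \<cdot> FAr L h = e"
proof -
  have L: "is_functor C D L" and R: "is_functor D C R"
    and eta: "nat_fam C C (id_ftor C) (comp_ftor C R L) (NComp eta)"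
    and eps: "nat_fam D D (comp_ftor D L R) (id_ftor D) (NComp eps)"
    and t1: "\<And>x. x \<in> Ob C \<Longrightarrow> NComp eps (FOb L x) \<cdot> FAr L (NComp eta x) = Ident D (FOb L x)"
    and t2: "\<And>y. y \<in> Ob D \<Longrightarrow> FAr R (NComp eps y) \<cdot>\<^bsub>C\<^esub> NComp eta (FOb R y) = Ident C (FOb R y)"
    using adj unfolding adjunction_def ntrans_between_def is_ntrans_iff by auto
  have CD: "category C" "category D" using L by (auto simp: is_functor_def)
  note Cs = category_simps[OF CD(1)] and Ds = category_simps[OF CD(2)]
  note Ls = functor_simps[OF L] and Rs = functor_simps[OF R]
  have etas: "NComp eta x \<in> Ar C" "Dom C (NComp eta x) = x" "Cod C (NComp eta x) = FOb R (FOb L x)"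
    if "x \<in> Ob C" for x
    using nat_fam_simps[OF eta that] that by (auto simp: id_ftor_def comp_ftor_def)
  have epss: "NComp eps y \<in> Ar D" "Dom D (NComp eps y) = FOb L (FOb R y)" "Cod D (NComp eps y) = y"
    if "y \<in> Ob D" for y
    using nat_fam_simps[OF eps that] that by (auto simp: id_ftor_def comp_ftor_def)
  have eta_n: "NComp eta (Cod C h) \<cdot>\<^bsub>C\<^esub> h = FAr R (FAr L h) \<cdot>\<^bsub>C\<^esub> NComp eta (Dom C h)" if "h \<in> Ar C"
    for h
    using nat_fam_comm[OF eta that HOL.refl HOL.refl] that by (simp add: id_ftor_def comp_ftor_def)
  have eps_n: "NComp eps (Cod D h) \<cdot> FAr L (FAr R h) = h \<cdot> NComp eps (Dom D h)" if "h \<in> Ar D" for h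
    using nat_fam_comm[OF eps that HOL.refl HOL.refl] that by (simp add: id_ftor_def comp_ftor_def)
  have es: "e \<in> Ar D" "Dom D e = FOb L x" "Cod D e = y" using e by (auto simp: hom_def)
  let ?h = "FAr R e \<cdot>\<^bsub>C\<^esub> NComp eta x"
  show ?thesis
  proof (rule ex1I[of _ ?h])
    have "NComp eps y \<cdot> FAr L ?h = NComp eps y \<cdot> FAr L (FAr R e) \<cdot> FAr L (NComp eta x)"
      using functor_Cmp[OF L etas(1)[OF x] Rs(2)[OF es(1)]] etas[OF x] Rs es by simp
    also have "\<dots> = (NComp eps y \<cdot> FAr L (FAr R e)) \<cdot> FAr L (NComp eta x)"
      using etas[OF x] Rs es Ls epss[OF y] by (simp add: Ds)
    also have "\<dots> = (e \<cdot> NComp eps (FOb L x)) \<cdot> FAr L (NComp eta x)"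
      using eps_n[OF es(1)] es by simp
    also have "\<dots> = e \<cdot> NComp eps (FOb L x) \<cdot> FAr L (NComp eta x)"
      using etas[OF x] es Ls epss[OF Ls(1)[OF x]] x by (simp add: Ds)
    also have "\<dots> = e" using t1[OF x] es Ls x by (simp add: Ds)
    finally show "?h \<in> hom C x (FOb R y) \<and> NComp eps y \<cdot> FAr L ?h = e"
      using etas[OF x] Rs es by (simp add: hom_def Cs)
  next
    fix h assume "h \<in> hom C x (FOb R y) \<and> NComp eps y \<cdot> FAr L h = e"
    then have h: "h \<in> Ar C" "Dom C h = x" "Cod C h = FOb R y" "NComp eps y \<cdot> FAr L h = e"
      by (auto simp: hom_def)
    have "?h = (FAr R (NComp eps y) \<cdot>\<^bsub>C\<^esub> FAr R (FAr L h)) \<cdot>\<^bsub>C\<^esub> NComp eta x"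
      using functor_Cmp[OF R Ls(2)[OF h(1)] epss(1)[OF y]] h epss[OF y] Ls by simp
    also have "\<dots> = FAr R (NComp eps y) \<cdot>\<^bsub>C\<^esub> FAr R (FAr L h) \<cdot>\<^bsub>C\<^esub> NComp eta x"
      using h epss[OF y] Ls Rs etas[OF x] by (simp add: Cs)
    also have "\<dots> = FAr R (NComp eps y) \<cdot>\<^bsub>C\<^esub> NComp eta (FOb R y) \<cdot>\<^bsub>C\<^esub> h"
      using eta_n[OF h(1)] h by simp
    also have "\<dots> = (FAr R (NComp eps y) \<cdot>\<^bsub>C\<^esub> NComp eta (FOb R y)) \<cdot>\<^bsub>C\<^esub> h"
      using h epss[OF y] Ls Rs etas[OF Rs(1)[OF y]] y by (simp add: Cs)
    also have "\<dots> = h" using t2[OF y] h by (simp add: Cs)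
    finally show "h = ?h" by simp
  qed
qed

lemma pullback_iso:
  fixes C (structure)
  assumes C: "category C" and pb: "is_pullback C f g p q"
    and i: "i \<in> Ar C" "j \<in> Ar C" "Cod C i = Dom C p" "Dom C j = Dom C p" "Cod C j = Dom C i"
      "i \<cdot> j = Ident C (Dom C p)" "j \<cdot> i = Ident C (Dom C i)"
  shows "is_pullback C f g (p \<cdot> i) (q \<cdot> i)"
proof -
  note Cs = category_simps[OF C]
  have pq: "f \<in> Ar C" "g \<in> Ar C" "p \<in> Ar C" "q \<in> Ar C" "Cod C f = Cod C g" "Dom C p = Dom C q"
    "Cod C p = Dom C f" "Cod C q = Dom C g" "f \<cdot> p = g \<cdot> q"
    using pb by (auto simp: is_pullback_def)
  have sq: "comm_sq C f g (p \<cdot> i) (q \<cdot> i)"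
    using comm_sq_precomp[OF C pullback_comm_sq[OF pb] i(1,3)] pq by blast
  have "\<exists>!h. h \<in> hom C (Dom C b) (Dom C (p \<cdot> i)) \<and> (p \<cdot> i) \<cdot> h = b \<and> (q \<cdot> i) \<cdot> h = y"
    if s: "comm_sq C f g b y" for b y
  proof (rule ex1I)
    note k = pairing[OF pb s]
    let ?k = "pairing C p q b y"
    have "i \<cdot> j \<cdot> ?k = ?k" using i k by (simp add: category_comp_ident[OF C] flip: category_assoc[OF C])
    then show "j \<cdot> ?k \<in> hom C (Dom C b) (Dom C (p \<cdot> i)) \<and> (p \<cdot> i) \<cdot> j \<cdot> ?k = b \<and> (q \<cdot> i) \<cdot> j \<cdot> ?k = y"
      using i k pq by (simp add: hom_def Cs)
  next
    note k = pairing[OF pb s]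
    let ?k = "pairing C p q b y"
    fix h assume h: "h \<in> hom C (Dom C b) (Dom C (p \<cdot> i)) \<and> (p \<cdot> i) \<cdot> h = b \<and> (q \<cdot> i) \<cdot> h = y"
    then have hs: "h \<in> Ar C" "Dom C h = Dom C b" "Cod C h = Dom C i" using i pq
      by (auto simp: hom_def Cs)
    have "?k = i \<cdot> h"
      by (rule pairing_eqI[OF pb s]) (use h hs i pq in \<open>simp_all add: Cs\<close>)
    moreover have "j \<cdot> i \<cdot> h = h" using i hs
      by (simp add: category_comp_ident[OF C] flip: category_assoc[OF C])
    ultimately show "h = j \<cdot> ?k" by simp
  qed
  then show ?thesis
    using sq pq i unfolding is_pullback_def comm_sq_def by (simp add: Cs)
qed

text \<open>The mediating maps at the single objects form a natural family, because naturality may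
  be tested after the two projections, which are jointly monic.\<close>

lemma pullback_pointwiseI:
  fixes E (structure)
  assumes E: "category E" and D: "category D" and f: "is_ntrans D E f" and z: "is_ntrans D E z"
    and p: "is_ntrans D E p" "is_ntrans D E q" "NDom p = NDom q" "NCod p = NDom f" "NCod q = NDom z"
      "NCod f = NCod z"
    and pb: "\<And>x. x \<in> Ob D \<Longrightarrow> is_pullback E (NComp f x) (NComp z x) (NComp p x) (NComp q x)"
  shows "is_pullback (fun_cat D E) f z p q"
proof -
  let ?F = "fun_cat D E"
  note Es = category_simps[OF E]
  note n = f[unfolded is_ntrans_iff] z[unfolded is_ntrans_iff] p(1,2)[unfolded is_ntrans_iff]
  have "f \<cdot>\<^bsub>?F\<^esub> p = z \<cdot>\<^bsub>?F\<^esub> q"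
    using f z p pb by (intro ntrans_eqI[of D E] is_ntrans_Cmp) (auto simp: is_pullback_def)
  moreover have "\<exists>!h. h \<in> hom ?F (NDom b) (NDom p) \<and> p \<cdot>\<^bsub>?F\<^esub> h = b \<and> q \<cdot>\<^bsub>?F\<^esub> h = y"
    if b: "is_ntrans D E b" "is_ntrans D E y" "NDom b = NDom y" "NCod b = NDom f" "NCod y = NDom z"
      "f \<cdot>\<^bsub>?F\<^esub> b = z \<cdot>\<^bsub>?F\<^esub> y" for b y
  proof -
    note bn = b(1,2)[unfolded is_ntrans_iff]
    have bx: "nat_fam D E (NDom b) (NDom f) (NComp b)" "nat_fam D E (NDom b) (NDom z) (NComp y)"
      "nat_fam D E (NDom p) (NDom f) (NComp p)" "nat_fam D E (NDom p) (NDom z) (NComp q)"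
      using bn n b p by auto
    have Fb: "is_functor D E (NDom b)" "is_functor D E (NDom p)" "is_functor D E (NDom f)"
      "is_functor D E (NDom z)"
      using bn n by auto
    note bs = nat_fam_simps[OF bx(1)] nat_fam_simps[OF bx(2)]
      and ps = nat_fam_simps[OF bx(3)] nat_fam_simps[OF bx(4)]
    have fs: "NComp f x \<in> Ar E \<and> Dom E (NComp f x) = FOb (NDom f) x"
      "NComp z x \<in> Ar E \<and> Dom E (NComp z x) = FOb (NDom z) x"
      if "x \<in> Ob D" for x
      using n nat_fam_simps that by metis+
    have sq: "comm_sq E (NComp f x) (NComp z x) (NComp b x) (NComp y x)" if "x \<in> Ob D" for x
    proof -
      have "NComp (f \<cdot>\<^bsub>?F\<^esub> b) x = NComp (z \<cdot>\<^bsub>?F\<^esub> y) x" using b(6) by simp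
      then show ?thesis using that bs[OF that] fs[OF that] by (simp add: comm_sq_def)
    qed
    let ?h = "\<lambda>x. pairing E (NComp p x) (NComp q x) (NComp b x) (NComp y x)"
    note hs = pairing[OF pb sq]
    have nat: "nat_fam D E (NDom b) (NDom p) ?h"
      unfolding nat_fam_def
    proof (intro conjI ballI)
      fix x assume x: "x \<in> Ob D"
      show "?h x \<in> hom E (FOb (NDom b) x) (FOb (NDom p) x)"
        using hs[OF x x] bs[OF x] ps[OF x] by (simp add: hom_def)
    next
      fix a assume a: "a \<in> Ar D"
      let ?x = "Dom D a" and ?y = "Cod D a"
      have x: "?x \<in> Ob D" "?y \<in> Ob D" using category_ends[OF D a] by auto
      note Fa = functor_simps(2-4)[OF Fb(1) a] functor_simps(2-4)[OF Fb(2) a] functor_simps(2-4)[OF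
        Fb(3) a] functor_simps(2-4)[OF Fb(4) a]
      note s = bs[OF x(1)] bs[OF x(2)] ps[OF x(1)] ps[OF x(2)] hs[OF x(1) x(1)] hs[OF x(2) x(2)]
      \<comment> \<open>One computation for both projections: \<open>r\<close> stands for the
        projection and \<open>c\<close> for the corresponding leg of the given square.\<close>
      have nb: "NComp r ?y \<cdot> ?h ?y \<cdot> FAr (NDom b) a = NComp r ?y \<cdot> FAr (NDom p) a \<cdot> ?h ?x"
        if r: "nat_fam D E (NDom p) T (NComp r)" "nat_fam D E (NDom b) T (NComp c)" "is_functor D E T"
          "NComp r ?x \<cdot> ?h ?x = NComp c ?x" "NComp r ?y \<cdot> ?h ?y = NComp c ?y" for r c T
      proof -
        note rs = nat_fam_simps[OF r(1) x(1)] nat_fam_simps[OF r(1) x(2)]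
        note Ta = functor_simps(2-4)[OF r(3) a]
        have "NComp r ?y \<cdot> ?h ?y \<cdot> FAr (NDom b) a = (NComp r ?y \<cdot> ?h ?y) \<cdot> FAr (NDom b) a"
          using rs s(1-15) s(19-21) s(13-15) hs(1-3)[OF x(2) x(2)] Fa
            by (intro category_assoc[OF E, symmetric]) simp_all
        also have "\<dots> = FAr T a \<cdot> NComp c ?x"
          unfolding r(5) by (rule nat_fam_comm[OF r(2) a HOL.refl HOL.refl])
        also have "\<dots> = (FAr T a \<cdot> NComp r ?x) \<cdot> ?h ?x"
          unfolding r(4)[symmetric] using rs hs(1-3)[OF x(1) x(1)] Ta ps[OF x(1)]
            by (intro category_assoc[OF E, symmetric]) simp_all
        also have "\<dots> = (NComp r ?y \<cdot> FAr (NDom p) a) \<cdot> ?h ?x"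
          using nat_fam_comm[OF r(1) a HOL.refl HOL.refl] by simp
        also have "\<dots> = NComp r ?y \<cdot> FAr (NDom p) a \<cdot> ?h ?x"
          using rs hs(1-3)[OF x(1) x(1)] Fa ps[OF x(1)] by (intro category_assoc[OF E]) simp_all
        finally show ?thesis .
      qed
      show "?h ?y \<cdot> FAr (NDom b) a = FAr (NDom p) a \<cdot> ?h ?x"
      proof (rule pullback_mono[OF E pb[OF x(2)]])
        show "NComp p ?y \<cdot> ?h ?y \<cdot> FAr (NDom b) a = NComp p ?y \<cdot> FAr (NDom p) a \<cdot> ?h ?x"
          by (rule nb[OF bx(3,1) Fb(3)]) (rule hs(4); rule x)+
        show "NComp q ?y \<cdot> ?h ?y \<cdot> FAr (NDom b) a = NComp q ?y \<cdot> FAr (NDom p) a \<cdot> ?h ?x"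
          by (rule nb[OF bx(4,2) Fb(4)]) (rule hs(5); rule x)+
      qed (use s Fa in \<open>simp_all add: Es\<close>)
    qed
    let ?H = "mk_ntrans D (NDom b) (NDom p) ?h"
    have H: "is_ntrans D E ?H" by (rule is_ntrans_mk[OF Fb(1,2) nat])
    show ?thesis
    proof (rule ex1I[of _ ?H])
      show "?H \<in> hom ?F (NDom b) (NDom p) \<and> p \<cdot>\<^bsub>?F\<^esub> ?H = b \<and> q \<cdot>\<^bsub>?F\<^esub> ?H = y"
        using H b p hs(4,5) by (auto simp: hom_def intro!: ntrans_eqI[of D E] is_ntrans_Cmp)
    next
      fix k assume k: "k \<in> hom ?F (NDom b) (NDom p) \<and> p \<cdot>\<^bsub>?F\<^esub> k = b \<and> q \<cdot>\<^bsub>?F\<^esub> k = y"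
      then have k': "is_ntrans D E k" "NDom k = NDom b" "NCod k = NDom p" by (auto simp: hom_def)
      have kn: "nat_fam D E (NDom b) (NDom p) (NComp k)" using k' by (simp add: is_ntrans_iff)
      have kc: "NComp (p \<cdot>\<^bsub>?F\<^esub> k) x = NComp b x" "NComp (q \<cdot>\<^bsub>?F\<^esub> k) x = NComp y x" for x using k
        by simp_all
      show "k = ?H"
      proof (rule ntrans_eqI[OF k'(1) H])
        fix x assume x: "x \<in> Ob D"
        show "NComp k x = NComp ?H x"
          using pairing_eqI[OF pb[OF x] sq[OF x], of "NComp k x"] nat_fam_simps[OF kn x] bs[OF x] ps[OF
            x] kc[of x] x by simp
      qed (use k' in simp_all)
    qed
  qed
  ultimately show ?thesis using f z p unfolding is_pullback_def by simp
qed

text \<open>A pullback in a functor category need not be computed pointwise in general. Here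
  pullbacks along the components of \<open>f\<close> exist, so chosen ones assemble into a functor
  \<open>R\<close>, which gives a pullback by \<open>pullback_pointwiseI\<close>. The given pullback
  is isomorphic to this one and hence pointwise too.\<close>

lemma pullback_pointwise:
  fixes E (structure)
  assumes E: "category E" and D: "category D" and f: "is_ntrans D E f"
    and z: "is_ntrans D E z" "NCod z = NCod f"
    and has: "\<And>x. x \<in> Ob D \<Longrightarrow> has_pullbacks_along E (NComp f x)"
    and pb: "is_pullback (fun_cat D E) f z p q" and x: "x \<in> Ob D"
  shows "is_pullback E (NComp f x) (NComp z x) (NComp p x) (NComp q x)"
proof -
  let ?F = "fun_cat D E"
  note Es = category_simps[OF E]
  let ?A = "NCod f" and ?B = "NDom f" and ?Z = "NDom z"
  have n: "is_functor D E ?A" "is_functor D E ?B" "is_functor D E ?Z" "nat_fam D E ?B ?A (NComp f)"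
    "nat_fam D E ?Z ?A (NComp z)"
    using f z by (auto simp: is_ntrans_iff)
  note fs = nat_fam_simps[OF n(4)] and zs = nat_fam_simps[OF n(5)]
  define b where "b x = pb_base E (NComp f x) (NComp z x)" for x
  define t where "t x = pb_top E (NComp f x) (NComp z x)" for x
  have pbx: "is_pullback E (NComp f x) (NComp z x) (b x) (t x)" if "x \<in> Ob D" for x
    unfolding b_def t_def by (rule chosen_pullback[OF has[OF that]]) (use fs[OF that] zs[OF that] in
      simp_all)
  have bt: "b x \<in> Ar E" "t x \<in> Ar E" "Dom E (t x) = Dom E (b x)" "Cod E (b x) = FOb ?B x"
    "Cod E (t x) = FOb ?Z x"
    if "x \<in> Ob D" for x
    using pbx[OF that] fs[OF that] zs[OF that] by (auto simp: is_pullback_def)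
  have sq: "comm_sq E (NComp f (Cod D a)) (NComp z (Cod D a)) (FAr ?B a \<cdot> b (Dom D a)) (FAr ?Z a \<cdot> t
    (Dom D a))"
    if "a \<in> Ar D" for a
    using comm_sq_map[OF n(1-5) pullback_comm_sq[OF pbx] that] category_ends[OF D that] by simp
  define r where "r a = pairing E (b (Cod D a)) (t (Cod D a)) (FAr ?B a \<cdot> b (Dom D a)) (FAr ?Z a \<cdot> t
    (Dom D a))" for a
  have rs: "r a \<in> Ar E" "Dom E (r a) = Dom E (b (Dom D a))" "Cod E (r a) = Dom E (b (Cod D a))"
    "b (Cod D a) \<cdot> r a = FAr ?B a \<cdot> b (Dom D a)" "t (Cod D a) \<cdot> r a = FAr ?Z a \<cdot> t (Dom D a)"
    if a: "a \<in> Ar D" for a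
    using pairing[OF pbx[OF category_ends(2)[OF D a]] sq[OF a], folded r_def]
      functor_simps[OF n(2)] a bt[OF category_ends(1)[OF D a]] by (simp_all add: Es)
  define R where "R = \<lparr>FOb = (\<lambda>x\<in>Ob D. Dom E (b x)), FAr = (\<lambda>a\<in>Ar D. r a)\<rparr>"
  have R: "is_functor D E R"
    unfolding is_functor_def
  proof (intro conjI ballI impI)
    show "FOb R \<in> Ob D \<rightarrow>\<^sub>E Ob E" "FAr R \<in> Ar D \<rightarrow>\<^sub>E Ar E"
      using category_ends(1)[OF E bt(1)] rs(1) by (auto simp: R_def)
  next
    fix x assume x: "x \<in> Ob D"
    note i = category_ident[OF D x]
    show "FAr R (Ident D x) = Ident E (FOb R x)"
    proof -
      note ri = rs[OF i(1), unfolded i functor_simps(5)[OF n(2) x] functor_simps(5)[OF n(3) x]]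
      have bx: "Dom E (b x) \<in> Ob E" using category_ends(1)[OF E bt(1)[OF x]] .
      note ix = category_ident[OF E bx]
      have "r (Ident D x) = Ident E (Dom E (b x))"
        by (rule pullback_mono[OF E pbx[OF x]]) (simp_all add: ri ix bt[OF x] category_comp_ident[OF E])
      then show ?thesis using x i by (simp add: R_def)
    qed
  next
    fix a c assume a: "a \<in> Ar D" and c: "c \<in> Ar D" "Dom D c = Cod D a"
    note ca = category_comp[OF D a c]
    note e = category_ends[OF D a] category_ends[OF D c(1)]
    \<comment> \<open>Again one computation for both projections, with \<open>T\<close> in place of
      \<open>b\<close> or \<open>t\<close>.\<close>
    have aux: "T (Cod D c) \<cdot> r (c \<cdot>\<^bsub>D\<^esub> a) = T (Cod D c) \<cdot> r c \<cdot> r a"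
      if T: "is_functor D E Y" "\<And>a. a \<in> Ar D \<Longrightarrow> T (Cod D a) \<cdot> r a = FAr Y a \<cdot> T (Dom D a)"
        "\<And>x. x \<in> Ob D \<Longrightarrow> T x \<in> Ar E \<and> Dom E (T x) = Dom E (b x) \<and> Cod E (T x) = FOb Y x" for T Y
    proof -
      note Y = functor_simps(2-4)[OF T(1) a] functor_simps(2-4)[OF T(1) c(1)]
      note Ts = T(3)[OF e(1)] T(3)[OF e(2)] T(3)[OF e(4)]
      have "T (Cod D c) \<cdot> r (c \<cdot>\<^bsub>D\<^esub> a) = (FAr Y c \<cdot> FAr Y a) \<cdot> T (Dom D a)"
        using T(2)[OF ca(1)] ca functor_Cmp[OF T(1) a c] by simp
      also have "\<dots> = FAr Y c \<cdot> T (Cod D a) \<cdot> r a"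
        using T(2)[OF a] Y Ts c by (simp add: Es)
      also have "\<dots> = (FAr Y c \<cdot> T (Dom D c)) \<cdot> r a"
        using Y Ts c rs(1-3)[OF a] by (simp add: Es)
      also have "\<dots> = T (Cod D c) \<cdot> r c \<cdot> r a"
        unfolding T(2)[OF c(1), symmetric] using Ts c rs(1-3)[OF a] rs(1-3)[OF c(1)] by (simp add: Es)
      finally show ?thesis .
    qed
    have "r (c \<cdot>\<^bsub>D\<^esub> a) = r c \<cdot> r a"
    proof (rule pullback_mono[OF E pbx[OF e(4)]])
      show "b (Cod D c) \<cdot> r (c \<cdot>\<^bsub>D\<^esub> a) = b (Cod D c) \<cdot> r c \<cdot> r a"
        by (rule aux[OF n(2)]) (use rs bt in auto)
      show "t (Cod D c) \<cdot> r (c \<cdot>\<^bsub>D\<^esub> a) = t (Cod D c) \<cdot> r c \<cdot> r a"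
        by (rule aux[OF n(3)]) (use rs bt in auto)
    qed (use rs(1-3)[OF ca(1)] rs(1-3)[OF a] rs(1-3)[OF c(1)] ca c in \<open>simp_all add: Es\<close>)
    then show "FAr R (c \<cdot>\<^bsub>D\<^esub> a) = FAr R c \<cdot> FAr R a" using a c ca by (simp add: R_def)
  qed (use D E rs category_ends[OF D] in \<open>auto simp: R_def\<close>)
  let ?b = "mk_ntrans D R ?B b" and ?t = "mk_ntrans D R ?Z t"
  have bn: "is_ntrans D E ?b" "is_ntrans D E ?t"
    by (intro is_ntrans_mk R n; use bt rs category_ends[OF D] in \<open>auto simp: nat_fam_def hom_def
      R_def\<close>)+
  have pb': "is_pullback ?F f z ?b ?t"
    by (rule pullback_pointwiseI[OF E D f z(1) bn]) (use z pbx in simp_all)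
  have F: "category ?F" by (rule category_fun_cat[OF D E])
  have sq1: "comm_sq ?F f z p q" "comm_sq ?F f z ?b ?t" by (rule pullback_comm_sq, fact)+
  \<comment> \<open>The two mediating maps between the given pullback and the pointwise one; they
    are inverse to each other.\<close>
  let ?k = "pairing ?F ?b ?t p q" and ?h = "pairing ?F p q ?b ?t"
  note k = pairing[OF pb' sq1(1)] and h = pairing[OF pb sq1(2)]
  have pq: "is_ntrans D E p" "is_ntrans D E q" "NDom q = NDom p" using sq1 by (auto simp: comm_sq_def)
  have kn: "is_ntrans D E ?k" "NDom ?k = NDom p" "NCod ?k = R"
    and hn: "is_ntrans D E ?h" "NDom ?h = R" "NCod ?h = NDom p"
    using k(1-3) h(1-3) by auto
  have hk: "?h \<cdot>\<^bsub>?F\<^esub> ?k = Ident ?F (NDom p)"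
  proof (rule pullback_mono[OF F pb])
    have "p \<cdot>\<^bsub>?F\<^esub> ?h \<cdot>\<^bsub>?F\<^esub> ?k = (p \<cdot>\<^bsub>?F\<^esub> ?h) \<cdot>\<^bsub>?F\<^esub> ?k" "q \<cdot>\<^bsub>?F\<^esub> ?h \<cdot>\<^bsub>?F\<^esub> ?k = (q \<cdot>\<^bsub>?F\<^esub> ?h) \<cdot>\<^bsub>?F\<^esub> ?k"
      by (rule category_assoc[OF F, symmetric]; use pq kn hn in simp)+
    then show "p \<cdot>\<^bsub>?F\<^esub> ?h \<cdot>\<^bsub>?F\<^esub> ?k = p \<cdot>\<^bsub>?F\<^esub> Ident ?F (NDom p)"
      "q \<cdot>\<^bsub>?F\<^esub> ?h \<cdot>\<^bsub>?F\<^esub> ?k = q \<cdot>\<^bsub>?F\<^esub> Ident ?F (NDom p)"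
      unfolding h(4,5) k(4,5) using pq category_comp_ident(1)[OF F] by simp_all
  qed (use pq kn hn in \<open>auto intro!: is_ntrans_Cmp is_ntrans_Ident simp: is_ntrans_iff[of D E p]\<close>)
  have kh: "?k \<cdot>\<^bsub>?F\<^esub> ?h = Ident ?F R"
  proof (rule pullback_mono[OF F pb'])
    have "?b \<cdot>\<^bsub>?F\<^esub> ?k \<cdot>\<^bsub>?F\<^esub> ?h = (?b \<cdot>\<^bsub>?F\<^esub> ?k) \<cdot>\<^bsub>?F\<^esub> ?h" "?t \<cdot>\<^bsub>?F\<^esub> ?k \<cdot>\<^bsub>?F\<^esub> ?h = (?t \<cdot>\<^bsub>?F\<^esub> ?k) \<cdot>\<^bsub>?F\<^esub> ?h"
      by (rule category_assoc[OF F, symmetric]; use bn kn hn in simp)+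
    then show "?b \<cdot>\<^bsub>?F\<^esub> ?k \<cdot>\<^bsub>?F\<^esub> ?h = ?b \<cdot>\<^bsub>?F\<^esub> Ident ?F R" "?t \<cdot>\<^bsub>?F\<^esub> ?k \<cdot>\<^bsub>?F\<^esub> ?h = ?t \<cdot>\<^bsub>?F\<^esub> Ident ?F R"
      unfolding h(4,5) k(4,5) using bn category_comp_ident(1)[OF F] by simp_all
  qed (use bn kn hn R in \<open>auto intro!: is_ntrans_Cmp is_ntrans_Ident\<close>)
  have kx: "nat_fam D E (NDom p) R (NComp ?k)" "nat_fam D E R (NDom p) (NComp ?h)"
    using kn hn by (auto simp: is_ntrans_iff)
  note ks = nat_fam_simps[OF kx(1) x] nat_fam_simps[OF kx(2) x]
  have Rx: "FOb R x = Dom E (b x)" using x by (simp add: R_def)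
  have "is_pullback E (NComp f x) (NComp z x) (b x \<cdot> NComp ?k x) (t x \<cdot> NComp ?k x)"
    using arg_cong[OF hk, of "\<lambda>t. NComp t x"] arg_cong[OF kh, of "\<lambda>t. NComp t x"] x ks Rx
    by (intro pullback_iso[OF E pbx[OF x], of _ "NComp ?h x"]) auto
  moreover have "b x \<cdot> NComp ?k x = NComp p x" "t x \<cdot> NComp ?k x = NComp q x"
    using arg_cong[OF k(4), of "\<lambda>t. NComp t x"] arg_cong[OF k(5), of "\<lambda>t. NComp t x"] x by simp_all
  ultimately show ?thesis by simp
qed

section \<open>The comparison map of dependent products\<close>

text \<open>The underlying arrow of the pullback functor applied to \<open>h\<close>, with the
  definite description in \<open>pb_ftor\<close> rewritten as a mediating map.\<close>

definition pb_ar where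
  "pb_ar C f z h z' = pairing C (pb_base C f z') (pb_top C f z') (pb_base C f z) (h \<cdot>\<^bsub>C\<^esub> pb_top C f z)"

lemma pb_ftor_FOb: "z \<in> Ar C \<Longrightarrow> Cod C z = Cod C f \<Longrightarrow> FOb (pb_ftor C f) z = pb_base C f z"
  by (simp add: pb_ftor_def)

lemma pb_ftor_FAr:
  assumes "(z, h, z') \<in> Ar (slice C (Cod C f))"
  shows "FAr (pb_ftor C f) (z, h, z') = (pb_base C f z, pb_ar C f z h z', pb_base C f z')"
  using assms by (simp add: pb_ftor_def pb_ar_def pairing_def)

lemma pb_ar:
  fixes C (structure)
  assumes C: "category C" and has: "has_pullbacks_along C f"
    and h: "(z, h, z') \<in> Ar (slice C (Cod C f))"
  shows "pb_ar C f z h z' \<in> Ar C" "Dom C (pb_ar C f z h z') = Dom C (pb_base C f z)"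
    "Cod C (pb_ar C f z h z') = Dom C (pb_base C f z')"
    "pb_base C f z' \<cdot> pb_ar C f z h z' = pb_base C f z"
    "pb_top C f z' \<cdot> pb_ar C f z h z' = h \<cdot> pb_top C f z"
proof -
  note hs = h[unfolded slice_Ar]
  have pb: "is_pullback C f z (pb_base C f z) (pb_top C f z)"
    "is_pullback C f z' (pb_base C f z') (pb_top C f z')"
    using hs chosen_pullback[OF has] by auto
  have p: "pb_base C f z \<in> Ar C" "pb_top C f z \<in> Ar C" "Dom C (pb_top C f z) = Dom C (pb_base C f z)"
    "Cod C (pb_base C f z) = Dom C f" "Cod C (pb_top C f z) = Dom C z"
      "f \<cdot> pb_base C f z = z \<cdot> pb_top C f z"
    using pb(1) by (auto simp: is_pullback_def)
  have "z' \<cdot> h \<cdot> pb_top C f z = z \<cdot> pb_top C f z"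
    using category_assoc[OF C, of "pb_top C f z" h z'] hs p by simp
  then have "comm_sq C f z' (pb_base C f z) (h \<cdot> pb_top C f z)"
    using hs p by (simp add: comm_sq_def category_comp[OF C])
  from pairing[OF pb(2) this] show "pb_ar C f z h z' \<in> Ar C"
    "Dom C (pb_ar C f z h z') = Dom C (pb_base C f z)"
    "Cod C (pb_ar C f z h z') = Dom C (pb_base C f z')"
    "pb_base C f z' \<cdot> pb_ar C f z h z' = pb_base C f z"
    "pb_top C f z' \<cdot> pb_ar C f z h z' = h \<cdot> pb_top C f z"
    unfolding pb_ar_def by auto
qed

lemma slice_ftor_simps:
  "g \<in> Ar C \<Longrightarrow> Cod C g = c \<Longrightarrow> FOb (slice_ftor C F c) g = FAr F g"
  "(f, h, g) \<in> Ar (slice C c) \<Longrightarrow> FAr (slice_ftor C F c) (f, h, g) = (FAr F f, FAr F h, FAr F g)"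
  by (auto simp: slice_ftor_def)

lemma slice_ftor_functor:
  assumes F: "is_functor C D F"
  shows "is_functor (slice C c) (slice D (FOb F c)) (slice_ftor C F c)"
proof -
  note CD = functor_cats[OF F] and Fs = functor_simps[OF F]
  have ar: "(FAr F f, FAr F h, FAr F g) \<in> Ar (slice D (FOb F c))" if "(f, h, g) \<in> Ar (slice C c)"
    for f h g
  proof -
    have "FAr F g \<cdot>\<^bsub>D\<^esub> FAr F h = FAr F f"
      using that[unfolded slice_Ar] functor_Cmp[OF F, of h g] by simp
    then show ?thesis using that[unfolded slice_Ar] Fs by (simp add: slice_Ar)
  qed
  show ?thesis
    unfolding is_functor_def
  proof (intro conjI ballI impI)
    show "category (slice C c)" "category (slice D (FOb F c))" by (rule category_slice CD)+
    show "FOb (slice_ftor C F c) \<in> Ob (slice C c) \<rightarrow>\<^sub>E Ob (slice D (FOb F c))"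
      using Fs by (auto simp: slice_ftor_def)
    show "FAr (slice_ftor C F c) \<in> Ar (slice C c) \<rightarrow>\<^sub>E Ar (slice D (FOb F c))"
      using ar by (auto simp: slice_ftor_def)
  next
    fix u assume u: "u \<in> Ar (slice C c)"
    obtain f h g where u': "u = (f, h, g)" by (cases u)
    note us = u[unfolded u' slice_Ar]
    show "Dom (slice D (FOb F c)) (FAr (slice_ftor C F c) u) = FOb (slice_ftor C F c) (Dom (slice C c)
      u)"
      "Cod (slice D (FOb F c)) (FAr (slice_ftor C F c) u) = FOb (slice_ftor C F c) (Cod (slice C c) u)"
      using us by (simp_all add: u' slice_ftor_simps(2)[OF u[unfolded u']] slice_ftor_simps(1))
    fix v assume v: "v \<in> Ar (slice C c)" and vu: "Dom (slice C c) v = Cod (slice C c) u"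
    then obtain k l where v': "v = (g, k, l)" using u' by (cases v) auto
    have "v \<cdot>\<^bsub>slice C c\<^esub> u \<in> Ar (slice C c)"
      using category_comp(1)[OF category_slice[OF CD(1)] u v vu] .
    then show "FAr (slice_ftor C F c) (v \<cdot>\<^bsub>slice C c\<^esub> u)
        = FAr (slice_ftor C F c) v \<cdot>\<^bsub>slice D (FOb F c)\<^esub> FAr (slice_ftor C F c) u"
      using functor_Cmp[OF F, of h k] us v[unfolded v' slice_Ar]
      by (simp add: u' v' slice_ftor_simps(2) slice_ftor_simps(2)[OF u[unfolded u']]
        slice_ftor_simps(2)[OF v[unfolded v']])
  next
    fix f assume f: "f \<in> Ob (slice C c)"
    then have "Ident (slice C c) f \<in> Ar (slice C c)"
      using category_ident(1)[OF category_slice[OF CD(1)]] by blast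
    then show "FAr (slice_ftor C F c) (Ident (slice C c) f) = Ident (slice D (FOb F c)) (FOb (slice_ftor
      C F c) f)"
      using f Fs category_ends[OF CD(1)] by (simp add: slice_ftor_simps)
  qed
qed

lemma iso_slice:
  assumes C: "category C" and u: "(f, h, g) \<in> Ar (slice C c)" and i: "iso_ar C h"
  shows "iso_ar (slice C c) (f, h, g)"
proof -
  note us = u[unfolded slice_Ar] and r = inv_ar[OF C i]
  have "f \<cdot>\<^bsub>C\<^esub> inv_ar C h = g"
    using us r category_assoc[OF C, of "inv_ar C h" h g] by (simp add: category_comp_ident[OF C])
  then have "(g, inv_ar C h, f) \<in> Ar (slice C c)" using us r by (simp add: slice_Ar)
  then show ?thesis using us r u by (intro iso_arI[of _ _ "(g, inv_ar C h, f)"]) simp_all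
qed

section \<open>Mates along a functor that preserves the pullbacks in question\<close>

locale pullback_preserving =
  fixes C :: "('o, 'a) cat" and D :: "('p, 'b) cat" (structure) and F f P eta ev P' eta' ev'
  assumes F: "is_functor C D F"
    and dp: "dependent_product C f P eta ev" and dp': "dependent_product D (FAr F f) P' eta' ev'"
    and pres: "z \<in> Ar C \<Longrightarrow> Cod C z = Cod C f \<Longrightarrow>
      is_pullback D (FAr F f) (FAr F z) (FAr F (pb_base C f z)) (FAr F (pb_top C f z))"
begin

abbreviation "A \<equiv> Cod C f"
abbreviation "B \<equiv> Dom C f"
abbreviation "SA \<equiv> slice C A"
abbreviation "SB \<equiv> slice C B"
abbreviation "SA' \<equiv> slice D (FOb F A)"
abbreviation "SB' \<equiv> slice D (FOb F B)"
abbreviation "FA \<equiv> slice_ftor C F A"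
abbreviation "FB \<equiv> slice_ftor C F B"
abbreviation "L \<equiv> pb_ftor C f"
abbreviation "L' \<equiv> pb_ftor D (FAr F f)"
abbreviation "pbb \<equiv> pb_base C f"
abbreviation "pbt \<equiv> pb_top C f"
abbreviation "pbb' z \<equiv> pb_base D (FAr F f) (FAr F z)"
abbreviation "pbt' z \<equiv> pb_top D (FAr F f) (FAr F z)"
abbreviation "cmp z \<equiv> pairing D (pbb' z) (pbt' z) (FAr F (pbb z)) (FAr F (pbt z))"
abbreviation "compare z \<equiv> pb_compare C D F f z"

lemmas C = functor_cats(1)[OF F] and D = functor_cats(2)[OF F]
lemmas Fs = functor_simps[OF F]

lemma has: "has_pullbacks_along C f" "has_pullbacks_along D (FAr F f)"
  using dp dp' by (auto simp: dependent_product_def)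

lemma f: "f \<in> Ar C" using has by (simp add: has_pullbacks_along_def)

lemma f': "Dom D (FAr F f) = FOb F B" "Cod D (FAr F f) = FOb F A"
  using Fs f by auto

lemma adj: "adjunction SA SB L P eta ev" "adjunction SA' SB' L' P' eta' ev'"
  using dp dp' by (auto simp: dependent_product_def f')

lemma cats: "category SA" "category SB" "category SA'" "category SB'"
  by (rule category_slice C D)+

lemma functors: "is_functor SA SB L" "is_functor SA' SB' L'" "is_functor SB SA P"
  "is_functor SB' SA' P'"
  using adj by (auto simp: adjunction_def)

lemmas FAf = slice_ftor_functor[OF F, of A] and FBf = slice_ftor_functor[OF F, of B]

lemma pbs:
  assumes "z \<in> Ob SA"
  shows "is_pullback C f z (pbb z) (pbt z)" "is_pullback D (FAr F f) (FAr F z) (pbb' z) (pbt' z)"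
    "is_pullback D (FAr F f) (FAr F z) (FAr F (pbb z)) (FAr F (pbt z))"
  using assms chosen_pullback[OF has(1)] chosen_pullback[OF has(2)] pres Fs f by auto

lemma pb_simps:
  assumes "z \<in> Ob SA"
  shows "pbb z \<in> Ar C" "Cod C (pbb z) = B" "pbt z \<in> Ar C" "Dom C (pbt z) = Dom C (pbb z)"
    "Cod C (pbt z) = Dom C z"
    "pbb' z \<in> Ar D" "Cod D (pbb' z) = FOb F B" "pbt' z \<in> Ar D" "Dom D (pbt' z) = Dom D (pbb' z)"
      "Cod D (pbt' z) = FOb F (Dom C z)"
  using pbs[OF assms] assms f' Fs by (auto simp: is_pullback_def)

lemma compare_eq: "compare z = (FAr F (pbb z), cmp z, pbb' z)"
  by (simp add: pb_compare_def pairing_def Let_def)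

lemma cmp:
  assumes "z \<in> Ob SA"
  shows "cmp z \<in> Ar D" "Dom D (cmp z) = FOb F (Dom C (pbb z))" "Cod D (cmp z) = Dom D (pbb' z)"
    "pbb' z \<cdot> cmp z = FAr F (pbb z)" "pbt' z \<cdot> cmp z = FAr F (pbt z)"
  using pairing[OF pbs(2)[OF assms] pullback_comm_sq[OF pbs(3)[OF assms]]] pb_simps[OF assms] Fs by auto

text \<open>Both objects are pullbacks of the same pair of arrows, so the mediating maps in the two
  directions are mutually inverse. The explicit inverse allows the transpose of the comparison to be
  computed componentwise.\<close>

lemma cmp_iso:
  assumes z: "z \<in> Ob SA"
  shows "iso_ar D (cmp z)"
    "inv_ar D (cmp z) = pairing D (FAr F (pbb z)) (FAr F (pbt z)) (pbb' z) (pbt' z)" (is "_ = ?i")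
proof -
  note p = pb_simps[OF z] and c = cmp[OF z]
  note i = pairing[OF pbs(3)[OF z] pullback_comm_sq[OF pbs(2)[OF z]]]
  have ii: "?i \<in> Ar D" "Dom D ?i = Dom D (pbb' z)" "Cod D ?i = FOb F (Dom C (pbb z))" using i p Fs
    by auto
  note Dc = category_simps(2-11)[OF D]
  have 1: "?i \<cdot> cmp z = Ident D (Dom D (cmp z))"
  proof (rule pullback_mono[OF D pbs(3)[OF z]])
    have "FAr F (pbb z) \<cdot> ?i \<cdot> cmp z = (FAr F (pbb z) \<cdot> ?i) \<cdot> cmp z"
      "FAr F (pbt z) \<cdot> ?i \<cdot> cmp z = (FAr F (pbt z) \<cdot> ?i) \<cdot> cmp z"
      using ii c(1-3) p Fs by (auto intro!: category_assoc[OF D, symmetric])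
    then show "FAr F (pbb z) \<cdot> ?i \<cdot> cmp z = FAr F (pbb z) \<cdot> Ident D (Dom D (cmp z))"
      "FAr F (pbt z) \<cdot> ?i \<cdot> cmp z = FAr F (pbt z) \<cdot> Ident D (Dom D (cmp z))"
      unfolding i(4,5) c(4,5) using c(1-3) p Fs by (simp_all add: Dc)
  qed (use ii c(1-3) p Fs category_ends[OF D c(1)] in \<open>simp_all add: Dc\<close>)
  have 2: "cmp z \<cdot> ?i = Ident D (Cod D (cmp z))"
  proof (rule pullback_mono[OF D pbs(2)[OF z]])
    have "pbb' z \<cdot> cmp z \<cdot> ?i = (pbb' z \<cdot> cmp z) \<cdot> ?i"
      "pbt' z \<cdot> cmp z \<cdot> ?i = (pbt' z \<cdot> cmp z) \<cdot> ?i"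
      using ii c(1-3) p Fs by (auto intro!: category_assoc[OF D, symmetric])
    then show "pbb' z \<cdot> cmp z \<cdot> ?i = pbb' z \<cdot> Ident D (Cod D (cmp z))"
      "pbt' z \<cdot> cmp z \<cdot> ?i = pbt' z \<cdot> Ident D (Cod D (cmp z))"
      unfolding c(4,5) i(4,5) using c(1-3) p Fs by (simp_all add: Dc)
  qed (use ii c(1-3) p Fs category_ends[OF D c(1)] in \<open>simp_all add: Dc\<close>)
  show iso: "iso_ar D (cmp z)" using ii c(1-3) 1 2 by (intro iso_arI) simp_all
  show "inv_ar D (cmp z) = ?i"
    using inverse_unique[OF D empty_subsetI D, of "cmp z" "Dom D (cmp z)" "Cod D (cmp z)"
      "inv_ar D (cmp z)" ?i]
      inv_ar[OF D iso] ii c(1-3) 1 2 by (simp add: hom_def)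
qed

lemma compare_Ar:
  assumes z: "z \<in> Ob SA"
  shows "compare z \<in> Ar SB'" "Dom SB' (compare z) = FOb FB (FOb L z)"
    "Cod SB' (compare z) = FOb L' (FOb FA z)"
  using pb_simps[OF z] cmp[OF z] Fs z f' pb_ftor_FOb[of z C f] pb_ftor_FOb[of "FAr F z" D "FAr F f"]
  by (auto simp: compare_eq slice_Ar slice_ftor_simps)

lemma compare_iso: "z \<in> Ob SA \<Longrightarrow> iso_ar SB' (compare z)"
  using compare_Ar cmp_iso unfolding compare_eq by (intro iso_slice[OF D]) auto

lemma inv_compare:
  assumes z: "z \<in> Ob SA"
  shows "inv_ar SB' (compare z) = (pbb' z, pairing D (FAr F (pbb z)) (FAr F (pbt z)) (pbb' z) (pbt' z),
    FAr F (pbb z))"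
    (is "_ = ?t")
proof -
  let ?i = "pairing D (FAr F (pbb z)) (FAr F (pbt z)) (pbb' z) (pbt' z)"
  note p = pb_simps[OF z] and c = cmp[OF z]
    and r = inv_ar[OF D cmp_iso(1)[OF z], unfolded cmp_iso(2)[OF z]]
  note i = pairing[OF pbs(3)[OF z] pullback_comm_sq[OF pbs(2)[OF z]]]
  have t: "?t \<in> Ar SB'" using i(4) r(1-3) p Fs c(1-3) by (simp add: slice_Ar)
  have "?t \<cdot>\<^bsub>SB'\<^esub> compare z = Ident SB' (Dom SB' (compare z))"
    "compare z \<cdot>\<^bsub>SB'\<^esub> ?t = Ident SB' (Cod SB' (compare z))"
    using r c p Fs by (simp_all add: compare_eq)
  then show ?thesis
    using inverse_unique[OF cats(4) empty_subsetI cats(4), of "compare z" "Dom SB' (compare z)"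
      "Cod SB' (compare z)" "inv_ar SB' (compare z)" ?t]
      inv_ar[OF cats(4) compare_iso[OF z]] compare_Ar[OF z] t by (simp add: hom_def compare_eq)
qed

text \<open>The two composites are mediating maps into one pullback; they agree after each of its
  projections.\<close>

lemma compare_natural:
  assumes v: "v \<in> Ar SA"
  shows "FAr L' (FAr FA v) \<cdot>\<^bsub>SB'\<^esub> compare (Dom SA v) = compare (Cod SA v) \<cdot>\<^bsub>SB'\<^esub> FAr FB (FAr L v)"
proof -
  obtain z h z' where v': "v = (z, h, z')" by (cases v)
  note vA = v[unfolded v'] and vs = v[unfolded v' slice_Ar]
  have z: "z \<in> Ob SA" "z' \<in> Ob SA" using vs by auto
  have FAv: "FAr FA v = (FAr F z, FAr F h, FAr F z')" "(FAr F z, FAr F h, FAr F z') \<in> Ar SA'"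
    using slice_ftor_simps(2)[OF vA, of F] functor_simps(2)[OF FAf v] by (auto simp: v')
  have Lv: "FAr L v = (pbb z, pb_ar C f z h z', pbb z')" "(pbb z, pb_ar C f z h z', pbb z') \<in> Ar SB"
    using pb_ftor_FAr[OF vA] functor_simps(2)[OF functors(1) v] by (auto simp: v')
  note a = pb_ar[OF C has(1) vA] and a' = pb_ar[OF D has(2) FAv(2)[folded f'(2)]]
  note c = cmp[OF z(1)] and c' = cmp[OF z(2)] and p = pb_simps[OF z(1)] and p' = pb_simps[OF z(2)]
  let ?a = "pb_ar C f z h z'" and ?a' = "pb_ar D (FAr F f) (FAr F z) (FAr F h) (FAr F z')"
  have Fa: "FAr F ?a \<in> Ar D" "Dom D (FAr F ?a) = FOb F (Dom C (pbb z))"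
    "Cod D (FAr F ?a) = FOb F (Dom C (pbb z'))"
    "FAr F (pbb z') \<cdot> FAr F ?a = FAr F (pbb z)" "FAr F (pbt z') \<cdot> FAr F ?a = FAr F h \<cdot> FAr F (pbt z)"
    using a Fs functor_Cmp[OF F a(1), of "pbb z'"] functor_Cmp[OF F a(1), of "pbt z'"] p p' vs
      functor_Cmp[OF F, of "pbt z" h] by auto
  have Fh: "FAr F h \<in> Ar D" "Dom D (FAr F h) = FOb F (Dom C z)" using vs Fs by auto
  have "?a' \<cdot> cmp z = cmp z' \<cdot> FAr F ?a"
  proof (rule pullback_mono[OF D pbs(2)[OF z(2)]])
    have "pbb' z' \<cdot> ?a' \<cdot> cmp z = (pbb' z' \<cdot> ?a') \<cdot> cmp z"
      "pbt' z' \<cdot> ?a' \<cdot> cmp z = (pbt' z' \<cdot> ?a') \<cdot> cmp z"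
      "pbb' z' \<cdot> cmp z' \<cdot> FAr F ?a = (pbb' z' \<cdot> cmp z') \<cdot> FAr F ?a"
      "pbt' z' \<cdot> cmp z' \<cdot> FAr F ?a = (pbt' z' \<cdot> cmp z') \<cdot> FAr F ?a"
      "(FAr F h \<cdot> pbt' z) \<cdot> cmp z = FAr F h \<cdot> pbt' z \<cdot> cmp z"
      using a'(1-3) c(1-3) c'(1-3) p p' Fa(1-3) Fh
        by (auto intro!: category_assoc[OF D] category_assoc[OF D, symmetric])
    then show "pbb' z' \<cdot> ?a' \<cdot> cmp z = pbb' z' \<cdot> cmp z' \<cdot> FAr F ?a"
      "pbt' z' \<cdot> ?a' \<cdot> cmp z = pbt' z' \<cdot> cmp z' \<cdot> FAr F ?a"
      using a'(4,5) c(4,5) c'(4,5) Fa(4,5) by simp_all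
  qed (use a'(1-3) c(1-3) c'(1-3) Fa(1-3) in \<open>simp_all add: category_comp[OF D]\<close>)
  then show ?thesis
    using pb_ftor_FAr[OF FAv(2)[folded f'(2)]] Lv slice_ftor_simps(2)[OF Lv(2), of F] FAv(1)
    by (simp add: compare_eq v')
qed

text \<open>The prescribed transpose of the comparison: the image of the counit, preceded by the
  inverse of the canonical map between the two ways of forming the fibre product.\<close>

definition transp where
  "transp g = FAr FB (NComp ev g) \<cdot>\<^bsub>SB'\<^esub> inv_ar SB' (compare (FOb P g))"

text \<open>The canonical comparison map at \<open>g\<close>, with \<open>transp g\<close> as its
  transpose. Existence and uniqueness come from the second adjunction.\<close>

definition mate where
  "mate g = (THE h. h \<in> hom SA' (FOb FA (FOb P g)) (FOb P' (FOb FB g)) \<and>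
      NComp ev' (FOb FB g) \<cdot>\<^bsub>SB'\<^esub> FAr L' h = transp g)"

lemma ev_simps:
  assumes "g \<in> Ob SB"
  shows "NComp ev g \<in> Ar SB" "Dom SB (NComp ev g) = FOb L (FOb P g)" "Cod SB (NComp ev g) = g"
proof -
  have e: "nat_fam SB SB (comp_ftor SB L P) (id_ftor SB) (NComp ev)"
    using adj(1) unfolding adjunction_def ntrans_between_def is_ntrans_iff by auto
  show "NComp ev g \<in> Ar SB" "Dom SB (NComp ev g) = FOb L (FOb P g)" "Cod SB (NComp ev g) = g"
    using nat_fam_simps[OF e assms] assms by (auto simp: comp_ftor_def id_ftor_def)
qed

lemma ev_natural:
  assumes "u \<in> Ar SB"
  shows "NComp ev (Cod SB u) \<cdot>\<^bsub>SB\<^esub> FAr L (FAr P u) = u \<cdot>\<^bsub>SB\<^esub> NComp ev (Dom SB u)"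
proof -
  have e: "nat_fam SB SB (comp_ftor SB L P) (id_ftor SB) (NComp ev)"
    using adj(1) unfolding adjunction_def ntrans_between_def is_ntrans_iff by auto
  show ?thesis using nat_fam_comm[OF e assms HOL.refl HOL.refl] assms
    by (simp add: comp_ftor_def id_ftor_def)
qed

lemma ev'_simps:
  assumes "g \<in> Ob SB'"
  shows "NComp ev' g \<in> Ar SB'" "Dom SB' (NComp ev' g) = FOb L' (FOb P' g)" "Cod SB' (NComp ev' g) = g"
proof -
  have e: "nat_fam SB' SB' (comp_ftor SB' L' P') (id_ftor SB') (NComp ev')"
    using adj(2) unfolding adjunction_def ntrans_between_def is_ntrans_iff by auto
  show "NComp ev' g \<in> Ar SB'" "Dom SB' (NComp ev' g) = FOb L' (FOb P' g)" "Cod SB' (NComp ev' g) = g"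
    using nat_fam_simps[OF e assms] assms by (auto simp: comp_ftor_def id_ftor_def)
qed

lemma ev'_natural:
  assumes "u \<in> Ar SB'"
  shows "NComp ev' (Cod SB' u) \<cdot>\<^bsub>SB'\<^esub> FAr L' (FAr P' u) = u \<cdot>\<^bsub>SB'\<^esub> NComp ev' (Dom SB' u)"
proof -
  have e: "nat_fam SB' SB' (comp_ftor SB' L' P') (id_ftor SB') (NComp ev')"
    using adj(2) unfolding adjunction_def ntrans_between_def is_ntrans_iff by auto
  show ?thesis using nat_fam_comm[OF e assms HOL.refl HOL.refl] assms
    by (simp add: comp_ftor_def id_ftor_def)
qed

lemma transp:
  assumes g: "g \<in> Ob SB"
  shows "transp g \<in> Ar SB'" "Dom SB' (transp g) = FOb L' (FOb FA (FOb P g))"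
    "Cod SB' (transp g) = FOb FB g"
proof -
  have p: "FOb P g \<in> Ob SA" using functor_simps(1)[OF functors(3) g] .
  note e = ev_simps[OF g] and c = compare_Ar[OF p] and i = inv_ar[OF cats(4) compare_iso[OF p]]
  note FBs = functor_simps[OF FBf]
  show "transp g \<in> Ar SB'" "Dom SB' (transp g) = FOb L' (FOb FA (FOb P g))"
    "Cod SB' (transp g) = FOb FB g"
    unfolding transp_def using e c i FBs by (simp_all add: category_comp[OF cats(4)] del: slice_simps)
qed

text \<open>The last claim, injectivity of transposition, is the means of proving equations between
  arrows into the second dependent product.\<close>

lemma mate:
  assumes g: "g \<in> Ob SB"
  shows "mate g \<in> Ar SA'" "Dom SA' (mate g) = FOb FA (FOb P g)" "Cod SA' (mate g) = FOb P' (FOb FB g)"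
    "NComp ev' (FOb FB g) \<cdot>\<^bsub>SB'\<^esub> FAr L' (mate g) = transp g"
    and transpose_inj: "\<And>h k z. h \<in> hom SA' z (FOb P' (FOb FB g)) \<Longrightarrow> k \<in> hom SA' z (FOb P' (FOb FB g)) \<Longrightarrow>
      z \<in> Ob SA' \<Longrightarrow>
      NComp ev' (FOb FB g) \<cdot>\<^bsub>SB'\<^esub> FAr L' h = NComp ev' (FOb FB g) \<cdot>\<^bsub>SB'\<^esub> FAr L' k \<Longrightarrow> h = k"
proof -
  have Fg: "FOb FB g \<in> Ob SB'" and Fp: "FOb FA (FOb P g) \<in> Ob SA'"
    using functor_simps(1)[OF FBf g] functor_simps(1)[OF FAf functor_simps(1)[OF functors(3) g]] by auto
  have "transp g \<in> hom SB' (FOb L' (FOb FA (FOb P g))) (FOb FB g)"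
    using transp[OF g] by (simp add: hom_def)
  from theI'[OF adjunction_transpose[OF adj(2) Fp Fg this], folded mate_def]
  show "mate g \<in> Ar SA'" "Dom SA' (mate g) = FOb FA (FOb P g)" "Cod SA' (mate g) = FOb P' (FOb FB g)"
    "NComp ev' (FOb FB g) \<cdot>\<^bsub>SB'\<^esub> FAr L' (mate g) = transp g"
    by (auto simp: hom_def)
  fix h k z assume h: "h \<in> hom SA' z (FOb P' (FOb FB g))" and k: "k \<in> hom SA' z (FOb P' (FOb FB g))"
    and z: "z \<in> Ob SA'"
    and e: "NComp ev' (FOb FB g) \<cdot>\<^bsub>SB'\<^esub> FAr L' h = NComp ev' (FOb FB g) \<cdot>\<^bsub>SB'\<^esub> FAr L' k"
  note e' = ev'_simps[OF Fg] and Ls = functor_simps[OF functors(2)]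
  have "NComp ev' (FOb FB g) \<cdot>\<^bsub>SB'\<^esub> FAr L' k \<in> hom SB' (FOb L' z) (FOb FB g)"
    using k e' Ls by (simp add: hom_def category_comp[OF cats(4)] del: slice_simps)
  from adjunction_transpose[OF adj(2) z Fg this] show "h = k" using h k e by blast
qed

text \<open>After transposition both sides reduce to \<open>FAr FB u\<close> after
  \<open>transp\<close>, by naturality of the two counits and of the inverse of
  \<open>compare\<close>.\<close>

lemma mate_natural:
  assumes u: "u \<in> Ar SB"
  shows "mate (Cod SB u) \<cdot>\<^bsub>SA'\<^esub> FAr FA (FAr P u) = FAr P' (FAr FB u) \<cdot>\<^bsub>SA'\<^esub> mate (Dom SB u)"
proof -
  let ?g = "Dom SB u" and ?g' = "Cod SB u"
  have g: "?g \<in> Ob SB" "?g' \<in> Ob SB" using category_ends[OF cats(2) u] by auto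
  note Ps = functor_simps[OF functors(3)] and P's = functor_simps[OF functors(4)]
    and FAs = functor_simps[OF FAf]
    and FBs = functor_simps[OF FBf] and Ls = functor_simps[OF functors(1)]
      and L's = functor_simps[OF functors(2)]
  let ?p = "FOb P ?g" and ?p' = "FOb P ?g'" and ?v = "FAr P u"
  have v: "?v \<in> Ar SA" "Dom SA ?v = ?p" "Cod SA ?v = ?p'" and p: "?p \<in> Ob SA" "?p' \<in> Ob SA"
    using Ps u g by auto
  note m = mate[OF g(1)] and m' = mate[OF g(2)]
  note e = ev_simps[OF g(1)] and e' = ev_simps[OF g(2)]
  have Fg: "FOb FB ?g \<in> Ob SB'" "FOb FB ?g' \<in> Ob SB'" using FBs g by auto
  note ee = ev'_simps[OF Fg(1)] and ee' = ev'_simps[OF Fg(2)]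
  note c = compare_Ar[OF p(1)] and c' = compare_Ar[OF p(2)]
  note i = inv_ar[OF cats(4) compare_iso[OF p(1)]] and i' = inv_ar[OF cats(4) compare_iso[OF p(2)]]
  have Fv: "FAr FA ?v \<in> Ar SA'" "Dom SA' (FAr FA ?v) = FOb FA ?p" "Cod SA' (FAr FA ?v) = FOb FA ?p'"
    using FAs v by auto
  have Fu: "FAr FB u \<in> Ar SB'" "Dom SB' (FAr FB u) = FOb FB ?g" "Cod SB' (FAr FB u) = FOb FB ?g'"
    using FBs u by auto
  have Lv: "FAr L ?v \<in> Ar SB" "Dom SB (FAr L ?v) = FOb L ?p" "Cod SB (FAr L ?v) = FOb L ?p'" using Ls v
    by auto
  have FLv: "FAr FB (FAr L ?v) \<in> Ar SB'" "Dom SB' (FAr FB (FAr L ?v)) = FOb FB (FOb L ?p)"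
    "Cod SB' (FAr FB (FAr L ?v)) = FOb FB (FOb L ?p')" using FBs Lv by auto
  have LFv: "FAr L' (FAr FA ?v) \<in> Ar SB'" "Dom SB' (FAr L' (FAr FA ?v)) = FOb L' (FOb FA ?p)"
    "Cod SB' (FAr L' (FAr FA ?v)) = FOb L' (FOb FA ?p')" using L's Fv by auto
  have Fe: "FAr FB (NComp ev ?g) \<in> Ar SB'" "Dom SB' (FAr FB (NComp ev ?g)) = FOb FB (FOb L ?p)"
    "Cod SB' (FAr FB (NComp ev ?g)) = FOb FB ?g" "FAr FB (NComp ev ?g') \<in> Ar SB'"
    "Dom SB' (FAr FB (NComp ev ?g')) = FOb FB (FOb L ?p')"
      "Cod SB' (FAr FB (NComp ev ?g')) = FOb FB ?g'"
    using FBs e e' by auto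
  have PFu: "FAr P' (FAr FB u) \<in> Ar SA'" "Dom SA' (FAr P' (FAr FB u)) = FOb P' (FOb FB ?g)"
    "Cod SA' (FAr P' (FAr FB u)) = FOb P' (FOb FB ?g')" using P's Fu by auto
  note Sa = category_assoc[OF cats(4)] category_comp[OF cats(4)] category_comp_ident[OF cats(4)]
  note L'm = L's(2-4)[OF m(1)] L's(2-4)[OF m'(1)] L's(2-4)[OF PFu(1)]
  note nos = slice_simps(1-4)
  have inv_nat: "inv_ar SB' (compare ?p') \<cdot>\<^bsub>SB'\<^esub> FAr L' (FAr FA ?v) = FAr FB (FAr L ?v) \<cdot>\<^bsub>SB'\<^esub> inv_ar
    SB' (compare ?p)"
  proof -
    have "inv_ar SB' (compare ?p') \<cdot>\<^bsub>SB'\<^esub> FAr L' (FAr FA ?v)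
      = inv_ar SB' (compare ?p') \<cdot>\<^bsub>SB'\<^esub> (FAr L' (FAr FA ?v) \<cdot>\<^bsub>SB'\<^esub> compare ?p) \<cdot>\<^bsub>SB'\<^esub> inv_ar SB'
        (compare ?p)"
      using c i LFv i'(1-3) c' by (simp add: Sa del: nos)
    also have "\<dots> = (inv_ar SB' (compare ?p') \<cdot>\<^bsub>SB'\<^esub> compare ?p') \<cdot>\<^bsub>SB'\<^esub> FAr FB (FAr L ?v) \<cdot>\<^bsub>SB'\<^esub> inv_ar
      SB' (compare ?p)"
      using compare_natural[OF v(1)] v c c' i(1-3) i'(1-3) FLv by (simp add: Sa del: nos)
    also have "\<dots> = FAr FB (FAr L ?v) \<cdot>\<^bsub>SB'\<^esub> inv_ar SB' (compare ?p)"
      unfolding i'(4) using c c' i(1-3) FLv by (simp add: Sa del: nos)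
    finally show ?thesis .
  qed
  show ?thesis
  proof (rule transpose_inj[OF g(2)])
    have "NComp ev' (FOb FB ?g') \<cdot>\<^bsub>SB'\<^esub> FAr L' (mate ?g' \<cdot>\<^bsub>SA'\<^esub> FAr FA ?v)
        = (NComp ev' (FOb FB ?g') \<cdot>\<^bsub>SB'\<^esub> FAr L' (mate ?g')) \<cdot>\<^bsub>SB'\<^esub> FAr L' (FAr FA ?v)"
      using functor_Cmp[OF functors(2) Fv(1) m'(1)] Fv m'(1-3) L'm LFv ee' by (simp add: Sa del: nos)
    also have "\<dots> = FAr FB (NComp ev ?g') \<cdot>\<^bsub>SB'\<^esub> inv_ar SB' (compare ?p') \<cdot>\<^bsub>SB'\<^esub> FAr L' (FAr FA ?v)"
      unfolding m'(4) transp_def using Fe LFv i'(1-3) c' by (simp add: Sa del: nos)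
    also have "\<dots> = (FAr FB (NComp ev ?g') \<cdot>\<^bsub>SB'\<^esub> FAr FB (FAr L ?v)) \<cdot>\<^bsub>SB'\<^esub> inv_ar SB' (compare ?p)"
      unfolding inv_nat using Fe FLv i(1-3) c by (simp add: Sa del: nos)
    also have "FAr FB (NComp ev ?g') \<cdot>\<^bsub>SB'\<^esub> FAr FB (FAr L ?v) = FAr FB u \<cdot>\<^bsub>SB'\<^esub> FAr FB (NComp ev ?g)"
      using functor_Cmp[OF FBf Lv(1) e'(1)] functor_Cmp[OF FBf e(1) u] ev_natural[OF u] Lv e e'
        by (simp del: nos)
    also have "(FAr FB u \<cdot>\<^bsub>SB'\<^esub> FAr FB (NComp ev ?g)) \<cdot>\<^bsub>SB'\<^esub> inv_ar SB' (compare ?p) = FAr FB u \<cdot>\<^bsub>SB'\<^esub>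
      transp ?g"
      unfolding transp_def using Fe Fu i(1-3) c by (simp add: Sa del: nos)
    also have "\<dots> = (FAr FB u \<cdot>\<^bsub>SB'\<^esub> NComp ev' (FOb FB ?g)) \<cdot>\<^bsub>SB'\<^esub> FAr L' (mate ?g)"
      unfolding m(4)[symmetric] using Fu ee L'm m(1-3) by (simp add: Sa del: nos)
    also have "\<dots> = (NComp ev' (FOb FB ?g') \<cdot>\<^bsub>SB'\<^esub> FAr L' (FAr P' (FAr FB u))) \<cdot>\<^bsub>SB'\<^esub> FAr L' (mate ?g)"
      using ev'_natural[OF Fu(1)] Fu by (simp del: nos)
    also have "\<dots> = NComp ev' (FOb FB ?g') \<cdot>\<^bsub>SB'\<^esub> FAr L' (FAr P' (FAr FB u) \<cdot>\<^bsub>SA'\<^esub> mate ?g)"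
      using functor_Cmp[OF functors(2) m(1) PFu(1)] m(1-3) PFu L'm ee' by (simp add: Sa del: nos)
    finally show "NComp ev' (FOb FB ?g') \<cdot>\<^bsub>SB'\<^esub> FAr L' (mate ?g' \<cdot>\<^bsub>SA'\<^esub> FAr FA ?v)
        = NComp ev' (FOb FB ?g') \<cdot>\<^bsub>SB'\<^esub> FAr L' (FAr P' (FAr FB u) \<cdot>\<^bsub>SA'\<^esub> mate ?g)" .
  qed (use m(1-3) m'(1-3) Fv PFu functor_simps(1)[OF FAf p(1)] in \<open>simp_all add: hom_def
    category_comp[OF cats(3)] del: nos\<close>)
qed

lemma natural_iso_mate:
  assumes "\<And>g. g \<in> Ob SB \<Longrightarrow> iso_ar SA' (mate g)"
  shows "natural_iso SB SA' (comp_ftor SB FA P) (comp_ftor SB P' FB) (mk_ntrans SB (comp_ftor SB FA P)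
    (comp_ftor SB P' FB) mate)"
proof -
  note c1 = comp_ftor_functor[OF functors(3) FAf] and c2 = comp_ftor_functor[OF FBf functors(4)]
  have "nat_fam SB SA' (comp_ftor SB FA P) (comp_ftor SB P' FB) mate"
    unfolding nat_fam_def using mate mate_natural category_ends[OF cats(2)]
    by (auto simp: comp_ftor_simps hom_def simp del: slice_simps)
  then show ?thesis
    using is_ntrans_mk[OF c1 c2] assms unfolding natural_iso_def ntrans_between_def by simp
qed

end

lemma slice_fun_cat:
  fixes E (structure)
  assumes "(z, h, z') \<in> Ar (slice (fun_cat D E) c)"
  shows "is_ntrans D E z" "NCod z = c" "is_ntrans D E z'" "NCod z' = c" "is_ntrans D E h"
    "NDom h = NDom z" "NCod h = NDom z'" "nat_fam D E (NDom z) c (NComp z)"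
      "nat_fam D E (NDom z') c (NComp z')"
    "nat_fam D E (NDom z) (NDom z') (NComp h)"
    "x \<in> Ob D \<Longrightarrow> NComp z' x \<cdot> NComp h x = NComp z x"
proof -
  have a: "is_ntrans D E z" "NCod z = c" "is_ntrans D E z'" "NCod z' = c" "is_ntrans D E h"
    "NDom h = NDom z" "NCod h = NDom z'" and e: "z' \<cdot>\<^bsub>fun_cat D E\<^esub> h = z"
    using assms by (simp_all add: slice_Ar)
  then show "is_ntrans D E z" "NCod z = c" "is_ntrans D E z'" "NCod z' = c" "is_ntrans D E h"
    "NDom h = NDom z" "NCod h = NDom z'" by blast+
  show "nat_fam D E (NDom z) c (NComp z)" "nat_fam D E (NDom z') c (NComp z')"
    "nat_fam D E (NDom z) (NDom z') (NComp h)"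
    using a by (simp_all add: is_ntrans_iff)
  show "x \<in> Ob D \<Longrightarrow> NComp z' x \<cdot> NComp h x = NComp z x"
    using arg_cong[OF e, of "\<lambda>t. NComp t x"] by simp
qed

section \<open>Dependent products in functor categories, read on generalised elements\<close>

locale fun_dprod =
  fixes D :: "('o, 'a) cat" and E :: "('p, 'b) cat" (structure) and f P eta ev
  assumes D: "category D" and E: "category E"
    and has: "x \<in> Ob D \<Longrightarrow> has_pullbacks_along E (NComp f x)"
    and dp: "dependent_product (fun_cat D E) f P eta ev"
begin

abbreviation "F \<equiv> fun_cat D E"
abbreviation "A \<equiv> NCod f"
abbreviation "B \<equiv> NDom f"
abbreviation "pbb z \<equiv> pb_base F f z"
abbreviation "pbt z \<equiv> pb_top F f z"
abbreviation "pr z x b y \<equiv> pairing E (NComp (pbb z) x) (NComp (pbt z) x) b y"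
abbreviation "eva g \<equiv> fst (snd (NComp ev g))"

text \<open>The counit at \<open>g\<close> applied to the generalised element \<open>(b, y)\<close>
  of the fibre product: the element is first turned into a map into the chosen pullback.\<close>

definition evop where
  "evop g x b y = NComp (eva g) x \<cdot> pr (FOb P g) x b y"

lemma F_cat: "category F" by (rule category_fun_cat[OF D E])

lemmas Fs = category_simps[OF F_cat] and Es = category_simps[OF E]

lemma f: "is_ntrans D E f"
  using dp by (simp add: dependent_product_def has_pullbacks_along_def)

lemma f_facts: "is_functor D E A" "is_functor D E B" "nat_fam D E B A (NComp f)"
  using f by (auto simp: is_ntrans_iff)

lemma adj: "adjunction (slice F A) (slice F B) (pb_ftor F f) P eta ev"
  using dp by (simp add: dependent_product_def)

lemma chosen:
  assumes "is_ntrans D E z" "NCod z = A"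
  shows "is_pullback F f z (pbb z) (pbt z)"
  by (rule chosen_pullback) (use dp assms in \<open>auto simp: dependent_product_def\<close>)

lemma pb_facts:
  assumes "is_ntrans D E z" "NCod z = A"
  shows "is_ntrans D E (pbb z)" "is_ntrans D E (pbt z)" "NDom (pbt z) = NDom (pbb z)" "NCod (pbb z) = B"
    "NCod (pbt z) = NDom z" "nat_fam D E (NDom (pbb z)) B (NComp (pbb z))"
    "nat_fam D E (NDom (pbb z)) (NDom z) (NComp (pbt z))" "f \<cdot>\<^bsub>F\<^esub> pbb z = z \<cdot>\<^bsub>F\<^esub> pbt z"
    "is_functor D E (NDom (pbb z))"
  using chosen[OF assms] by (auto simp: is_pullback_def is_ntrans_iff)

lemma pointwise:
  assumes "is_ntrans D E z" "NCod z = A" "x \<in> Ob D"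
  shows "is_pullback E (NComp f x) (NComp z x) (NComp (pbb z) x) (NComp (pbt z) x)"
  by (rule pullback_pointwise[OF E D f assms(1,2) has chosen[OF assms(1,2)] assms(3)])

lemma pr_facts:
  assumes "is_ntrans D E z" "NCod z = A" "x \<in> Ob D" and sq: "comm_sq E (NComp f x) (NComp z x) b y"
  shows "pr z x b y \<in> Ar E" "Dom E (pr z x b y) = Dom E b" "Cod E (pr z x b y) = FOb (NDom (pbb z)) x"
    "NComp (pbb z) x \<cdot> pr z x b y = b" "NComp (pbt z) x \<cdot> pr z x b y = y"
  using pairing[OF pointwise[OF assms(1-3)] sq] nat_fam_simps[OF pb_facts(6)[OF assms(1,2)] assms(3)]
    by auto

lemma comm_sq_self:
  assumes "is_ntrans D E z" "NCod z = A" "x \<in> Ob D"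
  shows "comm_sq E (NComp f x) (NComp z x) (NComp (pbb z) x) (NComp (pbt z) x)"
  by (rule pullback_comm_sq[OF pointwise[OF assms]])

lemma pr_self:
  assumes "is_ntrans D E z" "NCod z = A" "x \<in> Ob D"
  shows "pr z x (NComp (pbb z) x) (NComp (pbt z) x) = Ident E (FOb (NDom (pbb z)) x)"
  using nat_fam_simps[OF pb_facts(6)[OF assms(1,2)] assms(3)] nat_fam_simps[OF pb_facts(7)[OF
    assms(1,2)] assms(3)]
    functor_simps(1)[OF pb_facts(9)[OF assms(1,2)] assms(3)]
  by (intro pairing_eqI[OF pointwise[OF assms] comm_sq_self[OF assms]]) (simp_all add: Es)

lemma pb_ftor_FOb: "is_ntrans D E z \<Longrightarrow> NCod z = A \<Longrightarrow> FOb (pb_ftor F f) z = pbb z"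
  by (rule pb_ftor_FOb) simp_all

abbreviation "pba \<equiv> pb_ar F f"

lemma pb_ar_facts:
  assumes "(z, h, z') \<in> Ar (slice F A)"
  shows "is_ntrans D E (pba z h z')" "NDom (pba z h z') = NDom (pbb z)"
    "NCod (pba z h z') = NDom (pbb z')" "pbb z' \<cdot>\<^bsub>F\<^esub> pba z h z' = pbb z"
    "pbt z' \<cdot>\<^bsub>F\<^esub> pba z h z' = h \<cdot>\<^bsub>F\<^esub> pbt z"
  using pb_ar[OF F_cat, of f z h z'] dp assms by (auto simp: dependent_product_def)

lemma comm_sq_slice:
  assumes "(z, h, z') \<in> Ar (slice F A)" "x \<in> Ob D" and sq: "comm_sq E (NComp f x) (NComp z x) b y"
  shows "comm_sq E (NComp f x) (NComp z' x) b (NComp h x \<cdot> y)"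
proof -
  note z = slice_fun_cat(8-10)[OF assms(1)]
  have "NComp z' x \<cdot> NComp h x = NComp z x" by (rule slice_fun_cat(11)[OF assms(1,2)])
  then have "NComp z' x \<cdot> NComp h x \<cdot> y = NComp z x \<cdot> y"
    using nat_fam_simps[OF z(1) assms(2)] nat_fam_simps[OF z(2) assms(2)] nat_fam_simps[OF z(3)
      assms(2)] sq
    by (simp add: comm_sq_def flip: category_assoc[OF E])
  then show ?thesis
    using nat_fam_simps[OF z(1) assms(2)] nat_fam_simps[OF z(2) assms(2)] nat_fam_simps[OF z(3)
      assms(2)] sq
    by (simp add: comm_sq_def Es)
qed

lemma pb_ar_pr:
  assumes h: "(z, h, z') \<in> Ar (slice F A)" and x: "x \<in> Ob D"
    and sq: "comm_sq E (NComp f x) (NComp z x) b y"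
  shows "NComp (pba z h z') x \<cdot> pr z x b y = pr z' x b (NComp h x \<cdot> y)"
proof -
  have z: "is_ntrans D E z" "NCod z = A" "is_ntrans D E z'" "NCod z' = A" "is_ntrans D E h"
    "NDom h = NDom z"
    "NCod h = NDom z'"
    using h by (auto simp: slice_Ar)
  note k = pb_ar_facts[OF h]
  have n: "nat_fam D E (NDom (pbb z)) (NDom (pbb z')) (NComp (pba z h z'))"
    "nat_fam D E (NDom z) (NDom z') (NComp h)"
    using k z by (auto simp: is_ntrans_iff)
  note p = pr_facts[OF z(1,2) x sq]
  note ks = nat_fam_simps[OF n(1) x] nat_fam_simps[OF n(2) x] nat_fam_simps[OF pb_facts(6)[OF z(1,2)] x]
    nat_fam_simps[OF pb_facts(7)[OF z(1,2)] x] nat_fam_simps[OF pb_facts(6)[OF z(3,4)] x]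
    nat_fam_simps[OF pb_facts(7)[OF z(3,4)] x]
  have kb: "NComp (pbb z') x \<cdot> NComp (pba z h z') x = NComp (pbb z) x"
    "NComp (pbt z') x \<cdot> NComp (pba z h z') x = NComp h x \<cdot> NComp (pbt z) x"
    using arg_cong[OF k(4), of "\<lambda>t. NComp t x"] arg_cong[OF k(5), of "\<lambda>t. NComp t x"] x by simp_all
  have "NComp (pbb z') x \<cdot> NComp (pba z h z') x \<cdot> pr z x b y
      = (NComp (pbb z') x \<cdot> NComp (pba z h z') x) \<cdot> pr z x b y"
    "NComp (pbt z') x \<cdot> NComp (pba z h z') x \<cdot> pr z x b y
      = (NComp (pbt z') x \<cdot> NComp (pba z h z') x) \<cdot> pr z x b y"
    "(NComp h x \<cdot> NComp (pbt z) x) \<cdot> pr z x b y = NComp h x \<cdot> NComp (pbt z) x \<cdot> pr z x b y"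
    by (rule category_assoc[OF E, symmetric] category_assoc[OF E]; use p(1-3) ks in simp)+
  then show ?thesis
    unfolding kb p(4,5) using p(1-3) ks
    by (intro pairing_eqI[OF pointwise[OF z(3,4) x] comm_sq_slice[OF h x sq], symmetric]) (simp_all add:
      Es)
qed

lemma P_functor: "is_functor (slice F B) (slice F A) P"
  using adj by (simp add: adjunction_def)

context
  fixes g
  assumes g: "is_ntrans D E g" "NCod g = B"
begin

lemma Pg: "is_ntrans D E (FOb P g)" "NCod (FOb P g) = A"
  using functor_simps(1)[OF P_functor, of g] g by auto

lemma eva_slice: "NComp ev g = (pbb (FOb P g), eva g, g)" "(pbb (FOb P g), eva g, g) \<in> Ar (slice F B)"
proof -
  have e: "nat_fam (slice F B) (slice F B) (comp_ftor (slice F B) (pb_ftor F f) P) (id_ftor (slice F B))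
    (NComp ev)"
    using adj unfolding adjunction_def ntrans_between_def is_ntrans_iff by auto
  have gO: "g \<in> Ob (slice F B)" using g by simp
  have "NComp ev g \<in> Ar (slice F B)" "fst (NComp ev g) = pbb (FOb P g)" "snd (snd (NComp ev g)) = g"
    using nat_fam_simps[OF e gO] gO pb_ftor_FOb[OF Pg]
      by (auto simp: comp_ftor_def id_ftor_def split_beta)
  then show "NComp ev g = (pbb (FOb P g), eva g, g)" "(pbb (FOb P g), eva g, g) \<in> Ar (slice F B)"
    by (metis prod.collapse)+
qed

lemma eva_facts: "is_ntrans D E (eva g)" "NDom (eva g) = NDom (pbb (FOb P g))" "NCod (eva g) = NDom g"
  "g \<cdot>\<^bsub>F\<^esub> eva g = pbb (FOb P g)"
  "nat_fam D E (NDom (pbb (FOb P g))) (NDom g) (NComp (eva g))"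
  using eva_slice(2) by (auto simp: slice_Ar is_ntrans_iff)

text \<open>This links the adjunction with \<open>is_lift\<close>: the equation saying that
  \<open>e\<close> is the transpose of \<open>h\<close> is tested on generalised elements of the
  pullback. Testing on the two projections alone already gives it back.\<close>

lemma slice_comp_iff:
  assumes h: "(z, h, FOb P g) \<in> Ar (slice F A)" and e: "(pbb z, e, g) \<in> Ar (slice F B)"
  shows "NComp ev g \<cdot>\<^bsub>slice F B\<^esub> FAr (pb_ftor F f) (z, h, FOb P g) = (pbb z, e, g) \<longleftrightarrow>
    (\<forall>x\<in>Ob D. \<forall>b y. comm_sq E (NComp f x) (NComp z x) b y \<longrightarrow>
       evop g x b (NComp h x \<cdot> y) = NComp e x \<cdot> pr z x b y)"
proof -
  let ?k = "pba z h (FOb P g)"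
  have z: "is_ntrans D E z" "NCod z = A" using h by (auto simp: slice_Ar)
  have es: "is_ntrans D E e" "NDom e = NDom (pbb z)" "NCod e = NDom g" using e by (auto simp: slice_Ar)
  note k = pb_ar_facts[OF h]
  have n: "nat_fam D E (NDom (pbb z)) (NDom (pbb (FOb P g))) (NComp ?k)"
    "nat_fam D E (NDom (pbb z)) (NDom g) (NComp e)"
    using k es by (auto simp: is_ntrans_iff)
  note ks = nat_fam_simps[OF n(1)] nat_fam_simps[OF n(2)] nat_fam_simps[OF eva_facts(5)]
  have "NComp ev g \<cdot>\<^bsub>slice F B\<^esub> FAr (pb_ftor F f) (z, h, FOb P g) = (pbb z, e, g) \<longleftrightarrow> eva g \<cdot>\<^bsub>F\<^esub> ?k = e"
    using pb_ftor_FAr[of z h "FOb P g" F f] h by (simp, subst eva_slice(1)) simp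
  also have "\<dots> \<longleftrightarrow> (\<forall>x\<in>Ob D. NComp (eva g) x \<cdot> NComp ?k x = NComp e x)"
  proof
    assume "eva g \<cdot>\<^bsub>F\<^esub> ?k = e"
    then show "\<forall>x\<in>Ob D. NComp (eva g) x \<cdot> NComp ?k x = NComp e x" by (metis fun_cat_simps(10))
  next
    assume "\<forall>x\<in>Ob D. NComp (eva g) x \<cdot> NComp ?k x = NComp e x"
    then show "eva g \<cdot>\<^bsub>F\<^esub> ?k = e"
      using k es eva_facts by (intro ntrans_eqI[of D E] is_ntrans_Cmp) auto
  qed
  also have "\<dots> \<longleftrightarrow> (\<forall>x\<in>Ob D. \<forall>b y. comm_sq E (NComp f x) (NComp z x) b y \<longrightarrow>
       evop g x b (NComp h x \<cdot> y) = NComp e x \<cdot> pr z x b y)"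
  proof (intro ball_cong HOL.refl iffI allI impI)
    fix x b y assume x: "x \<in> Ob D" and eq: "NComp (eva g) x \<cdot> NComp ?k x = NComp e x"
      and sq: "comm_sq E (NComp f x) (NComp z x) b y"
    show "evop g x b (NComp h x \<cdot> y) = NComp e x \<cdot> pr z x b y"
      unfolding evop_def pb_ar_pr[OF h x sq, symmetric] eq[symmetric]
      using pr_facts(1-3)[OF z x sq] ks[OF x] by (simp add: Es)
  next
    fix x assume x: "x \<in> Ob D" and a: "\<forall>b y. comm_sq E (NComp f x) (NComp z x) b y \<longrightarrow>
       evop g x b (NComp h x \<cdot> y) = NComp e x \<cdot> pr z x b y"
    \<comment> \<open>The universal generalised element; its mediating map is the identity of the
      pullback.\<close>
    note sq = comm_sq_self[OF z x]
    have "NComp (eva g) x \<cdot> NComp ?k x \<cdot> pr z x (NComp (pbb z) x) (NComp (pbt z) x) =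
      NComp e x \<cdot> pr z x (NComp (pbb z) x) (NComp (pbt z) x)"
      using a[rule_format, OF sq] unfolding evop_def pb_ar_pr[OF h x sq, symmetric] .
    then show "NComp (eva g) x \<cdot> NComp ?k x = NComp e x"
      unfolding pr_self[OF z x] using ks[OF x] by (simp add: category_comp_ident[OF E])
  qed
  finally show ?thesis .
qed

text \<open>Stability under precomposition is inherited from \<open>pairing\<close>, and
  compatibility with the arrows of \<open>D\<close> from the naturality of both projections and of
  the counit.\<close>

lemma evop_section: "section_op D E B (NDom g) (NDom (FOb P g)) (NComp f) (NComp g) (NComp (FOb P g))
  (evop g)"
  unfolding section_op_def
proof (intro ballI allI impI)
  let ?p = "FOb P g"
  let ?R = "NDom (pbb ?p)"
  fix x b y assume x: "x \<in> Ob D" and sq: "comm_sq E (NComp f x) (NComp ?p x) b y"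
  have gn: "nat_fam D E (NDom g) B (NComp g)" "nat_fam D E (NDom ?p) A (NComp ?p)"
    "is_functor D E (NDom ?p)"
    "is_functor D E (NDom g)"
    using g Pg by (auto simp: is_ntrans_iff)
  note p = pr_facts[OF Pg x sq] and e = nat_fam_simps[OF eva_facts(5)] and gs = nat_fam_simps[OF gn(1)]
  note bs = nat_fam_simps[OF pb_facts(6)[OF Pg]] nat_fam_simps[OF pb_facts(7)[OF Pg]]
  note pw = pointwise[OF Pg]
  have "NComp g x \<cdot> NComp (eva g) x = NComp (pbb ?p) x"
    using arg_cong[OF eva_facts(4), of "\<lambda>t. NComp t x"] x by simp
  then have ge: "NComp g x \<cdot> evop g x b y = b"
    unfolding evop_def using p(1-4) e[OF x] gs[OF x] by (simp flip: category_assoc[OF E])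
  have hom: "evop g x b y \<in> hom E (Dom E b) (FOb (NDom g) x)"
    unfolding evop_def using p(1-3) e[OF x] by (simp add: hom_def Es)
  have pre: "evop g x (b \<cdot> t) (y \<cdot> t) = evop g x b y \<cdot> t" if "t \<in> Ar E" "Cod E t = Dom E b" for t
    unfolding evop_def pairing_precomp[OF E pw[OF x] sq that] using that p(1-3) e[OF x]
      by (simp add: Es)
  have nat: "FAr (NDom g) a \<cdot> evop g x b y = evop g (Cod D a) (FAr B a \<cdot> b) (FAr (NDom ?p) a \<cdot> y)"
    if a: "a \<in> Ar D" "Dom D a = x" for a
  proof -
    let ?y = "Cod D a"
    have y: "?y \<in> Ob D" using category_ends[OF D a(1)] by simp
    note sq' = comm_sq_map[OF f_facts(1,2) gn(3) f_facts(3) gn(2) sq a]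
    note Ra = functor_simps(2-4)[OF pb_facts(9)[OF Pg] a(1), unfolded a(2)]
    note Ca = functor_simps(2-4)[OF gn(4) a(1), unfolded a(2)] functor_simps(2-4)[OF f_facts(2) a(1),
      unfolded a(2)]
      functor_simps(2-4)[OF gn(3) a(1), unfolded a(2)]
    have pp: "NComp (pbb ?p) ?y \<cdot> FAr ?R a \<cdot> pr ?p x b y = FAr B a \<cdot> b"
    proof -
      have "NComp (pbb ?p) ?y \<cdot> FAr ?R a \<cdot> pr ?p x b y = (NComp (pbb ?p) ?y \<cdot> FAr ?R a) \<cdot> pr ?p x b y"
        using p(1-3) bs[OF y] Ra by (simp add: Es)
      also have "\<dots> = FAr B a \<cdot> NComp (pbb ?p) x \<cdot> pr ?p x b y"
        unfolding nat_fam_comm[OF pb_facts(6)[OF Pg] a HOL.refl] using p(1-3) bs[OF x] Ca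
          by (simp add: Es)
      finally show ?thesis unfolding p(4) .
    qed
    have pt: "NComp (pbt ?p) ?y \<cdot> FAr ?R a \<cdot> pr ?p x b y = FAr (NDom ?p) a \<cdot> y"
    proof -
      have "NComp (pbt ?p) ?y \<cdot> FAr ?R a \<cdot> pr ?p x b y = (NComp (pbt ?p) ?y \<cdot> FAr ?R a) \<cdot> pr ?p x b y"
        using p(1-3) bs[OF y] Ra by (simp add: Es)
      also have "\<dots> = FAr (NDom ?p) a \<cdot> NComp (pbt ?p) x \<cdot> pr ?p x b y"
        unfolding nat_fam_comm[OF pb_facts(7)[OF Pg] a HOL.refl] using p(1-3) bs[OF x] Ca
          by (simp add: Es)
      finally show ?thesis unfolding p(5) .
    qed
    have bd: "b \<in> Ar E" "Cod E b = FOb B x" using sq nat_fam_simps[OF f_facts(3) x]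
      by (auto simp: comm_sq_def)
    have "pr ?p ?y (FAr B a \<cdot> b) (FAr (NDom ?p) a \<cdot> y) = FAr ?R a \<cdot> pr ?p x b y"
      by (rule pairing_eqI[OF pw[OF y] sq' _ _ _ pp pt]) (use p(1-3) Ra Ca bs[OF y] bd in \<open>simp_all add:
        Es\<close>)
    moreover have "FAr (NDom g) a \<cdot> NComp (eva g) x \<cdot> pr ?p x b y
        = (FAr (NDom g) a \<cdot> NComp (eva g) x) \<cdot> pr ?p x b y"
      using p(1-3) e[OF x] Ca by (simp add: Es)
    ultimately show ?thesis
      unfolding evop_def nat_fam_comm[OF eva_facts(5) a HOL.refl, symmetric] using p(1-3) e[OF y] Ra
        by (simp add: Es)
  qed
  show "evop g x b y \<in> hom E (Dom E b) (FOb (NDom g) x) \<and> NComp g x \<cdot> evop g x b y = b \<and>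
        (\<forall>t\<in>Ar E. Cod E t = Dom E b \<longrightarrow> evop g x (b \<cdot> t) (y \<cdot> t) = evop g x b y \<cdot> t) \<and>
        (\<forall>a\<in>Ar D. Dom D a = x \<longrightarrow>
           FAr (NDom g) a \<cdot> evop g x b y = evop g (Cod D a) (FAr B a \<cdot> b) (FAr (NDom ?p) a \<cdot> y))"
    using hom ge pre nat by blast
qed

text \<open>A section operation over \<open>Z\<close> is the same as a map from the pullback of
  \<open>Z\<close> to \<open>NDom g\<close> over \<open>B\<close>: the map is the value of
  \<open>s\<close> on the universal element, and stability under precomposition recovers
  \<open>s\<close>. The universal property is then that of the adjunction.\<close>

theorem dprod: "is_dprod D E A B (NDom g) (NComp f) (NComp g) (NDom (FOb P g)) (NComp (FOb P g)) (evop
  g)"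
  unfolding is_dprod_def
proof (intro conjI allI impI)
  let ?p = "FOb P g"
  show "is_functor D E (NDom ?p)" "nat_fam D E (NDom ?p) A (NComp ?p)"
    using Pg by (auto simp: is_ntrans_iff)
  show "section_op D E B (NDom g) (NDom ?p) (NComp f) (NComp g) (NComp ?p) (evop g)"
    by (rule evop_section)
  fix Z z s assume Z: "is_functor D E Z" and z: "nat_fam D E Z A z"
    and s: "section_op D E B (NDom g) Z (NComp f) (NComp g) z s"
  let ?z = "mk_ntrans D Z A z"
  have zn: "is_ntrans D E ?z" "NCod ?z = A" using is_ntrans_mk[OF Z f_facts(1) z] by auto
  note pf = pb_facts[OF zn]
  have gn: "nat_fam D E (NDom g) B (NComp g)" "is_functor D E (NDom g)" using g
    by (auto simp: is_ntrans_iff)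
  have se: "s x b y \<in> hom E (Dom E b) (FOb (NDom g) x)" "NComp g x \<cdot> s x b y = b"
    "\<And>t. t \<in> Ar E \<Longrightarrow> Cod E t = Dom E b \<Longrightarrow> s x (b \<cdot> t) (y \<cdot> t) = s x b y \<cdot> t"
    "\<And>a. a \<in> Ar D \<Longrightarrow> Dom D a = x \<Longrightarrow>
           FAr (NDom g) a \<cdot> s x b y = s (Cod D a) (FAr B a \<cdot> b) (FAr Z a \<cdot> y)"
    if "x \<in> Ob D" "comm_sq E (NComp f x) (NComp ?z x) b y" for x b y
    using s that unfolding section_op_def by auto
  let ?R = "NDom (pbb ?z)"
  \<comment> \<open>The section operation evaluated at the universal element of the
    pullback.\<close>
  let ?e = "mk_ntrans D ?R (NDom g) (\<lambda>x. s x (NComp (pbb ?z) x) (NComp (pbt ?z) x))"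
  have "nat_fam D E ?R (NDom g) (\<lambda>x. s x (NComp (pbb ?z) x) (NComp (pbt ?z) x))"
    unfolding nat_fam_def
  proof (intro conjI ballI)
    fix x assume x: "x \<in> Ob D"
    show "s x (NComp (pbb ?z) x) (NComp (pbt ?z) x) \<in> hom E (FOb ?R x) (FOb (NDom g) x)"
      using se(1)[OF x comm_sq_self[OF zn x]] nat_fam_simps[OF pf(6) x] by simp
  next
    fix a assume a: "a \<in> Ar D"
    let ?x = "Dom D a" and ?y = "Cod D a"
    have x: "?x \<in> Ob D" "?y \<in> Ob D" using category_ends[OF D a] by auto
    note Ra = functor_simps(2-4)[OF pf(9) a]
    have "s ?y (NComp (pbb ?z) ?y) (NComp (pbt ?z) ?y) \<cdot> FAr ?R a
        = s ?y (NComp (pbb ?z) ?y \<cdot> FAr ?R a) (NComp (pbt ?z) ?y \<cdot> FAr ?R a)"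
      using se(3)[OF x(2) comm_sq_self[OF zn x(2)] Ra(1)] Ra nat_fam_simps[OF pf(6) x(2)] by simp
    also have "\<dots> = s ?y (FAr B a \<cdot> NComp (pbb ?z) ?x) (FAr Z a \<cdot> NComp (pbt ?z) ?x)"
      using nat_fam_comm[OF pf(6) a HOL.refl HOL.refl] nat_fam_comm[OF pf(7) a HOL.refl HOL.refl]
        by simp
    finally show "s ?y (NComp (pbb ?z) ?y) (NComp (pbt ?z) ?y) \<cdot> FAr ?R a
        = FAr (NDom g) a \<cdot> s ?x (NComp (pbb ?z) ?x) (NComp (pbt ?z) ?x)"
      using se(4)[OF x(1) comm_sq_self[OF zn x(1)] a HOL.refl] by simp
  qed
  then have en: "is_ntrans D E ?e" by (rule is_ntrans_mk[OF pf(9) gn(2)])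
  have "g \<cdot>\<^bsub>F\<^esub> ?e = pbb ?z"
    using g en pf se(2)[OF _ comm_sq_self[OF zn]] by (intro ntrans_eqI[of D E] is_ntrans_Cmp) auto
  then have eS: "(pbb ?z, ?e, g) \<in> Ar (slice F B)"
    using g en pf by (simp add: slice_Ar)
  \<comment> \<open>Every generalised element is the universal one precomposed with its mediating
    map, and \<open>s\<close> commutes with precomposition.\<close>
  have e_pr: "NComp ?e x \<cdot> pr ?z x b y = s x b y"
    if x: "x \<in> Ob D" "comm_sq E (NComp f x) (NComp ?z x) b y" for x b y
  proof -
    note p = pr_facts[OF zn x]
    show ?thesis
      using se(3)[OF x(1) comm_sq_self[OF zn x(1)] p(1)] p nat_fam_simps[OF pf(6) x(1)] x(1) by simp
  qed
  have "\<exists>!h. h \<in> hom (slice F A) ?z ?p \<and> NComp ev g \<cdot>\<^bsub>slice F B\<^esub> FAr (pb_ftor F f) h = (pbb ?z, ?e, g)"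
    by (rule adjunction_transpose[OF adj]) (use zn g eS pb_ftor_FOb[OF zn] in \<open>auto simp: hom_def\<close>)
  then obtain h where h: "h \<in> hom (slice F A) ?z ?p"
    "NComp ev g \<cdot>\<^bsub>slice F B\<^esub> FAr (pb_ftor F f) h = (pbb ?z, ?e, g)"
    and uniq: "\<And>k. k \<in> hom (slice F A) ?z ?p \<Longrightarrow> NComp ev g \<cdot>\<^bsub>slice F B\<^esub> FAr (pb_ftor F f) k = (pbb ?z,
      ?e, g) \<Longrightarrow> k = h"
    by blast
  have lift_iff: "is_lift D E (NDom ?p) (NComp f) (NComp ?p) (evop g) Z z s (NComp k) \<longleftrightarrow>
      NComp ev g \<cdot>\<^bsub>slice F B\<^esub> FAr (pb_ftor F f) (?z, k, ?p) = (pbb ?z, ?e, g)"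
    if k: "(?z, k, ?p) \<in> Ar (slice F A)" for k
  proof -
    have 1: "nat_fam D E Z (NDom ?p) (NComp k)" "\<And>x. x \<in> Ob D \<Longrightarrow> NComp ?p x \<cdot> NComp k x = z x"
      using slice_fun_cat(10,11)[OF k] by simp_all
    show ?thesis unfolding slice_comp_iff[OF k eS] is_lift_def using 1 e_pr by auto
  qed
  obtain h' where h': "h = (?z, h', ?p)" "(?z, h', ?p) \<in> Ar (slice F A)" using h(1)
    by (cases h) (auto simp: hom_def)
  show "\<exists>h. is_lift D E (NDom ?p) (NComp f) (NComp ?p) (evop g) Z z s h"
    using lift_iff[OF h'(2)] h(2) h'(1) by blast
  have lift_eq: "k x = NComp h' x" if k: "is_lift D E (NDom ?p) (NComp f) (NComp ?p) (evop g) Z z s k"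
    and x: "x \<in> Ob D" for k x
  proof -
    have kn: "nat_fam D E Z (NDom ?p) k" and kp: "\<And>x. x \<in> Ob D \<Longrightarrow> NComp ?p x \<cdot> k x = z x"
      using k by (auto simp: is_lift_def)
    let ?k = "mk_ntrans D Z (NDom ?p) k"
    have kt: "is_ntrans D E ?k" using is_ntrans_mk[OF Z _ kn] Pg by (simp add: is_ntrans_iff)
    have "?p \<cdot>\<^bsub>F\<^esub> ?k = ?z" using kt Pg zn kp by (intro ntrans_eqI[of D E] is_ntrans_Cmp) auto
    then have kS: "(?z, ?k, ?p) \<in> Ar (slice F A)" using kt Pg zn by (simp add: slice_Ar)
    have "nat_fam D E Z (NDom ?p) (NComp ?k)" using kt by (simp add: is_ntrans_iff)
    then have "is_lift D E (NDom ?p) (NComp f) (NComp ?p) (evop g) Z z s (NComp ?k)"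
      using k unfolding is_lift_def by auto
    then have "(?z, ?k, ?p) = h"
      using lift_iff[OF kS] uniq[of "(?z, ?k, ?p)"] kS by (simp add: hom_def)
    then show ?thesis using h' x by auto
  qed
  fix h1 h2 assume "is_lift D E (NDom ?p) (NComp f) (NComp ?p) (evop g) Z z s h1"
    "is_lift D E (NDom ?p) (NComp f) (NComp ?p) (evop g) Z z s h2"
  then show "\<forall>x\<in>Ob D. h1 x = h2 x" using lift_eq by metis
qed

end

end

section \<open>Preservation of dependent products\<close>

lemma precomp_FOb: "is_functor D E F \<Longrightarrow> FOb (precomp C D E K) F = comp_ftor C F K"
  by (simp add: precomp_def)

lemma precomp_FAr:
  assumes "is_ntrans D E t"
  shows "NDom (FAr (precomp C D E K) t) = comp_ftor C (NDom t) K"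
    "NCod (FAr (precomp C D E K) t) = comp_ftor C (NCod t) K"
    "x \<in> Ob C \<Longrightarrow> NComp (FAr (precomp C D E K) t) x = NComp t (FOb K x)"
    "NComp (FAr (precomp C D E K) t) \<in> extensional (Ob C)"
  using assms by (simp_all add: precomp_def)

lemma precomp_ntrans:
  fixes E (structure)
  assumes K: "is_functor C D K" and t: "is_ntrans D E t"
  shows "is_ntrans C E (FAr (precomp C D E K) t)"
proof -
  have tn: "nat_fam D E (NDom t) (NCod t) (NComp t)" "is_functor D E (NDom t)" "is_functor D E (NCod t)"
    using t by (auto simp: is_ntrans_iff)
  note Ks = functor_simps[OF K] and Ce = category_ends[OF functor_cats(1)[OF K]]
  have "nat_fam C E (comp_ftor C (NDom t) K) (comp_ftor C (NCod t) K) (NComp (FAr (precomp C D E K) t))"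
    unfolding nat_fam_def
  proof (intro conjI ballI)
    fix x assume "x \<in> Ob C"
    then show "NComp (FAr (precomp C D E K) t) x \<in> hom E (FOb (comp_ftor C (NDom t) K) x) (FOb
      (comp_ftor C (NCod t) K) x)"
      using nat_fam_simps[OF tn(1), of "FOb K x"] Ks
        by (simp add: precomp_FAr[OF t] comp_ftor_simps hom_def)
  next
    fix a assume a: "a \<in> Ar C"
    then show "NComp (FAr (precomp C D E K) t) (Cod C a) \<cdot> FAr (comp_ftor C (NDom t) K) a =
        FAr (comp_ftor C (NCod t) K) a \<cdot> NComp (FAr (precomp C D E K) t) (Dom C a)"
      using nat_fam_comm[OF tn(1) Ks(2)[OF a] Ks(3)[OF a] Ks(4)[OF a]] Ce[OF a]
      by (simp add: precomp_FAr[OF t] comp_ftor_simps)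
  qed
  then show ?thesis
    using comp_ftor_functor[OF K tn(2)] comp_ftor_functor[OF K tn(3)]
      by (simp add: is_ntrans_iff precomp_FAr[OF t])
qed

lemma precomp_functor:
  assumes K: "is_functor C D K" and E: "category E"
  shows "is_functor (fun_cat D E) (fun_cat C E) (precomp C D E K)"
  unfolding is_functor_def
proof (intro conjI ballI impI)
  note CD = functor_cats[OF K] and Ks = functor_simps[OF K]
  show "category (fun_cat D E)" "category (fun_cat C E)" by (rule category_fun_cat CD E)+
  show "FOb (precomp C D E K) \<in> Ob (fun_cat D E) \<rightarrow>\<^sub>E Ob (fun_cat C E)"
    using comp_ftor_functor[OF K] by (auto simp: precomp_def)
  show "FAr (precomp C D E K) \<in> Ar (fun_cat D E) \<rightarrow>\<^sub>E Ar (fun_cat C E)"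
  proof (rule PiE_I)
    fix t assume "t \<in> Ar (fun_cat D E)"
    then show "FAr (precomp C D E K) t \<in> Ar (fun_cat C E)" using precomp_ntrans[OF K] by simp
  qed (simp add: precomp_def)
next
  fix F assume "F \<in> Ob (fun_cat D E)"
  then have F: "is_functor D E F" by simp
  note Fi = is_ntrans_Ident[OF F]
  show "FAr (precomp C D E K) (Ident (fun_cat D E) F) = Ident (fun_cat C E) (FOb (precomp C D E K) F)"
  proof (rule ntrans_eqI[of C E])
    show "is_ntrans C E (Ident (fun_cat C E) (FOb (precomp C D E K) F))"
      using comp_ftor_functor[OF K F] by (intro is_ntrans_Ident) (simp add: precomp_FOb[OF F])
  qed (use F precomp_ntrans[OF K Fi] functor_simps(1)[OF K] in \<open>auto simp: precomp_FAr[OF Fi]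
    precomp_FOb[OF F] comp_ftor_simps\<close>)
next
  fix t assume "t \<in> Ar (fun_cat D E)"
  then have t: "is_ntrans D E t" by simp
  then show "Dom (fun_cat C E) (FAr (precomp C D E K) t) = FOb (precomp C D E K) (Dom (fun_cat D E) t)"
    "Cod (fun_cat C E) (FAr (precomp C D E K) t) = FOb (precomp C D E K) (Cod (fun_cat D E) t)"
    by (simp_all add: precomp_FAr[OF t] precomp_FOb is_ntrans_iff)
  fix s assume "s \<in> Ar (fun_cat D E)" and st: "Dom (fun_cat D E) s = Cod (fun_cat D E) t"
  then have s: "is_ntrans D E s" "NDom s = NCod t" by simp_all
  note c = is_ntrans_Cmp[OF t s]
  show "FAr (precomp C D E K) (s \<cdot>\<^bsub>fun_cat D E\<^esub> t) = FAr (precomp C D E K) s \<cdot>\<^bsub>fun_cat C E\<^esub> FAr (precomp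
    C D E K) t"
    using functor_simps(1)[OF K] s
    by (intro ntrans_eqI[of C E] is_ntrans_Cmp precomp_ntrans[OF K] c t)
      (auto simp: precomp_FAr[OF c] precomp_FAr[OF t] precomp_FAr[OF s(1)])
qed

lemma iso_fun_cat:
  fixes E (structure)
  assumes D: "category D" and E: "category E" and t: "is_ntrans D E t"
    and i: "\<And>x. x \<in> Ob D \<Longrightarrow> iso_ar E (NComp t x)"
  shows "iso_ar (fun_cat D E) t"
proof -
  let ?F = "NDom t" and ?G = "NCod t"
  have tn: "nat_fam D E ?F ?G (NComp t)" "is_functor D E ?F" "is_functor D E ?G"
    using t by (auto simp: is_ntrans_iff)
  note Es = category_simps[OF E] and ts = nat_fam_simps[OF tn(1)]
  let ?r = "\<lambda>x. inv_ar E (NComp t x)"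
  note r = inv_ar[OF E i]
  have "nat_fam D E ?G ?F ?r"
    unfolding nat_fam_def
  proof (intro conjI ballI)
    fix x assume "x \<in> Ob D"
    then show "?r x \<in> hom E (FOb ?G x) (FOb ?F x)" using r ts by (simp add: hom_def)
  next
    fix a assume a: "a \<in> Ar D"
    let ?x = "Dom D a" and ?y = "Cod D a"
    have x: "?x \<in> Ob D" "?y \<in> Ob D" using category_ends[OF D a] by auto
    note rx = r[OF x(1)] ts[OF x(1)] and ry = r[OF x(2)] ts[OF x(2)]
    note Fa = functor_simps(2-4)[OF tn(2) a] functor_simps(2-4)[OF tn(3) a]
    have "?r ?y \<cdot> FAr ?G a = ?r ?y \<cdot> (FAr ?G a \<cdot> NComp t ?x) \<cdot> ?r ?x"
      using rx ry Fa by (simp add: Es)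
    also have "\<dots> = (?r ?y \<cdot> NComp t ?y) \<cdot> FAr ?F a \<cdot> ?r ?x"
      unfolding nat_fam_comm[OF tn(1) a HOL.refl HOL.refl, symmetric] using rx(1-3,6-8) ry(1-3,6-8) Fa
        by (simp add: Es)
    also have "\<dots> = FAr ?F a \<cdot> ?r ?x"
      unfolding ry(4) using rx(1-3,6-8) ry(1-3,6-8) Fa by (simp add: Es)
    finally show "?r ?y \<cdot> FAr ?G a = FAr ?F a \<cdot> ?r ?x" .
  qed
  then have R: "is_ntrans D E (mk_ntrans D ?G ?F ?r)" by (rule is_ntrans_mk[OF tn(3,2)])
  show ?thesis
  proof (rule iso_arI[of _ _ "mk_ntrans D ?G ?F ?r"])
    show "mk_ntrans D ?G ?F ?r \<cdot>\<^bsub>fun_cat D E\<^esub> t = Ident (fun_cat D E) (Dom (fun_cat D E) t)"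
      using t R tn r(4) ts by (intro ntrans_eqI[of D E] is_ntrans_Cmp) (auto intro: is_ntrans_Ident)
    show "t \<cdot>\<^bsub>fun_cat D E\<^esub> mk_ntrans D ?G ?F ?r = Ident (fun_cat D E) (Cod (fun_cat D E) t)"
      using t R tn r(5) ts by (intro ntrans_eqI[of D E] is_ntrans_Cmp) (auto intro: is_ntrans_Ident)
  qed (use t R in simp_all)
qed

text \<open>Pullbacks along the components of \<open>f\<close> make all relevant pullbacks in both
  functor categories pointwise, so restriction along \<open>\<gamma>\<close> preserves them and the
  comparison is the mate. Its defining equation, read on generalised elements, is the hypothesis of
  \<open>dprod_comparison\<close>, which makes it invertible at every object.\<close>

theorem (in initial_gluing) comparison:
  fixes E :: "('eo, 'ea) cat"
  assumes E: "category E"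
  defines "EH \<equiv> fun_cat H E" and "EI \<equiv> fun_cat X E" and "r \<equiv> precomp X H E \<gamma>"
  assumes f: "f \<in> hom EH B A"
    and pbE: "\<And>x. x \<in> Ob H \<Longrightarrow> has_pullbacks_along E (NComp f x)"
    and dp: "dependent_product EH f P eta ev" and dp': "dependent_product EI (FAr r f) P' eta' ev'"
  shows "\<exists>\<phi>. natural_iso (slice EH B) (slice EI (FOb r A))
             (comp_ftor (slice EH B) (slice_ftor EH r A) P)
             (comp_ftor (slice EH B) P' (slice_ftor EH r B)) \<phi> \<and>
           (\<forall>g\<in>Ob (slice EH B).
              iso_ar (slice EI (FOb r B)) (pb_compare EH EI r f (FOb P g)) \<and>
              NComp ev' (FAr r g) \<cdot>\<^bsub>slice EI (FOb r B)\<^esub> FAr (pb_ftor EI (FAr r f)) (NComp \<phi> g)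
              = FAr (slice_ftor EH r B) (NComp ev g) \<cdot>\<^bsub>slice EI (FOb r B)\<^esub>
                inv_ar (slice EI (FOb r B)) (pb_compare EH EI r f (FOb P g)))"
proof -
  have fn: "is_ntrans H E f" "NDom f = B" "NCod f = A" using f by (auto simp: EH_def hom_def)
  have R: "is_functor EH EI r" unfolding EH_def EI_def r_def by (rule precomp_functor[OF \<gamma> E])
  \<comment> \<open>\<open>\<gamma>\<close> is the identity on objects, so restriction along it
    leaves the family of components literally unchanged.\<close>
  have r_comp: "NComp (FAr r t) = NComp t" if "is_ntrans H E t" for t
    unfolding r_def
    by (rule extensionalityI[where A = "Ob X"])
      (use that in \<open>auto simp: precomp_FAr[OF that] \<gamma>_Ob is_ntrans_iff H_Ob\<close>)
  have r_ends: "NDom (FAr r t) = comp_ftor X (NDom t) \<gamma>" "NCod (FAr r t) = comp_ftor X (NCod t) \<gamma>"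
    if "is_ntrans H E t" for t
    unfolding r_def by (simp_all add: precomp_FAr[OF that])
  have r_nt: "is_ntrans X E (FAr r t)" if "is_ntrans H E t" for t
    unfolding r_def by (rule precomp_ntrans[OF \<gamma> that])
  interpret S: fun_dprod H E f P eta ev
    by unfold_locales (use E H pbE dp in \<open>auto simp: EH_def\<close>)
  interpret S': fun_dprod X E "FAr r f" P' eta' ev'
    by unfold_locales (use E X_cat pbE dp' in \<open>auto simp: EI_def r_comp[OF fn(1)] H_Ob\<close>)
  \<comment> \<open>Preservation of pullbacks holds because they are pointwise in \<open>EH\<close>,
    and the components at the objects of \<open>X\<close> are the same after restriction.\<close>
  interpret M: pullback_preserving EH EI r f P eta ev P' eta' ev'
  proof
    show "is_functor EH EI r" "dependent_product EH f P eta ev"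
      "dependent_product EI (FAr r f) P' eta' ev'"
      by (rule R dp dp')+
    fix z assume "z \<in> Ar EH" "Cod EH z = Cod EH f"
    then have z: "is_ntrans H E z" "NCod z = NCod f" by (simp_all add: EH_def)
    note p = S.pb_facts[OF z]
    show "is_pullback EI (FAr r f) (FAr r z) (FAr r (pb_base EH f z)) (FAr r (pb_top EH f z))"
      unfolding EI_def EH_def
    proof (rule pullback_pointwiseI[OF E X_cat])
      fix x assume "x \<in> Ob X"
      then show "is_pullback E (NComp (FAr r f) x) (NComp (FAr r z) x) (NComp (FAr r (pb_base (fun_cat H
        E) f z)) x)
          (NComp (FAr r (pb_top (fun_cat H E) f z)) x)"
        using S.pointwise[OF z] by (simp add: r_comp fn z p H_Ob)
    qed (use z p fn in \<open>simp_all add: r_nt r_ends\<close>)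
  qed
  have ob: "Cod EH f = A" "Dom EH f = B" using fn by (simp_all add: EH_def)
  note M = M.natural_iso_mate[unfolded ob] M.mate[unfolded ob]
  have mate_iso: "iso_ar (slice EI (FOb r A)) (M.mate g)" if g: "g \<in> Ob (slice EH B)" for g
  proof -
    have gn: "is_ntrans H E g" "NCod g = B" using g by (simp_all add: EH_def)
    have gB: "NCod g = NDom f" using gn fn by simp
    let ?p = "FOb P g"
    have p: "is_ntrans H E ?p" "NCod ?p = A" using S.Pg[OF gn(1) gB] fn by auto
    have pA: "?p \<in> Ob (slice EH A)" using p by (simp add: EH_def)
    have g': "is_ntrans X E (FAr r g)" "NCod (FAr r g) = NDom (FAr r f)"
      using r_nt gn r_ends fn by auto
    let ?p' = "FOb P' (FAr r g)"
    note m = M(2-5)[OF g] 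
    have FBg: "FOb (slice_ftor EH r B) g = FAr r g" using g by (simp add: slice_ftor_def)
    have FAp: "FOb (slice_ftor EH r A) ?p = FAr r ?p" using pA by (simp add: slice_ftor_def)
    obtain h where mh: "M.mate g = (FAr r ?p, h, ?p')"
      using m(2,3) unfolding FBg FAp by (cases "M.mate g") auto
    have hA: "(FAr r ?p, h, ?p') \<in> Ar (slice EI (FOb r A))" using m(1) mh by simp
    have rA: "FOb r A = NCod (FAr r f)" "FOb r B = NDom (FAr r f)"
      using functor_simps(3,4)[OF R, of f] fn by (simp_all add: EH_def EI_def)
    have hA': "(FAr r ?p, h, ?p') \<in> Ar (slice (fun_cat X E) (NCod (FAr r f)))"
      using hA rA by (simp add: EI_def)
    let ?q = "pb_base (fun_cat X E) (FAr r f) (FAr r ?p)"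
      and ?t = "pb_top (fun_cat X E) (FAr r f) (FAr r ?p)"
    let ?b = "pb_base (fun_cat H E) f ?p" and ?s = "pb_top (fun_cat H E) f ?p"
    \<comment> \<open>The inverse of the comparison of pullbacks: from the chosen pullback in
      \<open>EI\<close> to the restriction of the one chosen in \<open>EH\<close>.\<close>
    let ?c = "pairing EI (FAr r ?b) (FAr r ?s) ?q ?t"
    note inv = M.inv_compare[unfolded ob, OF pA, folded EI_def, unfolded EH_def]
    note ev = S.eva_slice[OF gn(1) gB]
    note e = S.eva_facts[OF gn(1) gB]
    have evF: "FAr (slice_ftor EH r B) (NComp ev g) = (FAr r ?b, FAr r (S.eva g), FAr r g)"
    proof -
      have "FAr (slice_ftor EH r B) (?b, S.eva g, g) = (FAr r ?b, FAr r (S.eva g), FAr r g)"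
        by (rule slice_ftor_simps(2)) (use ev(2) fn in \<open>simp add: EH_def\<close>)
      then show ?thesis by (simp only: ev(1)[symmetric])
    qed
    have tr: "M.transp g = (?q, FAr r (S.eva g) \<cdot>\<^bsub>EI\<^esub> ?c, FAr r g)"
      using inv evF unfolding M.transp_def ob by (simp add: EH_def EI_def)
    have trA: "(?q, FAr r (S.eva g) \<cdot>\<^bsub>EI\<^esub> ?c, FAr r g) \<in> Ar (slice (fun_cat X E) (NDom (FAr r f)))"
      using M.transp(1)[unfolded ob, OF g] tr rA by (simp add: EI_def)
    have eq: "NComp ev' (FAr r g) \<cdot>\<^bsub>slice (fun_cat X E) (NDom (FAr r f))\<^esub>
        FAr (pb_ftor (fun_cat X E) (FAr r f)) (FAr r ?p, h, ?p') = (?q, FAr r (S.eva g) \<cdot>\<^bsub>EI\<^esub> ?c, FAr r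
          g)"
      using m(4) mh tr FBg rA by (simp add: EI_def)
    \<comment> \<open>The equation that characterises the mate, translated into an equation on
      generalised elements.\<close>
    note key = S'.slice_comp_iff[OF g' hA' trA, THEN iffD1, OF eq, rule_format]
    have p': "is_ntrans X E (FAr r ?p)" "NCod (FAr r ?p) = NCod (FAr r f)" using r_nt p r_ends fn
      by auto
    have pb1: "is_pullback EI (FAr r f) (FAr r ?p) (FAr r ?b) (FAr r ?s)"
      and pb2: "is_pullback EI (FAr r f) (FAr r ?p) ?q ?t"
      using M.pbs[unfolded ob, OF pA] by (simp_all add: EH_def EI_def)
    note c = pairing[OF pb1 pullback_comm_sq[OF pb2]]
    have bs: "is_ntrans H E ?b" "is_ntrans H E ?s" using S.pb_facts[of ?p] p fn by auto
    have cn: "is_ntrans X E ?c" "NDom ?c = NDom ?q" "NCod ?c = comp_ftor X (NDom ?b) \<gamma>"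
      using c r_ends[OF bs(1)] by (auto simp: EI_def)
    have lift: "is_lift X E (NDom ?p') (NComp f) (NComp ?p') (S'.evop (FAr r g)) (comp_ftor X (NDom ?p)
      \<gamma>) (NComp ?p) (S.evop g) (NComp h)"
      unfolding is_lift_def
    proof (intro conjI ballI allI impI)
      note sl = slice_fun_cat[OF hA']
      show "nat_fam X E (comp_ftor X (NDom ?p) \<gamma>) (NDom ?p') (NComp h)"
        using sl(10) r_ends[OF p(1)] by simp
      fix x assume x: "x \<in> Ob X"
      then show "NComp ?p' x \<cdot>\<^bsub>E\<^esub> NComp h x = NComp ?p x"
        using sl(11) r_comp[OF p(1)] by simp
      fix b y assume sq: "comm_sq E (NComp f x) (NComp ?p x) b y"
      have sq': "comm_sq E (NComp (FAr r f) x) (NComp (FAr r ?p) x) b y"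
        using sq by (simp add: r_comp fn p)
      have xH: "x \<in> Ob H" using x by (simp add: H_Ob)
      have pA': "NCod ?p = NCod f" using p fn by simp
      note pf' = S'.pr_facts[OF p' x sq']
      have cx: "nat_fam X E (NDom ?q) (comp_ftor X (NDom ?b) \<gamma>) (NComp ?c)" using cn
        by (simp add: is_ntrans_iff)
      note cs = nat_fam_simps[OF cx x] 
      have cb: "NComp ?b x \<cdot>\<^bsub>E\<^esub> NComp ?c x = NComp ?q x" "NComp ?s x \<cdot>\<^bsub>E\<^esub> NComp ?c x = NComp ?t x"
        using arg_cong[OF c(4), of "\<lambda>t. NComp t x"] arg_cong[OF c(5), of "\<lambda>t. NComp t x"] x
        by (simp_all add: EI_def r_comp[OF bs(1)] r_comp[OF bs(2)])
      note bx = nat_fam_simps[OF S.pb_facts(6)[OF p(1) pA'] xH] nat_fam_simps[OF S.pb_facts(7)[OF p(1)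
        pA'] xH]
      have FO: "FOb (comp_ftor X (NDom ?b) \<gamma>) x = FOb (NDom ?b) x" using x
        by (simp add: comp_ftor_simps \<gamma>_Ob)
      note ex = nat_fam_simps[OF e(5) xH]
      \<comment> \<open>At \<open>x\<close> both chosen pullbacks represent the same generalised
        elements, and \<open>?c\<close> carries one mediating map to the other. This removes the
        choice from the comparison of \<open>S.evop\<close> and \<open>S'.evop\<close>.\<close>
      have "S.pr ?p x b y = NComp ?c x \<cdot>\<^bsub>E\<^esub> S'.pr (FAr r ?p) x b y"
      proof (rule pairing_eqI[OF S.pointwise[OF p(1) pA' xH] sq])
        have "NComp ?b x \<cdot>\<^bsub>E\<^esub> NComp ?c x \<cdot>\<^bsub>E\<^esub> S'.pr (FAr r ?p) x b y = (NComp ?b x \<cdot>\<^bsub>E\<^esub> NComp ?c x) \<cdot>\<^bsub>E\<^esub>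
          S'.pr (FAr r ?p) x b y"
          "NComp ?s x \<cdot>\<^bsub>E\<^esub> NComp ?c x \<cdot>\<^bsub>E\<^esub> S'.pr (FAr r ?p) x b y = (NComp ?s x \<cdot>\<^bsub>E\<^esub> NComp ?c x) \<cdot>\<^bsub>E\<^esub>
            S'.pr (FAr r ?p) x b y"
          using pf'(1-3) cs bx FO by (simp_all add: category_assoc[OF E])
        then show "NComp ?b x \<cdot>\<^bsub>E\<^esub> NComp ?c x \<cdot>\<^bsub>E\<^esub> S'.pr (FAr r ?p) x b y = b"
          "NComp ?s x \<cdot>\<^bsub>E\<^esub> NComp ?c x \<cdot>\<^bsub>E\<^esub> S'.pr (FAr r ?p) x b y = y"
          unfolding cb using pf'(4,5) by simp_all
      qed (use pf'(1-3) cs bx FO in \<open>simp_all add: category_comp[OF E]\<close>)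
      moreover have "NComp (FAr r (S.eva g) \<cdot>\<^bsub>EI\<^esub> ?c) x \<cdot>\<^bsub>E\<^esub> S'.pr (FAr r ?p) x b y
          = NComp (S.eva g) x \<cdot>\<^bsub>E\<^esub> NComp ?c x \<cdot>\<^bsub>E\<^esub> S'.pr (FAr r ?p) x b y"
        using x r_comp[OF e(1)] pf'(1-3) cs ex FO by (simp add: EI_def category_assoc[OF E])
      ultimately show "S'.evop (FAr r g) x b (NComp h x \<cdot>\<^bsub>E\<^esub> y) = S.evop g x b y"
        using key[OF x sq'] by (simp add: S.evop_def)
    qed
    have gnf: "nat_fam H E (NDom g) B (NComp g)" "is_functor H E (NDom g)" using gn
      by (auto simp: is_ntrans_iff)
    interpret dprod_comparison X H \<gamma> d E A B "NDom g" "NComp f" "NComp g" "NDom ?p" "NComp ?p"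
      "S.evop g"
      "NDom ?p'" "NComp ?p'" "S'.evop (FAr r g)" "NComp h"
    proof unfold_locales
      show "is_functor H E A" "is_functor H E B" "nat_fam H E B A (NComp f)" using S.f_facts fn by auto
      show "is_functor H E (NDom g)" "nat_fam H E (NDom g) B (NComp g)" by (rule gnf)+
      show "is_dprod H E A B (NDom g) (NComp f) (NComp g) (NDom ?p) (NComp ?p) (S.evop g)"
        using S.dprod[OF gn(1) gB] fn by simp
      show "is_dprod X E (comp_ftor X A \<gamma>) (comp_ftor X B \<gamma>) (comp_ftor X (NDom g) \<gamma>) (NComp f) (NComp
        g)
          (NDom ?p') (NComp ?p') (S'.evop (FAr r g))"
        using S'.dprod[OF g'] fn by (simp add: r_comp r_ends gn)
      show "is_lift X E (NDom ?p') (NComp f) (NComp ?p') (S'.evop (FAr r g)) (comp_ftor X (NDom ?p) \<gamma>)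
        (NComp ?p) (S.evop g) (NComp h)"
        by (rule lift)
    qed
    have "iso_ar EI h"
      unfolding EI_def using slice_fun_cat(5)[OF hA'] iso_comparison by (intro iso_fun_cat X_cat E)
    then show ?thesis
      unfolding mh using hA by (intro iso_slice) (simp_all add: M.D)
  qed
  show ?thesis
  proof (intro exI conjI ballI)
    show "natural_iso (slice EH B) (slice EI (FOb r A))
             (comp_ftor (slice EH B) (slice_ftor EH r A) P)
             (comp_ftor (slice EH B) P' (slice_ftor EH r B))
             (mk_ntrans (slice EH B) (comp_ftor (slice EH B) (slice_ftor EH r A) P) (comp_ftor (slice EH
               B) P' (slice_ftor EH r B)) M.mate)"
      by (rule M(1)) (rule mate_iso)
    fix g assume g: "g \<in> Ob (slice EH B)"
    have "FOb P g \<in> Ob (slice EH A)" using functor_simps(1)[OF M.functors(3)[unfolded ob] g] .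
    then show "iso_ar (slice EI (FOb r B)) (pb_compare EH EI r f (FOb P g))"
      by (rule M.compare_iso[unfolded ob])
    have "FOb (slice_ftor EH r B) g = FAr r g" using g by (simp add: slice_ftor_def)
    then show "NComp ev' (FAr r g) \<cdot>\<^bsub>slice EI (FOb r B)\<^esub> FAr (pb_ftor EI (FAr r f))
          (NComp (mk_ntrans (slice EH B) (comp_ftor (slice EH B) (slice_ftor EH r A) P) (comp_ftor
            (slice EH B) P' (slice_ftor EH r B)) M.mate) g)
              = FAr (slice_ftor EH r B) (NComp ev g) \<cdot>\<^bsub>slice EI (FOb r B)\<^esub>
                inv_ar (slice EI (FOb r B)) (pb_compare EH EI r f (FOb P g))"
      using M(5)[OF g] g by (simp add: M.transp_def ob)
  qed
qed

theorem theorem6p23: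
  fixes G :: "('no, 'na, 'io, 'ia, 'd, 'e, 'h) gluing"
    and E :: "('eo, 'ea) cat"
  assumes "iterated_gluing G"
    and "wide_subcategory (G_inf G) W" and "two_of_three (G_inf G) W"
    and "category E"
    and "\<And>n i. n \<in> Ob (G_N G) \<Longrightarrow> i \<in> Ob (G_bd G n) \<Longrightarrow> has_limits_of_shape E (G_under G n i)"
    and "\<And>n i. n \<in> Ob (G_N G) \<Longrightarrow> i \<in> Ob (G_bd G n) \<Longrightarrow>
           has_limits_of_shape E (proper_coslice (G_Ho G W) (FOb (G_bd_Ho G W n) i))"
    and "\<And>a. a \<in> Ar (G_Ho G W) \<Longrightarrow> epi (G_Ho G W) a"
    and "\<And>n i. n \<in> Ob (G_N G) \<Longrightarrow> i \<in> Ob (G_bd G n) \<Longrightarrow>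
           initial_ftor (G_under G n i) (proper_coslice (G_Ho G W) (FOb (G_bd_Ho G W n) i))
             (G_gamma_at G W n i)"
  defines "EH \<equiv> fun_cat (G_Ho G W) E" and "EI \<equiv> fun_cat (G_inf G) E"
    and "\<gamma> \<equiv> precomp (G_inf G) (G_Ho G W) E (G_gamma G W)"
  assumes "f \<in> hom EH B A"
    and "\<And>n. n \<in> Ob (G_N G) \<Longrightarrow>
           powerful (fun_cat (G_bd G n) E) (FAr (precomp (G_bd G n) (G_Ho G W) E (G_bd_Ho G W n)) f)"
    and "\<And>n. n \<in> Ob (G_N G) \<Longrightarrow> powerful (fun_cat (G_bd G n) E) (G_match G E n (FAr \<gamma> f))"
    and "\<And>n i. n \<in> Ob (G_N G) \<Longrightarrow> i \<in> Ob (G_bd G n) \<Longrightarrow>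
           powerful E (NComp f (FOb (G_bd_Ho G W n) i))"
    and "\<And>n i. n \<in> Ob (G_N G) \<Longrightarrow> i \<in> Ob (G_bd G n) \<Longrightarrow>
           powerful E (coslice_match_ar (G_Ho G W) E f (FOb (G_bd_Ho G W n) i))"
    and "dependent_product EH f P eta ev"
    and "dependent_product EI (FAr \<gamma> f) P' eta' ev'"
  shows "\<exists>\<phi>. natural_iso (slice EH B) (slice EI (FOb \<gamma> A))
             (comp_ftor (slice EH B) (slice_ftor EH \<gamma> A) P)
             (comp_ftor (slice EH B) P' (slice_ftor EH \<gamma> B)) \<phi> \<and>
           (\<forall>g\<in>Ob (slice EH B).
              iso_ar (slice EI (FOb \<gamma> B)) (pb_compare EH EI \<gamma> f (FOb P g)) \<and>
              NComp ev' (FAr \<gamma> g) \<cdot>\<^bsub>slice EI (FOb \<gamma> B)\<^esub> FAr (pb_ftor EI (FAr \<gamma> f)) (NComp \<phi> g)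
              = FAr (slice_ftor EH \<gamma> B) (NComp ev g) \<cdot>\<^bsub>slice EI (FOb \<gamma> B)\<^esub>
                inv_ar (slice EI (FOb \<gamma> B)) (pb_compare EH EI \<gamma> f (FOb P g)))"
proof -
  interpret initial_gluing G W
    using assms(1,2,7,8) by unfold_locales (simp_all add: wide_subcategory_def)
  \<comment> \<open>Every object of the localisation is some \<open>[i]_n\<close>, and powerfulness
    of the component of \<open>f\<close> there includes the existence of pullbacks along it.\<close>
  have pb: "has_pullbacks_along E (NComp f x)" if x: "x \<in> Ob (G_Ho G W)" for x
  proof -
    obtain n i where n: "n \<in> Ob (G_N G)" "i \<in> Ob (G_bd G n)" "x = FOb (G_bd_inf G n) i"
      using bd_inf_cases[of x] x H_Ob by blast
    then have "powerful E (NComp f x)" using assms(15)[OF n(1,2)] bd_Ho_FOb[OF n(1,2)] by simp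
    then show ?thesis by (auto simp: powerful_def dependent_product_def)
  qed
  show ?thesis
    using comparison[OF assms(4) assms(12)[unfolded EH_def] pb assms(17)[unfolded EH_def] assms(18)[unfolded EI_def \<gamma>_def]]
    unfolding EH_def EI_def \<gamma>_def .
qed

end
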